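(* Let $\Omega\subset\mathbb{R}^N$ be a bounded open set, let $0<a_1<a_2$, $0<b_1<b_2$, let $A^\epsilon\in\mathcal{M}(a_1,a_2;\Omega)$ be a sequence which $H$-converges to $A^{*}\in\mathcal{M}(a_1,a_2;\Omega)$, and let $B^\epsilon\in\mathcal{M}(b_1,b_2;\Omega)$. Then there exist a subsequence (still denoted by $\epsilon$) and a matrix $B^{\#}\in\mathcal{M}(b_1,\widetilde{b_2};\Omega)$ with $\widetilde{b_2}=b_2\frac{a_2}{a_1}$ such that for all test sequences $u^\epsilon$ satisfying $$u^\epsilon\rightharpoonup u\ \text{ weakly in } H^1(\Omega),\qquad -\mathrm{div}(A^\epsilon\nabla u^\epsilon)\ \text{ strongly convergent in } H^{-1}(\Omega),$$ one has $$B^\epsilon\nabla u^\epsilon\cdot\nabla u^\epsilon\rightharpoonup B^{\#}\nabla u\cdot\nabla u\quad\text{in }\mathcal{D}'(\Omega).$$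
   Context: For $0<\alpha<\beta$, $\mathcal{M}(\alpha,\beta;\Omega)$ denotes the set of all real symmetric $N\times N$ matrices $A(x)$ of measurable functions on $\Omega$ such that $(A(x)\xi,\xi)\ge\alpha|\xi|^2$ and $|A(x)\xi|\le\beta|\xi|$ for all $\xi\in\mathbb{R}^N$ and a.e. $x\in\Omega$. A sequence $A^\epsilon\in\mathcal{M}(a_1,a_2;\Omega)$ $H$-converges to $A^{*}$ (written $A^\epsilon\xrightarrow{H}A^{*}$) if $A^\epsilon\nabla u^\epsilon\rightharpoonup A^{*}\nabla u$ weakly in $L^2(\Omega)$ for all sequences $u^\epsilon\rightharpoonup u$ weakly in $H^1(\Omega)$ such that $-\mathrm{div}(A^\epsilon\nabla u^\epsilon)$ is strongly convergent in $H^{-1}(\Omega)$. *)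

theory Defs
  imports "HOL-Analysis.Analysis"
begin

(* Elements of Lebesgue and Sobolev spaces on Omega are represented by functions on the whole
   space; only their values on Omega matter, up to a Lebesgue null set. *)

definition partial_derivative :: "'n \<Rightarrow> (real^'n \<Rightarrow> real) \<Rightarrow> real^'n \<Rightarrow> real" where
  "partial_derivative i f x = frechet_derivative f (at x) (axis i 1)"

primrec C_k :: "nat \<Rightarrow> (real^'n \<Rightarrow> real) set" where
  "C_k 0 = {f. continuous_on UNIV f}"
| "C_k (Suc k) = {f. (\<forall>x. f differentiable (at x)) \<and> (\<forall>i. partial_derivative i f \<in> C_k k)}"

definition test_functions :: "(real^'n) set \<Rightarrow> (real^'n \<Rightarrow> real) set" where
  "test_functions \<Omega> =
     {\<phi>. (\<forall>k. \<phi> \<in> C_k k) \<and> compact (closure {x. \<phi> x \<noteq> 0}) \<and> closure {x. \<phi> x \<noteq> 0} \<subseteq> \<Omega>}"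

definition locally_integrable_on ::
    "(real^'n \<Rightarrow> 'b::euclidean_space) \<Rightarrow> (real^'n) set \<Rightarrow> bool" (infix "locally'_integrable'_on" 46)
  where "f locally_integrable_on \<Omega> \<longleftrightarrow>
     (\<forall>K. compact K \<and> K \<subseteq> \<Omega> \<longrightarrow> integrable (lebesgue_on K) f)"

(* Convergence in D'(Omega) of the regular distributions given by locally integrable functions. *)
definition distr_converges ::
    "(real^'n) set \<Rightarrow> (nat \<Rightarrow> real^'n \<Rightarrow> real) \<Rightarrow> (real^'n \<Rightarrow> real) \<Rightarrow> bool" where
  "distr_converges \<Omega> f g \<longleftrightarrow>
     (\<forall>n. f n locally_integrable_on \<Omega>) \<and> g locally_integrable_on \<Omega> \<and>
     (\<forall>\<phi>\<in>test_functions \<Omega>.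
        (\<lambda>n. LINT x|lebesgue_on \<Omega>. f n x * \<phi> x) \<longlonglongrightarrow> (LINT x|lebesgue_on \<Omega>. g x * \<phi> x))"

definition L2 :: "(real^'n) set \<Rightarrow> (real^'n \<Rightarrow> 'b::euclidean_space) set" where
  "L2 \<Omega> = {f \<in> borel_measurable (lebesgue_on \<Omega>).
             integrable (lebesgue_on \<Omega>) (\<lambda>x. (norm (f x))\<^sup>2)}"

definition L2_norm :: "(real^'n) set \<Rightarrow> (real^'n \<Rightarrow> 'b::euclidean_space) \<Rightarrow> real" where
  "L2_norm \<Omega> f = sqrt (LINT x|lebesgue_on \<Omega>. (norm (f x))\<^sup>2)"

definition has_weak_gradient ::
    "(real^'n) set \<Rightarrow> (real^'n \<Rightarrow> real) \<Rightarrow> (real^'n \<Rightarrow> real^'n) \<Rightarrow> bool" where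
  "has_weak_gradient \<Omega> u g \<longleftrightarrow>
     u locally_integrable_on \<Omega> \<and> g locally_integrable_on \<Omega> \<and>
     (\<forall>\<phi>\<in>test_functions \<Omega>. \<forall>i.
        (LINT x|lebesgue_on \<Omega>. u x * partial_derivative i \<phi> x) =
        - (LINT x|lebesgue_on \<Omega>. g x $ i * \<phi> x))"

(* For open Omega a weak gradient is unique up to a null set, so the choice is immaterial. *)
definition weak_gradient :: "(real^'n) set \<Rightarrow> (real^'n \<Rightarrow> real) \<Rightarrow> real^'n \<Rightarrow> real^'n" where
  "weak_gradient \<Omega> u = (SOME g. has_weak_gradient \<Omega> u g)"

definition H1 :: "(real^'n) set \<Rightarrow> (real^'n \<Rightarrow> real) set" where
  "H1 \<Omega> = {u \<in> L2 \<Omega>. \<exists>g\<in>L2 \<Omega>. has_weak_gradient \<Omega> u g}"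

definition H1_norm :: "(real^'n) set \<Rightarrow> (real^'n \<Rightarrow> real) \<Rightarrow> real" where
  "H1_norm \<Omega> u = sqrt ((L2_norm \<Omega> u)\<^sup>2 + (L2_norm \<Omega> (weak_gradient \<Omega> u))\<^sup>2)"

definition H10 :: "(real^'n) set \<Rightarrow> (real^'n \<Rightarrow> real) set" where
  "H10 \<Omega> = {u \<in> H1 \<Omega>. \<exists>\<phi>. (\<forall>n. \<phi> n \<in> test_functions \<Omega>) \<and>
                          (\<lambda>n. H1_norm \<Omega> (\<lambda>x. u x - \<phi> n x)) \<longlonglongrightarrow> 0}"

(* Bounded linear functionals on a space V of functions with seminorm N. Boundedness with respect
   to N makes the value of a functional independent of the representative of a class. *)
definition dual_space ::
    "('a \<Rightarrow> 'b::real_vector) set \<Rightarrow> (('a \<Rightarrow> 'b) \<Rightarrow> real) \<Rightarrow> (('a \<Rightarrow> 'b) \<Rightarrow> real) set" where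
  "dual_space V N = {l.
     (\<forall>f\<in>V. \<forall>g\<in>V. l (\<lambda>x. f x + g x) = l f + l g) \<and>
     (\<forall>c. \<forall>f\<in>V. l (\<lambda>x. c *\<^sub>R f x) = c * l f) \<and>
     (\<exists>C. \<forall>f\<in>V. \<bar>l f\<bar> \<le> C * N f)}"

definition dual_norm ::
    "('a \<Rightarrow> 'b) set \<Rightarrow> (('a \<Rightarrow> 'b) \<Rightarrow> real) \<Rightarrow> (('a \<Rightarrow> 'b) \<Rightarrow> real) \<Rightarrow> real" where
  "dual_norm V N l = (SUP f\<in>{f \<in> V. N f \<le> 1}. \<bar>l f\<bar>)"

definition weakly_converges ::
    "('a \<Rightarrow> 'b::real_vector) set \<Rightarrow> (('a \<Rightarrow> 'b) \<Rightarrow> real) \<Rightarrow> (nat \<Rightarrow> 'a \<Rightarrow> 'b) \<Rightarrow> ('a \<Rightarrow> 'b) \<Rightarrow> bool"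
  where "weakly_converges V N f g \<longleftrightarrow>
     (\<forall>n. f n \<in> V) \<and> g \<in> V \<and> (\<forall>l\<in>dual_space V N. (\<lambda>n. l (f n)) \<longlonglongrightarrow> l g)"

definition weakly_converges_L2 ::
    "(real^'n) set \<Rightarrow> (nat \<Rightarrow> real^'n \<Rightarrow> 'b::euclidean_space) \<Rightarrow> (real^'n \<Rightarrow> 'b) \<Rightarrow> bool" where
  "weakly_converges_L2 \<Omega> = weakly_converges (L2 \<Omega>) (L2_norm \<Omega>)"

definition weakly_converges_H1 ::
    "(real^'n) set \<Rightarrow> (nat \<Rightarrow> real^'n \<Rightarrow> real) \<Rightarrow> (real^'n \<Rightarrow> real) \<Rightarrow> bool" where
  "weakly_converges_H1 \<Omega> = weakly_converges (H1 \<Omega>) (H1_norm \<Omega>)"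

definition Hm1 :: "(real^'n) set \<Rightarrow> ((real^'n \<Rightarrow> real) \<Rightarrow> real) set" where
  "Hm1 \<Omega> = dual_space (H10 \<Omega>) (H1_norm \<Omega>)"

definition strongly_convergent_Hm1 ::
    "(real^'n) set \<Rightarrow> (nat \<Rightarrow> (real^'n \<Rightarrow> real) \<Rightarrow> real) \<Rightarrow> bool" where
  "strongly_convergent_Hm1 \<Omega> F \<longleftrightarrow> (\<forall>n. F n \<in> Hm1 \<Omega>) \<and>
     (\<exists>G\<in>Hm1 \<Omega>. (\<lambda>n. dual_norm (H10 \<Omega>) (H1_norm \<Omega>) (\<lambda>v. F n v - G v)) \<longlonglongrightarrow> 0)"

(* The distribution -div s for a square integrable vector field s, which acts on a test function v
   as the integral of s . grad v, together with its continuous extension to H10. *)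
definition neg_div :: "(real^'n) set \<Rightarrow> (real^'n \<Rightarrow> real^'n) \<Rightarrow> (real^'n \<Rightarrow> real) \<Rightarrow> real" where
  "neg_div \<Omega> s v = (LINT x|lebesgue_on \<Omega>. s x \<bullet> weak_gradient \<Omega> v x)"

definition coefficient_matrices ::
    "real \<Rightarrow> real \<Rightarrow> (real^'n) set \<Rightarrow> (real^'n \<Rightarrow> real^'n^'n) set" where
  "coefficient_matrices \<alpha> \<beta> \<Omega> = {A \<in> borel_measurable (lebesgue_on \<Omega>).
     (\<forall>x\<in>\<Omega>. transpose (A x) = A x) \<and>
     (AE x in lebesgue_on \<Omega>. \<forall>\<xi>. (A x *v \<xi>) \<bullet> \<xi> \<ge> \<alpha> * (norm \<xi>)\<^sup>2 \<and> norm (A x *v \<xi>) \<le> \<beta> * norm \<xi>)}"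

definition flux ::
    "(real^'n) set \<Rightarrow> (real^'n \<Rightarrow> real^'n^'n) \<Rightarrow> (real^'n \<Rightarrow> real) \<Rightarrow> real^'n \<Rightarrow> real^'n" where
  "flux \<Omega> A u x = A x *v weak_gradient \<Omega> u x"

definition H_converges ::
    "(real^'n) set \<Rightarrow> (nat \<Rightarrow> real^'n \<Rightarrow> real^'n^'n) \<Rightarrow> (real^'n \<Rightarrow> real^'n^'n) \<Rightarrow> bool" where
  "H_converges \<Omega> A Astar \<longleftrightarrow>
     (\<forall>u ulim. weakly_converges_H1 \<Omega> u ulim \<and>
        strongly_convergent_Hm1 \<Omega> (\<lambda>n. neg_div \<Omega> (flux \<Omega> (A n) (u n))) \<longrightarrow>
        weakly_converges_L2 \<Omega> (\<lambda>n. flux \<Omega> (A n) (u n)) (flux \<Omega> Astar ulim))"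

end

theory Submission
  imports Defs "HOL-Library.Function_Algebras" "HOL-Library.Diagonal_Subsequence"
begin

text \<open>For test sequences \<open>u\<close> and \<open>v\<close>, where \<open>u\<close> has limit \<open>w\<close>, Rellich's theorem removes the terms
  with derivatives of \<open>\<phi>\<close>, and the integral of \<open>\<phi> * (A (grad v) \<bullet> (grad u - grad w))\<close> tends to \<open>0\<close>.
  With \<open>v = u\<close> and the Cauchy-Schwarz inequality for the symmetric form \<open>A\<close>, the energy of \<open>grad u\<close>
  weighted by \<open>\<phi> \<ge> 0\<close> is in the limit at most \<open>a\<^sub>2 / a\<^sub>1\<close> times that of \<open>grad w\<close>; this is where the
  constant of the theorem comes from. The estimate survives multiplication of gradients by smooth functions.

  Solutions \<open>X i\<close> of Neumann problems \<open>- div (A grad (X i)) + X i = F i\<close> are chosen such that, along a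
  subsequence, \<open>X i\<close> tends weakly to the coordinate function \<open>x $ i\<close>. By the energy estimate the
  products \<open>B (grad (X i)) \<bullet> grad (X j)\<close> have limits in \<open>L2\<close>, and these are the entries of the matrix
  sought. If smooth \<open>P i\<close> approximate the components of \<open>grad w\<close>, the energy estimate bounds
  the difference between \<open>grad u\<close> and \<open>\<Sum>i. P i * grad (X i)\<close>, so the limit of
  \<open>B (grad u) \<bullet> grad u\<close> is determined by those entries.\<close>

subsection \<open>Complete semi-inner-product spaces\<close>

text \<open>The products \<open>B (grad u) \<bullet> grad u\<close> are bounded only in
  \<open>L1\<close>, where weak convergence of \<open>grad u\<close> does not determine their limit
  and concentration is conceivable. The equation excludes this through the energy bound, since the
  coordinates have bounded gradients. The obstacle is to reach the coordinates as limits, because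
  the limit of solutions with given data is unknown beforehand. A subsequence of the solution
  operators converges weakly to a coercive, hence invertible, operator on a suitable closed
  subspace, and \<open>F i\<close> is the preimage of a coordinate under it. The zero-order term
  makes the Neumann form coercive on all of \<open>H1\<close>, so neither boundary regularity nor a
  Poincare inequality enters. Products \<open>P i * grad (X i)\<close> are not gradients, so the
  argument runs in a class of fields stable under smooth factors. In
  \<open>b\<^sub>2 * (a\<^sub>2 / a\<^sub>1)\<close> the factor \<open>b\<^sub>2\<close> is the
  bound of \<open>B\<close>; symmetry and nonnegativity of the limit matrix turn the bound of its
  quadratic form into one of its norm without loss, and \<open>b\<^sub>1\<close> survives by weak
  lower semicontinuity.\<close>

instantiation "fun" :: (type, real_vector) real_vector
begin

definition scaleR_fun_def: "c *\<^sub>R f = (\<lambda>x. c *\<^sub>R f x)"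

instance
  by standard (simp_all add: scaleR_fun_def fun_eq_iff algebra_simps)

end

lemma scaleR_fun_apply [simp]: "(c *\<^sub>R f) x = c *\<^sub>R f x"
  by (simp add: scaleR_fun_def)

text \<open>The form is only semidefinite because functions that agree almost everywhere are not identified.\<close>
locale semi_hilbert =
  fixes V :: "'v::real_vector set" and ip :: "'v \<Rightarrow> 'v \<Rightarrow> real"
  assumes V_subspace: "subspace V"
    and ip_add: "\<And>x y z. x \<in> V \<Longrightarrow> y \<in> V \<Longrightarrow> z \<in> V \<Longrightarrow> ip (x + y) z = ip x z + ip y z"
    and ip_scale: "\<And>c x z. x \<in> V \<Longrightarrow> z \<in> V \<Longrightarrow> ip (c *\<^sub>R x) z = c * ip x z"
    and ip_sym: "\<And>x y. x \<in> V \<Longrightarrow> y \<in> V \<Longrightarrow> ip x y = ip y x"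
    and ip_nonneg: "\<And>x. x \<in> V \<Longrightarrow> 0 \<le> ip x x"
    and V_complete: "\<And>X. (\<And>n::nat. X n \<in> V) \<Longrightarrow>
        (\<And>e. e > 0 \<Longrightarrow> \<exists>N. \<forall>m\<ge>N. \<forall>n\<ge>N. ip (X m - X n) (X m - X n) < e) \<Longrightarrow>
        \<exists>x\<in>V. (\<lambda>n. ip (X n - x) (X n - x)) \<longlonglongrightarrow> 0"
begin

definition nm :: "'v \<Rightarrow> real" where "nm x = sqrt (ip x x)"

lemmas V_closed = subspace_add[OF V_subspace] subspace_diff[OF V_subspace]
  subspace_scale[OF V_subspace] subspace_0[OF V_subspace]

lemma ip_add_right: "x \<in> V \<Longrightarrow> y \<in> V \<Longrightarrow> z \<in> V \<Longrightarrow> ip z (x + y) = ip z x + ip z y"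
  by (metis ip_add ip_sym V_closed(1))

lemma ip_scale_right: "x \<in> V \<Longrightarrow> z \<in> V \<Longrightarrow> ip z (c *\<^sub>R x) = c * ip z x"
  by (metis ip_scale ip_sym V_closed(3))

lemma ip_diff: "x \<in> V \<Longrightarrow> y \<in> V \<Longrightarrow> z \<in> V \<Longrightarrow> ip (x - y) z = ip x z - ip y z"
  using ip_add[of x "(-1) *\<^sub>R y" z] ip_scale[of y z "-1"] V_closed(3)[of y "-1"] by simp

lemma ip_diff_right: "x \<in> V \<Longrightarrow> y \<in> V \<Longrightarrow> z \<in> V \<Longrightarrow> ip z (x - y) = ip z x - ip z y"
  by (metis ip_diff ip_sym V_closed(2))

lemmas ip_simps = ip_add ip_scale ip_add_right ip_scale_right ip_diff ip_diff_right V_closed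

lemma nm_nonneg [simp]: "x \<in> V \<Longrightarrow> 0 \<le> nm x"
  by (simp add: nm_def ip_nonneg)

lemma nm_sq: "x \<in> V \<Longrightarrow> (nm x)\<^sup>2 = ip x x"
  by (simp add: nm_def ip_nonneg)

text \<open>In a semidefinite form \<open>ip y y = 0\<close> does not give \<open>y = 0\<close>, so
  besides the discriminant argument the degenerate case is treated: an affine function of
  \<open>t\<close> that is bounded below is constant.\<close>

lemma Cauchy_Schwarz:
  assumes x: "x \<in> V" and y: "y \<in> V"
  shows "\<bar>ip x y\<bar> \<le> nm x * nm y"
proof -
  have q: "0 \<le> ip x x + 2 * t * ip x y + t\<^sup>2 * ip y y" for t
  proof -
    have "0 \<le> ip (x + t *\<^sub>R y) (x + t *\<^sub>R y)" using x y by (intro ip_nonneg) (auto simp: V_closed)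
    then show ?thesis using x y ip_sym[OF x y]
      by (simp add: ip_simps power2_eq_square algebra_simps)
  qed
  have "(ip x y)\<^sup>2 \<le> ip x x * ip y y"
  proof (cases "ip y y = 0")
    case True
    show ?thesis
    proof (cases "ip x y = 0")
      case False
      \<comment> \<open>This \<open>t\<close> gives the affine function the value -1.\<close>
      have "0 \<le> ip x x + 2 * (- (ip x x + 1) / (2 * ip x y)) * ip x y"
        using q[of "- (ip x x + 1) / (2 * ip x y)"] True by simp
      with False show ?thesis by (simp add: field_simps)
    qed (simp add: True)
  next
    case False
    then have p: "ip y y > 0" using ip_nonneg[OF y] by simp
    have "0 \<le> ip x x + 2 * (- ip x y / ip y y) * ip x y + (- ip x y / ip y y)\<^sup>2 * ip y y" by (rule q)
    also have "\<dots> = ip x x - (ip x y)\<^sup>2 / ip y y" using p by (simp add: power2_eq_square field_simps)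
    finally show ?thesis using p by (simp add: field_simps)
  qed
  then have "(ip x y)\<^sup>2 \<le> (nm x * nm y)\<^sup>2" by (simp add: power_mult_distrib nm_sq x y)
  then show ?thesis using x y by (simp add: abs_le_square_iff[symmetric] abs_mult)
qed

lemma nm_triangle: "x \<in> V \<Longrightarrow> y \<in> V \<Longrightarrow> nm (x + y) \<le> nm x + nm y"
proof -
  assume x: "x \<in> V" and y: "y \<in> V"
  have "(nm (x + y))\<^sup>2 = ip x x + 2 * ip x y + ip y y"
    using x y ip_sym[OF x y] by (simp add: nm_sq ip_simps)
  also have "\<dots> \<le> (nm x + nm y)\<^sup>2"
    using Cauchy_Schwarz[OF x y] by (simp add: power2_sum nm_sq x y algebra_simps)
  finally show ?thesis using x y by (intro power2_le_imp_le[of "nm (x + y)"]) auto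
qed

lemma nm_scale: "x \<in> V \<Longrightarrow> nm (c *\<^sub>R x) = \<bar>c\<bar> * nm x"
  by (simp add: nm_def ip_simps real_sqrt_mult flip: mult.assoc)

lemma nm_diff: "x \<in> V \<Longrightarrow> y \<in> V \<Longrightarrow> nm (x - y) \<le> nm x + nm y"
  using nm_triangle[of x "(-1) *\<^sub>R y"] nm_scale[of y "-1"] V_closed(3)[of y "-1"] by simp

lemma nm_0_iff: "x \<in> V \<Longrightarrow> nm x = 0 \<longleftrightarrow> ip x x = 0"
  by (simp add: nm_def)

lemma ip_tendsto:
  assumes "\<And>n. X n \<in> V" "x \<in> V" "(\<lambda>n. nm (X n - x)) \<longlonglongrightarrow> 0" "y \<in> V"
  shows "(\<lambda>n. ip (X n) y) \<longlonglongrightarrow> ip x y"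
proof -
  have "(\<lambda>n. ip (X n) y - ip x y) \<longlonglongrightarrow> 0"
  proof (rule Lim_null_comparison)
    show "\<forall>\<^sub>F n in sequentially. norm (ip (X n) y - ip x y) \<le> nm (X n - x) * nm y"
      using Cauchy_Schwarz[of "X n - x" y for n] assms by (auto simp: ip_simps)
    show "(\<lambda>n. nm (X n - x) * nm y) \<longlonglongrightarrow> 0"
      using tendsto_mult_right[OF assms(3), of "nm y"] by simp
  qed
  then show ?thesis by (simp add: LIM_zero_iff)
qed

lemma complete_nm:
  assumes X: "\<And>n. X n \<in> V" and C: "\<And>e. e > 0 \<Longrightarrow> \<exists>N. \<forall>m\<ge>N. \<forall>n\<ge>N. nm (X m - X n) < e"
  shows "\<exists>x\<in>V. (\<lambda>n. nm (X n - x)) \<longlonglongrightarrow> 0"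
proof -
  have "\<exists>x\<in>V. (\<lambda>n. ip (X n - x) (X n - x)) \<longlonglongrightarrow> 0"
  proof (rule V_complete)
    fix e :: real assume "e > 0"
    then have "sqrt e > 0" by simp
    from C[OF this] obtain N where N: "\<And>m n. m \<ge> N \<Longrightarrow> n \<ge> N \<Longrightarrow> nm (X m - X n) < sqrt e" by blast
    show "\<exists>N. \<forall>m\<ge>N. \<forall>n\<ge>N. ip (X m - X n) (X m - X n) < e"
    proof (intro exI allI impI)
      fix m n assume "m \<ge> N" "n \<ge> N"
      from N[OF this] show "ip (X m - X n) (X m - X n) < e" by (simp add: nm_def)
    qed
  qed (use X in auto)
  then obtain x where x: "x \<in> V" "(\<lambda>n. ip (X n - x) (X n - x)) \<longlonglongrightarrow> 0" by blast
  then have "(\<lambda>n. nm (X n - x)) \<longlonglongrightarrow> 0"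
    unfolding nm_def using tendsto_real_sqrt[OF x(2)] by simp
  with x show ?thesis by blast
qed

text \<open>The functional is only defined on a possibly incomplete subspace \<open>W\<close>; minimising
  \<open>ip w w - 2 * l w\<close> over \<open>W\<close> yields a Cauchy sequence whose limit represents it.\<close>
lemma Riesz:
  assumes W: "subspace W" "W \<subseteq> V"
    and ladd: "\<And>x y. x \<in> W \<Longrightarrow> y \<in> W \<Longrightarrow> l (x + y) = l x + l y"
    and lscale: "\<And>c x. x \<in> W \<Longrightarrow> l (c *\<^sub>R x) = c * l x"
    and lbd: "\<And>x. x \<in> W \<Longrightarrow> \<bar>l x\<bar> \<le> C * nm x"
  shows "\<exists>u\<in>V. \<forall>w\<in>W. ip u w = l w"
proof -
  note WV = subsetD[OF W(2)]
  note Wc = subspace_add[OF W(1)] subspace_diff[OF W(1)] subspace_scale[OF W(1)] subspace_0[OF W(1)]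
  define J where "J w = ip w w - 2 * l w" for w
  \<comment> \<open>Completing the square: \<open>l w \<le> C * nm w\<close> leaves
    \<open>J w \<ge> (nm w - C)\<^sup>2 - C\<^sup>2\<close>.\<close>
  have Jlow: "J w \<ge> - C\<^sup>2" if "w \<in> W" for w
  proof -
    have "0 \<le> (nm w - C)\<^sup>2" by simp
    then show ?thesis using lbd[OF that] nm_sq[OF WV[OF that]] abs_le_D1[OF lbd[OF that]]
      by (simp add: J_def power2_diff algebra_simps)
  qed
  have bdd: "bdd_below (J ` W)" using Jlow by (auto intro!: bdd_belowI)
  have ne: "J ` W \<noteq> {}" using Wc(4) by auto
  define m where "m = Inf (J ` W)"
  have mle: "m \<le> J w" if "w \<in> W" for w unfolding m_def using bdd that by (intro cInf_lower) auto
  have "\<exists>w\<in>W. J w < m + 1 / Suc n" for n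
    using cInf_less_iff[OF ne bdd, of "m + 1 / Suc n"] by (auto simp: m_def)
  then obtain X where XW: "\<And>n. X n \<in> W" and XJ: "\<And>n. J (X n) < m + 1 / Suc n" by metis
  \<comment> \<open>Parallelogram identity: the linear parts of \<open>J\<close> cancel, so two
    near-minimisers are close because their midpoint cannot fall below the infimum.\<close>
  have para: "ip (x - y) (x - y) = 2 * J x + 2 * J y - 4 * J ((1/2) *\<^sub>R (x + y))" if "x \<in> W" "y \<in> W" for x y
    using that WV[OF that(1)] WV[OF that(2)] ip_sym[of x y] Wc
    by (simp add: J_def ip_simps ladd lscale algebra_simps)
  have cau: "ip (X i - X j) (X i - X j) \<le> 2 / Suc i + 2 / Suc j" for i j
  proof -
    have "m \<le> J ((1/2) *\<^sub>R (X i + X j))" using XW Wc by (intro mle) auto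
    then have "ip (X i - X j) (X i - X j) \<le> 2 * (1 / Suc i) + 2 * (1 / Suc j)"
      using para[OF XW XW, of i j] XJ[of i] XJ[of j] by linarith
    then show ?thesis by simp
  qed
  have "\<exists>x\<in>V. (\<lambda>n. ip (X n - x) (X n - x)) \<longlonglongrightarrow> 0"
  proof (rule V_complete)
    fix e :: real assume e: "e > 0"
    obtain N :: nat where N: "inverse (Suc N) < e / 4" using reals_Archimedean[of "e/4"] e by auto
    show "\<exists>N. \<forall>m\<ge>N. \<forall>n\<ge>N. ip (X m - X n) (X m - X n) < e"
    proof (intro exI allI impI)
      fix i j assume ij: "i \<ge> N" "j \<ge> N"
      have "2 / Suc i \<le> 2 * inverse (Suc N)" "2 / Suc j \<le> 2 * inverse (Suc N)"
        using ij by (auto simp: field_simps)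
      with cau[of i j] N show "ip (X i - X j) (X i - X j) < e" by linarith
    qed
  qed (use XW WV in auto)
  then obtain u where u: "u \<in> V" and "(\<lambda>n. ip (X n - u) (X n - u)) \<longlonglongrightarrow> 0" by blast
  then have nu: "(\<lambda>n. nm (X n - u)) \<longlonglongrightarrow> 0"
    unfolding nm_def using tendsto_real_sqrt by fastforce
  have "ip u w = l w" if w: "w \<in> W" for w
  proof -
    define d where "d = ip u w - l w"
    have lim: "(\<lambda>n. ip (X n) w - l w) \<longlonglongrightarrow> d"
      unfolding d_def by (intro tendsto_diff ip_tendsto nu u tendsto_const) (use XW WV w in auto)
    \<comment> \<open>First variation without differentiation: \<open>X n\<close> misses the infimum
      by less than \<open>1 / Suc n\<close>, so moving along \<open>w\<close> can lower
      \<open>J\<close> by no more than that, and the slack vanishes in the limit.\<close>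
    have pos: "0 \<le> 2 * t * d + t\<^sup>2 * ip w w" for t
    proof -
      have "0 \<le> inverse (Suc n) + 2 * t * (ip (X n) w - l w) + t\<^sup>2 * ip w w" for n
      proof -
        have "m \<le> J (X n + t *\<^sub>R w)" using XW w Wc by (intro mle) auto
        also have "\<dots> = J (X n) + 2 * t * (ip (X n) w - l w) + t\<^sup>2 * ip w w"
          using XW[of n] w WV[OF w] WV[OF XW[of n]] Wc ip_sym[OF WV[OF w] WV[OF XW[of n]]]
          by (simp add: J_def ip_simps ladd lscale power2_eq_square algebra_simps)
        finally show ?thesis using XJ[of n] unfolding inverse_eq_divide by linarith
      qed
      moreover have "(\<lambda>n. inverse (Suc n) + 2 * t * (ip (X n) w - l w) + t\<^sup>2 * ip w w)
            \<longlonglongrightarrow> 0 + 2 * t * d + t\<^sup>2 * ip w w"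
        by (intro tendsto_add tendsto_mult tendsto_const lim LIMSEQ_inverse_real_of_nat)
      ultimately show ?thesis by (metis (no_types, lifting) LIMSEQ_le_const add_0)
    qed
    define q where "q = ip w w"
    have q: "q \<ge> 0" using ip_nonneg WV w by (simp add: q_def)
    \<comment> \<open>Dividing by \<open>q + 1\<close> instead of \<open>q\<close> covers
      \<open>w\<close> of seminorm zero; the value is negative unless \<open>d = 0\<close>.\<close>
    have "0 \<le> 2 * (- d / (q + 1)) * d + (- d / (q + 1))\<^sup>2 * q" using pos unfolding q_def .
    also have "\<dots> = - d\<^sup>2 * (q + 2) / (q + 1)\<^sup>2"
    proof -
      have "q + 1 \<noteq> 0" using q by simp
      then show ?thesis by (simp add: power2_eq_square divide_simps) (simp add: algebra_simps)
    qed
    finally have "d\<^sup>2 * (q + 2) \<le> 0" using q by (simp add: divide_simps split: if_splits)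
    then have "d = 0" using q by (simp add: mult_le_0_iff)
    then show ?thesis by (simp add: d_def)
  qed
  with u show ?thesis by blast
qed

text \<open>A gliding hump argument, without Baire category. If the norms were unbounded, points
  \<open>x k\<close> could be chosen with steps of length at most \<open>(1/3)^k\<close>, each
  making the value of a functional of huge norm at least \<open>(1/3)^k\<close> times that norm; the
  later steps are too short to undo this, so the values at the limit \<open>z\<close> are
  unbounded.\<close>

lemma uniform_boundedness:
  assumes X: "\<And>n::nat. X n \<in> V" and b: "\<And>y. y \<in> V \<Longrightarrow> Bseq (\<lambda>n. ip (X n) y)"
  shows "\<exists>C. \<forall>n. nm (X n) \<le> C"
proof (rule ccontr)
  assume "\<not> ?thesis"
  then have unb: "\<exists>n. nm (X n) > K" for K by (meson not_le)
  define P where "P k = (\<lambda>(n::nat, x). x \<in> V \<and> \<bar>ip (X n) x\<bar> \<ge> (1/3)^k * nm (X n) \<and> nm (X n) \<ge> 2 * real k * 3^k)" for k :: nat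
  define Q where "Q k = (\<lambda>(n::nat, x) (n'::nat, x'). nm (x' - x) \<le> (1/3)^(Suc k))" for k :: nat
  have step: "\<exists>n x'. P k (n, x') \<and> nm (x' - x) \<le> (1/3)^k" if x: "x \<in> V" for k x
  proof -
    obtain n where n: "nm (X n) > 2 * real k * 3^k" using unb by blast
    then have pos: "nm (X n) > 0" by (smt (verit) of_nat_0_le_iff zero_le_mult_iff zero_le_power)
    \<comment> \<open>The sign of the current value, so that adding this multiple of
      \<open>X n\<close> can only enlarge the absolute value.\<close>
    define s :: real where "s = (if ip (X n) x \<ge> 0 then 1 else -1)"
    define y where "y = (s * (1/3)^k / nm (X n)) *\<^sub>R X n"
    have y: "y \<in> V" using X by (simp add: y_def V_closed)
    have "ip (X n) y = s * (1/3)^k * nm (X n)"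
      using X[of n] pos by (simp add: y_def ip_simps power2_eq_square nm_sq[OF X[of n], symmetric])
    then have "\<bar>ip (X n) (x + y)\<bar> \<ge> (1/3)^k * nm (X n)"
      using mult_pos_pos[OF _ pos, of "(1/3)^k"] X[of n] x y by (auto simp: ip_simps s_def abs_if)
    moreover have "nm y \<le> (1/3)^k" using pos X[of n] by (simp add: y_def nm_scale s_def abs_mult)
    ultimately have "P k (n, x + y) \<and> nm (x + y - x) \<le> (1/3)^k"
      using n x y by (auto simp: P_def V_closed)
    then show ?thesis by blast
  qed
  have "\<exists>f. \<forall>k. P k (f k) \<and> Q k (f k) (f (Suc k))"
  proof (rule dependent_nat_choice)
    show "\<exists>f. P 0 f" using step[OF V_closed(4), of 0] by blast
    fix f k assume "P k f"
    then have "snd f \<in> V" by (auto simp: P_def)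
    from step[OF this, of "Suc k"] show "\<exists>g. P (Suc k) g \<and> Q k f g"
      by (cases f) (auto simp: Q_def)
  qed
  then obtain f where f: "\<And>k. P k (f k)" "\<And>k. Q k (f k) (f (Suc k))" by blast
  define N where "N k = fst (f k)" for k
  define x where "x k = snd (f k)" for k
  have xV: "x k \<in> V" and xl: "\<bar>ip (X (N k)) (x k)\<bar> \<ge> (1/3)^k * nm (X (N k))"
    and Nl: "nm (X (N k)) \<ge> 2 * real k * 3^k" for k
    using f(1)[of k] by (auto simp: P_def N_def x_def split: prod.splits)
  have xd: "nm (x (Suc k) - x k) \<le> (1/3)^(Suc k)" for k
    using f(2)[of k] by (auto simp: Q_def x_def split: prod.splits)
  \<comment> \<open>The later steps sum to at most half of \<open>(1/3)^k\<close>, that is, half of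
    what the choice at stage \<open>k\<close> guarantees; the limit \<open>z\<close> keeps the other
    half.\<close>
  have dist: "nm (x (k + j) - x k) \<le> (1/2) * (1/3)^k * (1 - (1/3)^j)" for k j
  proof (induction j)
    case 0
    have "ip 0 0 = 0" using ip_scale[of 0 0 0] V_closed(4) by simp
    then show ?case by (simp add: nm_def)
  next
    case (Suc j)
    have "nm (x (k + Suc j) - x k) = nm ((x (Suc (k + j)) - x (k + j)) + (x (k + j) - x k))" by simp
    also have "\<dots> \<le> nm (x (Suc (k + j)) - x (k + j)) + nm (x (k + j) - x k)"
      using xV by (intro nm_triangle) (auto simp: V_closed)
    also have "\<dots> \<le> (1/3)^(Suc (k + j)) + (1/2) * (1/3)^k * (1 - (1/3)^j)"
      using xd Suc by (intro add_mono)
    also have "\<dots> = (1/2) * (1/3)^k * (1 - (1/3)^(Suc j))"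
      by (simp add: power_add field_simps)
    finally show ?case .
  qed
  have dist': "nm (x m - x k) \<le> (1/2) * (1/3)^k" if "m \<ge> k" for m k
  proof -
    have "nm (x m - x k) \<le> (1/2) * (1/3)^k * (1 - (1/3)^(m - k))" using dist[of k "m - k"] that by simp
    also have "\<dots> \<le> (1/2) * (1/3)^k * 1" by (intro mult_left_mono) auto
    finally show ?thesis by simp
  qed
  have "\<exists>z\<in>V. (\<lambda>n. nm (x n - z)) \<longlonglongrightarrow> 0"
  proof (rule complete_nm)
    fix e :: real assume e: "e > 0"
    obtain K where K: "(1/3::real)^K < e" using real_arch_pow_inv[OF e, of "1/3"] by auto
    show "\<exists>N. \<forall>m\<ge>N. \<forall>n\<ge>N. nm (x m - x n) < e"
    proof (intro exI allI impI)
      fix m n assume mn: "m \<ge> K" "n \<ge> K"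
      have "nm (x m - x n) = nm ((x m - x K) - (x n - x K))" by simp
      also have "\<dots> \<le> nm (x m - x K) + nm (x n - x K)" using xV by (intro nm_diff) (auto simp: V_closed)
      also have "\<dots> \<le> (1/3)^K" using dist'[OF mn(1)] dist'[OF mn(2)] by simp
      finally show "nm (x m - x n) < e" using K by simp
    qed
  qed (use xV in auto)
  then obtain z where z: "z \<in> V" "(\<lambda>n. nm (x n - z)) \<longlonglongrightarrow> 0" by blast
  have dz: "nm (x k - z) \<le> (1/2) * (1/3)^k" for k
  proof -
    have "(\<lambda>n. (1/2) * (1/3)^k + nm (x n - z)) \<longlonglongrightarrow> (1/2) * (1/3)^k + 0"
      by (intro tendsto_add tendsto_const z)
    moreover have "nm (x k - z) \<le> (1/2) * (1/3)^k + nm (x n - z)" if "n \<ge> k" for n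
    proof -
      have "nm (x k - z) = nm ((x n - z) - (x n - x k))" by simp
      also have "\<dots> \<le> nm (x n - z) + nm (x n - x k)" using xV z by (intro nm_diff) (auto simp: V_closed)
      finally show ?thesis using dist'[OF that] by simp
    qed
    ultimately show ?thesis by (metis (no_types, lifting) LIMSEQ_le_const add.right_neutral)
  qed
  have "\<bar>ip (X (N k)) z\<bar> \<ge> k" for k
  proof -
    have "\<bar>ip (X (N k)) (x k - z)\<bar> \<le> nm (X (N k)) * ((1/2) * (1/3)^k)"
      using Cauchy_Schwarz[of "X (N k)" "x k - z"] dz[of k] xV z X
      by (meson V_closed(2) mult_left_mono nm_nonneg order_trans)
    then have "\<bar>ip (X (N k)) z\<bar> \<ge> (1/2) * (1/3)^k * nm (X (N k))"
      using xl[of k] ip_diff_right[OF xV z(1) X, of "N k" k] by (simp add: mult.commute abs_if split: if_splits)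
    moreover have "(1/2) * (1/3)^k * nm (X (N k)) \<ge> (1/2) * (1/3)^k * (2 * real k * 3^k)"
      using Nl by (intro mult_left_mono) auto
    moreover have "(1/2) * (1/3)^k * (2 * real k * 3^k) = k" by (simp add: power_divide)
    ultimately show ?thesis by linarith
  qed
  moreover obtain C where "\<And>n. \<bar>ip (X n) z\<bar> \<le> C" using b[OF z(1)] by (auto simp: Bseq_def)
  ultimately show False by (metis le_less_trans less_irrefl order_trans reals_Archimedean2)
qed

text \<open>Closedness is sequential in the seminorm. In particular such a subspace contains every
  vector of \<open>V\<close> at seminorm distance zero from a member, which replaces the passage to
  equivalence classes.\<close>

definition closed_sub :: "'v set \<Rightarrow> bool" where
  "closed_sub M \<longleftrightarrow> subspace M \<and> M \<subseteq> V \<and>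
     (\<forall>X x. (\<forall>n::nat. X n \<in> M) \<longrightarrow> x \<in> V \<longrightarrow> (\<lambda>n. nm (X n - x)) \<longlonglongrightarrow> 0 \<longrightarrow> x \<in> M)"

lemma closed_subD:
  assumes "closed_sub M"
  shows "subspace M" "M \<subseteq> V"
    "\<And>X x. (\<And>n::nat. X n \<in> M) \<Longrightarrow> x \<in> V \<Longrightarrow> (\<lambda>n. nm (X n - x)) \<longlonglongrightarrow> 0 \<Longrightarrow> x \<in> M"
  using assms unfolding closed_sub_def by blast+

lemma closed_sub_V: "closed_sub V"
  using V_subspace by (auto simp: closed_sub_def)

text \<open>Completeness transfers in two halves: the lower bound makes a sequence that is Cauchy
  for \<open>s\<close> Cauchy for \<open>ip\<close>, and the upper bound makes its limit for
  \<open>ip\<close> a limit for \<open>s\<close>.\<close>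

lemma equiv_semi_hilbert:
  assumes M: "closed_sub M" and \<alpha>: "\<alpha> > 0"
    and sadd: "\<And>x y z. x \<in> M \<Longrightarrow> y \<in> M \<Longrightarrow> z \<in> M \<Longrightarrow> s (x + y) z = s x z + s y z"
    and sscale: "\<And>c x z. x \<in> M \<Longrightarrow> z \<in> M \<Longrightarrow> s (c *\<^sub>R x) z = c * s x z"
    and ssym: "\<And>x y. x \<in> M \<Longrightarrow> y \<in> M \<Longrightarrow> s x y = s y x"
    and low: "\<And>x. x \<in> M \<Longrightarrow> \<alpha> * ip x x \<le> s x x"
    and up: "\<And>x. x \<in> M \<Longrightarrow> s x x \<le> \<beta> * ip x x"
  shows "semi_hilbert M s"
proof
  note MV = subsetD[OF closed_subD(2)[OF M]]
  note Mc = subspace_diff[OF closed_subD(1)[OF M]]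
  show "subspace M" by (rule closed_subD(1)[OF M])
  show "0 \<le> s x x" if "x \<in> M" for x
    using low[OF that] ip_nonneg[OF MV[OF that]] \<alpha> by (meson less_imp_le mult_nonneg_nonneg order_trans)
  fix X :: "nat \<Rightarrow> 'v"
  assume X: "\<And>n. X n \<in> M" and C: "\<And>e. e > 0 \<Longrightarrow> \<exists>N. \<forall>m\<ge>N. \<forall>n\<ge>N. s (X m - X n) (X m - X n) < e"
  have "\<exists>x\<in>V. (\<lambda>n. ip (X n - x) (X n - x)) \<longlonglongrightarrow> 0"
  proof (rule V_complete)
    fix e :: real assume "e > 0"
    then have "\<alpha> * e > 0" using \<alpha> by simp
    from C[OF this] obtain N where N: "\<And>m n. m \<ge> N \<Longrightarrow> n \<ge> N \<Longrightarrow> s (X m - X n) (X m - X n) < \<alpha> * e" by blast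
    show "\<exists>N. \<forall>m\<ge>N. \<forall>n\<ge>N. ip (X m - X n) (X m - X n) < e"
    proof (intro exI allI impI)
      fix m n assume "m \<ge> N" "n \<ge> N"
      then have "\<alpha> * ip (X m - X n) (X m - X n) < \<alpha> * e"
        using N low[OF Mc[OF X X]] by (meson le_less_trans)
      then show "ip (X m - X n) (X m - X n) < e" using \<alpha> by simp
    qed
  qed (use X MV in auto)
  then obtain x where x: "x \<in> V" "(\<lambda>n. ip (X n - x) (X n - x)) \<longlonglongrightarrow> 0" by blast
  have "(\<lambda>n. nm (X n - x)) \<longlonglongrightarrow> 0"
    unfolding nm_def using tendsto_real_sqrt[OF x(2)] by simp
  then have xM: "x \<in> M" using closed_subD(3)[OF M, of X x] X x by blast
  have "(\<lambda>n. s (X n - x) (X n - x)) \<longlonglongrightarrow> 0"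
  proof (rule real_tendsto_sandwich)
    show "\<forall>\<^sub>F n in sequentially. 0 \<le> s (X n - x) (X n - x)"
      using low[OF Mc[OF X xM]] ip_nonneg[OF MV[OF Mc[OF X xM]]] \<alpha>
      by (auto intro!: always_eventually) (meson less_imp_le mult_nonneg_nonneg order_trans)
    show "\<forall>\<^sub>F n in sequentially. s (X n - x) (X n - x) \<le> \<beta> * ip (X n - x) (X n - x)"
      using up[OF Mc[OF X xM]] by simp
    show "(\<lambda>n. \<beta> * ip (X n - x) (X n - x)) \<longlonglongrightarrow> 0" using tendsto_mult_left[OF x(2), of \<beta>] by simp
  qed simp
  with xM show "\<exists>x\<in>M. (\<lambda>n. s (X n - x) (X n - x)) \<longlonglongrightarrow> 0" by blast
qed (use sadd sscale ssym in auto)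

text \<open>The symmetric case of the Lax-Milgram theorem: the coercive form \<open>s\<close> is
  itself a complete inner product, so Riesz applies to it. With \<open>s = ip\<close> and both
  constants equal to 1 it is the orthogonal projection onto \<open>M\<close>.\<close>

lemma equiv_Riesz:
  assumes M: "closed_sub M" and \<alpha>: "\<alpha> > 0"
    and sadd: "\<And>x y z. x \<in> M \<Longrightarrow> y \<in> M \<Longrightarrow> z \<in> M \<Longrightarrow> s (x + y) z = s x z + s y z"
    and sscale: "\<And>c x z. x \<in> M \<Longrightarrow> z \<in> M \<Longrightarrow> s (c *\<^sub>R x) z = c * s x z"
    and ssym: "\<And>x y. x \<in> M \<Longrightarrow> y \<in> M \<Longrightarrow> s x y = s y x"
    and low: "\<And>x. x \<in> M \<Longrightarrow> \<alpha> * ip x x \<le> s x x"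
    and up: "\<And>x. x \<in> M \<Longrightarrow> s x x \<le> \<beta> * ip x x"
    and x: "x \<in> V"
  shows "\<exists>u\<in>M. \<forall>v\<in>M. s u v = ip x v"
proof -
  note MV = subsetD[OF closed_subD(2)[OF M]]
  have S: "semi_hilbert M s" by (rule equiv_semi_hilbert[OF assms(1-7)])
  show ?thesis
  proof (rule semi_hilbert.Riesz[OF S closed_subD(1)[OF M], of "ip x" "nm x / sqrt \<alpha>"])
    fix v assume v: "v \<in> M"
    have "\<bar>ip x v\<bar> \<le> nm x * nm v" by (rule Cauchy_Schwarz[OF x MV[OF v]])
    also have "\<dots> \<le> nm x * (sqrt (s v v) / sqrt \<alpha>)"
      using low[OF v] \<alpha> x
      by (intro mult_left_mono) (auto simp: nm_def ip_nonneg field_simps real_sqrt_mult[symmetric])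
    finally show "\<bar>ip x v\<bar> \<le> nm x / sqrt \<alpha> * semi_hilbert.nm s v"
      by (simp add: semi_hilbert.nm_def[OF S])
  qed (use x MV in \<open>auto simp: ip_simps\<close>)
qed

text \<open>Equiboundedness and a three-term estimate for the Cauchy property. It serves to pass
  from convergence on generators to convergence on the closed subspace that they generate.\<close>

lemma closed_sub_convergent:
  assumes Tadd: "\<And>n x y. x \<in> V \<Longrightarrow> y \<in> V \<Longrightarrow> T n (x + y) = T n x + T n y"
    and Tscale: "\<And>n c x. x \<in> V \<Longrightarrow> T n (c *\<^sub>R x) = c * T n x"
    and Tbd: "\<And>n x. x \<in> V \<Longrightarrow> \<bar>T n x\<bar> \<le> C * nm x"
  shows "closed_sub {x\<in>V. convergent (\<lambda>n::nat. T n x :: real)}"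
  unfolding closed_sub_def
proof (intro conjI allI impI)
  have T0: "T n 0 = 0" for n using Tscale[of 0 n 0] V_closed(4) by simp
  show "subspace {x\<in>V. convergent (\<lambda>n. T n x)}"
    by (auto simp: subspace_def V_closed Tadd Tscale T0 convergent_const intro!: convergent_add convergent_mult)
  fix X x assume X: "\<forall>n. X n \<in> {x\<in>V. convergent (\<lambda>n. T n x)}" and x: "x \<in> V"
    and lim: "(\<lambda>n. nm (X n - x)) \<longlonglongrightarrow> 0"
  have XV: "X n \<in> V" for n using X by blast
  have Tdiff: "T n (y - z) = T n y - T n z" if "y \<in> V" "z \<in> V" for n y z
    using Tadd[of y "(-1) *\<^sub>R z" n] Tscale[of z n "-1"] that V_closed(3)[of z "-1"] by simp
  have "Cauchy (\<lambda>n. T n x)"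
  proof (rule metric_CauchyI)
    fix e :: real assume e: "e > 0"
    have "(\<lambda>n. C * nm (X n - x)) \<longlonglongrightarrow> 0" using tendsto_mult_left[OF lim, of C] by simp
    then have "\<forall>\<^sub>F n in sequentially. C * nm (X n - x) < e / 3" using e by (intro order_tendstoD) auto
    then obtain k where k: "C * nm (X k - x) < e / 3" by (auto simp: eventually_sequentially)
    have "Cauchy (\<lambda>n. T n (X k))" using X by (auto simp: Cauchy_convergent_iff)
    then obtain N where N: "\<And>m n. m \<ge> N \<Longrightarrow> n \<ge> N \<Longrightarrow> dist (T m (X k)) (T n (X k)) < e / 3"
      using e metric_CauchyD[of _ "e/3"] by (metis divide_pos_pos zero_less_numeral)
    have b: "\<bar>T n (X k) - T n x\<bar> < e / 3" for n
      using Tbd[of "X k - x" n] k XV[of k] x Tdiff[OF XV x, of n k] by (simp add: V_closed)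
    show "\<exists>N. \<forall>m\<ge>N. \<forall>n\<ge>N. dist (T m x) (T n x) < e"
    proof (intro exI allI impI)
      fix m n assume "m \<ge> N" "n \<ge> N"
      then show "dist (T m x) (T n x) < e"
        using N[of m n] b[of m] b[of n] unfolding dist_real_def by linarith
    qed
  qed
  then show "x \<in> {x\<in>V. convergent (\<lambda>n. T n x)}" using x by (simp add: Cauchy_convergent_iff)
qed auto

end

section \<open>Diagonal extraction and the limit of the solution operators\<close>

lemma bounded_diagonal_subsequence:
  fixes f :: "nat \<Rightarrow> nat \<Rightarrow> real"
  assumes "\<And>m. Bseq (f m)"
  shows "\<exists>r. strict_mono r \<and> (\<forall>m. convergent (\<lambda>n. f m (r n)))"
proof -
  interpret subseqs "\<lambda>m r. convergent (\<lambda>n. f m (r n))"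
  proof
    fix m and s :: "nat \<Rightarrow> nat" assume "strict_mono s"
    have "bounded (range (\<lambda>n. f m (s n)))"
      using assms[of m] by (auto simp: Bseq_def bounded_iff)
    then obtain l r where "strict_mono r" "((\<lambda>n. f m (s n)) \<circ> r) \<longlonglongrightarrow> l"
      using bounded_imp_convergent_subsequence by blast
    then show "\<exists>r'. strict_mono r' \<and> convergent (\<lambda>n. f m ((s \<circ> r') n))"
      by (auto simp: convergent_def o_def)
  qed
  have "convergent (\<lambda>n. f m (diagseq n))" for m
  proof -
    \<comment> \<open>The diagonal sequence is a subsequence of the \<open>m\<close>-th one only
      from index \<open>Suc m\<close> on; the initial segment does not affect convergence.\<close>
    have "convergent (\<lambda>n. f m ((diagseq \<circ> (+) (Suc m)) n))"
    proof (rule diagseq_holds)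
      fix r s :: "nat \<Rightarrow> nat" and n
      assume "strict_mono r" "convergent (\<lambda>k. f n (s k))"
      then show "convergent (\<lambda>k. f n ((s \<circ> r) k))"
        using convergent_subseq_convergent[of "\<lambda>k. f n (s k)" r] by (simp add: o_def)
    qed
    then show ?thesis using convergent_ignore_initial_segment[of "\<lambda>n. f m (diagseq n)" "Suc m"]
      by (simp add: o_def add.commute)
  qed
  then show ?thesis using subseq_diagseq by blast
qed

text \<open>The solution operators \<open>R n\<close> need only be studied on the smallest closed subspace that
  contains the targets \<open>w j\<close> and is invariant under all of them. It is generated by countably
  many vectors, so no separability of the whole space is needed to extract a subsequence.\<close>
lemma (in semi_hilbert) oscillating_solutions:
  fixes a :: "nat \<Rightarrow> 'v \<Rightarrow> 'v \<Rightarrow> real" and w :: "nat \<Rightarrow> 'v"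
  assumes \<alpha>: "\<alpha> > 0" and w: "\<And>j. w j \<in> V"
    and aadd: "\<And>n x y z. x \<in> V \<Longrightarrow> y \<in> V \<Longrightarrow> z \<in> V \<Longrightarrow> a n (x + y) z = a n x z + a n y z"
    and ascale: "\<And>n c x z. x \<in> V \<Longrightarrow> z \<in> V \<Longrightarrow> a n (c *\<^sub>R x) z = c * a n x z"
    and asym: "\<And>n x y. x \<in> V \<Longrightarrow> y \<in> V \<Longrightarrow> a n x y = a n y x"
    and alow: "\<And>n x. x \<in> V \<Longrightarrow> \<alpha> * ip x x \<le> a n x x"
    and aup: "\<And>n x. x \<in> V \<Longrightarrow> a n x x \<le> \<beta> * ip x x"
  shows "\<exists>r. strict_mono r \<and> (\<forall>j. \<exists>F\<in>V. \<exists>X. (\<forall>n. X n \<in> V) \<and>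
           (\<forall>n. \<forall>v\<in>V. a (r n) (X n) v = ip F v) \<and> (\<forall>v\<in>V. (\<lambda>n. ip (X n) v) \<longlonglongrightarrow> ip (w j) v))"
proof -
  have ex: "\<exists>u\<in>V. \<forall>v\<in>V. a n u v = ip x v" if "x \<in> V" for n x
    by (rule equiv_Riesz[OF closed_sub_V \<alpha>, of "a n" \<beta>]) (fact aadd ascale asym alow aup that)+
  define R where "R n x = (SOME u. u \<in> V \<and> (\<forall>v\<in>V. a n u v = ip x v))" for n x
  have "R n x \<in> V \<and> (\<forall>v\<in>V. a n (R n x) v = ip x v)" if "x \<in> V" for n x
    using someI_ex[OF ex[OF that, of n, unfolded Bex_def]] unfolding R_def .
  then have RV: "\<And>n x. x \<in> V \<Longrightarrow> R n x \<in> V" and Ra: "\<And>n x v. x \<in> V \<Longrightarrow> v \<in> V \<Longrightarrow> a n (R n x) v = ip x v"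
    by blast+
  have Rsym: "ip (R n x) y = ip x (R n y)" if "x \<in> V" "y \<in> V" for n x y
    using Ra[OF that(1) RV[OF that(2)]] Ra[OF that(2) RV[OF that(1)]] asym RV ip_sym that by metis
  have a_bd: "nm u \<le> nm x / \<alpha>" if u: "u \<in> V" and x: "x \<in> V" and e: "\<And>v. v \<in> V \<Longrightarrow> a n u v = ip x v" for n u x
  proof -
    have "\<alpha> * (nm u)\<^sup>2 \<le> nm x * nm u"
      using alow[OF u, of n] e[OF u] Cauchy_Schwarz[OF x u] by (simp add: nm_sq u)
    then show ?thesis
      using \<alpha> nm_nonneg[OF u] nm_nonneg[OF x] by (cases "nm u = 0") (auto simp: field_simps power2_eq_square)
  qed
  have Rbd: "nm (R n x) \<le> nm x / \<alpha>" if "x \<in> V" for n x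
    using that RV Ra by (intro a_bd[of _ _ n]) auto
  \<comment> \<open>Coercivity of the inverse: \<open>ip x x = a n (R n x) x\<close>, and
    Cauchy-Schwarz for the form \<open>a n\<close> bounds its square by
    \<open>ip (R n x) x * a n x x\<close>. This lower bound passes to the weak limit of the
    operators, where it gives invertibility.\<close>
  have Rlow: "ip x x \<le> \<beta> * ip (R n x) x" if x: "x \<in> V" for n x
  proof -
    interpret A: semi_hilbert V "a n"
      by (rule equiv_semi_hilbert[OF closed_sub_V \<alpha>]) (use aadd ascale asym alow aup in auto)
    have "(ip x x)\<^sup>2 \<le> (A.nm (R n x) * A.nm x)\<^sup>2"
      using A.Cauchy_Schwarz[OF RV[OF x, of n] x] Ra[OF x x, of n]
      by (metis abs_ge_self abs_le_square_iff abs_of_nonneg ip_nonneg[OF x] order_trans)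
    also have "\<dots> = ip (R n x) x * a n x x"
      using Ra[OF x RV[OF x], of n] ip_sym[OF x RV[OF x]]
      by (simp add: power_mult_distrib A.nm_sq x RV)
    also have "\<dots> \<le> ip (R n x) x * (\<beta> * ip x x)"
    proof (rule mult_left_mono[OF aup[OF x]])
      show "0 \<le> ip (R n x) x"
        using A.ip_nonneg[OF RV[OF x, of n]] Ra[OF x RV[OF x], of n] ip_sym[OF x RV[OF x]] by simp
    qed
    finally have "ip x x * ip x x \<le> ip x x * (\<beta> * ip (R n x) x)" by (simp add: power2_eq_square mult_ac)
    then show ?thesis
    proof (cases "ip x x = 0")
      case True
      then have "ip (R n x) x = 0" using Cauchy_Schwarz[OF RV[OF x, of n] x] nm_0_iff[OF x] by simp
      with True show ?thesis by simp
    qed (use ip_nonneg[OF x] in auto)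
  qed
  \<comment> \<open>All words in the operators \<open>R n\<close> applied to the targets.
    \<open>from_nat\<close> decodes a list of operator indices and a target index, so prefixing an
    index shows that the range of \<open>d\<close> is invariant.\<close>
  define d where "d k = (case from_nat k of (ns, j) \<Rightarrow> foldr R ns (w j))" for k
  have dV: "d k \<in> V" for k
  proof -
    have "foldr R ns (w j) \<in> V" for ns j by (induction ns) (auto simp: w RV)
    then show ?thesis by (simp add: d_def split: prod.splits)
  qed
  have dR: "\<exists>k'. R n (d k) = d k'" for n k
  proof -
    obtain ns :: "nat list" and j :: nat where "from_nat k = (ns, j)" by (cases "from_nat k :: nat list \<times> nat")
    then have "R n (d k) = d (to_nat (n # ns, j))" by (simp add: d_def)
    then show ?thesis by blast
  qed
  have dw: "\<exists>k. d k = w j" for j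
    by (rule exI[of _ "to_nat ([] :: nat list, j)"]) (simp add: d_def)
  define M where "M = \<Inter>{K. closed_sub K \<and> range d \<subseteq> K}"
  have Mleast: "M \<subseteq> K" if "closed_sub K" "\<And>k. d k \<in> K" for K
    using that by (auto simp: M_def)
  have MV: "M \<subseteq> V" using Mleast[OF closed_sub_V] dV by blast
  have M: "closed_sub M"
    unfolding closed_sub_def
  proof (intro conjI allI impI MV)
    show "subspace M" unfolding M_def using closed_subD(1) by (intro subspace_Inter) auto
    fix X x assume "\<forall>n. X n \<in> M" "x \<in> V" "(\<lambda>n. nm (X n - x)) \<longlonglongrightarrow> 0"
    then show "x \<in> M" unfolding M_def using closed_subD(3) by blast
  qed
  have dM: "d k \<in> M" for k by (auto simp: M_def)
  note Mc = subspace_add[OF closed_subD(1)[OF M]] subspace_diff[OF closed_subD(1)[OF M]]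
    subspace_scale[OF closed_subD(1)[OF M]] subspace_0[OF closed_subD(1)[OF M]]
  have null_M: "y \<in> M" if "x \<in> M" "y \<in> V" "nm (x - y) = 0" for x y
    using closed_subD(3)[OF M, of "\<lambda>_. x" y] that by simp
  \<comment> \<open>\<open>R\<close> picks solutions by choice, so it is linear only up to vectors
    of seminorm zero; closed subspaces absorb the difference.\<close>
  have Rlin: "nm (R n (x + y) - (R n x + R n y)) = 0" "nm (R n (c *\<^sub>R x) - c *\<^sub>R R n x) = 0"
    if x: "x \<in> V" and y: "y \<in> V" for n c x y
  proof -
    have z: "nm (0::'v) = 0" using ip_scale[of 0 0 0] V_closed(4) by (simp add: nm_def)
    have adiff: "a n (u - v) t = a n u t - a n v t" if "u \<in> V" "v \<in> V" "t \<in> V" for u v t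
      using aadd[of u "(-1) *\<^sub>R v" t n] ascale[of v t n "-1"] that V_closed(3)[of v "-1"] by simp
    have "ip 0 v = 0" if "v \<in> V" for v using ip_scale[of 0 v 0] that V_closed(4) by simp
    then have "nm (R n (x + y) - (R n x + R n y)) \<le> nm 0 / \<alpha>" "nm (R n (c *\<^sub>R x) - c *\<^sub>R R n x) \<le> nm 0 / \<alpha>"
      using x y by (intro a_bd[of _ _ n]; simp add: adiff aadd ascale Ra RV V_closed ip_simps)+
    then show "nm (R n (x + y) - (R n x + R n y)) = 0" "nm (R n (c *\<^sub>R x) - c *\<^sub>R R n x) = 0"
      using z nm_nonneg x y RV V_closed by (metis div_0 order_antisym)+
  qed
  have RM: "R n x \<in> M" if xM: "x \<in> M" for n x
  proof -
    \<comment> \<open>The members of \<open>M\<close> whose image stays in \<open>M\<close> form a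
      closed subspace containing every \<open>d k\<close>; minimality of \<open>M\<close> makes it
      all of \<open>M\<close>.\<close>
    have "closed_sub {x \<in> M. R n x \<in> M}"
      unfolding closed_sub_def
    proof (intro conjI allI impI)
      have zR: "R n 0 \<in> M"
      proof (rule null_M[OF Mc(4)])
        show "nm (0 - R n 0) = 0"
          using Rlin(2)[of 0 0 n 0] V_closed(4) nm_scale[of "R n 0" "-1"] RV[of 0] by simp
      qed (simp add: RV V_closed)
      show "subspace {x \<in> M. R n x \<in> M}"
        unfolding subspace_def
      proof (intro conjI ballI allI)
        fix x y assume "x \<in> {x \<in> M. R n x \<in> M}" "y \<in> {x \<in> M. R n x \<in> M}"
        then have *: "x \<in> M" "y \<in> M" "R n x \<in> M" "R n y \<in> M" "x \<in> V" "y \<in> V" using MV by auto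
        have "R n (x + y) \<in> M"
        proof (rule null_M[OF Mc(1)[OF *(3,4)]])
          show "nm (R n x + R n y - R n (x + y)) = 0"
            using Rlin(1)[of x y n] * nm_scale[of "R n (x + y) - (R n x + R n y)" "-1"]
            by (simp add: RV V_closed)
        qed (simp add: RV V_closed *)
        with * show "x + y \<in> {x \<in> M. R n x \<in> M}" by (simp add: Mc)
      next
        fix x and c :: real assume "x \<in> {x \<in> M. R n x \<in> M}"
        then have *: "x \<in> M" "R n x \<in> M" "x \<in> V" using MV by auto
        have "R n (c *\<^sub>R x) \<in> M"
        proof (rule null_M[OF Mc(3)[OF *(2)]])
          show "nm (c *\<^sub>R R n x - R n (c *\<^sub>R x)) = 0"
            using Rlin(2)[of x x n c] * nm_scale[of "R n (c *\<^sub>R x) - c *\<^sub>R R n x" "-1"]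
            by (simp add: RV V_closed)
        qed (simp add: RV V_closed *)
        with * show "c *\<^sub>R x \<in> {x \<in> M. R n x \<in> M}" by (simp add: Mc)
      qed (simp add: Mc zR)
      fix X x assume X: "\<forall>k. X k \<in> {x \<in> M. R n x \<in> M}" and x: "x \<in> V" and lim: "(\<lambda>k. nm (X k - x)) \<longlonglongrightarrow> 0"
      have XV: "X k \<in> V" for k using X MV by blast
      have adiff: "a n (u - v) t = a n u t - a n v t" if "u \<in> V" "v \<in> V" "t \<in> V" for u v t
        using aadd[of u "(-1) *\<^sub>R v" t n] ascale[of v t n "-1"] that V_closed(3)[of v "-1"] by simp
      have le: "nm (R n (X k) - R n x) \<le> nm (X k - x) / \<alpha>" for k
        using XV[of k] x by (intro a_bd[of _ _ n]) (auto simp: adiff Ra RV V_closed ip_simps)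
      have "(\<lambda>k. nm (R n (X k) - R n x)) \<longlonglongrightarrow> 0"
      proof (rule real_tendsto_sandwich[where f = "\<lambda>_. 0"])
        show "(\<lambda>k. nm (X k - x) / \<alpha>) \<longlonglongrightarrow> 0" using tendsto_divide[OF lim tendsto_const, of \<alpha>] \<alpha> by simp
      qed (use le XV x in \<open>auto simp: RV V_closed\<close>)
      then have "R n x \<in> M" using closed_subD(3)[OF M, of "\<lambda>k. R n (X k)" "R n x"] X x RV by blast
      moreover have "x \<in> M" using closed_subD(3)[OF M, of X x] X x lim by blast
      ultimately show "x \<in> {x \<in> M. R n x \<in> M}" by simp
    qed (use MV in auto)
    moreover have "d k \<in> {x \<in> M. R n x \<in> M}" for k using dM dR by (metis (mono_tags, lifting) mem_Collect_eq)
    ultimately show ?thesis using Mleast xM by blast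
  qed
  have sbd: "\<bar>ip x (R n y)\<bar> \<le> (nm y / \<alpha>) * nm x" if "x \<in> V" "y \<in> V" for n x y
    using Cauchy_Schwarz[OF that(1) RV[OF that(2)], of n] mult_left_mono[OF Rbd[OF that(2), of n] nm_nonneg[OF that(1)]]
    by (simp add: mult.commute)
  define f where "f m n = (case prod_decode m of (i, j) \<Rightarrow> ip (d i) (R n (d j)))" for m n
  have "Bseq (f m)" for m
    by (rule BseqI'[of _ "case prod_decode m of (i, j) \<Rightarrow> nm (d j) / \<alpha> * nm (d i)"])
      (use sbd dV in \<open>auto simp: f_def split: prod.splits\<close>)
  then obtain r where r: "strict_mono r" and conv: "\<And>m. convergent (\<lambda>n. f m (r n))"
    using bounded_diagonal_subsequence by blast
  have c1: "convergent (\<lambda>n. ip (d i) (R (r n) (d j)))" for i j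
    using conv[of "prod_encode (i, j)"] by (simp add: f_def)
  have c2: "convergent (\<lambda>n. ip x (R (r n) (d j)))" if "x \<in> M" for x j
  proof -
    have "closed_sub {x\<in>V. convergent (\<lambda>n. ip x (R (r n) (d j)))}"
      by (rule closed_sub_convergent[where C = "nm (d j) / \<alpha>"]) (use sbd dV in \<open>auto simp: ip_simps RV\<close>)
    from subsetD[OF Mleast[OF this] that] c1 dV show ?thesis by simp
  qed
  \<comment> \<open>The left argument has been extended from the \<open>d k\<close> to
    \<open>M\<close> by equiboundedness; symmetry of \<open>R\<close> lets the same argument extend
    the right one.\<close>
  have c3: "convergent (\<lambda>n. ip x (R (r n) y))" if x: "x \<in> M" and y: "y \<in> M" for x y
  proof -
    have xV: "x \<in> V" using x MV by blast
    have "closed_sub {y\<in>V. convergent (\<lambda>n. ip y (R (r n) x))}"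
      by (rule closed_sub_convergent[where C = "nm x / \<alpha>"]) (use sbd xV in \<open>auto simp: ip_simps RV\<close>)
    moreover have "ip y (R n x) = ip x (R n y)" if "y \<in> V" for n y
      using Rsym[OF that xV] ip_sym[OF RV[OF that] xV] by simp
    then have "(\<lambda>n. ip y (R (r n) x)) = (\<lambda>n. ip x (R (r n) y))" if "y \<in> V" for y
      using that by blast
    then have "{y\<in>V. convergent (\<lambda>n. ip y (R (r n) x))} = {y\<in>V. convergent (\<lambda>n. ip x (R (r n) y))}"
      by (metis (no_types, lifting))
    ultimately have "closed_sub {y\<in>V. convergent (\<lambda>n. ip x (R (r n) y))}" by simp
    from subsetD[OF Mleast[OF this] y] c2[OF x] dV show ?thesis by simp
  qed
  \<comment> \<open>The weak operator limit of \<open>R (r n)\<close>, expressed as a form on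
    \<open>M\<close>.\<close>
  define s where "s x y = lim (\<lambda>n. ip x (R (r n) y))" for x y
  have slim: "(\<lambda>n. ip x (R (r n) y)) \<longlonglongrightarrow> s x y" if "x \<in> M" "y \<in> M" for x y
    using c3[OF that] by (simp add: s_def convergent_LIMSEQ_iff)
  \<comment> \<open>\<open>\<beta>\<close> carries no sign, while the coercivity constant
    \<open>1 / \<beta>'\<close> of the limit form has to be positive.\<close>
  define \<beta>' where "\<beta>' = max \<beta> 1"
  have \<beta>': "\<beta>' > 0" "\<beta> \<le> \<beta>'" by (auto simp: \<beta>'_def)
  have sRiesz: "\<exists>u\<in>M. \<forall>v\<in>M. s u v = ip x v" if x: "x \<in> V" for x
  proof (rule equiv_Riesz[OF M, of "1 / \<beta>'" s "1 / \<alpha>"])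
    note MVd = subsetD[OF MV]
    fix x y z assume *: "x \<in> M" "y \<in> M" "z \<in> M"
    have "(\<lambda>n. ip (x + y) (R (r n) z)) \<longlonglongrightarrow> s x z + s y z"
      using tendsto_add[OF slim[OF *(1,3)] slim[OF *(2,3)]] MVd[OF *(1)] MVd[OF *(2)] MVd[OF *(3)]
      by (simp add: ip_simps RV)
    then show "s (x + y) z = s x z + s y z" by (rule LIMSEQ_unique[OF slim[OF Mc(1)[OF *(1,2)] *(3)]])
    fix c
    have "(\<lambda>n. ip (c *\<^sub>R x) (R (r n) z)) \<longlonglongrightarrow> c * s x z"
      using tendsto_mult_left[OF slim[OF *(1,3)], of c] MVd[OF *(1)] MVd[OF *(3)]
      by (simp add: ip_simps RV)
    then show "s (c *\<^sub>R x) z = c * s x z" by (rule LIMSEQ_unique[OF slim[OF Mc(3)[OF *(1)] *(3)]])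
    have "ip y (R n x) = ip x (R n y)" for n
      using Rsym[of y x n] ip_sym RV MVd[OF *(1)] MVd[OF *(2)] by metis
    then show "s x y = s y x" by (simp add: s_def)
    have xV: "x \<in> V" using MVd[OF *(1)] .
    have "1 / \<beta>' * ip x x \<le> ip x (R n x)" for n
    proof -
      have "\<alpha> * ip (R n x) (R n x) \<le> ip x (R n x)" using alow[OF RV[OF xV], of n n] Ra[OF xV RV[OF xV]] by simp
      then have "0 \<le> ip x (R n x)"
        using \<alpha> ip_nonneg[OF RV[OF xV]] by (meson less_imp_le mult_nonneg_nonneg order_trans)
      then have "ip x x \<le> \<beta>' * ip x (R n x)"
        using Rlow[OF xV, of n] ip_sym[OF xV RV[OF xV]] mult_right_mono[OF \<beta>'(2)] by fastforce
      then show ?thesis using \<beta>' by (simp add: field_simps)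
    qed
    then show "1 / \<beta>' * ip x x \<le> s x x" by (intro LIMSEQ_le_const[OF slim[OF *(1,1)]]) auto
    have "ip x (R n x) \<le> 1 / \<alpha> * ip x x" for n
      using abs_le_D1[OF sbd[OF xV xV]] by (simp add: nm_sq[OF xV, symmetric] power2_eq_square)
    then show "s x x \<le> 1 / \<alpha> * ip x x" by (intro LIMSEQ_le_const2[OF slim[OF *(1,1)]]) auto
  qed (use \<beta>' x in auto)
  \<comment> \<open>Orthogonal projection onto \<open>M\<close>: as \<open>R n F\<close> lies in
    \<open>M\<close>, testing with \<open>v\<close> amounts to testing with its projection, and
    convergence tested on \<open>M\<close> becomes weak convergence in all of
    \<open>V\<close>.\<close>
  have proj: "\<exists>p\<in>M. \<forall>v\<in>M. ip p v = ip x v" if "x \<in> V" for x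
    by (rule equiv_Riesz[OF M, of 1 ip 1]) (use that MV ip_sym in \<open>auto simp: ip_simps subset_iff\<close>)
  have "\<exists>F\<in>V. \<exists>X. (\<forall>n. X n \<in> V) \<and> (\<forall>n. \<forall>v\<in>V. a (r n) (X n) v = ip F v) \<and>
          (\<forall>v\<in>V. (\<lambda>n. ip (X n) v) \<longlonglongrightarrow> ip (w j) v)" for j
  proof -
    have wM: "w j \<in> M" using dM dw by metis
    \<comment> \<open>\<open>F\<close> is a preimage of \<open>w j\<close> under the limit operator,
      so the solutions with datum \<open>F\<close> tend weakly to the prescribed target.\<close>
    obtain F where F: "F \<in> M" "\<And>v. v \<in> M \<Longrightarrow> s F v = ip (w j) v" using sRiesz[OF w] by blast
    have FV: "F \<in> V" using F MV by blast
    have "(\<lambda>n. ip (R (r n) F) v) \<longlonglongrightarrow> ip (w j) v" if v: "v \<in> V" for v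
    proof -
      obtain p where p: "p \<in> M" "\<And>u. u \<in> M \<Longrightarrow> ip p u = ip v u" using proj[OF v] by blast
      have pV: "p \<in> V" using p MV by blast
      have "ip (R (r n) F) v = ip F (R (r n) p)" for n
        using p(2)[OF RM[OF F(1)], of "r n"] Rsym[OF FV pV, of "r n"] ip_sym RV FV v pV by metis
      moreover have "s F p = ip (w j) v"
        using F(2)[OF p(1)] p(2)[OF wM] ip_sym[OF w pV] ip_sym[OF w v] by simp
      ultimately show ?thesis using slim[OF F(1) p(1)] by simp
    qed
    then show ?thesis using FV RV Ra by (intro bexI[of _ F] exI[of _ "\<lambda>n. R (r n) F"]) auto
  qed
  with r show ?thesis by blast
qed

subsection \<open>Smooth functions and test functions\<close>

definition smooth :: "(real^'n \<Rightarrow> real) \<Rightarrow> bool" where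
  "smooth f \<longleftrightarrow> (\<forall>k. f \<in> C_k k)"

lemma partial_derivativeI: "(f has_derivative f') (at x) \<Longrightarrow> partial_derivative i f x = f' (axis i 1)"
  by (simp add: partial_derivative_def frechet_derivative_at[symmetric])

lemma has_derivative_partial:
  assumes "f differentiable (at x)"
  shows "(f has_derivative (\<lambda>h. \<Sum>i\<in>UNIV. h $ i * partial_derivative i f x)) (at x)"
proof -
  obtain f' where f': "(f has_derivative f') (at x)" using assms by (auto simp: differentiable_def)
  interpret bounded_linear f' using f' by (rule has_derivative_bounded_linear)
  have "f' h = (\<Sum>i\<in>UNIV. h $ i * partial_derivative i f x)" for h
  proof -
    have "h = (\<Sum>i\<in>UNIV. h $ i *\<^sub>R axis i 1)" by (simp add: basis_expansion scalar_mult_eq_scaleR[symmetric])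
    then have "f' h = f' (\<Sum>i\<in>UNIV. h $ i *\<^sub>R axis i 1)" by simp
    also have "\<dots> = (\<Sum>i\<in>UNIV. h $ i * f' (axis i 1))" by (simp add: sum scaleR)
    finally show ?thesis by (simp add: partial_derivativeI[OF f'])
  qed
  then show ?thesis using f' by presburger
qed

lemma C_k_mono: "f \<in> C_k (Suc k) \<Longrightarrow> f \<in> C_k k"
proof (induction k arbitrary: f)
  case 0
  then show ?case
    by (auto intro!: continuous_at_imp_continuous_on differentiable_imp_continuous_within)
qed auto

lemma smooth_differentiable: "smooth f \<Longrightarrow> f differentiable (at x)"
  unfolding smooth_def by (drule spec[of _ "Suc 0"]) simp

lemma smooth_continuous: "smooth f \<Longrightarrow> continuous_on UNIV f"
  unfolding smooth_def by (drule spec[of _ 0]) simp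

lemma smooth_partial: "smooth f \<Longrightarrow> smooth (partial_derivative i f)"
  unfolding smooth_def by (metis (no_types, lifting) C_k.simps(2) mem_Collect_eq)

text \<open>A coinduction principle: a family closed under partial derivatives, such as the
  convolutions of all test functions with a fixed \<open>f\<close>, is handled at once, without
  repeating an induction over the order of differentiability.\<close>

lemma smooth_coinduct:
  assumes "f \<in> S" and "\<And>f x. f \<in> S \<Longrightarrow> f differentiable (at x)"
    and "\<And>f i. f \<in> S \<Longrightarrow> partial_derivative i f \<in> S"
  shows "smooth f"
proof -
  have "f \<in> C_k k" for k using assms(1)
  proof (induction k arbitrary: f)
    case 0
    then show ?case using assms(2)
      by (auto intro!: continuous_at_imp_continuous_on differentiable_imp_continuous_within)
  qed (use assms in auto)
  then show ?thesis by (simp add: smooth_def)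
qed

lemma partial_derivative_const [simp]: "partial_derivative i (\<lambda>_. c) = (\<lambda>_. 0)"
  by (rule ext) (simp add: partial_derivativeI[OF has_derivative_const])

lemma partial_derivative_nth: "partial_derivative i (\<lambda>x. x $ j) = (\<lambda>_. if i = j then 1 else 0)"
  by (rule ext, subst partial_derivativeI[OF bounded_linear_imp_has_derivative[OF bounded_linear_vec_nth]])
    (simp add: axis_def)

lemma C_k_add: "f \<in> C_k k \<Longrightarrow> g \<in> C_k k \<Longrightarrow> (\<lambda>x. f x + g x) \<in> C_k k"
proof (induction k arbitrary: f g)
  case (Suc k)
  have "partial_derivative i (\<lambda>x. f x + g x) = (\<lambda>x. partial_derivative i f x + partial_derivative i g x)" for i
    using Suc.prems by (auto simp: fun_eq_iff partial_derivative_def frechet_derivative_works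
        intro!: partial_derivativeI[unfolded partial_derivative_def] has_derivative_add)
  then show ?case using Suc by auto
qed (auto intro: continuous_on_add)

lemma partial_derivative_mult:
  assumes "f differentiable (at x)" "g differentiable (at x)"
  shows "partial_derivative i (\<lambda>x. f x * g x) x = f x * partial_derivative i g x + partial_derivative i f x * g x"
  using assms by (auto simp: partial_derivative_def frechet_derivative_works
        intro!: partial_derivativeI[unfolded partial_derivative_def] has_derivative_mult)

lemma C_k_mult: "f \<in> C_k k \<Longrightarrow> g \<in> C_k k \<Longrightarrow> (\<lambda>x. f x * g x) \<in> C_k k"
proof (induction k arbitrary: f g)
  case (Suc k)
  have "partial_derivative i (\<lambda>x. f x * g x) = (\<lambda>x. f x * partial_derivative i g x + partial_derivative i f x * g x)" for i
    using Suc.prems by (auto simp: fun_eq_iff partial_derivative_mult)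
  moreover have "f \<in> C_k k" "g \<in> C_k k" using Suc.prems C_k_mono by blast+
  ultimately show ?case using Suc by (auto intro!: C_k_add Suc.IH)
qed (auto intro: continuous_on_mult)

lemma smooth_add: "smooth f \<Longrightarrow> smooth g \<Longrightarrow> smooth (\<lambda>x. f x + g x)"
  and smooth_mult: "smooth f \<Longrightarrow> smooth g \<Longrightarrow> smooth (\<lambda>x. f x * g x)"
  by (simp_all add: smooth_def C_k_add C_k_mult)

lemma smooth_const: "smooth (\<lambda>_. c)"
  by (rule smooth_coinduct[where S = "range (\<lambda>c _. c)"]) auto

lemma smooth_nth: "smooth (\<lambda>x. x $ j)"
  by (rule smooth_coinduct[where S = "insert (\<lambda>x. x $ j) (range (\<lambda>c _. c))"])
    (auto simp: partial_derivative_nth bounded_linear_imp_differentiable bounded_linear_vec_nth)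

lemma test_functionsI:
  assumes "smooth \<phi>" "compact K" "K \<subseteq> \<Omega>" "\<And>x. x \<notin> K \<Longrightarrow> \<phi> x = 0"
  shows "\<phi> \<in> test_functions \<Omega>"
proof -
  have sub: "closure {x. \<phi> x \<noteq> 0} \<subseteq> K"
    using assms by (intro closure_minimal) (auto intro: compact_imp_closed)
  moreover have "compact (closure {x. \<phi> x \<noteq> 0})"
    using compact_Int_closed[OF assms(2) closed_closure[of "{x. \<phi> x \<noteq> 0}"]] sub by (simp add: Int_absorb1)
  ultimately show ?thesis using assms by (auto simp: test_functions_def smooth_def)
qed

lemma test_functionsE:
  assumes "\<phi> \<in> test_functions \<Omega>"
  obtains K where "smooth \<phi>" "compact K" "K \<subseteq> \<Omega>" "\<And>x. x \<notin> K \<Longrightarrow> \<phi> x = 0"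
    "\<And>i x. x \<notin> K \<Longrightarrow> partial_derivative i \<phi> x = 0"
proof
  let ?K = "closure {x. \<phi> x \<noteq> 0}"
  show "smooth \<phi>" "compact ?K" "?K \<subseteq> \<Omega>" using assms by (auto simp: test_functions_def smooth_def)
  show 0: "\<phi> x = 0" if "x \<notin> ?K" for x using that closure_subset[of "{x. \<phi> x \<noteq> 0}"] by blast
  show "partial_derivative i \<phi> x = 0" if "x \<notin> ?K" for i x
  proof -
    have "((\<lambda>_. 0::real) has_derivative (\<lambda>_. 0)) (at x)" by (rule has_derivative_const)
    then have "(\<phi> has_derivative (\<lambda>_. 0)) (at x)"
    proof (rule has_derivative_transform_within_open)
      show "open (- ?K)" by (rule open_Compl[OF closed_closure])
      show "x \<in> - ?K" using that by simp
      show "0 = \<phi> y" if "y \<in> - ?K" for y using 0[of y] that by simp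
    qed
    then show ?thesis by (simp add: partial_derivativeI)
  qed
qed

lemma test_smooth: "\<phi> \<in> test_functions \<Omega> \<Longrightarrow> smooth \<phi>"
  by (auto simp: test_functions_def smooth_def)

lemma test_outside: "\<phi> \<in> test_functions \<Omega> \<Longrightarrow> x \<notin> \<Omega> \<Longrightarrow> \<phi> x = 0"
  by (metis test_functionsE subsetD)

lemma test_mult:
  assumes "\<phi> \<in> test_functions \<Omega>" "smooth f"
  shows "(\<lambda>x. \<phi> x * f x) \<in> test_functions \<Omega>" "(\<lambda>x. f x * \<phi> x) \<in> test_functions \<Omega>"
proof -
  obtain K where K: "smooth \<phi>" "compact K" "K \<subseteq> \<Omega>" "\<And>x. x \<notin> K \<Longrightarrow> \<phi> x = 0"
    by (rule test_functionsE[OF assms(1)]) blast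
  show "(\<lambda>x. \<phi> x * f x) \<in> test_functions \<Omega>" "(\<lambda>x. f x * \<phi> x) \<in> test_functions \<Omega>"
    using K assms by (auto intro!: test_functionsI[of _ K] smooth_mult)
qed

lemma test_add:
  assumes "\<phi> \<in> test_functions \<Omega>" "\<psi> \<in> test_functions \<Omega>"
  shows "(\<lambda>x. \<phi> x + \<psi> x) \<in> test_functions \<Omega>"
proof -
  obtain K L where "smooth \<phi>" "compact K" "K \<subseteq> \<Omega>" "\<And>x. x \<notin> K \<Longrightarrow> \<phi> x = 0"
    and "smooth \<psi>" "compact L" "L \<subseteq> \<Omega>" "\<And>x. x \<notin> L \<Longrightarrow> \<psi> x = 0"
    using assms by (metis test_functionsE)
  then show ?thesis by (intro test_functionsI[of _ "K \<union> L"] smooth_add) auto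
qed

lemma test_zero: "(\<lambda>_. 0) \<in> test_functions \<Omega>"
  by (rule test_functionsI[of _ "{}"]) (auto simp: smooth_const)

lemma test_partial: "\<phi> \<in> test_functions \<Omega> \<Longrightarrow> partial_derivative i \<phi> \<in> test_functions \<Omega>"
  by (rule test_functionsE, assumption, rule test_functionsI) (auto simp: smooth_partial)

lemma test_mono: "\<Omega> \<subseteq> \<Omega>' \<Longrightarrow> \<phi> \<in> test_functions \<Omega> \<Longrightarrow> \<phi> \<in> test_functions \<Omega>'"
  by (auto simp: test_functions_def)

lemma test_bounded:
  assumes "\<phi> \<in> test_functions \<Omega>"
  shows "\<exists>M>0. \<forall>x. \<bar>\<phi> x\<bar> \<le> M"
proof -
  obtain K where K: "smooth \<phi>" "compact K" "\<And>x. x \<notin> K \<Longrightarrow> \<phi> x = 0"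
    using assms by (metis test_functionsE)
  have "compact (\<phi> ` K)"
    using K smooth_continuous by (intro compact_continuous_image) (auto intro: continuous_on_subset)
  then obtain M where "M > 0" "\<And>y. y \<in> \<phi> ` K \<Longrightarrow> norm y \<le> M"
    using bounded_pos compact_imp_bounded by metis
  then show ?thesis using K(3) by (intro exI[of _ M]) (metis abs_zero image_eqI less_imp_le real_norm_def)
qed

subsection \<open>Mollification\<close>

text \<open>The bump profile is the case \<open>m = 0\<close>, \<open>exp (- (1 / t))\<close>. The
  powers of \<open>1 / t\<close> make the family closed under differentiation up to linear
  combinations, so an induction over the order can treat all \<open>m\<close> together.\<close>

definition flat_exp :: "nat \<Rightarrow> real \<Rightarrow> real" where
  "flat_exp m t = (if t > 0 then (1 / t) ^ m * exp (- (1 / t)) else 0)"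

lemma flat_exp_limit: "(flat_exp m \<longlongrightarrow> 0) (at 0)"
proof -
  have "((\<lambda>t. flat_exp m t) \<longlongrightarrow> 0) (at_right 0)"
  proof (rule Lim_transform_eventually)
    have "((\<lambda>s::real. s ^ m / exp s) \<longlongrightarrow> 0) at_top" by (rule tendsto_power_div_exp_0)
    from filterlim_compose[OF this filterlim_inverse_at_top_right]
    show "((\<lambda>t::real. (1 / t) ^ m * exp (- (1 / t))) \<longlongrightarrow> 0) (at_right 0)"
      by (simp add: exp_minus field_simps)
    show "\<forall>\<^sub>F t in at_right 0. (1 / t) ^ m * exp (- (1 / t)) = flat_exp m t"
      by (auto simp: flat_exp_def eventually_at_filter)
  qed
  moreover have "((\<lambda>t. flat_exp m t) \<longlongrightarrow> 0) (at_left 0)"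
    by (rule Lim_transform_eventually[OF tendsto_const]) (auto simp: flat_exp_def eventually_at_filter)
  ultimately show ?thesis by (simp add: filterlim_at_split)
qed

lemma flat_exp_deriv:
  "(flat_exp m has_real_derivative (flat_exp (m + 2) t - real m * flat_exp (m + 1) t)) (at t)"
proof -
  consider "t > 0" | "t < 0" | "t = 0" by linarith
  then show ?thesis
  proof cases
    case 1
    have "((\<lambda>t::real. (1 / t) ^ m * exp (- (1 / t))) has_real_derivative (flat_exp (m + 2) t - real m * flat_exp (m + 1) t)) (at t)"
    proof (cases m)
      case 0
      show ?thesis unfolding 0 flat_exp_def using 1
        by (auto intro!: derivative_eq_intros simp: power2_eq_square)
    next
      case (Suc k)
      show ?thesis unfolding Suc flat_exp_def using 1
        by (auto intro!: derivative_eq_intros simp: power2_eq_square field_simps; cases k; simp)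
    qed
    then show ?thesis
      by (rule has_field_derivative_transform_within_open[of _ _ _ "{0<..}"]) (use 1 in \<open>auto simp: flat_exp_def\<close>)
  next
    case 2
    have "((\<lambda>t::real. 0) has_real_derivative (flat_exp (m + 2) t - real m * flat_exp (m + 1) t)) (at t)"
      using 2 by (simp add: flat_exp_def)
    then show ?thesis
      by (rule has_field_derivative_transform_within_open[of _ _ _ "{..<0}"]) (use 2 in \<open>auto simp: flat_exp_def\<close>)
  next
    case 3
    \<comment> \<open>At 0 the difference quotient of \<open>flat_exp m\<close> is exactly
      \<open>flat_exp (Suc m)\<close>, whose limit is 0.\<close>
    have "((\<lambda>t. flat_exp (Suc m) t) \<longlongrightarrow> 0) (at 0)" by (rule flat_exp_limit)
    then have "((\<lambda>t. (flat_exp m t - flat_exp m 0) / (t - 0)) \<longlongrightarrow> 0) (at 0)"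
      by (rule Lim_transform_eventually) (auto simp: flat_exp_def eventually_at_filter)
    then show ?thesis unfolding 3 by (simp add: has_field_derivative_iff flat_exp_def)
  qed
qed

text \<open>The squared norm is a polynomial, so no singularity arises at the centre
  \<open>a\<close>; each derivative multiplies members of the flat family by an affine
  function.\<close>

lemma smooth_flat_exp: "smooth (\<lambda>x::real^'n. flat_exp m (c - (norm (x - a))\<^sup>2))"
proof -
  have D: "((\<lambda>x. flat_exp m (c - (norm (x - a))\<^sup>2)) has_derivative
      (\<lambda>h. (flat_exp (m + 2) (c - (norm (x - a))\<^sup>2) - real m * flat_exp (m + 1) (c - (norm (x - a))\<^sup>2)) *
        (- 2 * ((x - a) \<bullet> h)))) (at x)" for m and x :: "real^'n"
  proof -
    have "((\<lambda>x. c - (norm (x - a))\<^sup>2) has_derivative (\<lambda>h. - 2 * ((x - a) \<bullet> h))) (at x)"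
      unfolding power2_norm_eq_inner
      by (auto intro!: derivative_eq_intros simp: inner_commute algebra_simps)
    from has_derivative_compose[OF this flat_exp_deriv[THEN has_field_derivative_imp_has_derivative, of m]]
    show ?thesis by simp
  qed
  have "(\<lambda>x. flat_exp m (c - (norm (x - a))\<^sup>2)) \<in> C_k k" for k
  proof (induction k arbitrary: m)
    case 0
    then show ?case using has_derivative_continuous[OF D] by (simp add: continuous_at_imp_continuous_on)
  next
    case (Suc k)
    have P: "partial_derivative i (\<lambda>x. flat_exp m (c - (norm (x - a))\<^sup>2)) =
       (\<lambda>x. (flat_exp (m + 2) (c - (norm (x - a))\<^sup>2) + (- real m) * flat_exp (m + 1) (c - (norm (x - a))\<^sup>2)) *
         (- 2 * (x $ i + - a $ i)))" for i
      by (rule ext, subst partial_derivativeI[OF D]) (simp add: inner_axis)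
    have "(\<lambda>x. - 2 * (x $ i + - a $ i)) \<in> C_k k" for i
      using smooth_mult[OF smooth_const[of "- 2"] smooth_add[OF smooth_nth[of i] smooth_const[of "- a $ i"]]]
      unfolding smooth_def by blast
    note lin = this
    have const: "(\<lambda>x. c) \<in> C_k k" for c using smooth_const by (auto simp: smooth_def)
    have "partial_derivative i (\<lambda>x. flat_exp m (c - (norm (x - a))\<^sup>2)) \<in> C_k k" for i
      unfolding P by (rule C_k_mult[OF C_k_add[OF Suc C_k_mult[OF const Suc]] lin])
    moreover have "(\<lambda>x. flat_exp m (c - (norm (x - a))\<^sup>2)) differentiable (at x)" for x
      using D unfolding differentiable_def by blast
    ultimately show ?case by simp
  qed
  then show ?thesis by (simp add: smooth_def)
qed

definition mollifier :: "real \<Rightarrow> real^'n \<Rightarrow> real" where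
  "mollifier \<delta> z = flat_exp 0 (\<delta>\<^sup>2 - (norm z)\<^sup>2) /
     (LINT z|lborel. flat_exp 0 (\<delta>\<^sup>2 - (norm (z :: real^'n))\<^sup>2))"

lemma flat_exp_nonneg: "0 \<le> flat_exp m t"
  by (simp add: flat_exp_def)

lemma flat_exp_eq_0_iff: "flat_exp m t = 0 \<longleftrightarrow> t \<le> 0"
  by (auto simp: flat_exp_def)

lemma test_flat_exp: "cball a r \<subseteq> \<Omega> \<Longrightarrow> 0 \<le> r \<Longrightarrow> (\<lambda>x::real^'n. flat_exp m (r\<^sup>2 - (norm (x - a))\<^sup>2)) \<in> test_functions \<Omega>"
  by (rule test_functionsI[of _ "cball a r"])
    (auto simp: smooth_flat_exp flat_exp_eq_0_iff dist_norm norm_minus_commute intro!: power_mono)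

lemma integrable_continuous_compact_support:
  fixes f :: "real^'n \<Rightarrow> real"
  assumes "continuous_on UNIV f" "compact K" "\<And>x. x \<notin> K \<Longrightarrow> f x = 0"
  shows "integrable lborel f"
proof -
  have "integrable lborel (\<lambda>x. indicator K x *\<^sub>R f x)"
    using assms by (intro borel_integrable_compact) (auto intro: continuous_on_subset)
  moreover have "(\<lambda>x. indicator K x *\<^sub>R f x) = f" using assms(3) by (auto simp: indicator_def fun_eq_iff)
  ultimately show ?thesis by simp
qed

lemma integrable_flat_exp: "integrable lborel (\<lambda>z::real^'n. flat_exp m (c - (norm (z - a))\<^sup>2))"
proof (rule integrable_continuous_compact_support)
  show "continuous_on UNIV (\<lambda>z::real^'n. flat_exp m (c - (norm (z - a))\<^sup>2))"
    by (intro smooth_continuous smooth_flat_exp)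
  fix x :: "real^'n" assume "x \<notin> cball a (\<bar>c\<bar> + 1)"
  then have n: "norm (x - a) > \<bar>c\<bar> + 1" by (simp add: dist_norm norm_minus_commute)
  then have "norm (x - a) * 1 \<le> norm (x - a) * norm (x - a)" by (intro mult_left_mono) auto
  with n show "flat_exp m (c - (norm (x - a))\<^sup>2) = 0" by (auto simp: flat_exp_eq_0_iff power2_eq_square)
qed auto

text \<open>If the integral vanished, the nonnegative integrand would vanish almost everywhere,
  although it is positive on an open ball.\<close>

lemma mollifier_const_pos:
  assumes "\<delta> > 0"
  shows "(LINT z|lborel. flat_exp 0 (\<delta>\<^sup>2 - (norm (z :: real^'n))\<^sup>2)) > 0"
proof -
  have I: "integrable lborel (\<lambda>z::real^'n. flat_exp 0 (\<delta>\<^sup>2 - (norm z)\<^sup>2))"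
    using integrable_flat_exp[of 0 "\<delta>\<^sup>2" 0] by simp
  have "(LINT z|lborel. flat_exp 0 (\<delta>\<^sup>2 - (norm (z :: real^'n))\<^sup>2)) \<noteq> 0"
  proof
    assume "(LINT z|lborel. flat_exp 0 (\<delta>\<^sup>2 - (norm (z :: real^'n))\<^sup>2)) = 0"
    then have "AE z::real^'n in lborel. flat_exp 0 (\<delta>\<^sup>2 - (norm z)\<^sup>2) = 0"
      using integral_nonneg_eq_0_iff_AE[OF I] flat_exp_nonneg by auto
    then have "AE z::real^'n in lborel. z \<notin> ball 0 \<delta>"
      by (rule AE_mp) (auto intro!: AE_I2 simp: flat_exp_eq_0_iff abs_le_square_iff[symmetric] dest: power2_le_imp_le)
    then have "ball (0::real^'n) \<delta> \<in> null_sets lborel" by (subst (asm) AE_iff_null_sets[symmetric]) auto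
    then have "negligible (ball (0::real^'n) \<delta>)" by (simp add: negligible_iff_null_sets null_sets_completionI)
    then show False using open_not_negligible[of "ball (0::real^'n) \<delta>"] assms by auto
  qed
  moreover have "(LINT z|lborel. flat_exp 0 (\<delta>\<^sup>2 - (norm (z :: real^'n))\<^sup>2)) \<ge> 0"
    by (intro integral_nonneg_AE) (auto simp: flat_exp_nonneg)
  ultimately show ?thesis by linarith
qed

lemma mollifier_nonneg: "0 \<le> mollifier \<delta> z"
  unfolding mollifier_def by (intro divide_nonneg_nonneg integral_nonneg_AE) (auto simp: flat_exp_nonneg)

lemma mollifier_outside: "0 < \<delta> \<Longrightarrow> \<delta> \<le> norm z \<Longrightarrow> mollifier \<delta> z = 0"
  by (auto simp: mollifier_def flat_exp_eq_0_iff intro!: power_mono)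

lemma mollifier_minus: "mollifier \<delta> (x - y) = mollifier \<delta> (y - x)"
  by (simp add: mollifier_def norm_minus_commute)

lemma test_mollifier: "0 < \<delta> \<Longrightarrow> mollifier \<delta> \<in> test_functions UNIV"
  using test_mult(1)[OF test_flat_exp[of 0 \<delta> UNIV 0] smooth_const[of "1 / (LINT z|lborel. flat_exp 0 (\<delta>\<^sup>2 - (norm z)\<^sup>2))"]]
  by (simp add: mollifier_def[abs_def])

lemma mollifier_integrable: "integrable lborel (mollifier \<delta> :: real^'n \<Rightarrow> real)"
  unfolding mollifier_def[abs_def] using integrable_flat_exp[of 0 "\<delta>\<^sup>2" "0 :: real^'n"]
  by (intro integrable_divide_zero) simp

lemma mollifier_integral: "0 < \<delta> \<Longrightarrow> (LINT z|lborel. mollifier \<delta> (z :: real^'n)) = 1"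
  unfolding mollifier_def using mollifier_const_pos[where 'n='n, of \<delta>] by simp

section \<open>Translation invariance and uniform continuity\<close>

lemma lborel_translate:
  fixes f :: "real^'n \<Rightarrow> 'b::{banach, second_countable_topology}"
  shows "f \<in> borel_measurable borel \<Longrightarrow> (LINT x|lborel. f (c + x)) = (LINT x|lborel. f x)"
    and "integrable lborel (\<lambda>x. f (c + x)) \<longleftrightarrow> f \<in> borel_measurable borel \<and> integrable lborel f"
proof -
  show "(LINT x|lborel. f (c + x)) = (LINT x|lborel. f x)" if "f \<in> borel_measurable borel"
    using that by (subst (2) lborel_distr_plus[of c, symmetric], subst integral_distr) auto
  show "integrable lborel (\<lambda>x. f (c + x)) \<longleftrightarrow> f \<in> borel_measurable borel \<and> integrable lborel f"
  proof
    assume *: "integrable lborel (\<lambda>x. f (c + x))"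
    then have m: "(\<lambda>x. f (c + x)) \<in> borel_measurable borel" by (auto dest: borel_measurable_integrable)
    then have "(\<lambda>x. (\<lambda>x. f (c + x)) (- c + x)) \<in> borel_measurable borel"
      by (rule measurable_compose[rotated]) auto
    then have f: "f \<in> borel_measurable borel" by simp
    with * show "f \<in> borel_measurable borel \<and> integrable lborel f"
      by (subst lborel_distr_plus[of c, symmetric], subst integrable_distr_eq) auto
  next
    assume "f \<in> borel_measurable borel \<and> integrable lborel f"
    then show "integrable lborel (\<lambda>x. f (c + x))"
      by (subst (asm) lborel_distr_plus[of c, symmetric], subst (asm) integrable_distr_eq) auto
  qed
qed

lemma nn_integral_translate:
  fixes f :: "real^'n \<Rightarrow> ennreal"
  shows "f \<in> borel_measurable borel \<Longrightarrow> (\<integral>\<^sup>+ x. f (c + x) \<partial>lborel) = (\<integral>\<^sup>+ x. f x \<partial>lborel)"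
  by (subst (2) lborel_distr_plus[of c, symmetric], subst nn_integral_distr) auto

lemma mollifier_shift:
  assumes "0 < \<delta>"
  shows "integrable lborel (\<lambda>y. mollifier \<delta> (x - y :: real^'n))" "(LINT y|lborel. mollifier \<delta> (x - y :: real^'n)) = 1"
    "(\<integral>\<^sup>+ y. ennreal (mollifier \<delta> (x - y :: real^'n)) \<partial>lborel) = 1"
proof -
  have m: "mollifier \<delta> \<in> borel_measurable (borel :: (real^'n) measure)"
    using mollifier_integrable[of \<delta>] by (auto dest: borel_measurable_integrable)
  have eq: "(\<lambda>y. mollifier \<delta> (x - y)) = (\<lambda>y. mollifier \<delta> (- x + y))"
    by (subst mollifier_minus) simp
  show 1: "integrable lborel (\<lambda>y. mollifier \<delta> (x - y))"
    unfolding eq using mollifier_integrable[of \<delta>] m by (subst lborel_translate) auto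
  show 2: "(LINT y|lborel. mollifier \<delta> (x - y)) = 1"
    unfolding eq using m mollifier_integral[OF assms] by (subst lborel_translate) auto
  show "(\<integral>\<^sup>+ y. ennreal (mollifier \<delta> (x - y)) \<partial>lborel) = 1"
    using nn_integral_eq_integral[OF 1] 2 by (simp add: mollifier_nonneg)
qed

lemma uniformly_continuous_compact_support:
  fixes f :: "'a::euclidean_space \<Rightarrow> real"
  assumes f: "continuous_on UNIV f" and K: "compact K" "\<And>x. x \<notin> K \<Longrightarrow> f x = 0" and e: "e > 0"
  shows "\<exists>d>0. \<forall>x y. norm (y - x) < d \<longrightarrow> \<bar>f y - f x\<bar> < e"
proof -
  obtain R where "\<forall>x\<in>K. norm x \<le> R" using compact_imp_bounded[OF K(1)] by (auto simp: bounded_iff)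
  then have R: "K \<subseteq> cball 0 R" by auto
  have "uniformly_continuous_on (cball 0 (R + 1)) f"
    using f by (intro compact_uniformly_continuous) (auto intro: continuous_on_subset)
  then obtain d where d: "d > 0" "\<And>x y. x \<in> cball 0 (R + 1) \<Longrightarrow> y \<in> cball 0 (R + 1) \<Longrightarrow> dist y x < d \<Longrightarrow> dist (f y) (f x) < e"
    using e unfolding uniformly_continuous_on_def by meson
  have "\<bar>f y - f x\<bar> < e" if "norm (y - x) < min d 1" for x y
  proof (cases "x \<in> K \<or> y \<in> K")
    case True
    have "norm x \<le> norm y + norm (y - x)" "norm y \<le> norm x + norm (y - x)"
      using norm_triangle_sub[of x y] norm_triangle_sub[of y x] by (auto simp: norm_minus_commute)
    moreover have "x \<in> K \<Longrightarrow> norm x \<le> R" "y \<in> K \<Longrightarrow> norm y \<le> R" using R by auto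
    ultimately have "norm x \<le> R + 1 \<and> norm y \<le> R + 1" using True that by linarith
    then have "x \<in> cball 0 (R + 1)" "y \<in> cball 0 (R + 1)" by auto
    then show ?thesis using d(2)[of x y] that by (auto simp: dist_norm)
  qed (use K e in auto)
  then show ?thesis using d(1) by (intro exI[of _ "min d 1"]) auto
qed

section \<open>Convolution with test functions\<close>

definition conv :: "(real^'n \<Rightarrow> real) \<Rightarrow> (real^'n \<Rightarrow> real) \<Rightarrow> real^'n \<Rightarrow> real" where
  "conv \<psi> f x = (LINT y|lebesgue. \<psi> (x - y) * f y)"

lemma conv_integrable:
  assumes "\<psi> \<in> test_functions UNIV" "integrable lebesgue f"
  shows "integrable lebesgue (\<lambda>y. \<psi> (x - y) * f y)"
proof -
  obtain M where M: "\<And>x. \<bar>\<psi> x\<bar> \<le> M" using test_bounded[OF assms(1)] by blast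
  have "\<psi> \<in> borel_measurable borel"
    using smooth_continuous[OF test_smooth[OF assms(1)]] by (intro borel_measurable_continuous_onI)
  then have "(\<lambda>y. \<psi> (x - y)) \<in> borel_measurable borel" by measurable
  then have "(\<lambda>y. \<psi> (x - y)) \<in> borel_measurable lebesgue" by (intro measurable_completion) simp
  then show ?thesis
    by (intro Bochner_Integration.integrable_bound[OF integrable_mult_right[OF assms(2), of M]])
      (use M assms in \<open>auto simp: abs_mult intro!: AE_I2 mult_right_mono order_trans[OF M abs_ge_self]\<close>)
qed

text \<open>The partial derivatives of \<open>\<psi>\<close> are uniformly continuous, so the
  linearisation error of \<open>\<psi>\<close> is a small multiple of the length of the
  displacement, uniformly in the base point; integrating against \<open>\<bar>f\<bar>\<close> keeps
  that uniformity.\<close>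

lemma conv_has_derivative:
  fixes \<psi> :: "real^'n \<Rightarrow> real"
  assumes \<psi>: "\<psi> \<in> test_functions UNIV" and f: "integrable lebesgue f"
  shows "(conv \<psi> f has_derivative (\<lambda>h. \<Sum>i\<in>UNIV. h $ i * conv (partial_derivative i \<psi>) f x)) (at x)"
  unfolding has_derivative_at_alt
proof (intro conjI allI impI)
  show "bounded_linear (\<lambda>h. \<Sum>i\<in>UNIV. h $ i * conv (partial_derivative i \<psi>) f x)"
    by (intro bounded_linear_sum bounded_linear_mult_left[THEN bounded_linear_compose] bounded_linear_vec_nth)
  fix e :: real assume e: "e > 0"
  define I where "I = (LINT y|lebesgue. \<bar>f y\<bar>)"
  have I: "I \<ge> 0" by (simp add: I_def)
  \<comment> \<open>The factor \<open>CARD('n)\<close> pays for the sum over the partial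
    derivatives, and \<open>I + 1\<close> for the integral of \<open>\<bar>f\<bar>\<close>, which
    may be 0.\<close>
  define e' where "e' = e / (real CARD('n) * (I + 1))"
  have e': "e' > 0" using e I by (simp add: e'_def)
  obtain K where K: "compact K" "\<And>i x. x \<notin> K \<Longrightarrow> partial_derivative i \<psi> x = 0"
    by (rule test_functionsE[OF \<psi>]) blast
  have "\<forall>i. \<exists>d>0. \<forall>x y. norm (y - x) < d \<longrightarrow> \<bar>partial_derivative i \<psi> y - partial_derivative i \<psi> x\<bar> < e'"
    by (intro allI uniformly_continuous_compact_support[OF _ K(1)] smooth_continuous smooth_partial test_smooth[OF \<psi>] K e')
  then obtain D where D: "\<And>i. D i > 0" "\<And>i x y. norm (y - x) < D i \<Longrightarrow> \<bar>partial_derivative i \<psi> y - partial_derivative i \<psi> x\<bar> < e'"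
    by metis
  define d where "d = Min (range D)"
  have d: "d > 0" "\<And>i. d \<le> D i" using D(1) by (auto simp: d_def)
  have unif: "\<bar>\<psi> z' - \<psi> z - (\<Sum>i\<in>UNIV. (z' - z) $ i * partial_derivative i \<psi> z)\<bar> \<le> norm (z' - z) * (real CARD('n) * e')"
    if "norm (z' - z) < d" for z z'
  proof -
    define F where "F w h = (\<Sum>i\<in>UNIV. h $ i * partial_derivative i \<psi> w)" for w h
    have "norm (\<psi> z' - \<psi> z - F z (z' - z)) \<le> norm (z' - z) * (real CARD('n) * e')"
    proof (rule differentiable_bound_linearization[where S = "ball z d" and f' = F])
      fix t :: real assume t: "t \<in> {0..1}"
      have "norm (t *\<^sub>R (z' - z)) < d" using that t
        by (smt (verit) atLeastAtMost_iff mult_left_le_one_le norm_ge_zero norm_scaleR abs_of_nonneg)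
      then show "z + t *\<^sub>R (z' - z) \<in> ball z d" by (simp add: dist_norm)
    next
      fix w assume "w \<in> ball z d"
      then have w: "norm (w - z) < d" by (simp add: dist_norm norm_minus_commute)
      show "onorm (F w - F z) \<le> real CARD('n) * e'"
        unfolding fun_diff_def
      proof (rule onorm_le)
        fix h :: "real^'n"
        have "norm (F w h - F z h) = norm (\<Sum>i\<in>UNIV. h $ i * (partial_derivative i \<psi> w - partial_derivative i \<psi> z))"
          by (simp add: F_def sum_subtractf right_diff_distrib)
        also have "\<dots> \<le> (\<Sum>i\<in>(UNIV::'n set). norm h * e')"
        proof (rule sum_norm_le)
          fix i
          have "\<bar>partial_derivative i \<psi> w - partial_derivative i \<psi> z\<bar> \<le> e'"
            using D(2)[of w z i] d(2)[of i] w by simp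
          then show "norm (h $ i * (partial_derivative i \<psi> w - partial_derivative i \<psi> z)) \<le> norm h * e'"
            unfolding real_norm_def abs_mult
            using component_le_norm_cart[of h i] by (intro mult_mono) auto
        qed
        finally show "norm (F w h - F z h) \<le> real CARD('n) * e' * norm h" by (simp add: mult_ac)
      qed
      show "(\<psi> has_derivative F w) (at w within ball z d)"
        unfolding F_def using has_derivative_partial[OF smooth_differentiable[OF test_smooth[OF \<psi>]]]
        by (auto intro: has_derivative_at_withinI)
    qed (use d in auto)
    then show ?thesis by (simp add: F_def)
  qed
  show "\<exists>d>0. \<forall>x'. norm (x' - x) < d \<longrightarrow>
     norm (conv \<psi> f x' - conv \<psi> f x - (\<Sum>i\<in>UNIV. (x' - x) $ i * conv (partial_derivative i \<psi>) f x)) \<le> e * norm (x' - x)"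
  proof (intro exI[of _ d] conjI allI impI d)
    fix x' assume x': "norm (x' - x) < d"
    note int = conv_integrable[OF \<psi> f] conv_integrable[OF test_partial[OF \<psi>] f]
    have "conv \<psi> f x' - conv \<psi> f x - (\<Sum>i\<in>UNIV. (x' - x) $ i * conv (partial_derivative i \<psi>) f x) =
      (LINT y|lebesgue. \<psi> (x' - y) * f y - \<psi> (x - y) * f y - (\<Sum>i\<in>UNIV. (x' - x) $ i * (partial_derivative i \<psi> (x - y) * f y)))"
      unfolding conv_def using int by simp
    also have "norm \<dots> \<le> (LINT y|lebesgue. (norm (x' - x) * (real CARD('n) * e')) * \<bar>f y\<bar>)"
    proof (rule Bochner_Integration.integral_norm_bound_integral)
      show "integrable lebesgue (\<lambda>y. \<psi> (x' - y) * f y - \<psi> (x - y) * f y - (\<Sum>i\<in>UNIV. (x' - x) $ i * (partial_derivative i \<psi> (x - y) * f y)))"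
        using int by (intro Bochner_Integration.integrable_diff Bochner_Integration.integrable_sum integrable_mult_right) auto
      fix y
      have "\<psi> (x' - y) * f y - \<psi> (x - y) * f y - (\<Sum>i\<in>UNIV. (x' - x) $ i * (partial_derivative i \<psi> (x - y) * f y))
        = (\<psi> (x' - y) - \<psi> (x - y) - (\<Sum>i\<in>UNIV. ((x' - y) - (x - y)) $ i * partial_derivative i \<psi> (x - y))) * f y"
        by (simp add: algebra_simps sum_distrib_left)
      also have "norm \<dots> \<le> norm (x' - x) * (real CARD('n) * e') * \<bar>f y\<bar>"
        unfolding norm_mult using unif[of "x' - y" "x - y"] x' by (intro mult_mono) auto
      finally show "norm (\<psi> (x' - y) * f y - \<psi> (x - y) * f y - (\<Sum>i\<in>UNIV. (x' - x) $ i * (partial_derivative i \<psi> (x - y) * f y))) \<le>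
        norm (x' - x) * (real CARD('n) * e') * \<bar>f y\<bar>" .
    qed (use f in auto)
    also have "\<dots> = norm (x' - x) * (e * (I / (I + 1)))"
      using f by (simp add: I_def[symmetric] e'_def)
    also have "\<dots> \<le> e * norm (x' - x)"
      using I e mult_left_mono[of "e * (I / (I + 1))" e "norm (x' - x)"] by (simp add: field_simps)
    finally show "norm (conv \<psi> f x' - conv \<psi> f x - (\<Sum>i\<in>UNIV. (x' - x) $ i * conv (partial_derivative i \<psi>) f x)) \<le> e * norm (x' - x)" .
  qed
qed

lemma partial_conv:
  assumes "\<psi> \<in> test_functions UNIV" "integrable lebesgue f"
  shows "partial_derivative i (conv \<psi> f) = conv (partial_derivative i \<psi>) f"
  by (rule ext, subst partial_derivativeI[OF conv_has_derivative[OF assms]])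
    (simp add: axis_def if_distrib[of "\<lambda>t. t * _"] cong: if_cong)

lemma smooth_conv:
  assumes "\<psi> \<in> test_functions UNIV" "integrable lebesgue f"
  shows "smooth (conv \<psi> f)"
proof (rule smooth_coinduct[where S = "(\<lambda>\<psi>. conv \<psi> f) ` test_functions UNIV"])
  show "conv \<psi> f \<in> (\<lambda>\<psi>. conv \<psi> f) ` test_functions UNIV" using assms by blast
  fix g assume "g \<in> (\<lambda>\<psi>. conv \<psi> f) ` test_functions UNIV"
  then obtain \<phi> where \<phi>: "\<phi> \<in> test_functions UNIV" "g = conv \<phi> f" by blast
  show "g differentiable (at x)" for x
    using conv_has_derivative[OF \<phi>(1) assms(2)] unfolding \<phi>(2) differentiable_def by blast
  show "partial_derivative i g \<in> (\<lambda>\<psi>. conv \<psi> f) ` test_functions UNIV" for i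
    unfolding \<phi>(2) partial_conv[OF \<phi>(1) assms(2)] using test_partial[OF \<phi>(1)] by blast
qed

lemma conv_outside:
  assumes "0 < \<delta>" "\<And>y. y \<notin> K \<Longrightarrow> f y = 0" "\<And>y. y \<in> K \<Longrightarrow> \<delta> \<le> dist x y"
  shows "conv (mollifier \<delta>) f x = 0"
proof -
  have "mollifier \<delta> (x - y) * f y = 0" for y
    using assms mollifier_outside[of \<delta> "x - y"] by (cases "y \<in> K") (auto simp: dist_norm)
  note * = this
  show ?thesis unfolding conv_def * by simp
qed

lemma compact_Union_cball:
  fixes K :: "(real^'n) set"
  assumes "compact K"
  shows "compact (\<Union>y\<in>K. cball y \<delta>)"
proof -
  have "x \<in> {y + z | y z. y \<in> K \<and> z \<in> cball 0 \<delta>}" if "y \<in> K" "x \<in> cball y \<delta>" for x y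
    using that by (intro CollectI exI[of _ y] exI[of _ "x - y"]) (auto simp: dist_norm norm_minus_commute)
  moreover have "y + z \<in> cball y \<delta>" if "z \<in> cball 0 \<delta>" for y z :: "real^'n"
    using that by (simp add: dist_norm)
  ultimately have "(\<Union>y\<in>K. cball y \<delta>) = {y + z | y z. y \<in> K \<and> z \<in> cball 0 \<delta>}" by blast
  then show ?thesis using compact_sums[OF assms compact_cball[of 0 \<delta>]] by simp
qed

lemma test_conv:
  fixes f :: "real^'n \<Rightarrow> real"
  assumes \<delta>: "0 < \<delta>" and f: "integrable lebesgue f" and K: "compact K" "\<And>y. y \<notin> K \<Longrightarrow> f y = 0"
    and sub: "(\<Union>y\<in>K. cball y \<delta>) \<subseteq> \<Omega>"
  shows "conv (mollifier \<delta>) f \<in> test_functions \<Omega>"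
proof (rule test_functionsI)
  show "compact (\<Union>y\<in>K. cball y \<delta>)" by (rule compact_Union_cball[OF K(1)])
  show "smooth (conv (mollifier \<delta>) f)" by (intro smooth_conv test_mollifier \<delta> f)
  fix x assume "x \<notin> (\<Union>y\<in>K. cball y \<delta>)"
  then show "conv (mollifier \<delta>) f x = 0"
    by (intro conv_outside[OF \<delta> K(2)]) (force simp: dist_commute)+
qed (use sub in auto)

subsection \<open>Square-integrable fields\<close>

lemma L2_measurable: "f \<in> L2 \<Omega> \<Longrightarrow> f \<in> borel_measurable (lebesgue_on \<Omega>)"
  and L2_integrable_norm: "f \<in> L2 \<Omega> \<Longrightarrow> integrable (lebesgue_on \<Omega>) (\<lambda>x. (norm (f x))\<^sup>2)"
  by (auto simp: L2_def)

lemma L2_bound: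
  assumes "f \<in> borel_measurable (lebesgue_on \<Omega>)" "integrable (lebesgue_on \<Omega>) h"
    "AE x in lebesgue_on \<Omega>. (norm (f x))\<^sup>2 \<le> h x"
  shows "f \<in> L2 \<Omega>"
  unfolding L2_def using assms
  by (auto intro!: Bochner_Integration.integrable_bound[OF assms(2)] elim!: eventually_mono)

lemma norm_add_sq: "(norm (x + y :: 'b::real_normed_vector))\<^sup>2 \<le> 2 * (norm x)\<^sup>2 + 2 * (norm y)\<^sup>2"
proof -
  have "(norm (x + y))\<^sup>2 \<le> (norm x + norm y)\<^sup>2" by (intro power_mono norm_triangle_ineq) auto
  also have "\<dots> \<le> 2 * (norm x)\<^sup>2 + 2 * (norm y)\<^sup>2"
    using zero_le_power2[of "norm x - norm y"] by (simp add: power2_eq_square algebra_simps)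
  finally show ?thesis .
qed

lemma L2_add:
  assumes "f \<in> L2 \<Omega>" "g \<in> L2 \<Omega>" shows "(\<lambda>x. f x + g x) \<in> L2 \<Omega>"
proof (rule L2_bound)
  show "integrable (lebesgue_on \<Omega>) (\<lambda>x. 2 * (norm (f x))\<^sup>2 + 2 * (norm (g x))\<^sup>2)"
    using assms by (auto simp: L2_def)
qed (use assms norm_add_sq in \<open>auto simp: L2_def\<close>)

lemma L2_scale: "f \<in> L2 \<Omega> \<Longrightarrow> (\<lambda>x. c *\<^sub>R f x) \<in> L2 \<Omega>"
  by (auto simp: L2_def power_mult_distrib)

lemma L2_diff:
  assumes "f \<in> L2 \<Omega>" "g \<in> L2 \<Omega>" shows "(\<lambda>x. f x - g x) \<in> L2 \<Omega>"
  using L2_add[OF assms(1) L2_scale[OF assms(2), of "-1"]] by simp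

lemma L2_zero: "(\<lambda>_. 0) \<in> L2 \<Omega>"
  by (simp add: L2_def)

lemma L2_sum: "(\<And>i. i \<in> I \<Longrightarrow> f i \<in> L2 \<Omega>) \<Longrightarrow> (\<lambda>x. \<Sum>i\<in>I. f i x) \<in> L2 \<Omega>"
  by (induction I rule: infinite_finite_induct) (auto simp: L2_zero L2_add)

lemma L2_norm_le:
  assumes "g \<in> L2 \<Omega>" "f \<in> borel_measurable (lebesgue_on \<Omega>)" "AE x in lebesgue_on \<Omega>. norm (f x) \<le> C * norm (g x)"
  shows "f \<in> L2 \<Omega>"
proof (rule L2_bound[OF assms(2)])
  show "integrable (lebesgue_on \<Omega>) (\<lambda>x. C\<^sup>2 * (norm (g x))\<^sup>2)" using assms(1) by (auto simp: L2_def)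
  show "AE x in lebesgue_on \<Omega>. (norm (f x))\<^sup>2 \<le> C\<^sup>2 * (norm (g x))\<^sup>2"
    using assms(3)
  proof eventually_elim
    case (elim x)
    have "(norm (f x))\<^sup>2 \<le> (C * norm (g x))\<^sup>2" by (intro power_mono elim) simp
    then show ?case by (simp add: power_mult_distrib)
  qed
qed

lemma L2_cong_AE:
  assumes "f \<in> L2 \<Omega>" "g \<in> borel_measurable (lebesgue_on \<Omega>)" "AE x in lebesgue_on \<Omega>. f x = g x"
  shows "g \<in> L2 \<Omega>"
  by (rule L2_norm_le[OF assms(1,2), of 1]) (use assms(3) in \<open>auto elim: eventually_mono\<close>)

lemma L2_inner_integrable:
  assumes "f \<in> L2 \<Omega>" "g \<in> L2 \<Omega>" shows "integrable (lebesgue_on \<Omega>) (\<lambda>x. f x \<bullet> g x)"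
proof (rule Bochner_Integration.integrable_bound)
  show "integrable (lebesgue_on \<Omega>) (\<lambda>x. (norm (f x))\<^sup>2 + (norm (g x))\<^sup>2)" using assms by (auto simp: L2_def)
  show "AE x in lebesgue_on \<Omega>. norm (f x \<bullet> g x) \<le> norm ((norm (f x))\<^sup>2 + (norm (g x))\<^sup>2)"
  proof (rule AE_I2)
    fix x
    have "\<bar>f x \<bullet> g x\<bar> \<le> norm (f x) * norm (g x)" by (rule Cauchy_Schwarz_ineq2)
    also have "\<dots> \<le> (norm (f x))\<^sup>2 + (norm (g x))\<^sup>2"
      using sum_squares_bound[of "norm (f x)" "norm (g x)"] mult_nonneg_nonneg[OF norm_ge_zero[of "f x"] norm_ge_zero[of "g x"]]
      by linarith
    finally show "norm (f x \<bullet> g x) \<le> norm ((norm (f x))\<^sup>2 + (norm (g x))\<^sup>2)" by simp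
  qed
qed (use assms in \<open>auto simp: L2_def intro!: borel_measurable_inner\<close>)

lemma L2_mult_integrable:
  fixes f g :: "real^'n \<Rightarrow> real"
  shows "f \<in> L2 \<Omega> \<Longrightarrow> g \<in> L2 \<Omega> \<Longrightarrow> integrable (lebesgue_on \<Omega>) (\<lambda>x. f x * g x)"
  using L2_inner_integrable[of f \<Omega> g] by simp

text \<open>The Riesz-Fischer theorem. Along a fast Cauchy subsequence the increments are summable
  almost everywhere; the pointwise limit is then identified as the \<open>L2\<close> limit of the
  whole sequence by Fatou's lemma applied to \<open>X n - X (r k)\<close>.\<close>

lemma L2_complete:
  fixes X :: "nat \<Rightarrow> real^'n \<Rightarrow> 'b::euclidean_space"
  assumes X: "\<And>n. X n \<in> L2 \<Omega>"
    and C: "\<And>e. e > 0 \<Longrightarrow> \<exists>N. \<forall>m\<ge>N. \<forall>n\<ge>N. (LINT x|lebesgue_on \<Omega>. (norm (X m x - X n x))\<^sup>2) < e"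
  shows "\<exists>f\<in>L2 \<Omega>. (\<lambda>n. LINT x|lebesgue_on \<Omega>. (norm (X n x - f x))\<^sup>2) \<longlonglongrightarrow> 0"
proof -
  let ?M = "lebesgue_on \<Omega>"
  have [measurable]: "X n \<in> borel_measurable ?M" for n using X L2_measurable by blast
  have int: "integrable ?M (\<lambda>x. (norm (X m x - X n x))\<^sup>2)" for m n
    using L2_integrable_norm[OF L2_diff[OF X X]] .
  have nnint: "(\<integral>\<^sup>+ x. ennreal ((norm (X m x - X n x))\<^sup>2) \<partial>?M) = ennreal (LINT x|?M. (norm (X m x - X n x))\<^sup>2)" for m n
    by (rule nn_integral_eq_integral[OF int]) simp
  have "\<exists>N. \<forall>m\<ge>N. \<forall>n\<ge>N. (LINT x|?M. (norm (X m x - X n x))\<^sup>2) < (1/4)^k" for k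
    by (rule C) simp
  then obtain N where N: "\<And>k m n. m \<ge> N k \<Longrightarrow> n \<ge> N k \<Longrightarrow> (LINT x|?M. (norm (X m x - X n x))\<^sup>2) < (1/4)^k"
    by metis
  \<comment> \<open>Partial sums make \<open>r (Suc k)\<close> at least \<open>N k\<close> as well,
    and the summand \<open>k\<close> makes \<open>r\<close> tend to infinity.\<close>
  define r where "r k = (\<Sum>j\<le>k. N j) + k" for k
  have rN: "r k \<ge> N k" "r (Suc k) \<ge> N k" for k
    using member_le_sum[of k "{..k}" N] by (auto simp: r_def)
  have rge: "r k \<ge> k" for k by (simp add: r_def)
  define d where "d k x = norm (X (r (Suc k)) x - X (r k) x)" for k x
  have [measurable]: "d k \<in> borel_measurable ?M" for k unfolding d_def by measurable
  have "(\<integral>\<^sup>+ x. (\<Sum>k. ennreal (2^k * (d k x)\<^sup>2)) \<partial>?M) = (\<Sum>k. \<integral>\<^sup>+ x. ennreal (2^k * (d k x)\<^sup>2) \<partial>?M)"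
    by (rule nn_integral_suminf) measurable
  also have "\<dots> \<le> (\<Sum>k. ennreal ((1/2)^k))"
  proof (rule suminf_le)
    fix k
    have "(\<integral>\<^sup>+ x. ennreal (2^k * (d k x)\<^sup>2) \<partial>?M) = ennreal (2^k) * (\<integral>\<^sup>+ x. ennreal ((d k x)\<^sup>2) \<partial>?M)"
      by (subst nn_integral_cmult[symmetric]) (auto simp: ennreal_mult)
    also have "\<dots> = ennreal (2^k * (LINT x|?M. (d k x)\<^sup>2))"
      unfolding d_def nnint by (simp add: ennreal_mult)
    also have "\<dots> \<le> ennreal ((1/2)^k)"
    proof (rule ennreal_leI)
      have "2^k * (LINT x|?M. (d k x)\<^sup>2) \<le> 2^k * (1/4)^k"
        unfolding d_def using N[OF rN(2) rN(1)] by (intro mult_left_mono) (auto intro: less_imp_le)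
      also have "\<dots> = (1/2)^k" by (simp add: power_mult_distrib[symmetric])
      finally show "2^k * (LINT x|?M. (d k x)\<^sup>2) \<le> (1/2)^k" .
    qed
    finally show "(\<integral>\<^sup>+ x. ennreal (2^k * (d k x)\<^sup>2) \<partial>?M) \<le> ennreal ((1/2)^k)" .
  qed auto
  also have "\<dots> = ennreal (\<Sum>k. (1/2)^k)" by (rule suminf_ennreal2) (auto simp: summable_geometric)
  also have "\<dots> < \<infinity>" by simp
  finally have fin: "(\<integral>\<^sup>+ x. (\<Sum>k. ennreal (2^k * (d k x)\<^sup>2)) \<partial>?M) \<noteq> \<infinity>" by simp
  have "AE x in ?M. (\<Sum>k. ennreal (2^k * (d k x)\<^sup>2)) \<noteq> \<infinity>"
    by (rule nn_integral_PInf_AE[OF _ fin]) measurable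
  then have conv: "AE x in ?M. (\<lambda>k. X (r k) x) \<longlonglongrightarrow> lim (\<lambda>k. X (r k) x)"
  proof eventually_elim
    case (elim x)
    then have "summable (\<lambda>k. 2^k * (d k x)\<^sup>2)" by (intro summable_suminf_not_top) auto
    then have s1: "summable (\<lambda>k. (2^k * (d k x)\<^sup>2 + (1/2)^k) / 2)"
      by (intro summable_divide summable_add summable_geometric) auto
    \<comment> \<open>The arithmetic-geometric mean inequality: summability of the squares weighted
      by \<open>2^k\<close> gives summability of the increments themselves, pointwise and without a
      bound on the measure of the domain.\<close>
    have s2: "d k x \<le> (2^k * (d k x)\<^sup>2 + (1/2)^k) / 2" for k
    proof -
      have "0 \<le> (2^k * d k x - 1)\<^sup>2 / 2^k" by simp
      also have "\<dots> = 2^k * (d k x)\<^sup>2 - 2 * d k x + (1/2)^k"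
        by (simp add: power2_eq_square field_simps power_divide)
      finally show ?thesis by simp
    qed
    have "summable (\<lambda>k. d k x)"
      by (rule summable_comparison_test'[OF s1, of 0]) (use s2 in \<open>auto simp: d_def\<close>)
    then have "summable (\<lambda>k. X (r (Suc k)) x - X (r k) x)" unfolding d_def by (rule summable_norm_cancel)
    then have "convergent (\<lambda>n. (\<Sum>k<n. X (r (Suc k)) x - X (r k) x) + X (r 0) x)"
      unfolding summable_iff_convergent by (intro convergent_add convergent_const)
    then have "convergent (\<lambda>k. X (r k) x)"
      by (simp add: sum_lessThan_telescope[of "\<lambda>k. X (r k) x"])
    then show ?case by (simp add: convergent_LIMSEQ_iff)
  qed
  define f where "f x = lim (\<lambda>k. X (r k) x)" for x
  have [measurable]: "f \<in> borel_measurable ?M" unfolding f_def by measurable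
  have fat: "(\<integral>\<^sup>+ x. ennreal ((norm (X n x - f x))\<^sup>2) \<partial>?M) \<le> ennreal e"
    if "\<forall>m\<ge>K. (LINT x|?M. (norm (X n x - X m x))\<^sup>2) < e" for n K e
  proof -
    have "(\<integral>\<^sup>+ x. ennreal ((norm (X n x - f x))\<^sup>2) \<partial>?M) = (\<integral>\<^sup>+ x. liminf (\<lambda>k. ennreal ((norm (X n x - X (r k) x))\<^sup>2)) \<partial>?M)"
    proof (rule nn_integral_cong_AE)
      show "AE x in ?M. ennreal ((norm (X n x - f x))\<^sup>2) = liminf (\<lambda>k. ennreal ((norm (X n x - X (r k) x))\<^sup>2))"
        using conv
      proof eventually_elim
        case (elim x)
        then have "(\<lambda>k. ennreal ((norm (X n x - X (r k) x))\<^sup>2)) \<longlonglongrightarrow> ennreal ((norm (X n x - f x))\<^sup>2)"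
          unfolding f_def by (intro tendsto_ennrealI tendsto_intros)
        then show ?case using lim_imp_Liminf[OF sequentially_bot] by metis
      qed
    qed
    also have "\<dots> \<le> liminf (\<lambda>k. \<integral>\<^sup>+ x. ennreal ((norm (X n x - X (r k) x))\<^sup>2) \<partial>?M)"
      by (rule nn_integral_liminf) measurable
    also have "\<dots> \<le> liminf (\<lambda>k. ennreal e)"
    proof (rule Liminf_mono)
      show "\<forall>\<^sub>F k in sequentially. (\<integral>\<^sup>+ x. ennreal ((norm (X n x - X (r k) x))\<^sup>2) \<partial>?M) \<le> ennreal e"
        using that rge unfolding eventually_sequentially nnint
        by (intro exI[of _ K] allI impI ennreal_leI) (meson less_imp_le order_trans)
    qed
    finally show ?thesis by (simp add: Liminf_const)
  qed
  have fL2: "f \<in> L2 \<Omega>" and fsm: "\<And>e. e > 0 \<Longrightarrow> \<exists>N. \<forall>n\<ge>N. (LINT x|?M. (norm (X n x - f x))\<^sup>2) \<le> e"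
  proof -
    have D: "(\<lambda>x. X n x - f x) \<in> L2 \<Omega>" if "\<forall>m\<ge>K. (LINT x|?M. (norm (X n x - X m x))\<^sup>2) < e" for n K e
      using fat[OF that] unfolding L2_def
      by (auto intro!: integrableI_bounded simp: power2_eq_square less_top[symmetric] top_unique)
    obtain N1 where "\<forall>m\<ge>N1. \<forall>n\<ge>N1. (LINT x|?M. (norm (X m x - X n x))\<^sup>2) < 1" using C[of 1] by auto
    then have "(\<lambda>x. X N1 x - f x) \<in> L2 \<Omega>" by (intro D[of N1 N1 1]) auto
    from L2_diff[OF X[of N1] this] show "f \<in> L2 \<Omega>" by simp
    fix e :: real assume "e > 0"
    from C[OF this] obtain N2 where N2: "\<forall>m\<ge>N2. \<forall>n\<ge>N2. (LINT x|?M. (norm (X m x - X n x))\<^sup>2) < e" by blast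
    have "(LINT x|?M. (norm (X n x - f x))\<^sup>2) \<le> e" if "n \<ge> N2" for n
    proof -
      have *: "\<forall>m\<ge>N2. (LINT x|?M. (norm (X n x - X m x))\<^sup>2) < e" using N2 that by blast
      have "ennreal (LINT x|?M. (norm (X n x - f x))\<^sup>2) = (\<integral>\<^sup>+ x. ennreal ((norm (X n x - f x))\<^sup>2) \<partial>?M)"
        using L2_integrable_norm[OF D[OF *]] by (intro nn_integral_eq_integral[symmetric]) auto
      also have "\<dots> \<le> ennreal e" by (rule fat[OF *])
      finally show ?thesis using \<open>e > 0\<close> by (simp add: ennreal_le_iff)
    qed
    then show "\<exists>N. \<forall>n\<ge>N. (LINT x|?M. (norm (X n x - f x))\<^sup>2) \<le> e" by blast
  qed
  have "(\<lambda>n. LINT x|?M. (norm (X n x - f x))\<^sup>2) \<longlonglongrightarrow> 0"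
  proof (rule LIMSEQ_I)
    fix e :: real assume "e > 0"
    then obtain N where "\<forall>n\<ge>N. (LINT x|?M. (norm (X n x - f x))\<^sup>2) \<le> e / 2" using fsm[of "e/2"] by auto
    with \<open>e > 0\<close> show "\<exists>N. \<forall>n\<ge>N. norm ((LINT x|?M. (norm (X n x - f x))\<^sup>2) - 0) < e"
      by (intro exI[of _ N]) (fastforce simp: integral_nonneg_AE)
  qed
  with fL2 show ?thesis by blast
qed

interpretation L2: semi_hilbert "L2 \<Omega>" "\<lambda>f g. LINT x|lebesgue_on \<Omega>. f x \<bullet> g x"
  for \<Omega> :: "(real^'n) set"
proof
  fix f g h :: "real^'n \<Rightarrow> 'b::euclidean_space" and c :: real
  assume f: "f \<in> L2 \<Omega>" and h: "h \<in> L2 \<Omega>"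
  show "(LINT x|lebesgue_on \<Omega>. (c *\<^sub>R f) x \<bullet> h x) = c * (LINT x|lebesgue_on \<Omega>. f x \<bullet> h x)"
    using L2_inner_integrable[OF f h] by simp
  show "0 \<le> (LINT x|lebesgue_on \<Omega>. f x \<bullet> f x)" by simp
  show "(LINT x|lebesgue_on \<Omega>. f x \<bullet> h x) = (LINT x|lebesgue_on \<Omega>. h x \<bullet> f x)" by (simp add: inner_commute)
  assume g: "g \<in> L2 \<Omega>"
  show "(LINT x|lebesgue_on \<Omega>. (f + g) x \<bullet> h x) = (LINT x|lebesgue_on \<Omega>. f x \<bullet> h x) + (LINT x|lebesgue_on \<Omega>. g x \<bullet> h x)"
    using L2_inner_integrable[OF f h] L2_inner_integrable[OF g h] by (simp add: inner_add_left)
next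
  show "subspace (L2 \<Omega> :: (real^'n \<Rightarrow> 'b::euclidean_space) set)"
    by (auto simp: subspace_def plus_fun_def scaleR_fun_def zero_fun_def L2_add L2_scale L2_zero)
next
  fix X :: "nat \<Rightarrow> real^'n \<Rightarrow> 'b::euclidean_space"
  assume "\<And>n. X n \<in> L2 \<Omega>"
    "\<And>e. e > 0 \<Longrightarrow> \<exists>N. \<forall>m\<ge>N. \<forall>n\<ge>N. (LINT x|lebesgue_on \<Omega>. (X m - X n) x \<bullet> (X m - X n) x) < e"
  then show "\<exists>f\<in>L2 \<Omega>. (\<lambda>n. LINT x|lebesgue_on \<Omega>. (X n - f) x \<bullet> (X n - f) x) \<longlonglongrightarrow> 0"
    using L2_complete[of X \<Omega>] by (simp add: power2_norm_eq_inner)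
qed

lemma L2_nm: "L2.nm \<Omega> f = L2_norm \<Omega> f"
  by (simp add: L2.nm_def L2_norm_def power2_norm_eq_inner)

lemma L2_Cauchy_Schwarz:
  "f \<in> L2 \<Omega> \<Longrightarrow> g \<in> L2 \<Omega> \<Longrightarrow> \<bar>LINT x|lebesgue_on \<Omega>. f x \<bullet> g x\<bar> \<le> L2_norm \<Omega> f * L2_norm \<Omega> g"
  using L2.Cauchy_Schwarz[of f \<Omega> g] by (simp add: L2_nm)

lemma L2_norm_sq: "(L2_norm \<Omega> f)\<^sup>2 = (LINT x|lebesgue_on \<Omega>. (norm (f x))\<^sup>2)"
  by (simp add: L2_norm_def)

lemma L2_norm_nonneg [simp]: "0 \<le> L2_norm \<Omega> f"
  by (simp add: L2_norm_def)

lemma lebesgue_on_outside: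
  fixes f :: "real^'n \<Rightarrow> 'b::euclidean_space"
  assumes "\<Omega> \<in> sets lebesgue" "\<And>x. x \<notin> \<Omega> \<Longrightarrow> f x = 0"
  shows "(LINT x|lebesgue_on \<Omega>. f x) = (LINT x|lebesgue. f x)"
    "integrable (lebesgue_on \<Omega>) f \<longleftrightarrow> integrable lebesgue f"
    "f \<in> borel_measurable (lebesgue_on \<Omega>) \<longleftrightarrow> f \<in> borel_measurable lebesgue"
proof -
  have "(\<lambda>x. if x \<in> \<Omega> then f x else 0) = f" using assms(2) by auto
  then show "(LINT x|lebesgue_on \<Omega>. f x) = (LINT x|lebesgue. f x)"
    "integrable (lebesgue_on \<Omega>) f \<longleftrightarrow> integrable lebesgue f"
    "f \<in> borel_measurable (lebesgue_on \<Omega>) \<longleftrightarrow> f \<in> borel_measurable lebesgue"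
    using Lebesgue_Measure.integral_restrict_UNIV[OF assms(1), of f] Lebesgue_Measure.integrable_restrict_UNIV[OF assms(1), of f]
      borel_measurable_if[OF assms(1), of f] by auto
qed

lemma L2_UNIV_integrable:
  fixes f :: "real^'n \<Rightarrow> real"
  assumes "f \<in> L2 UNIV" "compact K" "\<And>x. x \<notin> K \<Longrightarrow> f x = 0"
  shows "integrable lebesgue f"
proof (rule Bochner_Integration.integrable_bound)
  have "integrable lebesgue (indicator K :: real^'n \<Rightarrow> real)"
    using lmeasurable_compact[OF assms(2)] by (simp add: lmeasurable_iff_integrable)
  then show "integrable lebesgue (\<lambda>x. indicator K x + (f x)\<^sup>2 :: real)"
    using L2_integrable_norm[OF assms(1)] by (simp add: lebesgue_on_UNIV_eq)
  show "f \<in> borel_measurable lebesgue" using L2_measurable[OF assms(1)] by (simp add: lebesgue_on_UNIV_eq)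
  have "\<bar>f x\<bar> \<le> indicator K x + (f x)\<^sup>2" for x
  proof (cases "x \<in> K")
    case True
    have "0 \<le> (\<bar>f x\<bar> - 1)\<^sup>2" by simp
    then show ?thesis using True by (simp add: power2_eq_square algebra_simps)
  qed (simp add: assms(3))
  then show "AE x in lebesgue. norm (f x) \<le> norm (indicator K x + (f x)\<^sup>2 :: real)"
    by (auto simp: abs_of_nonneg add_nonneg_nonneg)
qed

text \<open>Jensen's inequality for the probability density \<open>mollifier \<delta> (x - y)\<close>.\<close>
lemma conv_sq_le:
  assumes \<delta>: "0 < \<delta>" and f: "integrable lebesgue f" "integrable lebesgue (\<lambda>y. (f y)\<^sup>2)"
  shows "(conv (mollifier \<delta>) f x - c)\<^sup>2 \<le> (LINT y|lebesgue. mollifier \<delta> (x - y) * (f y - c)\<^sup>2)"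
    "integrable lebesgue (\<lambda>y. mollifier \<delta> (x - y) * (f y - c)\<^sup>2)"
proof -
  note m = test_mollifier[OF \<delta>]
  let ?a = "conv (mollifier \<delta>) f x"
  have 1: "integrable lebesgue (\<lambda>y. mollifier \<delta> (x - y))" "(LINT y|lebesgue. mollifier \<delta> (x - y)) = 1"
    using mollifier_shift[OF \<delta>, of x] by (auto simp: integrable_completion integral_completion)
  note i = conv_integrable[OF m f(1), of x] conv_integrable[OF m f(2), of x]
  have e: "(\<lambda>y. mollifier \<delta> (x - y) * (f y - d)\<^sup>2) =
     (\<lambda>y. mollifier \<delta> (x - y) * (f y)\<^sup>2 - 2 * d * (mollifier \<delta> (x - y) * f y) + d\<^sup>2 * mollifier \<delta> (x - y))" for d
    by (auto simp: fun_eq_iff power2_eq_square algebra_simps)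
  have I: "integrable lebesgue (\<lambda>y. mollifier \<delta> (x - y) * (f y - d)\<^sup>2)" for d
    unfolding e using 1 i by auto
  show "integrable lebesgue (\<lambda>y. mollifier \<delta> (x - y) * (f y - c)\<^sup>2)" by (rule I)
  \<comment> \<open>As a function of \<open>d\<close> the integral is a parabola with vertex at the
    mean \<open>?a\<close>; nonnegativity of its value there is Jensen's inequality.\<close>
  have v: "(LINT y|lebesgue. mollifier \<delta> (x - y) * (f y - d)\<^sup>2) =
     (LINT y|lebesgue. mollifier \<delta> (x - y) * (f y)\<^sup>2) - 2 * d * ?a + d\<^sup>2" for d
    unfolding e using 1 i by (simp add: conv_def)
  have "0 \<le> (LINT y|lebesgue. mollifier \<delta> (x - y) * (f y - ?a)\<^sup>2)"
    by (intro integral_nonneg_AE) (simp add: mollifier_nonneg)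
  then show "(?a - c)\<^sup>2 \<le> (LINT y|lebesgue. mollifier \<delta> (x - y) * (f y - c)\<^sup>2)"
    unfolding v by (simp add: power2_eq_square algebra_simps)
qed

section \<open>Mollification in \<open>L2\<close>\<close>

lemma conv_cong_AE:
  assumes "AE y in lebesgue. f y = g y" "f \<in> borel_measurable lebesgue" "g \<in> borel_measurable lebesgue"
  shows "conv (mollifier \<delta>) f x = conv (mollifier \<delta>) g x"
proof -
  have "(\<lambda>y. mollifier \<delta> (x - y)) \<in> borel_measurable lebesgue"
    unfolding mollifier_def[abs_def] flat_exp_def
    by (intro measurable_completion) simp
  with assms show ?thesis unfolding conv_def by (intro integral_cong_AE) auto
qed

lemma mollifier_borel [measurable]: "mollifier \<delta> \<in> borel_measurable borel"
  using mollifier_integrable[of \<delta>] by (auto dest: borel_measurable_integrable)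

text \<open>Jensen's inequality holds pointwise in \<open>x\<close>; after Tonelli the kernel
  integrates to 1 in \<open>x\<close> for each fixed \<open>y\<close>.\<close>

lemma Young_L2:
  fixes f :: "real^'n \<Rightarrow> real"
  assumes \<delta>: "0 < \<delta>" and f: "integrable lebesgue f" "f \<in> L2 UNIV"
  shows "conv (mollifier \<delta>) f \<in> L2 UNIV"
    "(LINT x|lebesgue. (conv (mollifier \<delta>) f x)\<^sup>2) \<le> (LINT x|lebesgue. (f x)\<^sup>2)"
proof -
  have f2: "integrable lebesgue (\<lambda>y. (f y)\<^sup>2)"
    using L2_integrable_norm[OF f(2)] by (simp add: lebesgue_on_UNIV_eq)
  have fm: "f \<in> borel_measurable lebesgue" using f(1) by auto
  \<comment> \<open>Tonelli needs measurability on the Borel product, hence a Borel representative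
    of \<open>f\<close>; the convolution does not see the change.\<close>
  obtain g where g[measurable]: "g \<in> borel_measurable lborel" and fg: "AE x in lborel. f x = g x"
    using completion_ex_borel_measurable_real[OF fm] by blast
  have fg': "AE x in lebesgue. f x = g x" by (rule AE_completion[OF fg])
  have gl: "g \<in> borel_measurable lebesgue" using g by (rule measurable_completion)
  have g1: "integrable lebesgue g" using f(1) fg' gl fm by (subst integrable_cong_AE[of g lebesgue f]) auto
  have g2: "integrable lebesgue (\<lambda>y. (g y)\<^sup>2)"
    using f2 fg' gl fm by (subst integrable_cong_AE[of "\<lambda>y. (g y)\<^sup>2" lebesgue "\<lambda>y. (f y)\<^sup>2"]) auto
  have ceq: "conv (mollifier \<delta>) f = conv (mollifier \<delta>) g" using conv_cong_AE[OF fg' fm gl] by blast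
  have cm: "conv (mollifier \<delta>) g \<in> borel_measurable borel"
    using smooth_continuous[OF smooth_conv[OF test_mollifier[OF \<delta>] g1]] by (rule borel_measurable_continuous_onI)
  have "(\<integral>\<^sup>+ x. ennreal ((conv (mollifier \<delta>) g x)\<^sup>2) \<partial>lborel) \<le> (\<integral>\<^sup>+ x. (\<integral>\<^sup>+ y. ennreal (mollifier \<delta> (x - y) * (g y)\<^sup>2) \<partial>lborel) \<partial>lborel)"
  proof (rule nn_integral_mono)
    fix x :: "real^'n"
    have i: "integrable lborel (\<lambda>y. mollifier \<delta> (x - y) * (g y - 0)\<^sup>2)"
      using conv_sq_le(2)[OF \<delta> g1 g2, of x 0] by (subst (asm) integrable_completion) auto
    have "(conv (mollifier \<delta>) g x - 0)\<^sup>2 \<le> (LINT y|lborel. mollifier \<delta> (x - y) * (g y - 0)\<^sup>2)"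
      using conv_sq_le(1)[OF \<delta> g1 g2, of x 0] by (subst (asm) integral_completion) auto
    then have "ennreal ((conv (mollifier \<delta>) g x)\<^sup>2) \<le> ennreal (LINT y|lborel. mollifier \<delta> (x - y) * (g y)\<^sup>2)"
      by (intro ennreal_leI) simp
    also have "\<dots> = (\<integral>\<^sup>+ y. ennreal (mollifier \<delta> (x - y) * (g y)\<^sup>2) \<partial>lborel)"
      using i by (intro nn_integral_eq_integral[symmetric]) (auto simp: mollifier_nonneg)
    finally show "ennreal ((conv (mollifier \<delta>) g x)\<^sup>2) \<le> (\<integral>\<^sup>+ y. ennreal (mollifier \<delta> (x - y) * (g y)\<^sup>2) \<partial>lborel)" .
  qed
  also have "\<dots> = (\<integral>\<^sup>+ y. (\<integral>\<^sup>+ x. ennreal (mollifier \<delta> (x - y) * (g y)\<^sup>2) \<partial>lborel) \<partial>lborel)"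
    by (rule lborel_pair.Fubini') measurable
  also have "\<dots> = (\<integral>\<^sup>+ y. ennreal ((g y)\<^sup>2) \<partial>lborel)"
  proof (rule nn_integral_cong)
    fix y :: "real^'n"
    have "(\<integral>\<^sup>+ x. ennreal (mollifier \<delta> (x - y) * (g y)\<^sup>2) \<partial>lborel) = (\<integral>\<^sup>+ x. ennreal (mollifier \<delta> (y - x)) * ennreal ((g y)\<^sup>2) \<partial>lborel)"
      by (simp add: mollifier_minus[of \<delta> _ y] ennreal_mult mollifier_nonneg)
    also have "\<dots> = ennreal ((g y)\<^sup>2)"
      using mollifier_shift(3)[OF \<delta>, of y] by (subst nn_integral_multc) auto
    finally show "(\<integral>\<^sup>+ x. ennreal (mollifier \<delta> (x - y) * (g y)\<^sup>2) \<partial>lborel) = ennreal ((g y)\<^sup>2)" .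
  qed
  also have "\<dots> = ennreal (LINT y|lborel. (g y)\<^sup>2)"
    using g2 by (intro nn_integral_eq_integral) (auto simp: integrable_completion)
  finally have le: "(\<integral>\<^sup>+ x. ennreal ((conv (mollifier \<delta>) g x)\<^sup>2) \<partial>lborel) \<le> ennreal (LINT y|lborel. (g y)\<^sup>2)" .
  have ci: "integrable lborel (\<lambda>x. (conv (mollifier \<delta>) g x)\<^sup>2)"
    using le cm by (intro integrableI_bounded) (auto simp: less_top[symmetric] top_unique)
  show "conv (mollifier \<delta>) f \<in> L2 UNIV"
    unfolding ceq L2_def lebesgue_on_UNIV_eq using ci cm
    by (auto simp: integrable_completion intro!: measurable_completion)
  have "ennreal (LINT x|lborel. (conv (mollifier \<delta>) g x)\<^sup>2) \<le> ennreal (LINT y|lborel. (g y)\<^sup>2)"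
    using le ci by (subst nn_integral_eq_integral[symmetric]) auto
  then have "(LINT x|lborel. (conv (mollifier \<delta>) g x)\<^sup>2) \<le> (LINT y|lborel. (g y)\<^sup>2)"
    by (simp add: ennreal_le_iff)
  moreover have "(LINT x|lebesgue. (f x)\<^sup>2) = (LINT x|lborel. (g x)\<^sup>2)"
    using fg' fm gl by (subst integral_completion[symmetric]) (auto intro!: integral_cong_AE)
  ultimately show "(LINT x|lebesgue. (conv (mollifier \<delta>) f x)\<^sup>2) \<le> (LINT x|lebesgue. (f x)\<^sup>2)"
    unfolding ceq using cm by (subst integral_completion) auto
qed

text \<open>Truncation in height and in space reduces to a bounded function of bounded support. A
  measurable function is an almost everywhere limit of continuous ones, and truncating these in the
  same way supplies a dominating function.\<close>

lemma L2_dense_continuous: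
  fixes f :: "real^'n \<Rightarrow> real"
  assumes f: "f \<in> L2 UNIV" and e: "e > 0"
  shows "\<exists>g K. continuous_on UNIV g \<and> compact K \<and> (\<forall>x. x \<notin> K \<longrightarrow> g x = 0) \<and> g \<in> L2 UNIV \<and>
    (LINT x|lebesgue. (f x - g x)\<^sup>2) < e"
proof -
  have fm[measurable]: "f \<in> borel_measurable lebesgue" and f2: "integrable lebesgue (\<lambda>x. (f x)\<^sup>2)"
    using f by (auto simp: L2_def lebesgue_on_UNIV_eq)
  define F where "F M x = (if norm x \<le> real M then max (- real M) (min (real M) (f x)) else 0)" for M :: nat and x
  have [measurable]: "(\<lambda>x::real^'n. norm x) \<in> borel_measurable lebesgue" by (intro measurable_completion) simp
  have Fm[measurable]: "F M \<in> borel_measurable lebesgue" for M unfolding F_def by measurable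
  have "(\<lambda>M. LINT x|lebesgue. (f x - F M x)\<^sup>2) \<longlonglongrightarrow> (LINT x::real^'n|lebesgue. 0)"
  proof (rule integral_dominated_convergence[where w = "\<lambda>x. (f x)\<^sup>2"])
    show "AE x in lebesgue. (\<lambda>M. (f x - F M x)\<^sup>2) \<longlonglongrightarrow> 0"
    proof (rule AE_I2)
      fix x
      obtain M0 where M0: "norm x \<le> real M0" "\<bar>f x\<bar> \<le> real M0"
        using real_arch_simple[of "max (norm x) \<bar>f x\<bar>"] by auto
      have "F M x = f x" if "M \<ge> M0" for M
      proof -
        have "real M0 \<le> real M" using that by simp
        then show ?thesis using M0 by (auto simp: F_def min_def max_def)
      qed
      then have "\<forall>\<^sub>F M in sequentially. (f x - F M x)\<^sup>2 = 0"
        unfolding eventually_sequentially by (intro exI[of _ M0]) auto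
      then show "(\<lambda>M. (f x - F M x)\<^sup>2) \<longlonglongrightarrow> 0" by (rule tendsto_eventually)
    qed
    show "AE x in lebesgue. norm ((f x - F M x)\<^sup>2) \<le> (f x)\<^sup>2" for M
      by (rule AE_I2) (auto simp: F_def abs_le_square_iff[symmetric])
  qed (use f2 in auto)
  then have "\<forall>\<^sub>F M in sequentially. (LINT x|lebesgue. (f x - F M x)\<^sup>2) < e / 4"
    using e by (intro order_tendstoD) auto
  then obtain M where M: "(LINT x|lebesgue. (f x - F M x)\<^sup>2) < e / 4" by (auto simp: eventually_sequentially)
  have "F M measurable_on UNIV"
    using lebesgue_measurable_imp_measurable_on[of "F M" UNIV] Fm by (simp add: lebesgue_on_UNIV_eq)
  then obtain N g where Ng: "negligible N \<and> (\<forall>n. continuous_on UNIV (g n)) \<and>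
      (\<forall>x. x \<notin> N \<longrightarrow> (\<lambda>n. g n x) \<longlonglongrightarrow> F M x)"
    unfolding measurable_on_def by auto
  then have N: "negligible N" and g: "\<And>n. continuous_on UNIV (g n)"
    "\<And>x. x \<notin> N \<Longrightarrow> (\<lambda>n. g n x) \<longlonglongrightarrow> F M x" by simp_all
  \<comment> \<open>Equal to 1 for \<open>norm x \<le> real M\<close> and 0 beyond
    \<open>real M + 1\<close>: clipping and cutting leave \<open>F M\<close> itself unchanged, so
    the modified approximants keep their limit.\<close>
  define cut :: "real^'n \<Rightarrow> real" where "cut x = max 0 (min 1 (real M + 1 - norm x))" for x
  define h where "h n x = cut x * max (- real M) (min (real M) (g n x))" for n x
  have hc: "continuous_on UNIV (h n)" for n
    unfolding h_def cut_def by (intro continuous_intros g)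
  have hm[measurable]: "h n \<in> borel_measurable lebesgue" for n
    using borel_measurable_continuous_onI[OF hc[of n]] by (intro measurable_completion) simp
  have hF: "cut x * max (- real M) (min (real M) (F M x)) = F M x" for x
    by (auto simp: cut_def F_def min_def max_def)
  let ?B = "\<lambda>x::real^'n. (2 * real M)\<^sup>2 * indicator (cball 0 (real M + 1)) x :: real"
  have hb: "(F M x - h n x)\<^sup>2 \<le> ?B x" and h0: "x \<notin> cball 0 (real M + 1) \<Longrightarrow> h n x = 0" and hM: "\<bar>h n x\<bar> \<le> real M" for n x
  proof -
    show h0: "x \<notin> cball 0 (real M + 1) \<Longrightarrow> h n x = 0" by (auto simp: h_def cut_def)
    have "0 \<le> cut x" "cut x \<le> 1" by (auto simp: cut_def)
    then show hM: "\<bar>h n x\<bar> \<le> real M"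
      unfolding h_def abs_mult using mult_mono[of "\<bar>cut x\<bar>" 1 "\<bar>max (- real M) (min (real M) (g n x))\<bar>" "real M"]
      by (auto simp: abs_le_iff)
    have "\<bar>F M x\<bar> \<le> real M" by (auto simp: F_def)
    then have "\<bar>F M x - h n x\<bar> \<le> 2 * real M" using hM by linarith
    then have "(F M x - h n x)\<^sup>2 \<le> (2 * real M)\<^sup>2" by (subst power2_le_iff_abs_le) auto
    moreover have "F M x = 0" if "x \<notin> cball 0 (real M + 1)" using that by (auto simp: F_def)
    ultimately show "(F M x - h n x)\<^sup>2 \<le> ?B x" using h0 by (cases "x \<in> cball 0 (real M + 1)") auto
  qed
  have Bint: "integrable lebesgue ?B"
    using lmeasurable_compact[OF compact_cball[of "0::real^'n" "real M + 1"]]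
    by (intro integrable_mult_right) (auto simp: lmeasurable_iff_integrable)
  have "(\<lambda>n. LINT x|lebesgue. (F M x - h n x)\<^sup>2) \<longlonglongrightarrow> (LINT x::real^'n|lebesgue. 0)"
  proof (rule integral_dominated_convergence[where w = ?B])
    have "AE x in lebesgue. x \<notin> N" using N by (simp add: AE_not_in negligible_iff_null_sets)
    then show "AE x in lebesgue. (\<lambda>n. (F M x - h n x)\<^sup>2) \<longlonglongrightarrow> 0"
    proof eventually_elim
      case (elim x)
      have "(\<lambda>n. (F M x - h n x)\<^sup>2) \<longlonglongrightarrow> (F M x - cut x * max (- real M) (min (real M) (F M x)))\<^sup>2"
        unfolding h_def by (intro tendsto_intros g(2)[OF elim])
      then show ?case by (simp add: hF)
    qed
  qed (use hb Bint in \<open>auto simp: abs_of_nonneg\<close>)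
  then have "\<forall>\<^sub>F n in sequentially. (LINT x|lebesgue. (F M x - h n x)\<^sup>2) < e / 4"
    using e by (intro order_tendstoD) auto
  then obtain n where n: "(LINT x|lebesgue. (F M x - h n x)\<^sup>2) < e / 4" by (auto simp: eventually_sequentially)
  have I1: "integrable lebesgue (\<lambda>x. (F M x - h n x)\<^sup>2)"
    by (rule Bochner_Integration.integrable_bound[OF Bint]) (use hb in \<open>auto simp: abs_of_nonneg\<close>)
  have I2: "integrable lebesgue (\<lambda>x. (f x - F M x)\<^sup>2)"
    by (rule Bochner_Integration.integrable_bound[OF f2]) (auto simp: F_def abs_le_square_iff[symmetric])
  have sq: "(f x - h n x)\<^sup>2 \<le> 2 * (f x - F M x)\<^sup>2 + 2 * (F M x - h n x)\<^sup>2" for x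
    using norm_add_sq[of "f x - F M x" "F M x - h n x"] by simp
  have "(LINT x|lebesgue. (f x - h n x)\<^sup>2) \<le> (LINT x|lebesgue. 2 * (f x - F M x)\<^sup>2 + 2 * (F M x - h n x)\<^sup>2)"
    by (rule integral_mono_AE'[OF _ AE_I2[OF sq]]) (use I1 I2 in auto)
  also have "\<dots> < e" using I1 I2 M n by simp
  finally have "(LINT x|lebesgue. (f x - h n x)\<^sup>2) < e" .
  moreover have "h n \<in> L2 UNIV"
    unfolding L2_def lebesgue_on_UNIV_eq
  proof (intro CollectI conjI)
    show "integrable lebesgue (\<lambda>x. (norm (h n x))\<^sup>2)"
    proof (rule Bochner_Integration.integrable_bound[OF Bint], measurable, rule AE_I2)
      fix x
      have "(h n x)\<^sup>2 \<le> (2 * real M)\<^sup>2" using hM[of n x] by (subst power2_le_iff_abs_le) auto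
      then show "norm ((norm (h n x))\<^sup>2) \<le> norm (?B x)"
        using h0[of x n] by (cases "x \<in> cball 0 (real M + 1)") auto
    qed
  qed (rule hm)
  ultimately show ?thesis using hc h0 by (intro exI[of _ "h n"] exI[of _ "cball 0 (real M + 1)"]) auto
qed

lemma conv_diff:
  assumes "\<psi> \<in> test_functions UNIV" "integrable lebesgue f" "integrable lebesgue g"
  shows "conv \<psi> (\<lambda>x. f x - g x) x = conv \<psi> f x - conv \<psi> g x"
  unfolding conv_def using conv_integrable[OF assms(1,2), of x] conv_integrable[OF assms(1,3), of x]
  by (simp add: right_diff_distrib)

text \<open>Density reduces to a continuous \<open>g\<close> of compact support: Young's bound
  carries the error \<open>f - g\<close> through the mollifier, and uniform continuity of
  \<open>g\<close> gives a uniformly small error on a fixed ball.\<close>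

lemma mollifier_L2:
  fixes f :: "real^'n \<Rightarrow> real"
  assumes f: "f \<in> L2 UNIV" "integrable lebesgue f" and e: "e > 0"
  shows "\<exists>d>0. \<forall>\<delta>. 0 < \<delta> \<longrightarrow> \<delta> < d \<longrightarrow> (LINT x|lebesgue. (conv (mollifier \<delta>) f x - f x)\<^sup>2) < e"
proof -
  \<comment> \<open>Three errors, each squared and weighted by 3 in the final estimate, hence
    ninths.\<close>
  have "e / 9 > 0" using e by simp
  from L2_dense_continuous[OF f(1) this] obtain g K where g: "continuous_on UNIV g" "compact K" "\<And>x. x \<notin> K \<Longrightarrow> g x = 0"
    "g \<in> L2 UNIV" "(LINT x|lebesgue. (f x - g x)\<^sup>2) < e / 9" by blast
  have gi: "integrable lebesgue g" by (rule L2_UNIV_integrable[OF g(4,2,3)])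
  have g2: "integrable lebesgue (\<lambda>x. (g x)\<^sup>2)" using L2_integrable_norm[OF g(4)] by (simp add: lebesgue_on_UNIV_eq)
  obtain R where "\<forall>x\<in>K. norm x \<le> R" using compact_imp_bounded[OF g(2)] by (auto simp: bounded_iff)
  then have R: "\<And>x. x \<in> K \<Longrightarrow> norm x \<le> R" by blast
  define v where "v = measure lebesgue (cball (0::real^'n) (R + 1))"
  \<comment> \<open>A tolerance in the supremum norm whose square times the volume \<open>v\<close>
    of the ball stays below \<open>e / 9\<close>.\<close>
  define c where "c = sqrt (e / (9 * (v + 1)))"
  have v: "v \<ge> 0" by (simp add: v_def)
  have c: "c > 0" "c\<^sup>2 * v < e / 9" using e v by (auto simp: c_def field_simps)
  obtain d where d: "d > 0" "\<And>x y. norm (y - x) < d \<Longrightarrow> \<bar>g y - g x\<bar> < c"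
    using uniformly_continuous_compact_support[OF g(1-3) c(1)] by blast
  show ?thesis
  proof (intro exI[of _ "min d 1"] conjI allI impI)
    fix \<delta> :: real assume \<delta>: "0 < \<delta>" "\<delta> < min d 1"
    note m = test_mollifier[OF \<delta>(1)]
    have pt: "(conv (mollifier \<delta>) g x - g x)\<^sup>2 \<le> c\<^sup>2 * indicator (cball 0 (R + 1)) x" for x
    proof (cases "x \<in> cball 0 (R + 1)")
      case True
      have 1: "integrable lebesgue (\<lambda>y. mollifier \<delta> (x - y))" "(LINT y|lebesgue. mollifier \<delta> (x - y)) = 1"
        using mollifier_shift[OF \<delta>(1), of x] by (auto simp: integrable_completion integral_completion)
      have "(conv (mollifier \<delta>) g x - g x)\<^sup>2 \<le> (LINT y|lebesgue. mollifier \<delta> (x - y) * (g y - g x)\<^sup>2)"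
        by (rule conv_sq_le(1)[OF \<delta>(1) gi g2])
      also have "\<dots> \<le> (LINT y|lebesgue. mollifier \<delta> (x - y) * c\<^sup>2)"
      proof (rule integral_mono[OF conv_sq_le(2)[OF \<delta>(1) gi g2]])
        fix y
        show "mollifier \<delta> (x - y) * (g y - g x)\<^sup>2 \<le> mollifier \<delta> (x - y) * c\<^sup>2"
        proof (cases "norm (x - y) < \<delta>")
          case True
          then have "\<bar>g y - g x\<bar> \<le> \<bar>c\<bar>" using d(2)[of y x] \<delta> c by (simp add: norm_minus_commute)
          then show ?thesis unfolding abs_le_square_iff by (intro mult_left_mono mollifier_nonneg)
        qed (use mollifier_outside[OF \<delta>(1), of "x - y"] in simp)
      qed (use 1 in simp)
      also have "\<dots> = c\<^sup>2" using 1 by simp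
      finally show ?thesis using True by simp
    next
      case False
      have "conv (mollifier \<delta>) g x = 0"
      proof (rule conv_outside[OF \<delta>(1) g(3)])
        fix y assume "y \<in> K"
        then have "norm y \<le> R" by (rule R)
        then show "\<delta> \<le> dist x y" using False \<delta> norm_triangle_ineq2[of x y] by (simp add: dist_norm)
      qed
      moreover have "g x = 0" using False R[of x] by (intro g(3)) auto
      ultimately show ?thesis by simp
    qed
    have cf: "conv (mollifier \<delta>) f \<in> L2 UNIV" by (rule Young_L2[OF \<delta>(1) f(2,1)])
    have cg: "conv (mollifier \<delta>) g \<in> L2 UNIV" by (rule Young_L2[OF \<delta>(1) gi g(4)])
    have fg: "(\<lambda>x. f x - g x) \<in> L2 UNIV" "integrable lebesgue (\<lambda>x. f x - g x)" using L2_diff[OF f(1) g(4)] f gi by auto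
    have sqi: "integrable lebesgue (\<lambda>x. (h x)\<^sup>2)" if "h \<in> L2 UNIV" for h :: "real^'n \<Rightarrow> real"
      using L2_integrable_norm[OF that] by (simp add: lebesgue_on_UNIV_eq)
    note i = sqi[OF L2_diff[OF cf f(1)]] sqi[OF L2_diff[OF cf cg]] sqi[OF L2_diff[OF cg g(4)]] sqi[OF fg(1)]
    have A: "(LINT x|lebesgue. (conv (mollifier \<delta>) f x - conv (mollifier \<delta>) g x)\<^sup>2) < e / 9"
      using Young_L2(2)[OF \<delta>(1) fg(2,1)] g(5) by (simp add: conv_diff[OF m f(2) gi])
    have B: "(LINT x|lebesgue. (conv (mollifier \<delta>) g x - g x)\<^sup>2) < e / 9"
    proof -
      have "(LINT x|lebesgue. (conv (mollifier \<delta>) g x - g x)\<^sup>2) \<le> (LINT x::real^'n|lebesgue. c\<^sup>2 * indicator (cball 0 (R + 1)) x)"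
        using i(3) pt lmeasurable_compact[OF compact_cball[of "0::real^'n" "R + 1"]]
        by (intro integral_mono integrable_mult_right) (auto simp: lmeasurable_iff_integrable)
      also have "\<dots> = c\<^sup>2 * v" by (simp add: v_def)
      finally show ?thesis using c by simp
    qed
    have sq: "(conv (mollifier \<delta>) f x - f x)\<^sup>2 \<le> 3 * (conv (mollifier \<delta>) f x - conv (mollifier \<delta>) g x)\<^sup>2
       + 3 * (conv (mollifier \<delta>) g x - g x)\<^sup>2 + 3 * (f x - g x)\<^sup>2" for x
    proof -
      have "(a + b - c)\<^sup>2 \<le> 3 * a\<^sup>2 + 3 * b\<^sup>2 + 3 * c\<^sup>2" for a b c :: real
        using zero_le_power2[of "a - b"] zero_le_power2[of "a + c"] zero_le_power2[of "b + c"]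
        by (simp add: power2_eq_square algebra_simps)
      from this[of "conv (mollifier \<delta>) f x - conv (mollifier \<delta>) g x" "conv (mollifier \<delta>) g x - g x" "f x - g x"]
      show ?thesis by simp
    qed
    have "(LINT x|lebesgue. (conv (mollifier \<delta>) f x - f x)\<^sup>2) \<le> (LINT x|lebesgue. 3 * (conv (mollifier \<delta>) f x - conv (mollifier \<delta>) g x)\<^sup>2
       + 3 * (conv (mollifier \<delta>) g x - g x)\<^sup>2 + 3 * (f x - g x)\<^sup>2)"
      using i by (intro integral_mono sq) auto
    also have "\<dots> < e" using i A B g(5) by simp
    finally show "(LINT x|lebesgue. (conv (mollifier \<delta>) f x - f x)\<^sup>2) < e" .
  qed (use d in auto)
qed

lemma conv_nonneg: "(\<And>x. 0 \<le> f x) \<Longrightarrow> 0 \<le> conv (mollifier \<delta>) f x"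
  unfolding conv_def by (intro integral_nonneg_AE) (auto simp: mollifier_nonneg)

lemma conv_le:
  assumes "0 < \<delta>" "integrable lebesgue f" "\<And>y. f y \<le> c"
  shows "conv (mollifier \<delta>) f x \<le> c"
proof -
  have 1: "integrable lebesgue (\<lambda>y. mollifier \<delta> (x - y))" "(LINT y|lebesgue. mollifier \<delta> (x - y)) = 1"
    using mollifier_shift[OF assms(1), of x] by (auto simp: integrable_completion integral_completion)
  have "integrable lebesgue (\<lambda>y. mollifier \<delta> (x - y) * c)" using 1 by simp
  then have "conv (mollifier \<delta>) f x \<le> (LINT y|lebesgue. mollifier \<delta> (x - y) * c)"
    unfolding conv_def using assms
    by (intro integral_mono conv_integrable[OF test_mollifier[OF assms(1)] assms(2)] mult_left_mono mollifier_nonneg) auto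
  then show ?thesis using 1 by simp
qed

lemma L2_indicator:
  fixes S :: "(real^'n) set"
  assumes "S \<in> sets lebesgue" "bounded S"
  shows "(indicator S :: real^'n \<Rightarrow> real) \<in> L2 UNIV" "integrable lebesgue (indicator S :: real^'n \<Rightarrow> real)"
proof -
  have "S \<in> lmeasurable" using assms by (simp add: bounded_set_imp_lmeasurable)
  then show "integrable lebesgue (indicator S :: real^'n \<Rightarrow> real)" by (simp add: lmeasurable_iff_integrable)
  moreover have "(\<lambda>x. (norm (indicator S x :: real))\<^sup>2) = indicator S" by (auto simp: indicator_def)
  ultimately show "(indicator S :: real^'n \<Rightarrow> real) \<in> L2 UNIV"
    unfolding L2_def lebesgue_on_UNIV_eq by auto
qed

text \<open>The indicator of the closed \<open>\<epsilon> / 2\<close> neighbourhood \<open>L\<close>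
  of \<open>K\<close> is mollified at the same scale: seen from a point of \<open>K\<close> the
  kernel meets only \<open>L\<close>, so its full mass 1 appears, and the support stays within
  \<open>\<epsilon>\<close> of \<open>K\<close>.\<close>

lemma cutoff:
  fixes K :: "(real^'n) set"
  assumes K: "compact K" "open \<Omega>" "K \<subseteq> \<Omega>"
  shows "\<exists>\<eta>\<in>test_functions \<Omega>. (\<forall>x. 0 \<le> \<eta> x \<and> \<eta> x \<le> 1) \<and> (\<forall>x\<in>K. \<eta> x = 1)"
proof -
  obtain \<epsilon> where \<epsilon>: "\<epsilon> > 0" "(\<Union>x\<in>K. cball x \<epsilon>) \<subseteq> \<Omega>"
    using compact_subset_open_imp_cball_epsilon_subset[OF K] by blast
  define \<delta> where "\<delta> = \<epsilon> / 2"
  have \<delta>: "\<delta> > 0" using \<epsilon> by (simp add: \<delta>_def)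
  define L where "L = (\<Union>x\<in>K. cball x \<delta>)"
  have L: "compact L" unfolding L_def by (rule compact_Union_cball[OF K(1)])
  then have Lm: "L \<in> sets lebesgue" "bounded L" by (auto simp: compact_imp_bounded lmeasurable_compact fmeasurableD)
  note ind = L2_indicator[OF Lm]
  let ?\<eta> = "conv (mollifier \<delta>) (indicator L)"
  have "?\<eta> \<in> test_functions \<Omega>"
  proof (rule test_conv[OF \<delta> ind(2) L])
    show "(\<Union>y\<in>L. cball y \<delta>) \<subseteq> \<Omega>"
    proof
      fix z assume "z \<in> (\<Union>y\<in>L. cball y \<delta>)"
      then obtain x y where "x \<in> K" "dist x y \<le> \<delta>" "dist y z \<le> \<delta>" by (auto simp: L_def)
      then have "dist x z \<le> \<epsilon>" using dist_triangle[of x z y] by (simp add: \<delta>_def)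
      then have "z \<in> cball x \<epsilon>" by simp
      then show "z \<in> \<Omega>" using \<epsilon>(2) \<open>x \<in> K\<close> by blast
    qed
  qed simp
  moreover have "0 \<le> ?\<eta> x" for x by (rule conv_nonneg) simp
  moreover have "?\<eta> x \<le> 1" for x by (rule conv_le[OF \<delta> ind(2)]) (simp add: indicator_def)
  moreover have "?\<eta> x = 1" if "x \<in> K" for x
  proof -
    have "mollifier \<delta> (x - y) * indicator L y = mollifier \<delta> (x - y)" for y
    proof (cases "y \<in> L")
      case False
      then have "\<delta> < dist x y" using that by (force simp: L_def)
      then show ?thesis using mollifier_outside[OF \<delta>, of "x - y"] by (simp add: dist_norm)
    qed simp
    note eq = this
    show ?thesis
      unfolding conv_def eq using mollifier_shift[OF \<delta>, of x] by (simp add: integral_completion)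
  qed
  ultimately show ?thesis by blast
qed

lemma locally_integrable_mult_test:
  assumes g: "g locally_integrable_on \<Omega>" and \<phi>: "\<phi> \<in> test_functions \<Omega>" and \<Omega>: "open \<Omega>"
  shows "integrable (lebesgue_on \<Omega>) (\<lambda>x. g x * \<phi> x :: real)"
proof -
  obtain K where K: "smooth \<phi>" "compact K" "K \<subseteq> \<Omega>" "\<And>x. x \<notin> K \<Longrightarrow> \<phi> x = 0"
    by (rule test_functionsE[OF \<phi>]) blast
  obtain M where M: "\<And>x. \<bar>\<phi> x\<bar> \<le> M" using test_bounded[OF \<phi>] by blast
  have Km: "K \<in> sets lebesgue" using K(2) by (simp add: lmeasurable_compact fmeasurableD)
  have \<Omega>m: "\<Omega> \<in> sets lebesgue" using \<Omega> by (simp add: borel_open)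
  have gK: "integrable (lebesgue_on K) g" using g K by (auto simp: locally_integrable_on_def)
  have "\<phi> \<in> borel_measurable (lebesgue_on K)"
    using borel_measurable_continuous_onI[OF smooth_continuous[OF K(1)]]
    by (intro measurable_restrict_space1 measurable_completion) simp
  moreover have "\<bar>\<phi> x\<bar> * \<bar>g x\<bar> \<le> \<bar>M\<bar> * \<bar>g x\<bar>" for x
    using M[of x] by (intro mult_right_mono) auto
  ultimately have "integrable (lebesgue_on K) (\<lambda>x. g x * \<phi> x)"
    using gK by (intro Bochner_Integration.integrable_bound[OF integrable_mult_right[OF gK, of M]])
      (auto simp: abs_mult mult.commute)
  then show ?thesis
    using lebesgue_on_outside(2)[OF Km, of "\<lambda>x. g x * \<phi> x"] lebesgue_on_outside(2)[OF \<Omega>m, of "\<lambda>x. g x * \<phi> x"]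
      K test_outside[OF \<phi>] by auto
qed

subsection \<open>Test integrals and integration by parts\<close>

text \<open>On a compact set \<open>K\<close> the negativity set \<open>S\<close> is tested:
  mollified indicators of \<open>S\<close> are nonnegative test functions that converge almost
  everywhere along a subsequence and are dominated, so the integral of \<open>g\<close> over
  \<open>S\<close> is nonnegative and \<open>S\<close> must be null. Countably many compact sets
  exhaust the domain.\<close>

lemma nonneg_if_test_integrals_nonneg:
  fixes g :: "real^'n \<Rightarrow> real"
  assumes \<Omega>: "open \<Omega>" and g: "g locally_integrable_on \<Omega>"
    and pos: "\<And>\<phi>. \<phi> \<in> test_functions \<Omega> \<Longrightarrow> (\<And>x. 0 \<le> \<phi> x) \<Longrightarrow> 0 \<le> (LINT x|lebesgue_on \<Omega>. g x * \<phi> x)"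
  shows "AE x in lebesgue_on \<Omega>. 0 \<le> g x"
proof -
  have \<Omega>m: "\<Omega> \<in> sets lebesgue" using \<Omega> by (simp add: borel_open)
  have K: "AE x in lebesgue. x \<in> K \<longrightarrow> 0 \<le> g x" if K: "compact K" "K \<subseteq> \<Omega>" for K
  proof -
    obtain \<epsilon> where \<epsilon>: "\<epsilon> > 0" "(\<Union>x\<in>K. cball x \<epsilon>) \<subseteq> \<Omega>"
      using compact_subset_open_imp_cball_epsilon_subset[OF K(1) \<Omega> K(2)] by blast
    define L where "L = (\<Union>x\<in>K. cball x \<epsilon>)"
    have L: "compact L" unfolding L_def by (rule compact_Union_cball[OF K(1)])
    have L\<Omega>: "L \<subseteq> \<Omega>" using \<epsilon> by (simp add: L_def)
    have KL: "K \<subseteq> L" using \<epsilon> by (force simp: L_def)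
    have Lm: "L \<in> sets lebesgue" using L by (simp add: lmeasurable_compact fmeasurableD)
    have Km: "K \<in> sets lebesgue" using K(1) by (simp add: lmeasurable_compact fmeasurableD)
    define G where "G x = (if x \<in> L then g x else 0)" for x
    have Gi: "integrable lebesgue G"
      unfolding G_def using g L L\<Omega> Lebesgue_Measure.integrable_restrict_UNIV[OF Lm, of g]
      by (simp add: locally_integrable_on_def)
    then have Gm[measurable]: "G \<in> borel_measurable lebesgue" by auto
    define S where "S = {x \<in> K. G x < 0}"
    have "{x \<in> space lebesgue. G x < 0} \<in> sets lebesgue" by measurable
    then have "K \<inter> {x. G x < 0} \<in> sets lebesgue" using Km by (intro sets.Int) auto
    moreover have "K \<inter> {x. G x < 0} = S" by (auto simp: S_def)
    ultimately have S: "S \<in> sets lebesgue" "bounded S"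
      using compact_imp_bounded[OF K(1)] bounded_subset by (auto simp: S_def)
    note ind = L2_indicator[OF S]
    \<comment> \<open>Scales strictly below \<open>\<epsilon>\<close> keep the mollified indicators
      supported in the compact set \<open>L\<close>, on which \<open>g\<close> is
      integrable.\<close>
    define \<delta> where "\<delta> n = \<epsilon> / real (Suc (Suc n))" for n
    have \<delta>: "0 < \<delta> n" "\<delta> n < \<epsilon>" for n
    proof -
      show "0 < \<delta> n" using \<epsilon> by (simp add: \<delta>_def)
      have "\<epsilon> / real (Suc (Suc n)) \<le> \<epsilon> / 2" using \<epsilon>(1) by (intro divide_left_mono) auto
      then show "\<delta> n < \<epsilon>" using \<epsilon>(1) unfolding \<delta>_def by linarith
    qed
    define h where "h n = conv (mollifier (\<delta> n)) (indicator S)" for n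
    have \<delta>0: "\<delta> \<longlonglongrightarrow> 0"
      using LIMSEQ_ignore_initial_segment[OF lim_const_over_n[of \<epsilon>], of 2] unfolding \<delta>_def by simp
    have hL2: "(\<lambda>x. h n x - indicator S x) \<in> L2 UNIV" for n
      unfolding h_def by (intro L2_diff Young_L2 \<delta> ind)
    have hi: "integrable lebesgue (\<lambda>x. (h n x - indicator S x)\<^sup>2)" for n
      using L2_integrable_norm[OF hL2[of n]] by (simp add: lebesgue_on_UNIV_eq)
    have "(\<lambda>n. LINT x|lebesgue. norm ((h n x - indicator S x)\<^sup>2)) \<longlonglongrightarrow> 0"
    proof (rule LIMSEQ_I)
      fix e :: real assume e: "e > 0"
      obtain d where d: "d > 0" "\<And>\<delta>. 0 < \<delta> \<Longrightarrow> \<delta> < d \<Longrightarrow> (LINT x|lebesgue. (conv (mollifier \<delta>) (indicator S) x - indicator S x)\<^sup>2) < e"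
        using mollifier_L2[OF ind e] by blast
      have "\<forall>\<^sub>F n in sequentially. \<delta> n < d" using \<delta>0 d(1) by (rule order_tendstoD)
      then obtain N where "\<forall>n\<ge>N. \<delta> n < d" by (auto simp: eventually_sequentially)
      then show "\<exists>N. \<forall>n\<ge>N. norm ((LINT x|lebesgue. norm ((h n x - indicator S x)\<^sup>2)) - 0) < e"
        using d(2) \<delta>(1) by (intro exI[of _ N]) (auto simp: h_def)
    qed
    from tendsto_L1_AE_subseq[OF hi this] obtain r where r: "strict_mono r"
      "AE x in lebesgue. (\<lambda>n. (h (r n) x - indicator S x)\<^sup>2) \<longlonglongrightarrow> 0" by blast
    have ht: "h n \<in> test_functions \<Omega>" for n
      unfolding h_def
    proof (rule test_conv[OF \<delta>(1) ind(2) K(1)])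
      show "(\<Union>y\<in>K. cball y (\<delta> n)) \<subseteq> \<Omega>"
        using \<epsilon>(2) \<delta>(2)[of n] by (force simp: subset_iff)
    qed (simp add: S_def)
    have hbd: "0 \<le> h n x" "h n x \<le> 1" for n x
      unfolding h_def by (auto intro!: conv_nonneg conv_le[OF \<delta>(1) ind(2)] simp: indicator_def)
    have hout: "h n x = 0" if "x \<notin> L" for n x
      unfolding h_def
    proof (rule conv_outside[OF \<delta>(1), of K])
      fix y assume "y \<in> K"
      then have "\<epsilon> < dist x y" using that by (force simp: L_def dist_commute)
      then show "\<delta> n \<le> dist x y" using \<delta>(2)[of n] by simp
    qed (simp add: S_def)
    have "(\<lambda>n. LINT x|lebesgue. G x * h (r n) x) \<longlonglongrightarrow> (LINT x|lebesgue. G x * indicator S x)"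
    proof (rule integral_dominated_convergence[where w = "\<lambda>x. \<bar>G x\<bar>"])
      show "AE x in lebesgue. (\<lambda>n. G x * h (r n) x) \<longlonglongrightarrow> G x * indicator S x"
        using r(2)
      proof eventually_elim
        case (elim x)
        have "(\<lambda>n. sqrt ((h (r n) x - indicator S x)\<^sup>2)) \<longlonglongrightarrow> 0" using tendsto_real_sqrt[OF elim] by simp
        then have "(\<lambda>n. h (r n) x) \<longlonglongrightarrow> indicator S x" by (simp add: tendsto_rabs_zero_iff LIM_zero_iff)
        then show ?case by (intro tendsto_intros)
      qed
      show "AE x in lebesgue. norm (G x * h (r n) x) \<le> \<bar>G x\<bar>" for n
        using hbd by (auto simp: abs_mult intro!: mult_left_le)
      show "(\<lambda>x. G x * h (r n) x) \<in> borel_measurable lebesgue" for n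
        using borel_measurable_continuous_onI[OF smooth_continuous[OF test_smooth[OF ht[of "r n"]]]]
        by (intro borel_measurable_times Gm) (simp add: measurable_completion)
      show "(\<lambda>x. G x * indicator S x) \<in> borel_measurable lebesgue"
        using S Gm by (intro borel_measurable_times borel_measurable_indicator) auto
    qed (use Gi in auto)
    moreover have "0 \<le> (LINT x|lebesgue. G x * h (r n) x)" for n
    proof -
      have "(LINT x|lebesgue. G x * h (r n) x) = (LINT x|lebesgue_on \<Omega>. G x * h (r n) x)"
        using L\<Omega> by (subst lebesgue_on_outside(1)[OF \<Omega>m]) (auto simp: G_def)
      also have "\<dots> = (LINT x|lebesgue_on \<Omega>. g x * h (r n) x)"
        using hout by (intro Bochner_Integration.integral_cong) (auto simp: G_def)
      also have "\<dots> \<ge> 0" using hbd by (intro pos ht)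
      finally show ?thesis .
    qed
    ultimately have ge: "0 \<le> (LINT x|lebesgue. G x * indicator S x)" by (intro LIMSEQ_le_const) auto
    have Ii: "integrable lebesgue (\<lambda>x. - (G x * indicator S x))"
      using integrable_mult_indicator[OF S(1) Gi] by (simp add: mult.commute)
    have nn: "0 \<le> - (G x * indicator S x)" for x by (auto simp: S_def indicator_def)
    have "(LINT x|lebesgue. - (G x * indicator S x)) = 0"
      using ge Ii integral_nonneg_AE[of "\<lambda>x. - (G x * indicator S x)" lebesgue] nn by simp
    then have "AE x in lebesgue. - (G x * indicator S x) = 0"
      using integral_nonneg_eq_0_iff_AE[OF Ii] nn by auto
    then show ?thesis
    proof eventually_elim
      case (elim x)
      show ?case
      proof
        assume x: "x \<in> K"
        then have "\<not> G x < 0" using elim by (auto simp: S_def indicator_def split: if_splits)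
        then show "0 \<le> g x" using x KL by (auto simp: G_def)
      qed
    qed
  qed
  obtain C :: "nat \<Rightarrow> (real^'n) set" where C: "\<And>n. compact (C n)" "\<And>n. C n \<subseteq> \<Omega>" "\<Union>(range C) = \<Omega>"
    using open_Union_compact_subsets[OF \<Omega>] by metis
  have "AE x in lebesgue. \<forall>n. x \<in> C n \<longrightarrow> 0 \<le> g x" using K C by (subst AE_all_countable) auto
  then have "AE x in lebesgue. x \<in> \<Omega> \<longrightarrow> 0 \<le> g x" using C(3) by (auto elim: eventually_mono)
  then show ?thesis using \<Omega>m by (subst AE_restrict_space_iff) auto
qed

lemma zero_if_test_integrals_zero:
  fixes g :: "real^'n \<Rightarrow> real"
  assumes \<Omega>: "open \<Omega>" and g: "g locally_integrable_on \<Omega>"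
    and z: "\<And>\<phi>. \<phi> \<in> test_functions \<Omega> \<Longrightarrow> (LINT x|lebesgue_on \<Omega>. g x * \<phi> x) = 0"
  shows "AE x in lebesgue_on \<Omega>. g x = 0"
proof -
  have "AE x in lebesgue_on \<Omega>. 0 \<le> g x"
    using z by (intro nonneg_if_test_integrals_nonneg[OF \<Omega> g]) auto
  moreover have "AE x in lebesgue_on \<Omega>. 0 \<le> - g x"
  proof (rule nonneg_if_test_integrals_nonneg[OF \<Omega>])
    show "(\<lambda>x. - g x) locally_integrable_on \<Omega>" using g by (auto simp: locally_integrable_on_def)
  qed (use z in auto)
  ultimately show ?thesis by eventually_elim simp
qed

lemma lborel_reflect: "distr lborel borel uminus = (lborel :: (real^'n) measure)"
  using lborel_affine[of "-1" "0::real^'n"] by (simp add: density_1)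

text \<open>Convolution of \<open>f\<close> with the indicator of a ball that contains all
  translates of the reflected support by less than 1 is constant near the origin. Its derivative at
  0 is therefore 0, and by the rule for differentiating convolutions that derivative is the integral
  of the partial derivative, up to a reflection.\<close>

lemma integral_partial_test:
  fixes f :: "real^'n \<Rightarrow> real"
  assumes f: "f \<in> test_functions UNIV"
  shows "(LINT x|lebesgue. partial_derivative i f x) = 0"
proof -
  obtain K where K: "smooth f" "compact K" "\<And>x. x \<notin> K \<Longrightarrow> f x = 0" "\<And>i x. x \<notin> K \<Longrightarrow> partial_derivative i f x = 0"
    by (rule test_functionsE[OF f]) blast
  obtain R where R: "\<And>x. x \<in> K \<Longrightarrow> norm x \<le> R" using compact_imp_bounded[OF K(2)] by (auto simp: bounded_iff)
  define g :: "real^'n \<Rightarrow> real" where "g = indicator (cball 0 (R + 1))"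
  have gi: "integrable lebesgue g" unfolding g_def by (rule L2_indicator) auto
  have fm: "h \<in> borel_measurable borel" if "smooth h" for h :: "real^'n \<Rightarrow> real"
    using smooth_continuous[OF that] by (rule borel_measurable_continuous_onI)
  have eq: "conv h g x = (LINT y|lborel. h (- y))"
    if h: "smooth h" "\<And>x. x \<notin> K \<Longrightarrow> h x = 0" and x: "norm x < 1" for h and x :: "real^'n"
  proof -
    have hm[measurable]: "h \<in> borel_measurable borel" by (rule fm[OF h(1)])
    have "h (x - y) * g y = h (x - y)" for y
    proof (cases "x - y \<in> K")
      case True
      have "norm y \<le> norm (x - y) + norm x" using norm_triangle_sub[of y x] by (simp add: norm_minus_commute)
      then show ?thesis using R[OF True] x by (simp add: g_def)
    qed (use h in simp)
    note * = this
    have "conv h g x = (LINT y|lborel. h (x - y))"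
      unfolding conv_def * by (rule integral_completion) measurable
    also have "\<dots> = (LINT y|lborel. (\<lambda>z. h (- z)) (- x + y))" by simp
    also have "\<dots> = (LINT y|lborel. h (- y))" by (rule lborel_translate) measurable
    finally show ?thesis .
  qed
  have "((\<lambda>_. LINT y|lborel. f (- y)) has_derivative (\<lambda>_. 0)) (at (0::real^'n))" by (rule has_derivative_const)
  then have "(conv f g has_derivative (\<lambda>_. 0)) (at 0)"
    by (rule has_derivative_transform_within_open[of _ _ _ _ "ball 0 1"]) (use eq[OF K(1,3)] in auto)
  then have "partial_derivative i (conv f g) 0 = 0" by (simp add: partial_derivativeI)
  then have "(LINT y|lborel. partial_derivative i f (- y)) = 0"
    using eq[of "partial_derivative i f" 0, OF smooth_partial[OF K(1)] K(4)] by (simp add: partial_conv[OF f gi])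
  then have "(LINT y|lborel. partial_derivative i f y) = 0"
    using fm[OF smooth_partial[OF K(1), of i]]
    by (subst lborel_reflect[symmetric], subst integral_distr) auto
  then show ?thesis using fm[OF smooth_partial[OF K(1), of i]] by (subst integral_completion) auto
qed

lemma smooth_borel: "smooth h \<Longrightarrow> h \<in> borel_measurable (lebesgue_on \<Omega>)"
  using borel_measurable_continuous_onI[OF smooth_continuous[of h]]
  by (intro measurable_restrict_space1 measurable_completion) simp

lemma test_integrable:
  assumes "\<phi> \<in> test_functions UNIV"
  shows "integrable lebesgue \<phi>"
proof -
  obtain K where "smooth \<phi>" "compact K" "\<And>x. x \<notin> K \<Longrightarrow> \<phi> x = 0"
    by (rule test_functionsE[OF assms]) blast
  then show ?thesis
    using integrable_continuous_compact_support[OF smooth_continuous] by (subst integrable_completion) auto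
qed

lemma test_UNIV: "\<phi> \<in> test_functions \<Omega> \<Longrightarrow> \<phi> \<in> test_functions UNIV"
  by (rule test_mono[of \<Omega>]) auto

lemma integration_by_parts_smooth:
  fixes f :: "real^'n \<Rightarrow> real"
  assumes \<Omega>: "open \<Omega>" and f: "smooth f" and \<phi>: "\<phi> \<in> test_functions \<Omega>"
  shows "(LINT x|lebesgue_on \<Omega>. f x * partial_derivative i \<phi> x) = - (LINT x|lebesgue_on \<Omega>. partial_derivative i f x * \<phi> x)"
proof -
  have \<Omega>m: "\<Omega> \<in> sets lebesgue" using \<Omega> by (simp add: borel_open)
  note U = test_UNIV[OF \<phi>] test_UNIV[OF test_partial[OF \<phi>]]
  have i: "integrable lebesgue (\<lambda>x. f x * partial_derivative i \<phi> x)" "integrable lebesgue (\<lambda>x. partial_derivative i f x * \<phi> x)"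
    by (intro test_integrable test_mult U f smooth_partial)+
  have "(LINT x|lebesgue. f x * partial_derivative i \<phi> x) + (LINT x|lebesgue. partial_derivative i f x * \<phi> x) =
     (LINT x|lebesgue. partial_derivative i (\<lambda>x. f x * \<phi> x) x)"
    using i by (simp add: partial_derivative_mult smooth_differentiable f test_smooth[OF \<phi>])
  also have "\<dots> = 0" by (intro integral_partial_test test_mult U f)
  finally have "(LINT x|lebesgue. f x * partial_derivative i \<phi> x) = - (LINT x|lebesgue. partial_derivative i f x * \<phi> x)" by simp
  then show ?thesis
    using test_outside[OF \<phi>] test_outside[OF test_partial[OF \<phi>]]
    by (subst (1 2) lebesgue_on_outside(1)[OF \<Omega>m]) auto
qed

section \<open>Restriction, local integrability and measurability\<close>

lemma lebesgue_on_subset: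
  fixes f :: "real^'n \<Rightarrow> 'b::euclidean_space"
  assumes "S \<subseteq> T" "S \<in> sets lebesgue" "T \<in> sets lebesgue" "integrable (lebesgue_on T) f"
  shows "integrable (lebesgue_on S) f"
proof -
  have "integrable lebesgue (\<lambda>x. if x \<in> T then f x else 0)"
    using assms Lebesgue_Measure.integrable_restrict_UNIV by blast
  from integrable_mult_indicator[OF assms(2) this]
  have "integrable lebesgue (\<lambda>x. if x \<in> S then f x else 0)"
    by (rule back_subst[where P = "integrable lebesgue"]) (use assms(1) in \<open>auto simp: indicator_def fun_eq_iff\<close>)
  then show ?thesis using assms Lebesgue_Measure.integrable_restrict_UNIV by blast
qed

lemma L2_locally_integrable:
  assumes f: "f \<in> L2 \<Omega>" and \<Omega>: "open \<Omega>"
  shows "f locally_integrable_on \<Omega>"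
  unfolding locally_integrable_on_def
proof (intro allI impI, elim conjE)
  fix K assume K: "compact K" "K \<subseteq> \<Omega>"
  have Km: "K \<in> lmeasurable" using K(1) by (simp add: lmeasurable_compact)
  have \<Omega>m: "\<Omega> \<in> sets lebesgue" using \<Omega> by (simp add: borel_open)
  show "integrable (lebesgue_on K) f"
  proof (rule Bochner_Integration.integrable_bound)
    interpret finite_measure "lebesgue_on K" by (rule finite_measure_lebesgue_on[OF Km])
    have "integrable (lebesgue_on K) (\<lambda>x. (norm (f x))\<^sup>2)"
      by (rule lebesgue_on_subset[OF K(2) fmeasurableD[OF Km] \<Omega>m L2_integrable_norm[OF f]])
    then show "integrable (lebesgue_on K) (\<lambda>x. 1 + (norm (f x))\<^sup>2)" by auto
    show "f \<in> borel_measurable (lebesgue_on K)"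
      using L2_measurable[OF f] K(2) by (rule measurable_restrict_mono)
    show "AE x in lebesgue_on K. norm (f x) \<le> norm (1 + (norm (f x))\<^sup>2)"
    proof (rule AE_I2)
      fix x
      have "0 \<le> (norm (f x) - 1)\<^sup>2" by simp
      then have "2 * norm (f x) \<le> (norm (f x))\<^sup>2 + 1" by (simp add: power2_diff)
      then have "norm (f x) \<le> 1 + (norm (f x))\<^sup>2" using norm_ge_zero[of "f x"] by linarith
      then show "norm (f x) \<le> norm (1 + (norm (f x))\<^sup>2)" by simp
    qed
  qed
qed

text \<open>A countable exhaustion by compact sets glues the measurable restrictions
  together.\<close>

lemma locally_integrable_measurable:
  assumes f: "f locally_integrable_on \<Omega>" and \<Omega>: "open (\<Omega> :: (real^'n) set)"
  shows "f \<in> borel_measurable (lebesgue_on \<Omega>)"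
proof -
  obtain C :: "nat \<Rightarrow> (real^'n) set" where C: "\<And>n. compact (C n)" "\<And>n. C n \<subseteq> \<Omega>" "\<Union>(range C) = \<Omega>"
    using open_Union_compact_subsets[OF \<Omega>] by metis
  have \<Omega>m: "\<Omega> \<in> sets lebesgue" using \<Omega> by (simp add: borel_open)
  show ?thesis
  proof (rule measurable_piecewise_restrict[of "range C"])
    fix K assume "K \<in> range C"
    then have K: "compact K" "K \<subseteq> \<Omega>" using C by auto
    have Km: "K \<in> sets lebesgue" using K(1) by (simp add: lmeasurable_compact fmeasurableD)
    then show "K \<inter> space (lebesgue_on \<Omega>) \<in> sets (lebesgue_on \<Omega>)"
      using \<Omega>m by (auto simp: sets_restrict_space)
    have "restrict_space (lebesgue_on \<Omega>) K = lebesgue_on K"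
      using K(2) \<Omega>m Km by (subst restrict_restrict_space) (auto simp: Int_absorb1)
    then show "f \<in> borel_measurable (restrict_space (lebesgue_on \<Omega>) K)"
      using f K by (auto simp: locally_integrable_on_def)
  qed (use C(3) in auto)
qed

subsection \<open>Sobolev spaces\<close>

lemma weak_gradient_unique:
  fixes g h :: "real^'n \<Rightarrow> real^'n"
  assumes \<Omega>: "open \<Omega>" and g: "has_weak_gradient \<Omega> u g" and h: "has_weak_gradient \<Omega> u h"
  shows "AE x in lebesgue_on \<Omega>. g x = h x"
proof -
  have li: "(\<lambda>x. g x $ i) locally_integrable_on \<Omega>" "(\<lambda>x. h x $ i) locally_integrable_on \<Omega>" for i
    using g h
    by (auto simp: has_weak_gradient_def locally_integrable_on_def
        intro!: integrable_bounded_linear[OF bounded_linear_vec_nth])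
  have "AE x in lebesgue_on \<Omega>. g x $ i - h x $ i = 0" for i
  proof (rule zero_if_test_integrals_zero[OF \<Omega>])
    show "(\<lambda>x. g x $ i - h x $ i) locally_integrable_on \<Omega>"
      using li by (auto simp: locally_integrable_on_def)
    fix \<phi> assume \<phi>: "\<phi> \<in> test_functions \<Omega>"
    have "(LINT x|lebesgue_on \<Omega>. u x * partial_derivative i \<phi> x) = - (LINT x|lebesgue_on \<Omega>. g x $ i * \<phi> x)"
      using g \<phi> unfolding has_weak_gradient_def by blast
    moreover have "(LINT x|lebesgue_on \<Omega>. u x * partial_derivative i \<phi> x) = - (LINT x|lebesgue_on \<Omega>. h x $ i * \<phi> x)"
      using h \<phi> unfolding has_weak_gradient_def by blast
    ultimately have "(LINT x|lebesgue_on \<Omega>. g x $ i * \<phi> x) = (LINT x|lebesgue_on \<Omega>. h x $ i * \<phi> x)" by linarith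
    then show "(LINT x|lebesgue_on \<Omega>. (g x $ i - h x $ i) * \<phi> x) = 0"
      using locally_integrable_mult_test[OF li(1) \<phi> \<Omega>, of i] locally_integrable_mult_test[OF li(2) \<phi> \<Omega>, of i]
      by (simp add: left_diff_distrib)
  qed
  then have "AE x in lebesgue_on \<Omega>. \<forall>i\<in>UNIV. g x $ i - h x $ i = 0" by (subst AE_finite_all) auto
  then show ?thesis by eventually_elim (simp add: vec_eq_iff)
qed

lemma weak_gradient_AE:
  assumes "open \<Omega>" "has_weak_gradient \<Omega> u g"
  shows "AE x in lebesgue_on \<Omega>. weak_gradient \<Omega> u x = g x"
proof (rule weak_gradient_unique[OF assms(1) _ assms(2)])
  show "has_weak_gradient \<Omega> u (weak_gradient \<Omega> u)"
    unfolding weak_gradient_def by (rule someI[of "has_weak_gradient \<Omega> u", OF assms(2)])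
qed

lemma H1I:
  fixes u :: "real^'n \<Rightarrow> real"
  assumes \<Omega>: "open \<Omega>" and u: "u \<in> L2 \<Omega>" and g: "g \<in> L2 \<Omega>"
    and id: "\<And>\<phi> i. \<phi> \<in> test_functions \<Omega> \<Longrightarrow>
      (LINT x|lebesgue_on \<Omega>. u x * partial_derivative i \<phi> x) = - (LINT x|lebesgue_on \<Omega>. g x $ i * \<phi> x)"
  shows "u \<in> H1 \<Omega>" "AE x in lebesgue_on \<Omega>. weak_gradient \<Omega> u x = g x"
proof -
  have "has_weak_gradient \<Omega> u g"
    unfolding has_weak_gradient_def using id L2_locally_integrable[OF u \<Omega>] L2_locally_integrable[OF g \<Omega>] by auto
  then show "u \<in> H1 \<Omega>" "AE x in lebesgue_on \<Omega>. weak_gradient \<Omega> u x = g x"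
    using u g weak_gradient_AE[OF \<Omega>] by (auto simp: H1_def)
qed

lemma H1D:
  assumes \<Omega>: "open \<Omega>" and u: "u \<in> H1 \<Omega>"
  shows "u \<in> L2 \<Omega>" "weak_gradient \<Omega> u \<in> L2 \<Omega>" "has_weak_gradient \<Omega> u (weak_gradient \<Omega> u)"
proof -
  obtain g where g: "g \<in> L2 \<Omega>" "has_weak_gradient \<Omega> u g" using u by (auto simp: H1_def)
  show 1: "has_weak_gradient \<Omega> u (weak_gradient \<Omega> u)"
    unfolding weak_gradient_def by (rule someI[of "has_weak_gradient \<Omega> u", OF g(2)])
  show "u \<in> L2 \<Omega>" using u by (auto simp: H1_def)
  have "AE x in lebesgue_on \<Omega>. g x = weak_gradient \<Omega> u x" using weak_gradient_unique[OF \<Omega> g(2) 1] .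
  then show "weak_gradient \<Omega> u \<in> L2 \<Omega>"
    using 1 by (intro L2_cong_AE[OF g(1)] locally_integrable_measurable[OF _ \<Omega>]) (auto simp: has_weak_gradient_def)
qed

lemma weak_gradient_identity:
  assumes "open \<Omega>" "u \<in> H1 \<Omega>" "\<phi> \<in> test_functions \<Omega>"
  shows "(LINT x|lebesgue_on \<Omega>. u x * partial_derivative i \<phi> x) = - (LINT x|lebesgue_on \<Omega>. weak_gradient \<Omega> u x $ i * \<phi> x)"
  using H1D(3)[OF assms(1,2)] assms(3) by (auto simp: has_weak_gradient_def)

lemma borel_measurable_vec_nth:
  "g \<in> borel_measurable M \<Longrightarrow> (\<lambda>x. g x $ i :: real) \<in> borel_measurable M"
  by (rule measurable_compose[OF _ borel_measurable_continuous_onI]) (auto intro: continuous_intros)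

lemma L2_nth:
  fixes g :: "real^'n \<Rightarrow> real^'m"
  shows "g \<in> L2 \<Omega> \<Longrightarrow> (\<lambda>x. g x $ i) \<in> L2 \<Omega>"
  by (rule L2_norm_le[of g _ _ 1])
    (auto simp: component_le_norm_cart dest!: L2_measurable intro: borel_measurable_vec_nth)

lemma L2_vec:
  fixes g :: "real^'n \<Rightarrow> real^'n"
  assumes "\<And>i. (\<lambda>x. g x $ i) \<in> L2 \<Omega>" shows "g \<in> L2 \<Omega>"
proof -
  have "(\<lambda>x. \<Sum>i\<in>UNIV. g x $ i *\<^sub>R (axis i 1 :: real^'n)) \<in> L2 \<Omega>"
  proof (rule L2_sum)
    fix i :: 'n
    show "(\<lambda>x. g x $ i *\<^sub>R (axis i 1 :: real^'n)) \<in> L2 \<Omega>"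
      by (rule L2_norm_le[OF assms[of i], of _ 1]) (use L2_measurable[OF assms[of i]] in auto)
  qed
  moreover have "g = (\<lambda>x. \<Sum>i\<in>UNIV. g x $ i *\<^sub>R axis i 1)"
    by (simp add: basis_expansion scalar_mult_eq_scaleR[symmetric])
  ultimately show ?thesis by simp
qed

lemma L2_mult_bounded:
  fixes h :: "real^'n \<Rightarrow> real" and f :: "real^'n \<Rightarrow> 'b::euclidean_space"
  assumes "f \<in> L2 \<Omega>" "h \<in> borel_measurable (lebesgue_on \<Omega>)" "\<And>x. \<bar>h x\<bar> \<le> M"
  shows "(\<lambda>x. h x *\<^sub>R f x) \<in> L2 \<Omega>"
proof (rule L2_norm_le[OF assms(1)])
  show "AE x in lebesgue_on \<Omega>. norm (h x *\<^sub>R f x) \<le> M * norm (f x)"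
    using assms(3) by (auto intro!: mult_right_mono)
qed (use assms(2) L2_measurable[OF assms(1)] in measurable)

lemma L2_mult_test:
  fixes f :: "real^'n \<Rightarrow> real"
  assumes "f \<in> L2 \<Omega>" "\<phi> \<in> test_functions \<Omega>'"
  shows "(\<lambda>x. \<phi> x * f x) \<in> L2 \<Omega>" "(\<lambda>x. f x * \<phi> x) \<in> L2 \<Omega>"
proof -
  obtain M where "\<And>x. \<bar>\<phi> x\<bar> \<le> M" using test_bounded[OF assms(2)] by blast
  from L2_mult_bounded[OF assms(1) smooth_borel[OF test_smooth[OF assms(2)]] this]
  show "(\<lambda>x. \<phi> x * f x) \<in> L2 \<Omega>" by simp
  then show "(\<lambda>x. f x * \<phi> x) \<in> L2 \<Omega>" by (simp add: mult.commute)
qed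

lemma test_L2:
  assumes "open \<Omega>" "\<phi> \<in> test_functions \<Omega>'"
  shows "\<phi> \<in> L2 \<Omega>"
proof -
  have \<Omega>m: "\<Omega> \<in> sets lebesgue" using assms(1) by (simp add: borel_open)
  have "integrable (lebesgue_on \<Omega>) (\<lambda>x. \<phi> x * \<phi> x)"
    using test_integrable[OF test_mult(1)[OF test_UNIV[OF assms(2)] test_smooth[OF assms(2)]]]
    by (intro lebesgue_on_subset[of \<Omega> UNIV]) (auto simp: \<Omega>m lebesgue_on_UNIV_eq)
  then show ?thesis using smooth_borel[OF test_smooth[OF assms(2)]] by (simp add: L2_def power2_eq_square)
qed

lemma H1_add:
  assumes \<Omega>: "open \<Omega>" and u: "u \<in> H1 \<Omega>" and v: "v \<in> H1 \<Omega>"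
  shows "(\<lambda>x. u x + c * v x) \<in> H1 \<Omega>"
    "AE x in lebesgue_on \<Omega>. weak_gradient \<Omega> (\<lambda>x. u x + c * v x) x = weak_gradient \<Omega> u x + c *\<^sub>R weak_gradient \<Omega> v x"
proof -
  have *: "(LINT x|lebesgue_on \<Omega>. (u x + c * v x) * partial_derivative i \<phi> x) =
     - (LINT x|lebesgue_on \<Omega>. (weak_gradient \<Omega> u x + c *\<^sub>R weak_gradient \<Omega> v x) $ i * \<phi> x)"
    if \<phi>: "\<phi> \<in> test_functions \<Omega>" for \<phi> i
  proof -
    note p = test_L2[OF \<Omega> \<phi>] test_L2[OF \<Omega> test_partial[OF \<phi>], of i]
    note i = L2_mult_integrable[OF H1D(1)[OF \<Omega> u] p(2)] L2_mult_integrable[OF H1D(1)[OF \<Omega> v] p(2)]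
      L2_mult_integrable[OF L2_nth[OF H1D(2)[OF \<Omega> u]] p(1), of i] L2_mult_integrable[OF L2_nth[OF H1D(2)[OF \<Omega> v]] p(1), of i]
    show ?thesis
      using i weak_gradient_identity[OF \<Omega> u \<phi>, of i] weak_gradient_identity[OF \<Omega> v \<phi>, of i]
      by (simp add: distrib_right mult.assoc)
  qed
  have L: "(\<lambda>x. u x + c * v x) \<in> L2 \<Omega>" "(\<lambda>x. weak_gradient \<Omega> u x + c *\<^sub>R weak_gradient \<Omega> v x) \<in> L2 \<Omega>"
    using L2_add[OF H1D(1)[OF \<Omega> u] L2_scale[OF H1D(1)[OF \<Omega> v], of c]]
      L2_add[OF H1D(2)[OF \<Omega> u] L2_scale[OF H1D(2)[OF \<Omega> v], of c]] by auto
  show "(\<lambda>x. u x + c * v x) \<in> H1 \<Omega>"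
    "AE x in lebesgue_on \<Omega>. weak_gradient \<Omega> (\<lambda>x. u x + c * v x) x = weak_gradient \<Omega> u x + c *\<^sub>R weak_gradient \<Omega> v x"
    using H1I[OF \<Omega> L *] by auto
qed

lemma H1_smooth:
  assumes \<Omega>: "open \<Omega>" and f: "smooth f" and b: "f \<in> L2 \<Omega>" "\<And>i. partial_derivative i f \<in> L2 \<Omega>"
  shows "f \<in> H1 \<Omega>" "AE x in lebesgue_on \<Omega>. weak_gradient \<Omega> f x = (\<chi> i. partial_derivative i f x)"
proof -
  have "(\<lambda>x. \<chi> i. partial_derivative i f x) \<in> L2 \<Omega>" by (rule L2_vec) (simp add: b)
  from H1I[OF \<Omega> b(1) this] show "f \<in> H1 \<Omega>" "AE x in lebesgue_on \<Omega>. weak_gradient \<Omega> f x = (\<chi> i. partial_derivative i f x)"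
    using integration_by_parts_smooth[OF \<Omega> f] by auto
qed

lemma H1_test:
  assumes "open \<Omega>" "\<phi> \<in> test_functions \<Omega>"
  shows "\<phi> \<in> H1 \<Omega>" "AE x in lebesgue_on \<Omega>. weak_gradient \<Omega> \<phi> x = (\<chi> i. partial_derivative i \<phi> x)"
  using H1_smooth[OF assms(1) test_smooth[OF assms(2)] test_L2[OF assms] test_L2[OF assms(1) test_partial[OF assms(2)]]]
  by auto

text \<open>The product rule, tested against a function \<open>\<psi>\<close> that need not vanish near the boundary.\<close>
lemma product_identity:
  assumes \<Omega>: "open \<Omega>" and u: "u \<in> H1 \<Omega>" and \<phi>: "\<phi> \<in> test_functions \<Omega>" and \<psi>: "smooth \<psi>"
  shows "(LINT x|lebesgue_on \<Omega>. (\<phi> x * u x) * partial_derivative i \<psi> x) =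
     - (LINT x|lebesgue_on \<Omega>. (\<phi> x * weak_gradient \<Omega> u x $ i + u x * partial_derivative i \<phi> x) * \<psi> x)"
proof -
  note t = test_mult(1)[OF \<phi> \<psi>] test_mult(1)[OF \<phi> smooth_partial[OF \<psi>], of i] test_mult(1)[OF test_partial[OF \<phi>] \<psi>, of i]
  note p = test_L2[OF \<Omega> t(1)] test_L2[OF \<Omega> t(2)] test_L2[OF \<Omega> t(3)]
  note i = L2_mult_integrable[OF H1D(1)[OF \<Omega> u] p(2)] L2_mult_integrable[OF H1D(1)[OF \<Omega> u] p(3)]
    L2_mult_integrable[OF L2_nth[OF H1D(2)[OF \<Omega> u]] p(1), of i]
  have "partial_derivative i (\<lambda>x. \<phi> x * \<psi> x) x = \<phi> x * partial_derivative i \<psi> x + partial_derivative i \<phi> x * \<psi> x" for x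
    by (intro partial_derivative_mult smooth_differentiable \<psi> test_smooth[OF \<phi>])
  with weak_gradient_identity[OF \<Omega> u t(1), of i]
  have "(LINT x|lebesgue_on \<Omega>. u x * (\<phi> x * partial_derivative i \<psi> x)) + (LINT x|lebesgue_on \<Omega>. u x * (partial_derivative i \<phi> x * \<psi> x))
    = - (LINT x|lebesgue_on \<Omega>. weak_gradient \<Omega> u x $ i * (\<phi> x * \<psi> x))"
    using i by (simp add: distrib_left)
  then show ?thesis using i by (simp add: algebra_simps)
qed

lemma H1_mult_test:
  assumes \<Omega>: "open \<Omega>" and u: "u \<in> H1 \<Omega>" and \<phi>: "\<phi> \<in> test_functions \<Omega>"
  shows "(\<lambda>x. \<phi> x * u x) \<in> H1 \<Omega>"
    "AE x in lebesgue_on \<Omega>. weak_gradient \<Omega> (\<lambda>x. \<phi> x * u x) x = (\<chi> i. \<phi> x * weak_gradient \<Omega> u x $ i + u x * partial_derivative i \<phi> x)"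
proof -
  have L: "(\<lambda>x. \<phi> x * u x) \<in> L2 \<Omega>" by (rule L2_mult_test[OF H1D(1)[OF \<Omega> u] \<phi>])
  have G: "(\<lambda>x. \<chi> i. \<phi> x * weak_gradient \<Omega> u x $ i + u x * partial_derivative i \<phi> x) \<in> L2 \<Omega>"
    using L2_add[OF L2_mult_test(1)[OF L2_nth[OF H1D(2)[OF \<Omega> u]] \<phi>] L2_mult_test(2)[OF H1D(1)[OF \<Omega> u] test_partial[OF \<phi>]]]
    by (intro L2_vec) simp
  show "(\<lambda>x. \<phi> x * u x) \<in> H1 \<Omega>"
    "AE x in lebesgue_on \<Omega>. weak_gradient \<Omega> (\<lambda>x. \<phi> x * u x) x = (\<chi> i. \<phi> x * weak_gradient \<Omega> u x $ i + u x * partial_derivative i \<phi> x)"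
    using H1I[OF \<Omega> L G] product_identity[OF \<Omega> u \<phi> test_smooth] by auto
qed

definition H1_ip :: "(real^'n) set \<Rightarrow> (real^'n \<Rightarrow> real) \<Rightarrow> (real^'n \<Rightarrow> real) \<Rightarrow> real" where
  "H1_ip \<Omega> u v = (LINT x|lebesgue_on \<Omega>. u x * v x) + (LINT x|lebesgue_on \<Omega>. weak_gradient \<Omega> u x \<bullet> weak_gradient \<Omega> v x)"

lemma AE_integral_cong_L2:
  fixes f g :: "real^'n \<Rightarrow> 'b::euclidean_space"
  assumes "f \<in> L2 \<Omega>" "g \<in> L2 \<Omega>" "h \<in> L2 \<Omega>" "AE x in lebesgue_on \<Omega>. f x = g x"
  shows "(LINT x|lebesgue_on \<Omega>. f x \<bullet> h x) = (LINT x|lebesgue_on \<Omega>. g x \<bullet> h x)"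
  using assms by (intro integral_cong_AE) (auto dest!: L2_measurable elim: eventually_mono)

lemma gradient_integral_linear:
  assumes \<Omega>: "open \<Omega>" and u: "u \<in> H1 \<Omega>" and v: "v \<in> H1 \<Omega>" and h: "h \<in> L2 \<Omega>"
  shows "(LINT x|lebesgue_on \<Omega>. weak_gradient \<Omega> (\<lambda>x. u x + c * v x) x \<bullet> h x) =
    (LINT x|lebesgue_on \<Omega>. weak_gradient \<Omega> u x \<bullet> h x) + c * (LINT x|lebesgue_on \<Omega>. weak_gradient \<Omega> v x \<bullet> h x)"
proof -
  note g = H1D(2)[OF \<Omega> u] H1D(2)[OF \<Omega> v]
  have "(LINT x|lebesgue_on \<Omega>. weak_gradient \<Omega> (\<lambda>x. u x + c * v x) x \<bullet> h x) =
    (LINT x|lebesgue_on \<Omega>. (weak_gradient \<Omega> u x + c *\<^sub>R weak_gradient \<Omega> v x) \<bullet> h x)"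
    by (intro AE_integral_cong_L2 H1D(2) H1_add \<Omega> u v h L2_add L2_scale)
  also have "\<dots> = (LINT x|lebesgue_on \<Omega>. weak_gradient \<Omega> u x \<bullet> h x) + c * (LINT x|lebesgue_on \<Omega>. weak_gradient \<Omega> v x \<bullet> h x)"
    using L2_inner_integrable[OF g(1) h] L2_inner_integrable[OF g(2) h] by (simp add: inner_add_left)
  finally show ?thesis .
qed

lemma H1_zero: "open \<Omega> \<Longrightarrow> (\<lambda>_. 0) \<in> H1 \<Omega>"
  using H1_test(1)[OF _ test_zero] .

lemma H1_scale: "open \<Omega> \<Longrightarrow> u \<in> H1 \<Omega> \<Longrightarrow> (\<lambda>x. c * u x) \<in> H1 \<Omega>"
  using H1_add(1)[OF _ H1_zero, of \<Omega> u c] by simp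

lemma gradient_zero:
  assumes "open \<Omega>" shows "AE x in lebesgue_on \<Omega>. weak_gradient \<Omega> (\<lambda>_. 0) x = 0"
  using H1_test(2)[OF assms test_zero] by (simp add: zero_vec_def)

lemma gradient_scale:
  assumes \<Omega>: "open \<Omega>" and u: "u \<in> H1 \<Omega>"
  shows "AE x in lebesgue_on \<Omega>. weak_gradient \<Omega> (\<lambda>x. c * u x) x = c *\<^sub>R weak_gradient \<Omega> u x"
  using H1_add(2)[OF \<Omega> H1_zero[OF \<Omega>] u, of c] gradient_zero[OF \<Omega>] by eventually_elim simp

lemma gradient_diff:
  assumes "open \<Omega>" "u \<in> H1 \<Omega>" "v \<in> H1 \<Omega>"
  shows "(\<lambda>x. u x - v x) \<in> H1 \<Omega>"
    "AE x in lebesgue_on \<Omega>. weak_gradient \<Omega> (\<lambda>x. u x - v x) x = weak_gradient \<Omega> u x - weak_gradient \<Omega> v x"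
  using H1_add[OF assms, of "-1"] by auto

lemma H1_ip_self: "H1_ip \<Omega> u u = (L2_norm \<Omega> u)\<^sup>2 + (L2_norm \<Omega> (weak_gradient \<Omega> u))\<^sup>2"
  by (simp add: H1_ip_def L2_norm_sq power2_norm_eq_inner flip: power2_eq_square)

text \<open>Completeness is closedness of the weak gradient: the functions and their gradients
  converge separately in \<open>L2\<close>, and the defining identity passes to the limit because
  each side is an \<open>L2\<close> product with a fixed function.\<close>

lemma H1_semi_hilbert:
  fixes \<Omega> :: "(real^'n) set"
  assumes \<Omega>: "open \<Omega>"
  shows "semi_hilbert (H1 \<Omega>) (H1_ip \<Omega>)"
proof
  have add: "u + v = (\<lambda>x. u x + 1 * v x)" for u v :: "real^'n \<Rightarrow> real" by (simp add: plus_fun_def)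
  have sc: "c *\<^sub>R u = (\<lambda>x. 0 + c * u x)" for c and u :: "real^'n \<Rightarrow> real" by (simp add: scaleR_fun_def)
  show sub: "subspace (H1 \<Omega>)"
    using H1_zero[OF \<Omega>] H1_add(1)[OF \<Omega>, of _ _ 1] H1_scale[OF \<Omega>]
    by (auto simp: subspace_def plus_fun_def scaleR_fun_def zero_fun_def)
  show "H1_ip \<Omega> u v = H1_ip \<Omega> v u" for u v
    by (simp add: H1_ip_def inner_commute mult.commute)
  show "0 \<le> H1_ip \<Omega> u u" for u by (simp add: H1_ip_self)
  fix u v w c assume u: "u \<in> H1 \<Omega>" and w: "w \<in> H1 \<Omega>"
  note i = L2_mult_integrable[OF H1D(1)[OF \<Omega> u] H1D(1)[OF \<Omega> w]]
  have 0: "(LINT x|lebesgue_on \<Omega>. weak_gradient \<Omega> (\<lambda>_. 0) x \<bullet> weak_gradient \<Omega> w x) = 0"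
    using AE_integral_cong_L2[OF H1D(2)[OF \<Omega> H1_zero[OF \<Omega>]] L2_zero H1D(2)[OF \<Omega> w] gradient_zero[OF \<Omega>]] by simp
  show "H1_ip \<Omega> (c *\<^sub>R u) w = c * H1_ip \<Omega> u w"
    unfolding sc H1_ip_def gradient_integral_linear[OF \<Omega> H1_zero[OF \<Omega>] u H1D(2)[OF \<Omega> w]] 0
    using i by (simp add: distrib_left mult.assoc)
  assume v: "v \<in> H1 \<Omega>"
  show "H1_ip \<Omega> (u + v) w = H1_ip \<Omega> u w + H1_ip \<Omega> v w"
    unfolding add H1_ip_def gradient_integral_linear[OF \<Omega> u v H1D(2)[OF \<Omega> w]]
    using i L2_mult_integrable[OF H1D(1)[OF \<Omega> v] H1D(1)[OF \<Omega> w]] by (simp add: distrib_right)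
next
  fix X :: "nat \<Rightarrow> real^'n \<Rightarrow> real"
  assume X: "\<And>n. X n \<in> H1 \<Omega>"
    and C: "\<And>e. e > 0 \<Longrightarrow> \<exists>N. \<forall>m\<ge>N. \<forall>n\<ge>N. H1_ip \<Omega> (X m - X n) (X m - X n) < e"
  have diff: "(L2_norm \<Omega> (\<lambda>x. weak_gradient \<Omega> u x - weak_gradient \<Omega> v x))\<^sup>2 = (L2_norm \<Omega> (weak_gradient \<Omega> (u - v)))\<^sup>2"
    if "u \<in> H1 \<Omega>" "v \<in> H1 \<Omega>" for u v
    unfolding L2_norm_sq fun_diff_def
    using gradient_diff(2)[OF \<Omega> that] L2_measurable[OF H1D(2)[OF \<Omega> that(1)]] L2_measurable[OF H1D(2)[OF \<Omega> that(2)]]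
      L2_measurable[OF H1D(2)[OF \<Omega> gradient_diff(1)[OF \<Omega> that]]]
    by (intro integral_cong_AE) (auto elim: eventually_mono)
  have sm: "(LINT x|lebesgue_on \<Omega>. (norm (X m x - X n x))\<^sup>2) \<le> H1_ip \<Omega> (X m - X n) (X m - X n)"
    "(LINT x|lebesgue_on \<Omega>. (norm (weak_gradient \<Omega> (X m) x - weak_gradient \<Omega> (X n) x))\<^sup>2) \<le> H1_ip \<Omega> (X m - X n) (X m - X n)" for m n
    using diff[OF X X, of m n] unfolding H1_ip_self L2_norm_sq by (simp_all add: fun_diff_def)
  have tr: "\<exists>N. \<forall>m\<ge>N. \<forall>n\<ge>N. F m n < e"
    if le: "\<And>m n. F m n \<le> H1_ip \<Omega> (X m - X n) (X m - X n)" and e: "e > 0" for F and e :: real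
  proof -
    obtain N where "\<And>m n. m \<ge> N \<Longrightarrow> n \<ge> N \<Longrightarrow> H1_ip \<Omega> (X m - X n) (X m - X n) < e" using C[OF e] by blast
    then show ?thesis by (intro exI[of _ N]) (auto intro: le_less_trans[OF le])
  qed
  have "\<exists>u\<in>L2 \<Omega>. (\<lambda>n. LINT x|lebesgue_on \<Omega>. (norm (X n x - u x))\<^sup>2) \<longlonglongrightarrow> 0"
    by (rule L2_complete[OF H1D(1)[OF \<Omega> X]]) (rule tr[OF sm(1)])
  then obtain u where u: "u \<in> L2 \<Omega>" "(\<lambda>n. LINT x|lebesgue_on \<Omega>. (norm (X n x - u x))\<^sup>2) \<longlonglongrightarrow> 0" by blast
  have "\<exists>g\<in>L2 \<Omega>. (\<lambda>n. LINT x|lebesgue_on \<Omega>. (norm (weak_gradient \<Omega> (X n) x - g x))\<^sup>2) \<longlonglongrightarrow> 0"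
    by (rule L2_complete[OF H1D(2)[OF \<Omega> X]]) (rule tr[OF sm(2)])
  then obtain g where g: "g \<in> L2 \<Omega>" "(\<lambda>n. LINT x|lebesgue_on \<Omega>. (norm (weak_gradient \<Omega> (X n) x - g x))\<^sup>2) \<longlonglongrightarrow> 0" by blast
  have nu: "(\<lambda>n. L2.nm \<Omega> (X n - u)) \<longlonglongrightarrow> 0" and ng: "(\<lambda>n. L2.nm \<Omega> (weak_gradient \<Omega> (X n) - g)) \<longlonglongrightarrow> 0"
    using tendsto_real_sqrt[OF u(2)] tendsto_real_sqrt[OF g(2)] unfolding L2_nm L2_norm_def by simp_all
  have id: "(LINT x|lebesgue_on \<Omega>. u x * partial_derivative i \<phi> x) = - (LINT x|lebesgue_on \<Omega>. g x $ i * \<phi> x)"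
    if \<phi>: "\<phi> \<in> test_functions \<Omega>" for \<phi> i
  proof -
    have a: "(\<lambda>x. \<phi> x *\<^sub>R (axis i 1 :: real^'n)) \<in> L2 \<Omega>"
      using test_L2[OF \<Omega> \<phi>] by (rule L2_norm_le[of _ _ _ 1]) (use L2_measurable[OF test_L2[OF \<Omega> \<phi>]] in auto)
    have "(\<lambda>n. LINT x|lebesgue_on \<Omega>. X n x \<bullet> partial_derivative i \<phi> x) \<longlonglongrightarrow> (LINT x|lebesgue_on \<Omega>. u x \<bullet> partial_derivative i \<phi> x)"
      by (rule L2.ip_tendsto[OF H1D(1)[OF \<Omega> X] u(1) nu test_L2[OF \<Omega> test_partial[OF \<phi>]]])
    moreover have "(\<lambda>n. LINT x|lebesgue_on \<Omega>. weak_gradient \<Omega> (X n) x \<bullet> (\<phi> x *\<^sub>R (axis i 1 :: real^'n))) \<longlonglongrightarrow> (LINT x|lebesgue_on \<Omega>. g x \<bullet> (\<phi> x *\<^sub>R axis i 1))"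
      by (rule L2.ip_tendsto[OF H1D(2)[OF \<Omega> X] g(1) ng a])
    then have "(\<lambda>n. - (LINT x|lebesgue_on \<Omega>. weak_gradient \<Omega> (X n) x $ i * \<phi> x)) \<longlonglongrightarrow> - (LINT x|lebesgue_on \<Omega>. g x $ i * \<phi> x)"
      by (intro tendsto_minus) (simp add: inner_axis mult.commute)
    ultimately show ?thesis
      using weak_gradient_identity[OF \<Omega> X \<phi>, of _ i] by (simp add: LIMSEQ_unique)
  qed
  note H = H1I[OF \<Omega> u(1) g(1) id]
  have "H1_ip \<Omega> (X n - u) (X n - u) = (LINT x|lebesgue_on \<Omega>. (norm (X n x - u x))\<^sup>2) +
     (LINT x|lebesgue_on \<Omega>. (norm (weak_gradient \<Omega> (X n) x - g x))\<^sup>2)" for n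
  proof -
    have "(LINT x|lebesgue_on \<Omega>. (norm (weak_gradient \<Omega> (X n) x - weak_gradient \<Omega> u x))\<^sup>2) =
      (LINT x|lebesgue_on \<Omega>. (norm (weak_gradient \<Omega> (X n) x - g x))\<^sup>2)"
      using H(2) L2_measurable[OF H1D(2)[OF \<Omega> X[of n]]] L2_measurable[OF H1D(2)[OF \<Omega> H(1)]] L2_measurable[OF g(1)]
      by (intro integral_cong_AE) (auto elim: eventually_mono)
    then show ?thesis using diff[OF X H(1), of n] unfolding H1_ip_self L2_norm_sq by (simp add: fun_diff_def)
  qed
  then have "(\<lambda>n. H1_ip \<Omega> (X n - u) (X n - u)) \<longlonglongrightarrow> 0" using tendsto_add[OF u(2) g(2)] by simp
  with H(1) show "\<exists>u\<in>H1 \<Omega>. (\<lambda>n. H1_ip \<Omega> (X n - u) (X n - u)) \<longlonglongrightarrow> 0" by blast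
qed

lemma H1_nm: "open \<Omega> \<Longrightarrow> semi_hilbert.nm (H1_ip \<Omega>) u = H1_norm \<Omega> u"
  by (simp add: semi_hilbert.nm_def[OF H1_semi_hilbert] H1_norm_def H1_ip_self)

lemma H1_norm_nonneg [simp]: "0 \<le> H1_norm \<Omega> u"
  by (simp add: H1_norm_def)

lemma H1_norm_ge: "L2_norm \<Omega> u \<le> H1_norm \<Omega> u" "L2_norm \<Omega> (weak_gradient \<Omega> u) \<le> H1_norm \<Omega> u"
  by (auto simp: H1_norm_def intro: real_le_rsqrt)

lemma H1_norm_le: "H1_norm \<Omega> u \<le> L2_norm \<Omega> u + L2_norm \<Omega> (weak_gradient \<Omega> u)"
  by (simp add: H1_norm_def sqrt_add_le_add_sqrt[THEN order_trans])

section \<open>Dual functionals and weak convergence in \<open>H1\<close>\<close>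

lemma dual_H1I:
  assumes "\<And>u v. u \<in> H1 \<Omega> \<Longrightarrow> v \<in> H1 \<Omega> \<Longrightarrow> l (\<lambda>x. u x + v x) = l u + l v"
    "\<And>c u. u \<in> H1 \<Omega> \<Longrightarrow> l (\<lambda>x. c * u x) = c * l u"
    "\<And>u. u \<in> H1 \<Omega> \<Longrightarrow> \<bar>l u\<bar> \<le> C * H1_norm \<Omega> u"
  shows "l \<in> dual_space (H1 \<Omega>) (H1_norm \<Omega>)"
  unfolding dual_space_def using assms by (intro CollectI conjI exI[of _ C]) auto

lemma dual_ip:
  assumes \<Omega>: "open \<Omega>" and v: "v \<in> H1 \<Omega>"
  shows "(\<lambda>u. H1_ip \<Omega> u v) \<in> dual_space (H1 \<Omega>) (H1_norm \<Omega>)"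
proof -
  interpret H: semi_hilbert "H1 \<Omega>" "H1_ip \<Omega>" by (rule H1_semi_hilbert[OF \<Omega>])
  show ?thesis
  proof (rule dual_H1I)
    show "H1_ip \<Omega> (\<lambda>x. a x + b x) v = H1_ip \<Omega> a v + H1_ip \<Omega> b v" if "a \<in> H1 \<Omega>" "b \<in> H1 \<Omega>" for a b
      using H.ip_add[OF that v] by (simp add: plus_fun_def)
    show "H1_ip \<Omega> (\<lambda>x. c * a x) v = c * H1_ip \<Omega> a v" if "a \<in> H1 \<Omega>" for c a
      using H.ip_scale[OF that v, of c] by (simp add: scaleR_fun_def)
    show "\<bar>H1_ip \<Omega> a v\<bar> \<le> H1_norm \<Omega> v * H1_norm \<Omega> a" if "a \<in> H1 \<Omega>" for a
      using H.Cauchy_Schwarz[OF that v] by (simp add: H1_nm[OF \<Omega>] mult.commute)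
  qed
qed

lemma dual_L2:
  fixes h :: "real^'n \<Rightarrow> real"
  assumes \<Omega>: "open \<Omega>" and h: "h \<in> L2 \<Omega>"
  shows "(\<lambda>u. LINT x|lebesgue_on \<Omega>. u x * h x) \<in> dual_space (H1 \<Omega>) (H1_norm \<Omega>)"
proof (rule dual_H1I)
  show "(LINT x|lebesgue_on \<Omega>. (u x + v x) * h x) = (LINT x|lebesgue_on \<Omega>. u x * h x) + (LINT x|lebesgue_on \<Omega>. v x * h x)"
    if "u \<in> H1 \<Omega>" "v \<in> H1 \<Omega>" for u v
    using L2_mult_integrable[OF H1D(1)[OF \<Omega> that(1)] h] L2_mult_integrable[OF H1D(1)[OF \<Omega> that(2)] h]
    by (simp add: distrib_right)
  show "(LINT x|lebesgue_on \<Omega>. (c * u x) * h x) = c * (LINT x|lebesgue_on \<Omega>. u x * h x)" for c u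
    by (simp add: mult.assoc)
  fix u assume u: "u \<in> H1 \<Omega>"
  have "\<bar>LINT x|lebesgue_on \<Omega>. u x * h x\<bar> \<le> L2_norm \<Omega> u * L2_norm \<Omega> h"
    using L2_Cauchy_Schwarz[OF H1D(1)[OF \<Omega> u] h] by simp
  also have "\<dots> \<le> H1_norm \<Omega> u * L2_norm \<Omega> h" by (intro mult_right_mono H1_norm_ge) auto
  finally show "\<bar>LINT x|lebesgue_on \<Omega>. u x * h x\<bar> \<le> L2_norm \<Omega> h * H1_norm \<Omega> u" by (simp add: mult.commute)
qed

lemma dual_gradient:
  assumes \<Omega>: "open \<Omega>" and h: "h \<in> L2 \<Omega>"
  shows "(\<lambda>u. LINT x|lebesgue_on \<Omega>. weak_gradient \<Omega> u x \<bullet> h x) \<in> dual_space (H1 \<Omega>) (H1_norm \<Omega>)"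
proof (rule dual_H1I)
  show "(LINT x|lebesgue_on \<Omega>. weak_gradient \<Omega> (\<lambda>x. u x + v x) x \<bullet> h x) =
     (LINT x|lebesgue_on \<Omega>. weak_gradient \<Omega> u x \<bullet> h x) + (LINT x|lebesgue_on \<Omega>. weak_gradient \<Omega> v x \<bullet> h x)"
    if "u \<in> H1 \<Omega>" "v \<in> H1 \<Omega>" for u v
    using gradient_integral_linear[OF \<Omega> that h, of 1] by simp
  fix u assume u: "u \<in> H1 \<Omega>"
  show "(LINT x|lebesgue_on \<Omega>. weak_gradient \<Omega> (\<lambda>x. c * u x) x \<bullet> h x) = c * (LINT x|lebesgue_on \<Omega>. weak_gradient \<Omega> u x \<bullet> h x)" for c
    using AE_integral_cong_L2[OF H1D(2)[OF \<Omega> H1_scale[OF \<Omega> u]] L2_scale[OF H1D(2)[OF \<Omega> u]] h gradient_scale[OF \<Omega> u], of c] by simp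
  have "\<bar>LINT x|lebesgue_on \<Omega>. weak_gradient \<Omega> u x \<bullet> h x\<bar> \<le> L2_norm \<Omega> (weak_gradient \<Omega> u) * L2_norm \<Omega> h"
    by (rule L2_Cauchy_Schwarz[OF H1D(2)[OF \<Omega> u] h])
  also have "\<dots> \<le> H1_norm \<Omega> u * L2_norm \<Omega> h" by (intro mult_right_mono H1_norm_ge) auto
  finally show "\<bar>LINT x|lebesgue_on \<Omega>. weak_gradient \<Omega> u x \<bullet> h x\<bar> \<le> L2_norm \<Omega> h * H1_norm \<Omega> u" by (simp add: mult.commute)
qed

lemma weakD:
  assumes "weakly_converges_H1 \<Omega> u w"
  shows "\<And>n. u n \<in> H1 \<Omega>" "w \<in> H1 \<Omega>"
    "\<And>l. l \<in> dual_space (H1 \<Omega>) (H1_norm \<Omega>) \<Longrightarrow> (\<lambda>n. l (u n)) \<longlonglongrightarrow> l w"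
  using assms by (auto simp: weakly_converges_H1_def weakly_converges_def)

text \<open>Weak convergence makes every sequence \<open>H1_ip \<Omega> (u n) y\<close> bounded, and
  uniform boundedness turns this into a norm bound.\<close>

lemma weak_bounded:
  assumes \<Omega>: "open \<Omega>" and u: "weakly_converges_H1 \<Omega> u w"
  shows "\<exists>C>0. \<forall>n. H1_norm \<Omega> (u n) \<le> C"
proof -
  interpret H: semi_hilbert "H1 \<Omega>" "H1_ip \<Omega>" by (rule H1_semi_hilbert[OF \<Omega>])
  have "\<exists>C. \<forall>n. H.nm (u n) \<le> C"
  proof (rule H.uniform_boundedness[OF weakD(1)[OF u]])
    fix y assume "y \<in> H1 \<Omega>"
    then have "convergent (\<lambda>n. H1_ip \<Omega> (u n) y)" using weakD(3)[OF u dual_ip[OF \<Omega>]] by (auto simp: convergent_def)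
    then show "Bseq (\<lambda>n. H1_ip \<Omega> (u n) y)" by (rule convergent_imp_Bseq)
  qed
  then obtain C where "\<And>n. H1_norm \<Omega> (u n) \<le> C" by (auto simp: H1_nm[OF \<Omega>])
  then show ?thesis by (intro exI[of _ "max C 1"]) (auto simp: le_max_iff_disj)
qed

text \<open>Every functional in the dual is an inner product by Riesz, so testing with inner
  products suffices.\<close>

lemma weakI_ip:
  assumes \<Omega>: "open \<Omega>" and u: "\<And>n. u n \<in> H1 \<Omega>" "w \<in> H1 \<Omega>"
    and lim: "\<And>v. v \<in> H1 \<Omega> \<Longrightarrow> (\<lambda>n. H1_ip \<Omega> (u n) v) \<longlonglongrightarrow> H1_ip \<Omega> w v"
  shows "weakly_converges_H1 \<Omega> u w"
  unfolding weakly_converges_H1_def weakly_converges_def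
proof (intro conjI allI ballI u)
  interpret H: semi_hilbert "H1 \<Omega>" "H1_ip \<Omega>" by (rule H1_semi_hilbert[OF \<Omega>])
  fix l assume l: "l \<in> dual_space (H1 \<Omega>) (H1_norm \<Omega>)"
  then obtain C where "\<And>f. f \<in> H1 \<Omega> \<Longrightarrow> \<bar>l f\<bar> \<le> C * H1_norm \<Omega> f" unfolding dual_space_def by blast
  then have "\<exists>r\<in>H1 \<Omega>. \<forall>v\<in>H1 \<Omega>. H1_ip \<Omega> r v = l v"
    using l by (intro H.Riesz[where C = C] H.V_subspace)
      (auto simp: dual_space_def plus_fun_def scaleR_fun_def H1_nm[OF \<Omega>])
  then obtain r where r: "r \<in> H1 \<Omega>" "\<And>v. v \<in> H1 \<Omega> \<Longrightarrow> l v = H1_ip \<Omega> v r" using H.ip_sym by metis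
  show "(\<lambda>n. l (u n)) \<longlonglongrightarrow> l w" using lim[OF r(1)] u by (simp add: r(2))
qed

subsection \<open>Localisation and Rellich compactness\<close>

lemma L2_extend:
  fixes f :: "real^'n \<Rightarrow> real"
  assumes \<Omega>: "open \<Omega>" and f: "f \<in> L2 \<Omega>" "\<And>x. x \<notin> \<Omega> \<Longrightarrow> f x = 0"
  shows "f \<in> L2 UNIV" "L2_norm UNIV f = L2_norm \<Omega> f"
proof -
  have \<Omega>m: "\<Omega> \<in> sets lebesgue" using \<Omega> by (simp add: borel_open)
  show "f \<in> L2 UNIV" "L2_norm UNIV f = L2_norm \<Omega> f"
    using f lebesgue_on_outside[OF \<Omega>m, of "\<lambda>x. (f x)\<^sup>2"] lebesgue_on_outside(3)[OF \<Omega>m, of f]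
    by (auto simp: L2_def L2_norm_def lebesgue_on_UNIV_eq)
qed

lemma L2_restrict:
  fixes f :: "real^'n \<Rightarrow> real"
  assumes \<Omega>: "open \<Omega>" and f: "f \<in> L2 UNIV"
  shows "f \<in> L2 \<Omega>" "L2_norm \<Omega> f \<le> L2_norm UNIV f"
proof -
  have \<Omega>m: "\<Omega> \<in> sets lebesgue" using \<Omega> by (simp add: borel_open)
  have i: "integrable lebesgue (\<lambda>x. (f x)\<^sup>2)" using L2_integrable_norm[OF f] by (simp add: lebesgue_on_UNIV_eq)
  have "integrable (lebesgue_on \<Omega>) (\<lambda>x. (f x)\<^sup>2)"
    by (rule lebesgue_on_subset[of \<Omega> UNIV]) (auto simp: \<Omega>m lebesgue_on_UNIV_eq i)
  moreover have "f \<in> borel_measurable (lebesgue_on \<Omega>)"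
    using L2_measurable[OF f] by (rule measurable_restrict_mono) simp
  ultimately show "f \<in> L2 \<Omega>" by (simp add: L2_def)
  have "(LINT x|lebesgue_on \<Omega>. (f x)\<^sup>2) \<le> (LINT x|lebesgue_on UNIV. (f x)\<^sup>2)"
    by (rule integral_mono_lebesgue_on_AE) (use i \<Omega>m in \<open>auto simp: lebesgue_on_UNIV_eq\<close>)
  then show "L2_norm \<Omega> f \<le> L2_norm UNIV f" by (simp add: L2_norm_def)
qed

lemma L2_norm_triangle:
  "f \<in> L2 \<Omega> \<Longrightarrow> g \<in> L2 \<Omega> \<Longrightarrow> L2_norm \<Omega> (\<lambda>x. f x + g x) \<le> L2_norm \<Omega> f + L2_norm \<Omega> g"
  using L2.nm_triangle[of f \<Omega> g] by (simp add: L2_nm plus_fun_def)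

lemma L2_norm_scale: "f \<in> L2 \<Omega> \<Longrightarrow> L2_norm \<Omega> (\<lambda>x. c *\<^sub>R f x) = \<bar>c\<bar> * L2_norm \<Omega> f"
  using L2.nm_scale[of f \<Omega> c] by (simp add: L2_nm scaleR_fun_def)

lemma L2_norm_mono:
  assumes "g \<in> L2 \<Omega>" "f \<in> borel_measurable (lebesgue_on \<Omega>)" "0 \<le> C" "AE x in lebesgue_on \<Omega>. norm (f x) \<le> C * norm (g x)"
  shows "L2_norm \<Omega> f \<le> C * L2_norm \<Omega> g"
proof -
  have f: "f \<in> L2 \<Omega>" by (rule L2_norm_le[OF assms(1,2,4)])
  have "(LINT x|lebesgue_on \<Omega>. (norm (f x))\<^sup>2) \<le> (LINT x|lebesgue_on \<Omega>. C\<^sup>2 * (norm (g x))\<^sup>2)"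
  proof (rule integral_mono_AE)
    show "AE x in lebesgue_on \<Omega>. (norm (f x))\<^sup>2 \<le> C\<^sup>2 * (norm (g x))\<^sup>2"
      using assms(4)
    proof eventually_elim
      case (elim x)
      have "(norm (f x))\<^sup>2 \<le> (C * norm (g x))\<^sup>2" by (intro power_mono elim) simp
      then show ?case by (simp add: power_mult_distrib)
    qed
  qed (use L2_integrable_norm[OF f] L2_integrable_norm[OF assms(1)] in auto)
  then have "(L2_norm \<Omega> f)\<^sup>2 \<le> (C * L2_norm \<Omega> g)\<^sup>2" by (simp add: power_mult_distrib L2_norm_sq)
  then show ?thesis by (rule power2_le_imp_le) (use assms(3) in auto)
qed

lemma L2_norm_cong_AE:
  assumes "AE x in lebesgue_on \<Omega>. f x = g x" "f \<in> borel_measurable (lebesgue_on \<Omega>)" "g \<in> borel_measurable (lebesgue_on \<Omega>)"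
  shows "L2_norm \<Omega> f = L2_norm \<Omega> g"
proof -
  have "(LINT x|lebesgue_on \<Omega>. (norm (f x))\<^sup>2) = (LINT x|lebesgue_on \<Omega>. (norm (g x))\<^sup>2)"
    using assms by (intro integral_cong_AE) (auto elim: eventually_mono)
  then show ?thesis by (simp add: L2_norm_def)
qed

lemma L2_norm_vec:
  fixes g :: "real^'n \<Rightarrow> real^'m"
  assumes "g \<in> L2 \<Omega>"
  shows "(L2_norm \<Omega> g)\<^sup>2 = (\<Sum>i\<in>UNIV. (L2_norm \<Omega> (\<lambda>x. g x $ i))\<^sup>2)"
proof -
  have "(norm (g x))\<^sup>2 = (\<Sum>i\<in>UNIV. (g x $ i)\<^sup>2)" for x
    by (simp only: power2_norm_eq_inner inner_vec_def) (simp add: power2_eq_square)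
  then show ?thesis
    using L2_integrable_norm[OF L2_nth[OF assms]] by (simp add: L2_norm_sq)
qed

text \<open>The gradient of \<open>\<phi> * u\<close>, in a form that vanishes outside the support of \<open>\<phi>\<close>; the values of
  \<open>weak_gradient\<close> outside \<open>\<Omega>\<close> are arbitrary.\<close>
definition cut_grad :: "(real^'n) set \<Rightarrow> (real^'n \<Rightarrow> real) \<Rightarrow> (real^'n \<Rightarrow> real) \<Rightarrow> 'n \<Rightarrow> real^'n \<Rightarrow> real" where
  "cut_grad \<Omega> \<phi> u i x = \<phi> x * weak_gradient \<Omega> u x $ i + u x * partial_derivative i \<phi> x"

lemma cut_L2:
  assumes \<Omega>: "open \<Omega>" and u: "u \<in> H1 \<Omega>" and \<phi>: "\<phi> \<in> test_functions \<Omega>"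
  shows "(\<lambda>x. \<phi> x * u x) \<in> L2 \<Omega>" "cut_grad \<Omega> \<phi> u i \<in> L2 \<Omega>"
    "(\<lambda>x. \<phi> x * u x) \<in> L2 UNIV" "cut_grad \<Omega> \<phi> u i \<in> L2 UNIV"
    "integrable lebesgue (\<lambda>x. \<phi> x * u x)" "integrable lebesgue (cut_grad \<Omega> \<phi> u i)"
proof -
  obtain K where K: "compact K" "K \<subseteq> \<Omega>" "\<And>x. x \<notin> K \<Longrightarrow> \<phi> x = 0" "\<And>i x. x \<notin> K \<Longrightarrow> partial_derivative i \<phi> x = 0"
    by (rule test_functionsE[OF \<phi>]) blast
  show 1: "(\<lambda>x. \<phi> x * u x) \<in> L2 \<Omega>" by (rule L2_mult_test[OF H1D(1)[OF \<Omega> u] \<phi>])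
  show 2: "cut_grad \<Omega> \<phi> u i \<in> L2 \<Omega>"
    using L2_add[OF L2_mult_test(1)[OF L2_nth[OF H1D(2)[OF \<Omega> u]] \<phi>] L2_mult_test(2)[OF H1D(1)[OF \<Omega> u] test_partial[OF \<phi>]]]
    unfolding cut_grad_def[abs_def] .
  have o: "x \<notin> K" if "x \<notin> \<Omega>" for x using K(2) that by blast
  show 3: "(\<lambda>x. \<phi> x * u x) \<in> L2 UNIV" by (rule L2_extend[OF \<Omega> 1]) (simp add: K o)
  show 4: "cut_grad \<Omega> \<phi> u i \<in> L2 UNIV" by (rule L2_extend[OF \<Omega> 2]) (simp add: cut_grad_def K o)
  show "integrable lebesgue (\<lambda>x. \<phi> x * u x)" by (rule L2_UNIV_integrable[OF 3 K(1)]) (use K in auto)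
  show "integrable lebesgue (cut_grad \<Omega> \<phi> u i)" by (rule L2_UNIV_integrable[OF 4 K(1)]) (use K in \<open>auto simp: cut_grad_def\<close>)
qed

lemma smooth_mollifier_shift: "smooth (\<lambda>y. mollifier \<delta> (x - y :: real^'n))"
proof -
  have eq: "(\<lambda>y. mollifier \<delta> (x - y)) = (\<lambda>y. flat_exp 0 (\<delta>\<^sup>2 - (norm (y - x))\<^sup>2) *
     (1 / (LINT z|lborel. flat_exp 0 (\<delta>\<^sup>2 - (norm (z :: real^'n))\<^sup>2))))"
    by (simp add: mollifier_def norm_minus_commute)
  show ?thesis unfolding eq by (intro smooth_mult smooth_flat_exp smooth_const)
qed

text \<open>As a function of \<open>y\<close> the kernel is smooth but may fail to be a test
  function of the domain; \<open>product_identity\<close> applies because the cutoff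
  \<open>\<phi>\<close> provides the compact support. The formula holds at every \<open>x\<close>,
  also near and outside the boundary.\<close>

lemma partial_mollify:
  fixes \<Omega> :: "(real^'n) set"
  assumes \<Omega>: "open \<Omega>" and u: "u \<in> H1 \<Omega>" and \<phi>: "\<phi> \<in> test_functions \<Omega>" and \<delta>: "0 < \<delta>"
  shows "partial_derivative i (conv (mollifier \<delta>) (\<lambda>x. \<phi> x * u x)) = conv (mollifier \<delta>) (cut_grad \<Omega> \<phi> u i)"
proof
  fix x :: "real^'n"
  have \<Omega>m: "\<Omega> \<in> sets lebesgue" using \<Omega> by (simp add: borel_open)
  have p: "partial_derivative i (\<lambda>y. mollifier \<delta> (x - y)) y = - partial_derivative i (mollifier \<delta>) (x - y)" for y
  proof -
    have "((\<lambda>y. x - y) has_derivative (\<lambda>h. - h)) (at y)" by (auto intro!: derivative_eq_intros)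
    note has_derivative_compose[OF this has_derivative_partial[OF smooth_differentiable[OF test_smooth[OF test_mollifier[OF \<delta>]]]]]
    from partial_derivativeI[OF this, of i] show ?thesis
      by (simp add: axis_def sum_negf if_distrib[of "\<lambda>t. t * _"] cong: if_cong)
  qed
  have "partial_derivative i (conv (mollifier \<delta>) (\<lambda>x. \<phi> x * u x)) x =
    (LINT y|lebesgue. partial_derivative i (mollifier \<delta>) (x - y) * (\<phi> y * u y))"
    by (simp add: partial_conv[OF test_mollifier[OF \<delta>] cut_L2(5)[OF \<Omega> u \<phi>]] conv_def)
  also have "\<dots> = (LINT y|lebesgue_on \<Omega>. partial_derivative i (mollifier \<delta>) (x - y) * (\<phi> y * u y))"
    using test_outside[OF \<phi>] by (subst lebesgue_on_outside(1)[OF \<Omega>m]) auto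
  also have "\<dots> = - (LINT y|lebesgue_on \<Omega>. (\<phi> y * u y) * partial_derivative i (\<lambda>y. mollifier \<delta> (x - y)) y)"
    by (simp add: p mult.commute)
  also have "\<dots> = (LINT y|lebesgue_on \<Omega>. cut_grad \<Omega> \<phi> u i y * mollifier \<delta> (x - y))"
    by (subst product_identity[OF \<Omega> u \<phi> smooth_mollifier_shift]) (simp add: cut_grad_def)
  also have "\<dots> = (LINT y|lebesgue. cut_grad \<Omega> \<phi> u i y * mollifier \<delta> (x - y))"
    using test_outside[OF \<phi>] test_outside[OF test_partial[OF \<phi>]]
    by (subst lebesgue_on_outside(1)[OF \<Omega>m]) (auto simp: cut_grad_def)
  also have "\<dots> = conv (mollifier \<delta>) (cut_grad \<Omega> \<phi> u i) x" by (simp add: conv_def mult.commute)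
  finally show "partial_derivative i (conv (mollifier \<delta>) (\<lambda>x. \<phi> x * u x)) x = conv (mollifier \<delta>) (cut_grad \<Omega> \<phi> u i) x" .
qed

text \<open>One scale serves the function and all of its finitely many gradient components, and it
  is so small that the mollified product still has its support in the domain.\<close>

lemma mollify_cut_approx:
  fixes \<Omega> :: "(real^'n) set"
  assumes \<Omega>: "open \<Omega>" and u: "u \<in> H1 \<Omega>" and \<phi>: "\<phi> \<in> test_functions \<Omega>" and e: "0 < e"
  shows "\<exists>\<delta>>0. conv (mollifier \<delta>) (\<lambda>x. \<phi> x * u x) \<in> test_functions \<Omega> \<and>
     (LINT x|lebesgue. (conv (mollifier \<delta>) (\<lambda>x. \<phi> x * u x) x - \<phi> x * u x)\<^sup>2) < e \<and>
     (\<forall>i. (LINT x|lebesgue. (conv (mollifier \<delta>) (cut_grad \<Omega> \<phi> u i) x - cut_grad \<Omega> \<phi> u i x)\<^sup>2) < e)"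
proof -
  obtain K where K: "compact K" "K \<subseteq> \<Omega>" "\<And>x. x \<notin> K \<Longrightarrow> \<phi> x = 0"
    by (rule test_functionsE[OF \<phi>]) blast
  obtain \<epsilon> where \<epsilon>: "\<epsilon> > 0" "(\<Union>x\<in>K. cball x \<epsilon>) \<subseteq> \<Omega>"
    using compact_subset_open_imp_cball_epsilon_subset[OF K(1) \<Omega> K(2)] by blast
  obtain d where d: "d > 0" "\<And>\<delta>. 0 < \<delta> \<Longrightarrow> \<delta> < d \<Longrightarrow>
      (LINT x|lebesgue. (conv (mollifier \<delta>) (\<lambda>x. \<phi> x * u x) x - \<phi> x * u x)\<^sup>2) < e"
    using mollifier_L2[OF cut_L2(3,5)[OF \<Omega> u \<phi>] e] by blast
  have "\<forall>i. \<exists>d>0. \<forall>\<delta>. 0 < \<delta> \<longrightarrow> \<delta> < d \<longrightarrow>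
      (LINT x|lebesgue. (conv (mollifier \<delta>) (cut_grad \<Omega> \<phi> u i) x - cut_grad \<Omega> \<phi> u i x)\<^sup>2) < e"
    using mollifier_L2[OF cut_L2(4,6)[OF \<Omega> u \<phi>] e] by blast
  then obtain D where D: "\<And>i. D i > 0" "\<And>i \<delta>. 0 < \<delta> \<Longrightarrow> \<delta> < D i \<Longrightarrow>
      (LINT x|lebesgue. (conv (mollifier \<delta>) (cut_grad \<Omega> \<phi> u i) x - cut_grad \<Omega> \<phi> u i x)\<^sup>2) < e" by metis
  define m where "m = min (min \<epsilon> d) (Min (range D))"
  define \<delta> where "\<delta> = m / 2"
  have "Min (range D) > 0" using D(1) by simp
  then have "m > 0" using \<epsilon> d by (simp add: m_def)
  moreover have "m \<le> \<epsilon>" "m \<le> d" "m \<le> Min (range D)" by (auto simp: m_def)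
  ultimately have \<delta>: "\<delta> > 0" "\<delta> < d" "\<delta> \<le> \<epsilon>" "\<delta> < Min (range D)"
    unfolding \<delta>_def by linarith+
  then have "\<delta> < D i" for i using Min_le[of "range D" "D i"] by simp
  moreover have "conv (mollifier \<delta>) (\<lambda>x. \<phi> x * u x) \<in> test_functions \<Omega>"
  proof (rule test_conv[OF \<delta>(1) cut_L2(5)[OF \<Omega> u \<phi>] K(1)])
    show "(\<Union>y\<in>K. cball y \<delta>) \<subseteq> \<Omega>" using \<epsilon>(2) \<delta>(3) by (force simp: subset_iff)
  qed (use K in simp)
  ultimately show ?thesis using \<delta> d(2) D(2) by (intro exI[of _ \<delta>]) auto
qed

text \<open>Mollifications of \<open>\<phi> * u\<close> at small scales are test functions of the
  domain and converge in the full \<open>H1\<close> norm. This makes \<open>\<phi> * u\<close> an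
  admissible argument for functionals in \<open>Hm1\<close>, whatever \<open>u\<close> does at the
  boundary.\<close>

lemma H10_mult_test:
  fixes \<Omega> :: "(real^'n) set"
  assumes \<Omega>: "open \<Omega>" and u: "u \<in> H1 \<Omega>" and \<phi>: "\<phi> \<in> test_functions \<Omega>"
  shows "(\<lambda>x. \<phi> x * u x) \<in> H10 \<Omega>"
proof -
  let ?v = "\<lambda>x. \<phi> x * u x"
  have "\<exists>\<psi>\<in>test_functions \<Omega>. H1_norm \<Omega> (\<lambda>x. ?v x - \<psi> x) < e" if e: "e > 0" for e
  proof -
    \<comment> \<open>The function and the gradient components contribute
      \<open>CARD('n) + 1\<close> squared errors, whose sum must stay strictly below
      \<open>e\<^sup>2\<close>.\<close>
    define e' where "e' = e\<^sup>2 / (real CARD('n) + 2)"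
    have e': "e' > 0" "(real CARD('n) + 1) * e' < e\<^sup>2" using e by (auto simp: e'_def field_simps)
    obtain \<delta> where \<delta>: "\<delta> > 0" and t: "conv (mollifier \<delta>) ?v \<in> test_functions \<Omega>"
      and 1: "(LINT x|lebesgue. (conv (mollifier \<delta>) ?v x - ?v x)\<^sup>2) < e'"
      and 2: "\<And>i. (LINT x|lebesgue. (conv (mollifier \<delta>) (cut_grad \<Omega> \<phi> u i) x - cut_grad \<Omega> \<phi> u i x)\<^sup>2) < e'"
      using mollify_cut_approx[OF \<Omega> u \<phi> e'(1)] by blast
    let ?\<psi> = "conv (mollifier \<delta>) ?v"
    note cL = cut_L2[OF \<Omega> u \<phi>]
    have y: "?\<psi> \<in> L2 UNIV" "conv (mollifier \<delta>) (cut_grad \<Omega> \<phi> u i) \<in> L2 UNIV" for i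
      by (intro Young_L2 \<delta> cL)+
    have "(L2_norm UNIV f)\<^sup>2 = (LINT x|lebesgue. (f x)\<^sup>2)" for f :: "real^'n \<Rightarrow> real"
      by (simp add: L2_norm_sq lebesgue_on_UNIV_eq)
    note sq = this
    have b1: "(L2_norm \<Omega> (\<lambda>x. ?v x - ?\<psi> x))\<^sup>2 < e'"
    proof -
      have "(L2_norm \<Omega> (\<lambda>x. ?v x - ?\<psi> x))\<^sup>2 \<le> (L2_norm UNIV (\<lambda>x. ?v x - ?\<psi> x))\<^sup>2"
        by (rule power_mono[OF L2_restrict(2)[OF \<Omega> L2_diff[OF cL(3) y(1)]]]) simp
      then show ?thesis using 1 by (simp add: sq power2_commute)
    qed
    have b2: "(L2_norm \<Omega> (\<lambda>x. cut_grad \<Omega> \<phi> u i x - conv (mollifier \<delta>) (cut_grad \<Omega> \<phi> u i) x))\<^sup>2 < e'" for i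
    proof -
      have "(L2_norm \<Omega> (\<lambda>x. cut_grad \<Omega> \<phi> u i x - conv (mollifier \<delta>) (cut_grad \<Omega> \<phi> u i) x))\<^sup>2
        \<le> (L2_norm UNIV (\<lambda>x. cut_grad \<Omega> \<phi> u i x - conv (mollifier \<delta>) (cut_grad \<Omega> \<phi> u i) x))\<^sup>2"
        by (rule power_mono[OF L2_restrict(2)[OF \<Omega> L2_diff[OF cL(4) y(2)]]]) simp
      then show ?thesis using 2[of i] by (simp add: sq power2_commute)
    qed
    let ?G = "\<lambda>x. \<chi> i. cut_grad \<Omega> \<phi> u i x - conv (mollifier \<delta>) (cut_grad \<Omega> \<phi> u i) x"
    have G: "?G \<in> L2 \<Omega>" by (rule L2_vec) (simp add: L2_diff cL L2_restrict[OF \<Omega> y(2)])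
    have v: "?v \<in> H1 \<Omega>" "AE x in lebesgue_on \<Omega>. weak_gradient \<Omega> ?v x = (\<chi> i. cut_grad \<Omega> \<phi> u i x)"
      using H1_mult_test[OF \<Omega> u \<phi>] by (auto simp: cut_grad_def)
    have p: "?\<psi> \<in> H1 \<Omega>" "AE x in lebesgue_on \<Omega>. weak_gradient \<Omega> ?\<psi> x = (\<chi> i. conv (mollifier \<delta>) (cut_grad \<Omega> \<phi> u i) x)"
      using H1_test[OF \<Omega> t] by (auto simp: partial_mollify[OF \<Omega> u \<phi> \<delta>])
    note d = gradient_diff[OF \<Omega> v(1) p(1)]
    have "AE x in lebesgue_on \<Omega>. weak_gradient \<Omega> (\<lambda>x. ?v x - ?\<psi> x) x = ?G x"
      using d(2) v(2) p(2) by eventually_elim (simp add: vec_eq_iff)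
    then have "L2_norm \<Omega> (weak_gradient \<Omega> (\<lambda>x. ?v x - ?\<psi> x)) = L2_norm \<Omega> ?G"
      by (rule L2_norm_cong_AE) (intro L2_measurable G H1D(2)[OF \<Omega> d(1)])+
    then have "(L2_norm \<Omega> (weak_gradient \<Omega> (\<lambda>x. ?v x - ?\<psi> x)))\<^sup>2 \<le> (\<Sum>i\<in>(UNIV::'n set). e')"
      unfolding L2_norm_vec[OF G] using b2 by (simp add: L2_norm_vec[OF G]) (intro sum_bounded_above[THEN order_trans], auto intro: less_imp_le)
    then have "H1_norm \<Omega> (\<lambda>x. ?v x - ?\<psi> x) < sqrt (e\<^sup>2)"
      unfolding H1_norm_def using b1 e'(2) by (intro real_sqrt_less_mono) (simp add: distrib_right)
    then show ?thesis using t e by auto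
  qed
  then have "\<exists>\<psi>\<in>test_functions \<Omega>. H1_norm \<Omega> (\<lambda>x. ?v x - \<psi> x) < inverse (real (Suc n))" for n by simp
  then obtain \<psi> where \<psi>: "\<And>n. \<psi> n \<in> test_functions \<Omega>" "\<And>n. H1_norm \<Omega> (\<lambda>x. ?v x - \<psi> n x) < inverse (real (Suc n))"
    by metis
  have "(\<lambda>n. H1_norm \<Omega> (\<lambda>x. ?v x - \<psi> n x)) \<longlonglongrightarrow> 0"
    by (rule real_tendsto_sandwich[where f = "\<lambda>_. 0" and h = "\<lambda>n. inverse (real (Suc n))"])
      (use \<psi>(2) LIMSEQ_inverse_real_of_nat in \<open>auto intro!: always_eventually less_imp_le\<close>)
  then show ?thesis using \<psi>(1) H1_mult_test(1)[OF \<Omega> u \<phi>] by (auto simp: H10_def)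
qed

text \<open>The first estimate makes multiplication by \<open>\<phi>\<close> bounded on
  \<open>H1\<close>, so that functionals can be localised; the second is kept in terms of
  \<open>cut_grad\<close>, the quantity on the right of the mollification estimate.\<close>

lemma H1_mult_test_bound:
  fixes \<Omega> :: "(real^'n) set"
  assumes \<Omega>: "open \<Omega>" and \<phi>: "\<phi> \<in> test_functions \<Omega>"
  shows "\<exists>C>0. \<forall>u\<in>H1 \<Omega>. H1_norm \<Omega> (\<lambda>x. \<phi> x * u x) \<le> C * H1_norm \<Omega> u \<and>
     (\<Sum>i\<in>UNIV. (L2_norm \<Omega> (cut_grad \<Omega> \<phi> u i))\<^sup>2) \<le> (C * H1_norm \<Omega> u)\<^sup>2"
proof -
  obtain M where M: "M > 0" "\<And>x. \<bar>\<phi> x\<bar> \<le> M" using test_bounded[OF \<phi>] by blast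
  have "\<forall>i. \<exists>M>0. \<forall>x. \<bar>partial_derivative i \<phi> x\<bar> \<le> M" using test_bounded[OF test_partial[OF \<phi>]] by blast
  then obtain P where P: "\<And>i. P i > 0" "\<And>i x. \<bar>partial_derivative i \<phi> x\<bar> \<le> P i" by metis
  define C where "C = M + (\<Sum>i\<in>UNIV. M + P i)"
  have nn: "(\<Sum>i\<in>UNIV. M + P i) \<ge> 0" using M(1) P(1) by (intro sum_nonneg add_nonneg_nonneg) (auto intro: less_imp_le)
  have C: "C > 0" "M \<le> C" "(\<Sum>i\<in>UNIV. M + P i) \<le> C" using M(1) nn by (auto simp: C_def)
  show ?thesis
  proof (intro exI[of _ C] conjI ballI C)
    fix u assume u: "u \<in> H1 \<Omega>"
    note h = H1D[OF \<Omega> u]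
    have g: "L2_norm \<Omega> (cut_grad \<Omega> \<phi> u i) \<le> (M + P i) * H1_norm \<Omega> u" for i
    proof -
      have "L2_norm \<Omega> (cut_grad \<Omega> \<phi> u i) \<le> L2_norm \<Omega> (\<lambda>x. \<phi> x * weak_gradient \<Omega> u x $ i) + L2_norm \<Omega> (\<lambda>x. u x * partial_derivative i \<phi> x)"
        unfolding cut_grad_def[abs_def]
        by (intro L2_norm_triangle L2_mult_test[OF L2_nth[OF h(2)] \<phi>] L2_mult_test[OF h(1) test_partial[OF \<phi>]])
      also have "L2_norm \<Omega> (\<lambda>x. \<phi> x * weak_gradient \<Omega> u x $ i) \<le> M * L2_norm \<Omega> (weak_gradient \<Omega> u)"
      proof (rule L2_norm_mono[OF h(2)])
        show "AE x in lebesgue_on \<Omega>. norm (\<phi> x * weak_gradient \<Omega> u x $ i) \<le> M * norm (weak_gradient \<Omega> u x)"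
          using M by (auto simp: abs_mult intro!: mult_mono component_le_norm_cart)
      qed (use M L2_measurable[OF L2_mult_test(1)[OF L2_nth[OF h(2)] \<phi>]] in auto)
      also have "L2_norm \<Omega> (\<lambda>x. u x * partial_derivative i \<phi> x) \<le> P i * L2_norm \<Omega> u"
      proof (rule L2_norm_mono[OF h(1)])
        show "AE x in lebesgue_on \<Omega>. norm (u x * partial_derivative i \<phi> x) \<le> P i * norm (u x)"
          using P(2)[of i] by (auto simp: abs_mult mult.commute[of "P i"] intro!: mult_left_mono)
      qed (use P(1)[of i] L2_measurable[OF L2_mult_test(2)[OF h(1) test_partial[OF \<phi>]]] in auto)
      finally show ?thesis
        using mult_left_mono[OF H1_norm_ge(1)[of \<Omega> u] less_imp_le[OF P(1)[of i]]]
          mult_left_mono[OF H1_norm_ge(2)[of \<Omega> u] less_imp_le[OF M(1)]]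
        unfolding distrib_right by linarith
    qed
    have v: "L2_norm \<Omega> (\<lambda>x. \<phi> x * u x) \<le> M * H1_norm \<Omega> u"
    proof -
      have "L2_norm \<Omega> (\<lambda>x. \<phi> x * u x) \<le> M * L2_norm \<Omega> u"
        by (rule L2_norm_mono[OF h(1) L2_measurable[OF cut_L2(1)[OF \<Omega> u \<phi>]]])
          (use M in \<open>auto simp: abs_mult intro!: mult_right_mono\<close>)
      then show ?thesis using mult_left_mono[OF H1_norm_ge(1)[of \<Omega> u] less_imp_le[OF M(1)]] by linarith
    qed
    have "(\<Sum>i\<in>UNIV. (L2_norm \<Omega> (cut_grad \<Omega> \<phi> u i))\<^sup>2) \<le> (\<Sum>i\<in>UNIV. L2_norm \<Omega> (cut_grad \<Omega> \<phi> u i))\<^sup>2"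
      using L2_set_le_sum[of UNIV "\<lambda>i. L2_norm \<Omega> (cut_grad \<Omega> \<phi> u i)"]
      by (simp add: L2_set_def sqrt_le_D)
    also have "\<dots> \<le> ((\<Sum>i\<in>UNIV. M + P i) * H1_norm \<Omega> u)\<^sup>2"
      unfolding sum_distrib_right by (intro power_mono sum_mono g sum_nonneg) simp
    finally have s: "(\<Sum>i\<in>UNIV. (L2_norm \<Omega> (cut_grad \<Omega> \<phi> u i))\<^sup>2) \<le> ((\<Sum>i\<in>UNIV. M + P i) * H1_norm \<Omega> u)\<^sup>2" .
    also have "\<dots> \<le> (C * H1_norm \<Omega> u)\<^sup>2"
      using nn C by (intro power_mono mult_right_mono) auto
    finally show "(\<Sum>i\<in>UNIV. (L2_norm \<Omega> (cut_grad \<Omega> \<phi> u i))\<^sup>2) \<le> (C * H1_norm \<Omega> u)\<^sup>2" .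
    let ?G = "\<lambda>x. \<chi> i. cut_grad \<Omega> \<phi> u i x"
    have G: "?G \<in> L2 \<Omega>" by (rule L2_vec) (simp add: cut_L2(2)[OF \<Omega> u \<phi>])
    have "L2_norm \<Omega> (weak_gradient \<Omega> (\<lambda>x. \<phi> x * u x)) = L2_norm \<Omega> ?G"
      using H1_mult_test[OF \<Omega> u \<phi>]
      by (intro L2_norm_cong_AE L2_measurable G H1D(2)[OF \<Omega>]) (auto simp: cut_grad_def)
    also have "\<dots> \<le> (\<Sum>i\<in>UNIV. M + P i) * H1_norm \<Omega> u"
      by (rule power2_le_imp_le) (use s nn in \<open>auto simp: L2_norm_vec[OF G]\<close>)
    finally have "H1_norm \<Omega> (\<lambda>x. \<phi> x * u x) \<le> M * H1_norm \<Omega> u + (\<Sum>i\<in>UNIV. M + P i) * H1_norm \<Omega> u"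
      using H1_norm_le[of \<Omega> "\<lambda>x. \<phi> x * u x"] v by linarith
    then show "H1_norm \<Omega> (\<lambda>x. \<phi> x * u x) \<le> C * H1_norm \<Omega> u" by (simp add: C_def distrib_right)
  qed
qed

section \<open>Translation and mollification estimates\<close>

lemma smooth_borel': "smooth f \<Longrightarrow> f \<in> borel_measurable borel"
  by (rule borel_measurable_continuous_onI[OF smooth_continuous])

lemma partial_square_integrable:
  assumes "f \<in> test_functions UNIV"
  shows "integrable lborel (\<lambda>x. (partial_derivative i f x)\<^sup>2)"
proof -
  have "integrable lebesgue (\<lambda>x. partial_derivative i f x * partial_derivative i f x)"
    by (intro test_integrable test_mult test_partial assms smooth_partial test_smooth[OF assms])
  then show ?thesis
    using smooth_borel'[OF smooth_partial[OF test_smooth[OF assms]]]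
    by (simp add: power2_eq_square integrable_completion)
qed

text \<open>The increment is the integral of the directional derivative along the segment; its
  square is at most the mean square, and after Tonelli translation invariance removes the shift
  \<open>t *\<^sub>R h\<close>.\<close>

lemma translation_estimate:
  fixes f :: "real^'n \<Rightarrow> real"
  assumes f: "f \<in> test_functions UNIV"
  shows "(\<integral>\<^sup>+ x. ennreal ((f (x + h) - f x)\<^sup>2) \<partial>lborel) \<le>
    ennreal ((norm h)\<^sup>2 * (\<Sum>i\<in>UNIV. LINT x|lborel. (partial_derivative i f x)\<^sup>2))"
proof -
  note fs = test_smooth[OF f]
  define P where "P x = (\<Sum>i\<in>UNIV. (partial_derivative i f x)\<^sup>2)" for x
  have Pm[measurable]: "P \<in> borel_measurable borel"
    unfolding P_def using smooth_borel'[OF smooth_partial[OF fs]] by measurable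
  have Pi: "integrable lborel P" unfolding P_def[abs_def] using partial_square_integrable[OF f] by auto
  have P0: "0 \<le> P x" for x unfolding P_def by (intro sum_nonneg) auto
  have pt: "ennreal ((f (x + h) - f x)\<^sup>2) \<le> (\<integral>\<^sup>+ t. ennreal ((norm h)\<^sup>2 * P (t *\<^sub>R h + x)) * indicator {0..1} t \<partial>lborel)" for x
  proof -
    define k where "k t = (\<Sum>i\<in>UNIV. h $ i * partial_derivative i f (x + t *\<^sub>R h))" for t
    have kc: "continuous_on UNIV k"
      unfolding k_def
      by (intro continuous_intros continuous_on_compose2[OF smooth_continuous[OF smooth_partial[OF fs]]]) auto
    have D: "((\<lambda>t. f (x + t *\<^sub>R h)) has_real_derivative k t) (at t)" for t
    proof -
      have "((\<lambda>t. x + t *\<^sub>R h) has_derivative (\<lambda>s. s *\<^sub>R h)) (at t)" by (auto intro!: derivative_eq_intros)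
      note c = has_derivative_compose[OF this has_derivative_partial[OF smooth_differentiable[OF fs]]]
      have "(\<lambda>s. \<Sum>i\<in>UNIV. (s *\<^sub>R h) $ i * partial_derivative i f (x + t *\<^sub>R h)) = (*) (k t)"
        unfolding k_def by (rule ext) (simp add: sum_distrib_left mult_ac)
      with c show ?thesis by (simp only: has_field_derivative_def)
    qed
    define I where "I = f (x + h) - f x"
    have FI: "has_bochner_integral lborel (\<lambda>t. k t * indicator {0..1} t) (f (x + 1 *\<^sub>R h) - f (x + 0 *\<^sub>R h))"
      by (rule has_bochner_integral_FTC_Icc_real[where F = "\<lambda>t. f (x + t *\<^sub>R h)", OF _ D])
        (use kc in \<open>auto simp: continuous_on_eq_continuous_at\<close>)
    have k1: "integrable lborel (\<lambda>t. k t * indicator {0..1} t)" "(LINT t|lborel. k t * indicator {0..1} t) = I"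
      using FI by (auto simp: has_bochner_integral_iff I_def)
    have k2: "integrable lborel (\<lambda>t. (k t)\<^sup>2 * indicator {0..1} t)"
      using borel_integrable_compact[of "{0..1::real}" "\<lambda>t. (k t)\<^sup>2"] kc
      by (auto simp: mult.commute intro: continuous_intros continuous_on_subset)
    have k0: "integrable lborel (indicator {0..1} :: real \<Rightarrow> real)" "(LINT t|lborel. indicator {0..1::real} t) = (1::real)"
      by auto
    \<comment> \<open>The variance of \<open>k\<close> on the unit interval about its mean
      \<open>I\<close>; its nonnegativity is the Cauchy-Schwarz inequality needed here.\<close>
    have "0 \<le> (LINT t|lborel. (k t - I)\<^sup>2 * indicator {0..1} t)" by (intro integral_nonneg_AE) auto
    also have "(\<lambda>t. (k t - I)\<^sup>2 * indicator {0..1} t) =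
        (\<lambda>t. (k t)\<^sup>2 * indicator {0..1} t - 2 * I * (k t * indicator {0..1} t) + I\<^sup>2 * indicator {0..1} t)"
      by (auto simp: fun_eq_iff power2_eq_square algebra_simps)
    also have "(LINT t|lborel. \<dots> t) = (LINT t|lborel. (k t)\<^sup>2 * indicator {0..1} t) - I\<^sup>2"
      using k0 k1 k2 by (simp add: power2_eq_square)
    finally have "I\<^sup>2 \<le> (LINT t|lborel. (k t)\<^sup>2 * indicator {0..1} t)" by simp
    then have "ennreal (I\<^sup>2) \<le> ennreal (LINT t|lborel. (k t)\<^sup>2 * indicator {0..1} t)" by (rule ennreal_leI)
    also have "\<dots> = (\<integral>\<^sup>+ t. ennreal ((k t)\<^sup>2 * indicator {0..1} t) \<partial>lborel)"
      by (rule nn_integral_eq_integral[symmetric, OF k2]) auto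
    also have "\<dots> \<le> (\<integral>\<^sup>+ t. ennreal ((norm h)\<^sup>2 * P (t *\<^sub>R h + x)) * indicator {0..1} t \<partial>lborel)"
    proof (rule nn_integral_mono)
      fix t :: real
      have "k t = h \<bullet> (\<chi> i. partial_derivative i f (x + t *\<^sub>R h))" by (simp add: k_def inner_vec_def)
      then have "(k t)\<^sup>2 \<le> (h \<bullet> h) * ((\<chi> i. partial_derivative i f (x + t *\<^sub>R h)) \<bullet> (\<chi> i. partial_derivative i f (x + t *\<^sub>R h)))"
        by (simp add: Cauchy_Schwarz_ineq)
      also have "\<dots> = (norm h)\<^sup>2 * P (t *\<^sub>R h + x)"
        by (simp add: P_def inner_vec_def power2_norm_eq_inner add.commute power2_eq_square[symmetric])
      finally show "ennreal ((k t)\<^sup>2 * indicator {0..1} t) \<le> ennreal ((norm h)\<^sup>2 * P (t *\<^sub>R h + x)) * indicator {0..1} t"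
        by (auto simp: indicator_def intro: ennreal_leI)
    qed
    finally show ?thesis by (simp add: I_def)
  qed
  have "(\<integral>\<^sup>+ x. ennreal ((f (x + h) - f x)\<^sup>2) \<partial>lborel) \<le>
    (\<integral>\<^sup>+ x. (\<integral>\<^sup>+ t. ennreal ((norm h)\<^sup>2 * P (t *\<^sub>R h + x)) * indicator {0..1} t \<partial>lborel) \<partial>lborel)"
    by (intro nn_integral_mono pt)
  also have "\<dots> = (\<integral>\<^sup>+ t. (\<integral>\<^sup>+ x. ennreal ((norm h)\<^sup>2 * P (t *\<^sub>R h + x)) * indicator {0..1::real} t \<partial>lborel) \<partial>lborel)"
    by (rule lborel_pair.Fubini') measurable
  also have "\<dots> = (\<integral>\<^sup>+ t. ennreal ((norm h)\<^sup>2 * (LINT x|lborel. P x)) * indicator {0..1::real} t \<partial>lborel)"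
  proof (rule nn_integral_cong)
    fix t :: real
    have "(\<integral>\<^sup>+ x. ennreal ((norm h)\<^sup>2 * P (t *\<^sub>R h + x)) \<partial>lborel) = (\<integral>\<^sup>+ x. ennreal ((norm h)\<^sup>2 * P x) \<partial>lborel)"
      by (rule nn_integral_translate) measurable
    also have "\<dots> = ennreal (LINT x|lborel. (norm h)\<^sup>2 * P x)"
      using Pi P0 by (intro nn_integral_eq_integral) auto
    finally show "(\<integral>\<^sup>+ x. ennreal ((norm h)\<^sup>2 * P (t *\<^sub>R h + x)) * indicator {0..1::real} t \<partial>lborel) =
       ennreal ((norm h)\<^sup>2 * (LINT x|lborel. P x)) * indicator {0..1::real} t"
      by (subst nn_integral_multc) auto
  qed
  also have "\<dots> = ennreal ((norm h)\<^sup>2 * (LINT x|lborel. P x))" by (subst nn_integral_cmult_indicator) auto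
  also have "(LINT x|lborel. P x) = (\<Sum>i\<in>UNIV. LINT x|lborel. (partial_derivative i f x)\<^sup>2)"
    unfolding P_def by (rule Bochner_Integration.integral_sum) (rule partial_square_integrable[OF f])
  finally show ?thesis .
qed

lemma L2_norm_UNIV: "(L2_norm UNIV f)\<^sup>2 = (LINT x|lebesgue. (f x :: real)\<^sup>2)"
  by (simp add: L2_norm_sq lebesgue_on_UNIV_eq)

text \<open>Jensen's inequality, the substitution \<open>y = x + h\<close> and Tonelli reduce the
  claim to translations by \<open>h\<close>; the kernel lives on \<open>norm h < \<delta>\<close>,
  whence the factor \<open>\<delta>\<^sup>2\<close>.\<close>

lemma test_mollify_estimate:
  fixes f :: "real^'n \<Rightarrow> real"
  assumes f: "f \<in> test_functions UNIV" and \<delta>: "0 < \<delta>"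
  shows "(L2_norm UNIV (\<lambda>x. conv (mollifier \<delta>) f x - f x))\<^sup>2 \<le> \<delta>\<^sup>2 * (\<Sum>i\<in>UNIV. (L2_norm UNIV (partial_derivative i f))\<^sup>2)"
proof -
  note fs = test_smooth[OF f]
  have fm[measurable]: "f \<in> borel_measurable borel" by (rule smooth_borel'[OF fs])
  have fi: "integrable lebesgue f" by (rule test_integrable[OF f])
  have f2: "integrable lebesgue (\<lambda>x. (f x)\<^sup>2)"
    using test_integrable[OF test_mult(1)[OF f fs]] by (simp add: power2_eq_square)
  have cm[measurable]: "conv (mollifier \<delta>) f \<in> borel_measurable borel"
    by (rule smooth_borel'[OF smooth_conv[OF test_mollifier[OF \<delta>] fi]])
  define G where "G = (\<Sum>i\<in>UNIV. LINT x|lborel. (partial_derivative i f x)\<^sup>2)"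
  have G0: "G \<ge> 0" unfolding G_def by (intro sum_nonneg integral_nonneg_AE) auto
  have Geq: "(\<Sum>i\<in>UNIV. (L2_norm UNIV (partial_derivative i f))\<^sup>2) = G"
    unfolding G_def L2_norm_UNIV using smooth_borel'[OF smooth_partial[OF fs]]
    by (intro sum.cong refl integral_completion) simp
  have "(\<integral>\<^sup>+ x. ennreal ((conv (mollifier \<delta>) f x - f x)\<^sup>2) \<partial>lborel) \<le>
    (\<integral>\<^sup>+ x. (\<integral>\<^sup>+ h. ennreal (mollifier \<delta> h * (f (x + h) - f x)\<^sup>2) \<partial>lborel) \<partial>lborel)"
  proof (rule nn_integral_mono)
    fix x :: "real^'n"
    have i: "integrable lborel (\<lambda>y. mollifier \<delta> (x - y) * (f y - f x)\<^sup>2)"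
      using conv_sq_le(2)[OF \<delta> fi f2, of x "f x"] by (subst (asm) integrable_completion) auto
    have "(conv (mollifier \<delta>) f x - f x)\<^sup>2 \<le> (LINT y|lborel. mollifier \<delta> (x - y) * (f y - f x)\<^sup>2)"
      using conv_sq_le(1)[OF \<delta> fi f2, of x "f x"] by (subst (asm) integral_completion) auto
    then have "ennreal ((conv (mollifier \<delta>) f x - f x)\<^sup>2) \<le> ennreal (LINT y|lborel. mollifier \<delta> (x - y) * (f y - f x)\<^sup>2)"
      by (rule ennreal_leI)
    also have "\<dots> = (\<integral>\<^sup>+ y. ennreal (mollifier \<delta> (x - y) * (f y - f x)\<^sup>2) \<partial>lborel)"
      using i by (intro nn_integral_eq_integral[symmetric]) (auto simp: mollifier_nonneg)
    also have "\<dots> = (\<integral>\<^sup>+ h. ennreal (mollifier \<delta> (x - (x + h)) * (f (x + h) - f x)\<^sup>2) \<partial>lborel)"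
      by (rule nn_integral_translate[symmetric]) measurable
    also have "\<dots> = (\<integral>\<^sup>+ h. ennreal (mollifier \<delta> h * (f (x + h) - f x)\<^sup>2) \<partial>lborel)"
      using mollifier_minus[of \<delta> "0 :: real^'n"] by simp
    finally show "ennreal ((conv (mollifier \<delta>) f x - f x)\<^sup>2) \<le> (\<integral>\<^sup>+ h. ennreal (mollifier \<delta> h * (f (x + h) - f x)\<^sup>2) \<partial>lborel)" .
  qed
  also have "\<dots> = (\<integral>\<^sup>+ h. (\<integral>\<^sup>+ x. ennreal (mollifier \<delta> h * (f (x + h) - f x)\<^sup>2) \<partial>lborel) \<partial>lborel)"
    by (rule lborel_pair.Fubini') measurable
  also have "\<dots> \<le> (\<integral>\<^sup>+ h. ennreal (\<delta>\<^sup>2 * G) * ennreal (mollifier \<delta> (0 - h :: real^'n)) \<partial>lborel)"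
  proof (rule nn_integral_mono)
    fix h :: "real^'n"
    have "(\<integral>\<^sup>+ x. ennreal (mollifier \<delta> h * (f (x + h) - f x)\<^sup>2) \<partial>lborel) = ennreal (mollifier \<delta> h) * (\<integral>\<^sup>+ x. ennreal ((f (x + h) - f x)\<^sup>2) \<partial>lborel)"
      by (subst nn_integral_cmult[symmetric]) (auto simp: ennreal_mult mollifier_nonneg)
    also have "\<dots> \<le> ennreal (mollifier \<delta> h) * ennreal ((norm h)\<^sup>2 * G)"
      unfolding G_def by (intro mult_left_mono translation_estimate f) auto
    also have "\<dots> \<le> ennreal (mollifier \<delta> h) * ennreal (\<delta>\<^sup>2 * G)"
    proof (cases "norm h < \<delta>")
      case True
      then have "(norm h)\<^sup>2 \<le> \<delta>\<^sup>2" by (intro power_mono) auto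
      then show ?thesis using G0 by (intro mult_left_mono ennreal_leI mult_right_mono) auto
    qed (use mollifier_outside[OF \<delta>, of h] in simp)
    finally show "(\<integral>\<^sup>+ x. ennreal (mollifier \<delta> h * (f (x + h) - f x)\<^sup>2) \<partial>lborel) \<le> ennreal (\<delta>\<^sup>2 * G) * ennreal (mollifier \<delta> (0 - h))"
      using mollifier_minus[of \<delta> 0 h] by (simp add: mult.commute)
  qed
  also have "\<dots> = ennreal (\<delta>\<^sup>2 * G) * (\<integral>\<^sup>+ h. ennreal (mollifier \<delta> (0 - h :: real^'n)) \<partial>lborel)"
    by (rule nn_integral_cmult) measurable
  also have "\<dots> = ennreal (\<delta>\<^sup>2 * G)" by (simp only: mollifier_shift(3)[OF \<delta>] mult_1_right)
  finally have le: "(\<integral>\<^sup>+ x. ennreal ((conv (mollifier \<delta>) f x - f x)\<^sup>2) \<partial>lborel) \<le> ennreal (\<delta>\<^sup>2 * G)" .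
  have "integrable lborel (\<lambda>x. (conv (mollifier \<delta>) f x - f x)\<^sup>2)"
    using le by (intro integrableI_bounded) (auto simp: less_top[symmetric] top_unique)
  then have "ennreal (LINT x|lborel. (conv (mollifier \<delta>) f x - f x)\<^sup>2) \<le> ennreal (\<delta>\<^sup>2 * G)"
    using le by (subst nn_integral_eq_integral[symmetric]) auto
  then have "(LINT x|lborel. (conv (mollifier \<delta>) f x - f x)\<^sup>2) \<le> \<delta>\<^sup>2 * G"
    using G0 by (simp add: ennreal_le_iff)
  then show ?thesis
    unfolding Geq unfolding L2_norm_UNIV by (subst integral_completion) auto
qed

text \<open>Transfer from test functions by density: \<open>?w\<close>, a mollification of
  \<open>\<phi> * u\<close> at an auxiliary scale \<open>\<epsilon>\<close>, is a test function, and
  its partial derivatives are mollifications of \<open>cut_grad\<close>, which by Young's bound have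
  no larger norm.\<close>

lemma mollify_estimate:
  fixes \<Omega> :: "(real^'n) set"
  assumes \<Omega>: "open \<Omega>" and u: "u \<in> H1 \<Omega>" and \<phi>: "\<phi> \<in> test_functions \<Omega>" and \<delta>: "0 < \<delta>"
  shows "L2_norm UNIV (\<lambda>x. conv (mollifier \<delta>) (\<lambda>x. \<phi> x * u x) x - \<phi> x * u x) \<le>
    \<delta> * sqrt (\<Sum>i\<in>UNIV. (L2_norm \<Omega> (cut_grad \<Omega> \<phi> u i))\<^sup>2)"
proof (rule field_le_epsilon)
  let ?v = "\<lambda>x. \<phi> x * u x"
  let ?S = "\<Sum>i\<in>UNIV. (L2_norm \<Omega> (cut_grad \<Omega> \<phi> u i))\<^sup>2"
  fix e :: real assume e: "e > 0"
  have "(e / 2)\<^sup>2 > 0" using e by simp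
  from mollify_cut_approx[OF \<Omega> u \<phi> this] obtain \<epsilon> where \<epsilon>: "\<epsilon> > 0" and t: "conv (mollifier \<epsilon>) ?v \<in> test_functions \<Omega>"
    and 1: "(LINT x|lebesgue. (conv (mollifier \<epsilon>) ?v x - ?v x)\<^sup>2) < (e / 2)\<^sup>2" by blast
  let ?w = "conv (mollifier \<epsilon>) ?v"
  note cL = cut_L2[OF \<Omega> u \<phi>]
  note tU = test_UNIV[OF t]
  have w: "?w \<in> L2 UNIV" "integrable lebesgue ?w" using test_L2[OF open_UNIV tU] test_integrable[OF tU] by auto
  have d: "(\<lambda>x. ?v x - ?w x) \<in> L2 UNIV" "integrable lebesgue (\<lambda>x. ?v x - ?w x)" using L2_diff[OF cL(3) w(1)] cL(5) w(2) by auto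
  have b0: "L2_norm UNIV (\<lambda>x. ?v x - ?w x) \<le> e / 2"
    by (rule power2_le_imp_le) (use 1 e in \<open>auto simp: L2_norm_UNIV power2_commute less_imp_le\<close>)
  have b1: "L2_norm UNIV (conv (mollifier \<delta>) (\<lambda>x. ?v x - ?w x)) \<le> e / 2"
  proof -
    have "L2_norm UNIV (conv (mollifier \<delta>) (\<lambda>x. ?v x - ?w x)) \<le> L2_norm UNIV (\<lambda>x. ?v x - ?w x)"
      by (rule power2_le_imp_le) (use Young_L2(2)[OF \<delta> d(2,1)] in \<open>auto simp: L2_norm_UNIV\<close>)
    with b0 show ?thesis by simp
  qed
  have b2: "L2_norm UNIV (\<lambda>x. conv (mollifier \<delta>) ?w x - ?w x) \<le> \<delta> * sqrt ?S"
  proof (rule power2_le_imp_le)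
    have "(L2_norm UNIV (\<lambda>x. conv (mollifier \<delta>) ?w x - ?w x))\<^sup>2 \<le> \<delta>\<^sup>2 * (\<Sum>i\<in>UNIV. (L2_norm UNIV (partial_derivative i ?w))\<^sup>2)"
      by (rule test_mollify_estimate[OF tU \<delta>])
    also have "\<dots> \<le> \<delta>\<^sup>2 * ?S"
    proof (intro mult_left_mono sum_mono)
      fix i
      have "(L2_norm UNIV (partial_derivative i ?w))\<^sup>2 \<le> (L2_norm UNIV (cut_grad \<Omega> \<phi> u i))\<^sup>2"
        using Young_L2(2)[OF \<epsilon> cL(6,4)] by (simp add: partial_mollify[OF \<Omega> u \<phi> \<epsilon>] L2_norm_UNIV)
      also have "L2_norm UNIV (cut_grad \<Omega> \<phi> u i) = L2_norm \<Omega> (cut_grad \<Omega> \<phi> u i)"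
        by (rule L2_extend(2)[OF \<Omega> cL(2)]) (simp add: cut_grad_def test_outside[OF \<phi>] test_outside[OF test_partial[OF \<phi>]])
      finally show "(L2_norm UNIV (partial_derivative i ?w))\<^sup>2 \<le> (L2_norm \<Omega> (cut_grad \<Omega> \<phi> u i))\<^sup>2" .
    qed simp
    also have "\<dots> = (\<delta> * sqrt ?S)\<^sup>2" by (simp add: power_mult_distrib sum_nonneg)
    finally show "(L2_norm UNIV (\<lambda>x. conv (mollifier \<delta>) ?w x - ?w x))\<^sup>2 \<le> (\<delta> * sqrt ?S)\<^sup>2" .
  qed (use \<delta> in \<open>simp add: sum_nonneg\<close>)
  have c: "conv (mollifier \<delta>) (\<lambda>x. ?v x - ?w x) \<in> L2 UNIV" "conv (mollifier \<delta>) ?w \<in> L2 UNIV"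
    by (intro Young_L2 \<delta> d w)+
  have "(\<lambda>x. conv (mollifier \<delta>) ?v x - ?v x) =
    (\<lambda>x. (conv (mollifier \<delta>) (\<lambda>x. ?v x - ?w x) x + (conv (mollifier \<delta>) ?w x - ?w x)) + (- 1) *\<^sub>R (?v x - ?w x))"
    by (simp add: conv_diff[OF test_mollifier[OF \<delta>] cL(5) w(2)])
  then have "L2_norm UNIV (\<lambda>x. conv (mollifier \<delta>) ?v x - ?v x) \<le>
     L2_norm UNIV (\<lambda>x. conv (mollifier \<delta>) (\<lambda>x. ?v x - ?w x) x + (conv (mollifier \<delta>) ?w x - ?w x)) + L2_norm UNIV (\<lambda>x. (- 1) *\<^sub>R (?v x - ?w x))"
    using L2_norm_triangle[OF L2_add[OF c(1) L2_diff[OF c(2) w(1)]] L2_scale[OF d(1), of "-1"]] by simp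
  also have "\<dots> \<le> (L2_norm UNIV (conv (mollifier \<delta>) (\<lambda>x. ?v x - ?w x)) + L2_norm UNIV (\<lambda>x. conv (mollifier \<delta>) ?w x - ?w x)) + L2_norm UNIV (\<lambda>x. ?v x - ?w x)"
    using L2_norm_triangle[OF c(1) L2_diff[OF c(2) w(1)]] L2_norm_scale[OF d(1), of "-1"] by simp
  also have "\<dots> \<le> \<delta> * sqrt ?S + e" using b0 b1 b2 by simp
  finally show "L2_norm UNIV (\<lambda>x. conv (mollifier \<delta>) ?v x - ?v x) \<le> \<delta> * sqrt ?S + e" .
qed

text \<open>At a fixed scale the value at \<open>x\<close> is the pairing of \<open>z n\<close> with
  a fixed \<open>L2\<close> function, so it tends to 0; a bound uniform in \<open>n\<close> and
  \<open>x\<close> and a common compact support permit dominated convergence.\<close>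

lemma conv_weakly_null:
  fixes \<Omega> :: "(real^'n) set"
  assumes \<Omega>: "open \<Omega>" and z: "weakly_converges_H1 \<Omega> z (\<lambda>_. 0)" and \<phi>: "\<phi> \<in> test_functions \<Omega>" and \<delta>: "0 < \<delta>"
  shows "(\<lambda>n. L2_norm UNIV (conv (mollifier \<delta>) (\<lambda>x. \<phi> x * z n x))) \<longlonglongrightarrow> 0"
proof -
  have \<Omega>m: "\<Omega> \<in> sets lebesgue" using \<Omega> by (simp add: borel_open)
  note zH = weakD(1)[OF z]
  obtain C where C: "C > 0" "\<And>n. H1_norm \<Omega> (z n) \<le> C" using weak_bounded[OF \<Omega> z] by blast
  obtain K where K: "compact K" "K \<subseteq> \<Omega>" "\<And>x. x \<notin> K \<Longrightarrow> \<phi> x = 0"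
    by (rule test_functionsE[OF \<phi>]) blast
  obtain M where M: "M > 0" "\<And>x :: real^'n. \<bar>mollifier \<delta> x\<bar> \<le> M" using test_bounded[OF test_mollifier[OF \<delta>]] by blast
  define F where "F n = conv (mollifier \<delta>) (\<lambda>x. \<phi> x * z n x)" for n
  have h: "(\<lambda>y. \<phi> y * mollifier \<delta> (x - y)) \<in> L2 \<Omega>" for x
    by (rule test_L2[OF \<Omega> test_mult(1)[OF \<phi> smooth_mollifier_shift]])
  have Feq: "F n x = (LINT y|lebesgue_on \<Omega>. z n y * (\<phi> y * mollifier \<delta> (x - y)))" for n x
    unfolding F_def conv_def using test_outside[OF \<phi>]
    by (subst lebesgue_on_outside(1)[OF \<Omega>m]) (auto simp: mult_ac)
  have pt: "(\<lambda>n. F n x) \<longlonglongrightarrow> 0" for x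
    unfolding Feq using weakD(3)[OF z dual_L2[OF \<Omega> h[of x]]] by simp
  define B where "B = C * (M * L2_norm \<Omega> \<phi>)"
  have bd: "\<bar>F n x\<bar> \<le> B" for n x
  proof -
    have "\<bar>F n x\<bar> \<le> L2_norm \<Omega> (z n) * L2_norm \<Omega> (\<lambda>y. \<phi> y * mollifier \<delta> (x - y))"
      unfolding Feq using L2_Cauchy_Schwarz[OF H1D(1)[OF \<Omega> zH] h] by simp
    also have "\<dots> \<le> C * (M * L2_norm \<Omega> \<phi>)"
    proof (intro mult_mono)
      show "L2_norm \<Omega> (z n) \<le> C" using H1_norm_ge(1)[of \<Omega> "z n"] C(2)[of n] by simp
      show "L2_norm \<Omega> (\<lambda>y. \<phi> y * mollifier \<delta> (x - y)) \<le> M * L2_norm \<Omega> \<phi>"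
      proof (rule L2_norm_mono[OF test_L2[OF \<Omega> \<phi>] L2_measurable[OF h]])
        show "AE y in lebesgue_on \<Omega>. norm (\<phi> y * mollifier \<delta> (x - y)) \<le> M * norm (\<phi> y)"
          using M(2) by (intro AE_I2) (simp add: abs_mult mult.commute[of M], intro mult_left_mono, auto)
      qed (use M in simp)
    qed (use C in auto)
    finally show ?thesis by (simp add: B_def)
  qed
  define L where "L = (\<Union>y\<in>K. cball y \<delta>)"
  have L: "compact L" unfolding L_def by (rule compact_Union_cball[OF K(1)])
  have out: "F n x = 0" if "x \<notin> L" for n x
    unfolding F_def by (rule conv_outside[OF \<delta>, of K]) (use K that in \<open>force simp: L_def dist_commute\<close>)+
  have Fm[measurable]: "F n \<in> borel_measurable lebesgue" for n
    unfolding F_def using smooth_borel'[OF smooth_conv[OF test_mollifier[OF \<delta>] cut_L2(5)[OF \<Omega> zH \<phi>]]]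
    by (simp add: measurable_completion)
  have "(\<lambda>n. LINT x|lebesgue. (F n x)\<^sup>2) \<longlonglongrightarrow> (LINT x::real^'n|lebesgue. 0)"
  proof (rule integral_dominated_convergence[where w = "\<lambda>x. B\<^sup>2 * indicator L x"])
    show "integrable lebesgue (\<lambda>x. B\<^sup>2 * indicator L x)"
      using lmeasurable_compact[OF L] by (intro integrable_mult_right) (auto simp: lmeasurable_iff_integrable)
    show "AE x in lebesgue. (\<lambda>n. (F n x)\<^sup>2) \<longlonglongrightarrow> 0"
      using tendsto_power[OF pt, of _ 2] by simp
    show "AE x in lebesgue. norm ((F n x)\<^sup>2) \<le> B\<^sup>2 * indicator L x" for n
    proof (rule AE_I2)
      fix x
      have "\<bar>F n x\<bar> \<le> \<bar>B\<bar>" using bd[of n x] by linarith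
      then have "(F n x)\<^sup>2 \<le> B\<^sup>2" by (simp add: abs_le_square_iff)
      then show "norm ((F n x)\<^sup>2) \<le> B\<^sup>2 * indicator L x" using out[of x n] by (cases "x \<in> L") auto
    qed
  qed auto
  then have "(\<lambda>n. sqrt (LINT x|lebesgue. (F n x)\<^sup>2)) \<longlonglongrightarrow> sqrt 0" by (intro tendsto_real_sqrt) simp
  then show ?thesis by (simp add: L2_norm_def lebesgue_on_UNIV_eq F_def)
qed

text \<open>The mollification error of \<open>\<phi> * z n\<close> is of order
  \<open>\<delta>\<close> uniformly in \<open>n\<close>, and at a fixed \<open>\<delta>\<close> the
  mollifications vanish in the limit. The cutoff \<open>\<phi>\<close> makes the argument local, and
  since the weak limit is known the whole sequence converges.\<close>

lemma Rellich:
  fixes \<Omega> :: "(real^'n) set"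
  assumes \<Omega>: "open \<Omega>" and z: "weakly_converges_H1 \<Omega> z (\<lambda>_. 0)" and \<phi>: "\<phi> \<in> test_functions \<Omega>"
  shows "(\<lambda>n. L2_norm \<Omega> (\<lambda>x. \<phi> x * z n x)) \<longlonglongrightarrow> 0"
proof (rule LIMSEQ_I)
  fix e :: real assume e: "e > 0"
  note zH = weakD(1)[OF z]
  obtain B where B: "B > 0" "\<And>n. H1_norm \<Omega> (z n) \<le> B" using weak_bounded[OF \<Omega> z] by blast
  obtain C where C: "C > 0" "\<And>u. u \<in> H1 \<Omega> \<Longrightarrow> (\<Sum>i\<in>UNIV. (L2_norm \<Omega> (cut_grad \<Omega> \<phi> u i))\<^sup>2) \<le> (C * H1_norm \<Omega> u)\<^sup>2"
    using H1_mult_test_bound[OF \<Omega> \<phi>] by blast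
  \<comment> \<open>\<open>C * B\<close> bounds the gradients of all \<open>\<phi> * z n\<close>, so
    this scale keeps the mollification error at most \<open>e / 2\<close>.\<close>
  define \<delta> where "\<delta> = e / (2 * (C * B))"
  have \<delta>: "\<delta> > 0" "\<delta> * (C * B) = e / 2" using e B C by (auto simp: \<delta>_def)
  have "\<forall>\<^sub>F n in sequentially. L2_norm UNIV (conv (mollifier \<delta>) (\<lambda>x. \<phi> x * z n x)) < e / 2"
    using conv_weakly_null[OF \<Omega> z \<phi> \<delta>(1)] by (rule order_tendstoD) (use e in auto)
  then obtain N where N: "\<And>n. n \<ge> N \<Longrightarrow> L2_norm UNIV (conv (mollifier \<delta>) (\<lambda>x. \<phi> x * z n x)) < e / 2"
    by (auto simp: eventually_sequentially)
  have "L2_norm \<Omega> (\<lambda>x. \<phi> x * z n x) < e" if n: "n \<ge> N" for n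
  proof -
    let ?v = "\<lambda>x. \<phi> x * z n x"
    note cL = cut_L2[OF \<Omega> zH[of n] \<phi>]
    have c: "conv (mollifier \<delta>) ?v \<in> L2 UNIV" by (rule Young_L2[OF \<delta>(1) cL(5,3)])
    have "L2_norm UNIV (\<lambda>x. conv (mollifier \<delta>) ?v x - ?v x) \<le> \<delta> * sqrt (\<Sum>i\<in>UNIV. (L2_norm \<Omega> (cut_grad \<Omega> \<phi> (z n) i))\<^sup>2)"
      by (rule mollify_estimate[OF \<Omega> zH \<phi> \<delta>(1)])
    also have "\<dots> \<le> \<delta> * (C * B)"
    proof (intro mult_left_mono)
      have "sqrt (\<Sum>i\<in>UNIV. (L2_norm \<Omega> (cut_grad \<Omega> \<phi> (z n) i))\<^sup>2) \<le> sqrt ((C * H1_norm \<Omega> (z n))\<^sup>2)"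
        by (intro real_sqrt_le_mono C zH)
      also have "\<dots> \<le> C * B" using C(1) mult_left_mono[OF B(2)[of n], of C] by (simp add: abs_mult)
      finally show "sqrt (\<Sum>i\<in>UNIV. (L2_norm \<Omega> (cut_grad \<Omega> \<phi> (z n) i))\<^sup>2) \<le> C * B" .
    qed (use \<delta> in simp)
    finally have 1: "L2_norm UNIV (\<lambda>x. conv (mollifier \<delta>) ?v x - ?v x) \<le> e / 2" using \<delta> by simp
    have "?v = (\<lambda>x. conv (mollifier \<delta>) ?v x + (- 1) *\<^sub>R (conv (mollifier \<delta>) ?v x - ?v x))" by simp
    then have "L2_norm UNIV ?v \<le> L2_norm UNIV (conv (mollifier \<delta>) ?v) + L2_norm UNIV (\<lambda>x. (- 1) *\<^sub>R (conv (mollifier \<delta>) ?v x - ?v x))"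
      using L2_norm_triangle[OF c L2_scale[OF L2_diff[OF c cL(3)], of "-1"]] by simp
    also have "\<dots> < e" using 1 N[OF n] L2_norm_scale[OF L2_diff[OF c cL(3)], of "-1"] by simp
    also have "L2_norm UNIV ?v = L2_norm \<Omega> ?v"
      by (rule L2_extend(2)[OF \<Omega> cL(1)]) (simp add: test_outside[OF \<phi>])
    finally show ?thesis .
  qed
  then show "\<exists>N. \<forall>n\<ge>N. norm (L2_norm \<Omega> (\<lambda>x. \<phi> x * z n x) - 0) < e" by (intro exI[of _ N]) auto
qed

subsection \<open>Energy estimates\<close>

lemma matrix_vector_measurable:
  fixes A :: "'a \<Rightarrow> real^'n^'m" and g :: "'a \<Rightarrow> real^'n"
  assumes "A \<in> borel_measurable M" "g \<in> borel_measurable M"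
  shows "(\<lambda>x. A x *v g x) \<in> borel_measurable M"
proof (rule borel_measurable_continuous_Pair[OF assms])
  show "continuous_on UNIV (\<lambda>p. (fst p :: real^'n^'m) *v snd p)"
    unfolding matrix_vector_mult_def by (intro continuous_intros)
qed

lemma coefficient_matricesD:
  assumes "A \<in> coefficient_matrices \<alpha> \<beta> \<Omega>"
  shows "A \<in> borel_measurable (lebesgue_on \<Omega>)"
    "\<And>x \<xi> \<eta>. x \<in> \<Omega> \<Longrightarrow> (A x *v \<xi>) \<bullet> \<eta> = (A x *v \<eta>) \<bullet> \<xi>"
    "AE x in lebesgue_on \<Omega>. \<forall>\<xi>. (A x *v \<xi>) \<bullet> \<xi> \<ge> \<alpha> * (norm \<xi>)\<^sup>2 \<and> norm (A x *v \<xi>) \<le> \<beta> * norm \<xi>"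
proof -
  show "A \<in> borel_measurable (lebesgue_on \<Omega>)"
    "AE x in lebesgue_on \<Omega>. \<forall>\<xi>. (A x *v \<xi>) \<bullet> \<xi> \<ge> \<alpha> * (norm \<xi>)\<^sup>2 \<and> norm (A x *v \<xi>) \<le> \<beta> * norm \<xi>"
    using assms by (auto simp: coefficient_matrices_def)
  fix x \<xi> \<eta> assume "x \<in> \<Omega>"
  then have t: "transpose (A x) = A x" using assms by (auto simp: coefficient_matrices_def)
  have "(A x *v \<eta>) \<bullet> \<xi> = \<xi> \<bullet> (A x *v \<eta>)" by (rule inner_commute)
  also have "\<dots> = (\<xi> v* A x) \<bullet> \<eta>" by (rule dot_lmul_matrix[symmetric])
  also have "\<xi> v* A x = A x *v \<xi>" using transpose_matrix_vector[of "A x" \<xi>] by (simp add: t)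
  finally show "(A x *v \<xi>) \<bullet> \<eta> = (A x *v \<eta>) \<bullet> \<xi>" by simp
qed

lemma coefficient_L2:
  assumes A: "A \<in> coefficient_matrices \<alpha> \<beta> \<Omega>" and g: "g \<in> L2 \<Omega>"
  shows "(\<lambda>x. A x *v g x) \<in> L2 \<Omega>"
    "0 \<le> \<beta> \<Longrightarrow> L2_norm \<Omega> (\<lambda>x. A x *v g x) \<le> \<beta> * L2_norm \<Omega> g"
proof -
  have m: "(\<lambda>x. A x *v g x) \<in> borel_measurable (lebesgue_on \<Omega>)"
    by (intro matrix_vector_measurable coefficient_matricesD(1)[OF A] L2_measurable[OF g])
  have b: "AE x in lebesgue_on \<Omega>. norm (A x *v g x) \<le> \<beta> * norm (g x)"
    using coefficient_matricesD(3)[OF A] by eventually_elim blast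
  show "(\<lambda>x. A x *v g x) \<in> L2 \<Omega>" by (rule L2_norm_le[OF g m b])
  show "0 \<le> \<beta> \<Longrightarrow> L2_norm \<Omega> (\<lambda>x. A x *v g x) \<le> \<beta> * L2_norm \<Omega> g" by (rule L2_norm_mono[OF g m _ b])
qed

lemma test_inner_integrable:
  assumes "f \<in> L2 \<Omega>" "g \<in> L2 \<Omega>" "smooth \<phi>" "\<And>x. \<bar>\<phi> x\<bar> \<le> M"
  shows "integrable (lebesgue_on \<Omega>) (\<lambda>x. \<phi> x * (f x \<bullet> g x))"
  using L2_inner_integrable[OF L2_mult_bounded[OF assms(1) smooth_borel[OF assms(3)] assms(4)] assms(2)]
  by simp

lemma test_inner_integrable':
  assumes "f \<in> L2 \<Omega>" "g \<in> L2 \<Omega>" "\<phi> \<in> test_functions \<Omega>'"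
  shows "integrable (lebesgue_on \<Omega>) (\<lambda>x. \<phi> x * (f x \<bullet> g x))"
  using test_bounded[OF assms(3)] test_inner_integrable[OF assms(1,2) test_smooth[OF assms(3)]] by blast

text \<open>A weak substitute for local strong convergence of the divergence of
  \<open>A n *v U n\<close> in the negative norm: pairings with gradients of weakly null sequences
  vanish in the limit. The weight \<open>\<phi>\<close> stands outside the gradient, so it can
  absorb a smooth factor of \<open>U\<close>, and the notion makes sense for fields that are not
  gradients.\<close>

definition flux_test :: "(real^'n) set \<Rightarrow> (nat \<Rightarrow> real^'n \<Rightarrow> real^'n^'n) \<Rightarrow> (nat \<Rightarrow> real^'n \<Rightarrow> real^'n) \<Rightarrow> bool" where
  "flux_test \<Omega> A U \<longleftrightarrow> (\<forall>n. U n \<in> L2 \<Omega>) \<and>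
     (\<forall>\<phi>\<in>test_functions \<Omega>. \<forall>z. weakly_converges_H1 \<Omega> z (\<lambda>_. 0) \<longrightarrow>
        (\<lambda>n. LINT x|lebesgue_on \<Omega>. \<phi> x * ((A n x *v U n x) \<bullet> weak_gradient \<Omega> (z n) x)) \<longlonglongrightarrow> 0)"

text \<open>A class of vector fields that contains the gradients of all test sequences and, unlike the
  gradients themselves, is a module over the bounded smooth functions.\<close>
definition grad_like :: "(real^'n) set \<Rightarrow> (nat \<Rightarrow> real^'n \<Rightarrow> real^'n^'n) \<Rightarrow> (nat \<Rightarrow> real^'n \<Rightarrow> real^'n) \<Rightarrow> (real^'n \<Rightarrow> real^'n) \<Rightarrow> bool" where
  "grad_like \<Omega> A U W \<longleftrightarrow> flux_test \<Omega> A U \<and> W \<in> L2 \<Omega> \<and>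
     (\<forall>h\<in>L2 \<Omega>. (\<lambda>n. LINT x|lebesgue_on \<Omega>. U n x \<bullet> h x) \<longlonglongrightarrow> (LINT x|lebesgue_on \<Omega>. W x \<bullet> h x)) \<and>
     (\<forall>V. flux_test \<Omega> A V \<longrightarrow> (\<forall>\<phi>\<in>test_functions \<Omega>.
        (\<lambda>n. LINT x|lebesgue_on \<Omega>. \<phi> x * ((A n x *v V n x) \<bullet> (U n x - W x))) \<longlonglongrightarrow> 0))"

lemma flux_testD:
  assumes "flux_test \<Omega> A U"
  shows "\<And>n. U n \<in> L2 \<Omega>" "\<And>\<phi> z. \<phi> \<in> test_functions \<Omega> \<Longrightarrow> weakly_converges_H1 \<Omega> z (\<lambda>_. 0) \<Longrightarrow>
        (\<lambda>n. LINT x|lebesgue_on \<Omega>. \<phi> x * ((A n x *v U n x) \<bullet> weak_gradient \<Omega> (z n) x)) \<longlonglongrightarrow> 0"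
  using assms by (auto simp: flux_test_def)

lemma grad_likeD:
  assumes "grad_like \<Omega> A U W"
  shows "flux_test \<Omega> A U" "\<And>n. U n \<in> L2 \<Omega>" "W \<in> L2 \<Omega>"
    "\<And>h. h \<in> L2 \<Omega> \<Longrightarrow> (\<lambda>n. LINT x|lebesgue_on \<Omega>. U n x \<bullet> h x) \<longlonglongrightarrow> (LINT x|lebesgue_on \<Omega>. W x \<bullet> h x)"
    "\<And>V \<phi>. flux_test \<Omega> A V \<Longrightarrow> \<phi> \<in> test_functions \<Omega> \<Longrightarrow>
        (\<lambda>n. LINT x|lebesgue_on \<Omega>. \<phi> x * ((A n x *v V n x) \<bullet> (U n x - W x))) \<longlonglongrightarrow> 0"
  using assms by (auto simp: grad_like_def flux_test_def)

text \<open>A smooth factor \<open>c\<close> moves into the test function, as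
  \<open>\<phi> * c\<close> is again a test function. The bound on \<open>c\<close> keeps the
  products square integrable, since \<open>c\<close> itself may lack compact support.\<close>

lemma grad_like_add:
  assumes \<Omega>: "open \<Omega>" and A: "\<And>n. A n \<in> coefficient_matrices \<alpha> \<beta> \<Omega>"
    and U: "grad_like \<Omega> A U W" and V: "grad_like \<Omega> A V X" and c: "smooth c" "\<And>x. \<bar>c x\<bar> \<le> M"
  shows "grad_like \<Omega> A (\<lambda>n x. U n x + c x *\<^sub>R V n x) (\<lambda>x. W x + c x *\<^sub>R X x)"
proof -
  note u = grad_likeD[OF U] and v = grad_likeD[OF V]
  have cL: "(\<lambda>x. c x *\<^sub>R f x) \<in> L2 \<Omega>" if "f \<in> L2 \<Omega>" for f :: "real^'a \<Rightarrow> real^'a"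
    by (rule L2_mult_bounded[OF that smooth_borel[OF c(1)] c(2)])
  note AL = coefficient_L2(1)[OF A]
  show ?thesis
    unfolding grad_like_def
  proof (intro conjI allI ballI impI)
    show "(\<lambda>x. W x + c x *\<^sub>R X x) \<in> L2 \<Omega>" by (intro L2_add cL u v)
    show "flux_test \<Omega> A (\<lambda>n x. U n x + c x *\<^sub>R V n x)"
      unfolding flux_test_def
    proof (intro conjI allI ballI impI)
      show "(\<lambda>x. U n x + c x *\<^sub>R V n x) \<in> L2 \<Omega>" for n by (intro L2_add cL u v)
      fix \<phi> z assume \<phi>: "\<phi> \<in> test_functions \<Omega>" and z: "weakly_converges_H1 \<Omega> z (\<lambda>_. 0)"
      note zg = H1D(2)[OF \<Omega> weakD(1)[OF z]]
      note \<phi>c = test_mult(1)[OF \<phi> c(1)]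
      have "(LINT x|lebesgue_on \<Omega>. \<phi> x * ((A n x *v (U n x + c x *\<^sub>R V n x)) \<bullet> weak_gradient \<Omega> (z n) x)) =
        (LINT x|lebesgue_on \<Omega>. \<phi> x * ((A n x *v U n x) \<bullet> weak_gradient \<Omega> (z n) x)) +
        (LINT x|lebesgue_on \<Omega>. (\<phi> x * c x) * ((A n x *v V n x) \<bullet> weak_gradient \<Omega> (z n) x))" for n
      proof -
        have "\<phi> x * ((A n x *v (U n x + c x *\<^sub>R V n x)) \<bullet> weak_gradient \<Omega> (z n) x) =
          \<phi> x * ((A n x *v U n x) \<bullet> weak_gradient \<Omega> (z n) x) + (\<phi> x * c x) * ((A n x *v V n x) \<bullet> weak_gradient \<Omega> (z n) x)" for x
          by (simp add: matrix_vector_right_distrib matrix_vector_mult_scaleR inner_add_left algebra_simps)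
        then show ?thesis
          using test_inner_integrable'[OF AL[OF u(2)] zg \<phi>, of n n] test_inner_integrable'[OF AL[OF v(2)] zg \<phi>c, of n n]
          by simp
      qed
      then show "(\<lambda>n. LINT x|lebesgue_on \<Omega>. \<phi> x * ((A n x *v (U n x + c x *\<^sub>R V n x)) \<bullet> weak_gradient \<Omega> (z n) x)) \<longlonglongrightarrow> 0"
        using tendsto_add[OF flux_testD(2)[OF u(1) \<phi> z] flux_testD(2)[OF v(1) \<phi>c z]] by simp
    qed
  next
    fix h :: "real^'a \<Rightarrow> real^'a" assume h: "h \<in> L2 \<Omega>"
    have split: "(LINT x|lebesgue_on \<Omega>. (f x + c x *\<^sub>R g x) \<bullet> h x) = (LINT x|lebesgue_on \<Omega>. f x \<bullet> h x) + (LINT x|lebesgue_on \<Omega>. g x \<bullet> (c x *\<^sub>R h x))"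
      if "f \<in> L2 \<Omega>" "g \<in> L2 \<Omega>" for f g :: "real^'a \<Rightarrow> real^'a"
      using L2_inner_integrable[OF that(1) h] L2_inner_integrable[OF that(2) cL[OF h]] by (simp add: inner_add_left)
    show "(\<lambda>n. LINT x|lebesgue_on \<Omega>. (U n x + c x *\<^sub>R V n x) \<bullet> h x) \<longlonglongrightarrow> (LINT x|lebesgue_on \<Omega>. (W x + c x *\<^sub>R X x) \<bullet> h x)"
      unfolding split[OF u(2) v(2)] split[OF u(3) v(3)] by (intro tendsto_add u(4) v(4) h cL)
  next
    fix Y \<phi> assume Y: "flux_test \<Omega> A Y" and \<phi>: "\<phi> \<in> test_functions \<Omega>"
    note \<phi>c = test_mult(1)[OF \<phi> c(1)] and y = flux_testD(1)[OF Y]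
    have "(LINT x|lebesgue_on \<Omega>. \<phi> x * ((A n x *v Y n x) \<bullet> (U n x + c x *\<^sub>R V n x - (W x + c x *\<^sub>R X x)))) =
      (LINT x|lebesgue_on \<Omega>. \<phi> x * ((A n x *v Y n x) \<bullet> (U n x - W x))) +
      (LINT x|lebesgue_on \<Omega>. (\<phi> x * c x) * ((A n x *v Y n x) \<bullet> (V n x - X x)))" for n
    proof -
      have "\<phi> x * ((A n x *v Y n x) \<bullet> (U n x + c x *\<^sub>R V n x - (W x + c x *\<^sub>R X x))) =
        \<phi> x * ((A n x *v Y n x) \<bullet> (U n x - W x)) + (\<phi> x * c x) * ((A n x *v Y n x) \<bullet> (V n x - X x))" for x
        by (simp add: inner_add_right inner_diff_right algebra_simps)
      then show ?thesis
        using test_inner_integrable'[OF AL[OF y] L2_diff[OF u(2,3)] \<phi>, of n n] test_inner_integrable'[OF AL[OF y] L2_diff[OF v(2,3)] \<phi>c, of n n]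
        by simp
    qed
    then show "(\<lambda>n. LINT x|lebesgue_on \<Omega>. \<phi> x * ((A n x *v Y n x) \<bullet> (U n x + c x *\<^sub>R V n x - (W x + c x *\<^sub>R X x)))) \<longlonglongrightarrow> 0"
      using tendsto_add[OF u(5)[OF Y \<phi>] v(5)[OF Y \<phi>c]] by simp
  qed
qed

lemma grad_like_zero:
  assumes \<Omega>: "open \<Omega>" and A: "\<And>n. A n \<in> coefficient_matrices \<alpha> \<beta> \<Omega>"
  shows "grad_like \<Omega> A (\<lambda>n x. 0) (\<lambda>x. 0)"
  by (auto simp: grad_like_def flux_test_def L2_zero)

lemma grad_like_sum:
  assumes \<Omega>: "open \<Omega>" and A: "\<And>n. A n \<in> coefficient_matrices \<alpha> \<beta> \<Omega>"
    and U: "\<And>i. grad_like \<Omega> A (U i) (W i)" and c: "\<And>i. smooth (c i)" "\<And>i x. \<bar>c i x\<bar> \<le> M i" and I: "finite I"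
  shows "grad_like \<Omega> A (\<lambda>n x. \<Sum>i\<in>I. c i x *\<^sub>R U i n x) (\<lambda>x. \<Sum>i\<in>I. c i x *\<^sub>R W i x)"
  using I
proof induction
  case empty
  show ?case using grad_like_zero[OF \<Omega> A] by simp
next
  case (insert i I)
  then show ?case
    using grad_like_add[OF \<Omega> A insert.IH U c(1) c(2), of i] by (simp add: add.commute)
qed

text \<open>Expanding the nonnegative \<open>(A (U - W)) \<bullet> (U - W)\<close> shows that
  \<open>(A U) \<bullet> U\<close> is at most
  \<open>2 * ((A U) \<bullet> (U - W)) + (A W) \<bullet> W\<close>. The mixed term vanishes in the
  limit by the definition of \<open>grad_like\<close> with \<open>V = U\<close>. Ellipticity bounds
  the left side below by \<open>\<alpha>\<close> times the energy of \<open>U\<close>, and the last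
  term is at most \<open>\<beta>\<close> times that of \<open>W\<close>.\<close>

lemma energy_estimate:
  assumes A: "\<And>n. A n \<in> coefficient_matrices \<alpha> \<beta> \<Omega>" and U: "grad_like \<Omega> A U W" and \<alpha>: "0 < \<alpha>"
    and \<phi>: "\<phi> \<in> test_functions \<Omega>" "\<And>x. 0 \<le> \<phi> x" and e: "0 < e"
  shows "\<forall>\<^sub>F n in sequentially. (LINT x|lebesgue_on \<Omega>. \<phi> x * (norm (U n x))\<^sup>2) \<le>
     \<beta> / \<alpha> * (LINT x|lebesgue_on \<Omega>. \<phi> x * (norm (W x))\<^sup>2) + e"
proof -
  note u = grad_likeD[OF U]
  note AL = coefficient_L2(1)[OF A]
  have pair: "integrable (lebesgue_on \<Omega>) (\<lambda>x. \<phi> x * ((A n x *v f x) \<bullet> g x))" if "f \<in> L2 \<Omega>" "g \<in> L2 \<Omega>" for f g n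
    by (rule test_inner_integrable'[OF AL[OF that(1)] that(2) \<phi>(1)])
  have sq: "integrable (lebesgue_on \<Omega>) (\<lambda>x. \<phi> x * (norm (f x))\<^sup>2)" if "f \<in> L2 \<Omega>" for f :: "real^'a \<Rightarrow> real^'a"
    using test_inner_integrable'[OF that that \<phi>(1)] by (simp add: power2_norm_eq_inner)
  define d where "d n = (LINT x|lebesgue_on \<Omega>. \<phi> x * ((A n x *v U n x) \<bullet> (U n x - W x)))" for n
  have d0: "d \<longlonglongrightarrow> 0" unfolding d_def by (rule u(5)[OF u(1) \<phi>(1)])
  have main: "\<alpha> * (LINT x|lebesgue_on \<Omega>. \<phi> x * (norm (U n x))\<^sup>2) \<le> 2 * d n + \<beta> * (LINT x|lebesgue_on \<Omega>. \<phi> x * (norm (W x))\<^sup>2)" for n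
  proof -
    have "(LINT x|lebesgue_on \<Omega>. \<alpha> * (\<phi> x * (norm (U n x))\<^sup>2)) \<le>
      (LINT x|lebesgue_on \<Omega>. 2 * (\<phi> x * ((A n x *v U n x) \<bullet> (U n x - W x))) + \<beta> * (\<phi> x * (norm (W x))\<^sup>2))"
    proof (rule integral_mono_AE)
      show "AE x in lebesgue_on \<Omega>. \<alpha> * (\<phi> x * (norm (U n x))\<^sup>2) \<le> 2 * (\<phi> x * ((A n x *v U n x) \<bullet> (U n x - W x))) + \<beta> * (\<phi> x * (norm (W x))\<^sup>2)"
        using coefficient_matricesD(3)[OF A[of n]] AE_space
      proof eventually_elim
        case (elim x)
        let ?B = "\<lambda>a b. (A n x *v a) \<bullet> b"
        have s: "?B (U n x) (W x) = ?B (W x) (U n x)" using elim(2) by (intro coefficient_matricesD(2)[OF A[of n]]) simp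
        have e: "\<alpha> * (norm \<xi>)\<^sup>2 \<le> ?B \<xi> \<xi>" "norm (A n x *v \<xi>) \<le> \<beta> * norm \<xi>" for \<xi> using elim(1) by blast+
        have "0 \<le> \<alpha> * (norm (U n x - W x))\<^sup>2" using \<alpha> by simp
        also have "\<dots> \<le> ?B (U n x - W x) (U n x - W x)" by (rule e)
        also have "\<dots> = ?B (U n x) (U n x) - 2 * ?B (U n x) (W x) + ?B (W x) (W x)"
          using s by (simp add: matrix_vector_mult_diff_distrib inner_diff_left inner_diff_right)
        finally have 1: "?B (U n x) (U n x) \<le> 2 * ?B (U n x) (U n x - W x) + ?B (W x) (W x)"
          by (simp add: inner_diff_right)
        have "?B (W x) (W x) \<le> norm (A n x *v W x) * norm (W x)" by (rule norm_cauchy_schwarz)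
        also have "\<dots> \<le> \<beta> * norm (W x) * norm (W x)" by (intro mult_right_mono e) simp
        finally have "?B (W x) (W x) \<le> \<beta> * (norm (W x))\<^sup>2" by (simp add: power2_eq_square mult.assoc)
        with 1 e(1)[of "U n x"] have "\<alpha> * (norm (U n x))\<^sup>2 \<le> 2 * ?B (U n x) (U n x - W x) + \<beta> * (norm (W x))\<^sup>2" by linarith
        from mult_left_mono[OF this \<phi>(2)[of x]] show ?case by (simp add: algebra_simps)
      qed
    qed (use pair[OF u(2) L2_diff[OF u(2,3)]] sq[OF u(2)] sq[OF u(3)] in auto)
    then show ?thesis
      using pair[OF u(2) L2_diff[OF u(2,3)], of n n n] sq[OF u(3)] by (simp add: d_def)
  qed
  have "\<forall>\<^sub>F n in sequentially. d n < \<alpha> * e / 2" using d0 by (rule order_tendstoD) (use e \<alpha> in simp)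
  then show ?thesis
  proof eventually_elim
    case (elim n)
    then have "\<alpha> * (LINT x|lebesgue_on \<Omega>. \<phi> x * (norm (U n x))\<^sup>2) \<le> \<alpha> * (\<beta> / \<alpha> * (LINT x|lebesgue_on \<Omega>. \<phi> x * (norm (W x))\<^sup>2) + e)"
      using main[of n] \<alpha> by (simp add: distrib_left)
    then show ?case using \<alpha> by (simp only: mult_le_cancel_left_pos)
  qed
qed

text \<open>Weak lower semicontinuity of the weighted norm, from \<open>2 * (U \<bullet> W) - (norm
  W)\<^sup>2 \<le> (norm U)\<^sup>2\<close>: the left side is affine in \<open>U\<close> and passes
  to the weak limit.\<close>

lemma energy_lower:
  assumes U: "grad_like \<Omega> A U W" and \<phi>: "\<phi> \<in> test_functions \<Omega>" "\<And>x. 0 \<le> \<phi> x" and e: "0 < e"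
  shows "\<forall>\<^sub>F n in sequentially. (LINT x|lebesgue_on \<Omega>. \<phi> x * (norm (W x))\<^sup>2) - e \<le> (LINT x|lebesgue_on \<Omega>. \<phi> x * (norm (U n x))\<^sup>2)"
proof -
  note u = grad_likeD[OF U]
  obtain M where M: "\<And>x. \<bar>\<phi> x\<bar> \<le> M" using test_bounded[OF \<phi>(1)] by blast
  have h: "(\<lambda>x. \<phi> x *\<^sub>R W x) \<in> L2 \<Omega>" by (rule L2_mult_bounded[OF u(3) smooth_borel[OF test_smooth[OF \<phi>(1)]] M])
  have sq: "integrable (lebesgue_on \<Omega>) (\<lambda>x. \<phi> x * (norm (f x))\<^sup>2)" if "f \<in> L2 \<Omega>" for f :: "real^'a \<Rightarrow> real^'a"
    using test_inner_integrable'[OF that that \<phi>(1)] by (simp add: power2_norm_eq_inner)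
  let ?N = "LINT x|lebesgue_on \<Omega>. \<phi> x * (norm (W x))\<^sup>2"
  have "(\<lambda>n. LINT x|lebesgue_on \<Omega>. U n x \<bullet> (\<phi> x *\<^sub>R W x)) \<longlonglongrightarrow> (LINT x|lebesgue_on \<Omega>. W x \<bullet> (\<phi> x *\<^sub>R W x))"
    by (rule u(4)[OF h])
  then have "(\<lambda>n. LINT x|lebesgue_on \<Omega>. U n x \<bullet> (\<phi> x *\<^sub>R W x)) \<longlonglongrightarrow> ?N" by (simp add: power2_norm_eq_inner)
  then have "\<forall>\<^sub>F n in sequentially. ?N - e / 2 < (LINT x|lebesgue_on \<Omega>. U n x \<bullet> (\<phi> x *\<^sub>R W x))"
    by (rule order_tendstoD) (use e in simp)
  then show ?thesis
  proof eventually_elim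
    case (elim n)
    have "(LINT x|lebesgue_on \<Omega>. 2 * (U n x \<bullet> (\<phi> x *\<^sub>R W x)) - \<phi> x * (norm (W x))\<^sup>2) \<le> (LINT x|lebesgue_on \<Omega>. \<phi> x * (norm (U n x))\<^sup>2)"
    proof (rule integral_mono_AE[OF _ sq[OF u(2)] AE_I2])
      show "integrable (lebesgue_on \<Omega>) (\<lambda>x. 2 * (U n x \<bullet> (\<phi> x *\<^sub>R W x)) - \<phi> x * (norm (W x))\<^sup>2)"
        using sq[OF u(3)] L2_inner_integrable[OF u(2) h] by (intro Bochner_Integration.integrable_diff integrable_mult_right) auto
      fix x
      have "0 \<le> \<phi> x * (norm (U n x - W x))\<^sup>2" using \<phi>(2) by simp
      then show "2 * (U n x \<bullet> (\<phi> x *\<^sub>R W x)) - \<phi> x * (norm (W x))\<^sup>2 \<le> \<phi> x * (norm (U n x))\<^sup>2"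
        by (simp add: power2_norm_eq_inner inner_diff_left inner_diff_right inner_commute algebra_simps)
    qed
    then have "2 * (LINT x|lebesgue_on \<Omega>. U n x \<bullet> (\<phi> x *\<^sub>R W x)) - ?N \<le> (LINT x|lebesgue_on \<Omega>. \<phi> x * (norm (U n x))\<^sup>2)"
      using sq[OF u(3)] L2_inner_integrable[OF u(2) h, of n] by simp
    with elim show ?case by linarith
  qed
qed

lemma weak_diff:
  assumes \<Omega>: "open \<Omega>" and u: "weakly_converges_H1 \<Omega> u w"
  shows "weakly_converges_H1 \<Omega> (\<lambda>n x. u n x - w x) (\<lambda>_. 0)"
  unfolding weakly_converges_H1_def weakly_converges_def
proof (intro conjI allI ballI)
  note U = weakD[OF u]
  show "(\<lambda>x. u n x - w x) \<in> H1 \<Omega>" for n by (rule gradient_diff(1)[OF \<Omega> U(1,2)])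
  show "(\<lambda>_. 0) \<in> H1 \<Omega>" by (rule H1_zero[OF \<Omega>])
  fix l assume l: "l \<in> dual_space (H1 \<Omega>) (H1_norm \<Omega>)"
  then have add: "\<And>f g. f \<in> H1 \<Omega> \<Longrightarrow> g \<in> H1 \<Omega> \<Longrightarrow> l (\<lambda>x. f x + g x) = l f + l g"
    and sc: "\<And>c f. f \<in> H1 \<Omega> \<Longrightarrow> l (\<lambda>x. c * f x) = c * l f" by (auto simp: dual_space_def)
  have "l (\<lambda>x. u n x - w x) = l (u n) - l w" for n
    using add[OF U(1) H1_scale[OF \<Omega> U(2), of "-1"], of n] sc[OF U(2), of "-1"] by simp
  moreover have "l (\<lambda>_. 0) = 0" using sc[OF H1_zero[OF \<Omega>], of 0] by simp
  ultimately show "(\<lambda>n. l (\<lambda>x. u n x - w x)) \<longlonglongrightarrow> l (\<lambda>_. 0)"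
    using tendsto_diff[OF U(3)[OF l] tendsto_const[of "l w"]] by simp
qed

text \<open>For a gradient field the equation need only be tested against \<open>\<phi> * z n\<close>: the commutator term
  \<open>z n * grad \<phi>\<close> vanishes in the limit by Rellich's theorem.\<close>
lemma grad_like_gradient:
  assumes \<Omega>: "open \<Omega>" and A: "\<And>n. A n \<in> coefficient_matrices \<alpha> \<beta> \<Omega>" and \<beta>: "0 \<le> \<beta>"
    and u: "weakly_converges_H1 \<Omega> u w"
    and eq: "\<And>\<phi> z. \<phi> \<in> test_functions \<Omega> \<Longrightarrow> weakly_converges_H1 \<Omega> z (\<lambda>_. 0) \<Longrightarrow>
      (\<lambda>n. LINT x|lebesgue_on \<Omega>. (A n x *v weak_gradient \<Omega> (u n) x) \<bullet> weak_gradient \<Omega> (\<lambda>x. \<phi> x * z n x) x) \<longlonglongrightarrow> 0"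
  shows "grad_like \<Omega> A (\<lambda>n. weak_gradient \<Omega> (u n)) (weak_gradient \<Omega> w)"
proof -
  note uH = weakD(1)[OF u] and wH = weakD(2)[OF u]
  note ug = H1D(2)[OF \<Omega> uH] and wg = H1D(2)[OF \<Omega> wH]
  note AL = coefficient_L2[OF A]
  have f: "flux_test \<Omega> A (\<lambda>n. weak_gradient \<Omega> (u n))"
    unfolding flux_test_def
  proof (intro conjI allI ballI impI ug)
    fix \<phi> z assume \<phi>: "\<phi> \<in> test_functions \<Omega>" and z: "weakly_converges_H1 \<Omega> z (\<lambda>_. 0)"
    note zH = weakD(1)[OF z]
    obtain C where C: "C > 0" "\<And>n. H1_norm \<Omega> (u n) \<le> C" using weak_bounded[OF \<Omega> u] by blast
    let ?F = "\<lambda>n x. A n x *v weak_gradient \<Omega> (u n) x"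
    have FL: "?F n \<in> L2 \<Omega>" for n by (rule AL(1)[OF ug])
    have FB: "L2_norm \<Omega> (?F n) \<le> \<beta> * C" for n
    proof -
      have "L2_norm \<Omega> (?F n) \<le> \<beta> * L2_norm \<Omega> (weak_gradient \<Omega> (u n))" by (rule AL(2)[OF ug \<beta>])
      also have "\<dots> \<le> \<beta> * C"
        using order_trans[OF H1_norm_ge(2) C(2)[of n]] \<beta> by (intro mult_left_mono)
      finally show ?thesis .
    qed
    have com: "(\<lambda>n. LINT x|lebesgue_on \<Omega>. ?F n x $ i * (partial_derivative i \<phi> x * z n x)) \<longlonglongrightarrow> 0" for i
    proof (rule Lim_null_comparison)
      show "(\<lambda>n. \<beta> * C * L2_norm \<Omega> (\<lambda>x. partial_derivative i \<phi> x * z n x)) \<longlonglongrightarrow> 0"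
        using tendsto_mult_left[OF Rellich[OF \<Omega> z test_partial[OF \<phi>]], of "\<beta> * C" i] by simp
      show "\<forall>\<^sub>F n in sequentially. norm (LINT x|lebesgue_on \<Omega>. ?F n x $ i * (partial_derivative i \<phi> x * z n x)) \<le>
          \<beta> * C * L2_norm \<Omega> (\<lambda>x. partial_derivative i \<phi> x * z n x)"
      proof (rule always_eventually, rule allI)
        fix n
        note zL = L2_mult_test(1)[OF H1D(1)[OF \<Omega> zH[of n]] test_partial[OF \<phi>], of i]
        have "norm (LINT x|lebesgue_on \<Omega>. ?F n x $ i * (partial_derivative i \<phi> x * z n x)) \<le>
          L2_norm \<Omega> (\<lambda>x. ?F n x $ i) * L2_norm \<Omega> (\<lambda>x. partial_derivative i \<phi> x * z n x)"
          using L2_Cauchy_Schwarz[OF L2_nth[OF FL] zL] by simp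
        also have "L2_norm \<Omega> (\<lambda>x. ?F n x $ i) \<le> 1 * L2_norm \<Omega> (?F n)"
          by (rule L2_norm_mono[OF FL L2_measurable[OF L2_nth[OF FL]]]) (auto simp: component_le_norm_cart)
        finally show "norm (LINT x|lebesgue_on \<Omega>. ?F n x $ i * (partial_derivative i \<phi> x * z n x)) \<le>
          \<beta> * C * L2_norm \<Omega> (\<lambda>x. partial_derivative i \<phi> x * z n x)"
          using FB[of n] by (smt (verit) L2_norm_nonneg mult_right_mono)
      qed
    qed
    have "(LINT x|lebesgue_on \<Omega>. \<phi> x * (?F n x \<bullet> weak_gradient \<Omega> (z n) x)) =
      (LINT x|lebesgue_on \<Omega>. ?F n x \<bullet> weak_gradient \<Omega> (\<lambda>x. \<phi> x * z n x) x) -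
      (\<Sum>i\<in>UNIV. LINT x|lebesgue_on \<Omega>. ?F n x $ i * (partial_derivative i \<phi> x * z n x))" for n
    proof -
      note p = H1_mult_test[OF \<Omega> zH[of n] \<phi>]
      note i1 = test_inner_integrable'[OF FL H1D(2)[OF \<Omega> zH[of n]] \<phi>]
      note i2 = L2_mult_integrable[OF L2_nth[OF FL] L2_mult_test(1)[OF H1D(1)[OF \<Omega> zH[of n]] test_partial[OF \<phi>]]]
      have "(LINT x|lebesgue_on \<Omega>. ?F n x \<bullet> weak_gradient \<Omega> (\<lambda>x. \<phi> x * z n x) x) =
        (LINT x|lebesgue_on \<Omega>. \<phi> x * (?F n x \<bullet> weak_gradient \<Omega> (z n) x) + (\<Sum>i\<in>UNIV. ?F n x $ i * (partial_derivative i \<phi> x * z n x)))"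
      proof (rule integral_cong_AE)
        show "AE x in lebesgue_on \<Omega>. ?F n x \<bullet> weak_gradient \<Omega> (\<lambda>x. \<phi> x * z n x) x =
           \<phi> x * (?F n x \<bullet> weak_gradient \<Omega> (z n) x) + (\<Sum>i\<in>UNIV. ?F n x $ i * (partial_derivative i \<phi> x * z n x))"
          using p(2) by eventually_elim (simp add: inner_vec_def sum_distrib_left sum.distrib[symmetric] algebra_simps)
        show "(\<lambda>x. ?F n x \<bullet> weak_gradient \<Omega> (\<lambda>x. \<phi> x * z n x) x) \<in> borel_measurable (lebesgue_on \<Omega>)"
          using L2_inner_integrable[OF FL H1D(2)[OF \<Omega> p(1)]] by auto
        show "(\<lambda>x. \<phi> x * (?F n x \<bullet> weak_gradient \<Omega> (z n) x) + (\<Sum>i\<in>UNIV. ?F n x $ i * (partial_derivative i \<phi> x * z n x))) \<in> borel_measurable (lebesgue_on \<Omega>)"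
          using i1[of n] i2[of n] by auto
      qed
      then show ?thesis using i1[of n] i2[of n] by simp
    qed
    moreover have "(\<lambda>n. (LINT x|lebesgue_on \<Omega>. ?F n x \<bullet> weak_gradient \<Omega> (\<lambda>x. \<phi> x * z n x) x) -
      (\<Sum>i\<in>UNIV. LINT x|lebesgue_on \<Omega>. ?F n x $ i * (partial_derivative i \<phi> x * z n x))) \<longlonglongrightarrow> 0 - (\<Sum>i\<in>(UNIV::'a set). 0)"
      by (intro tendsto_diff tendsto_sum com eq \<phi> z)
    ultimately show "(\<lambda>n. LINT x|lebesgue_on \<Omega>. \<phi> x * (?F n x \<bullet> weak_gradient \<Omega> (z n) x)) \<longlonglongrightarrow> 0" by simp
  qed
  show ?thesis
    unfolding grad_like_def
  proof (intro conjI allI ballI impI f wg)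
    fix h :: "real^'a \<Rightarrow> real^'a" assume "h \<in> L2 \<Omega>"
    then show "(\<lambda>n. LINT x|lebesgue_on \<Omega>. weak_gradient \<Omega> (u n) x \<bullet> h x) \<longlonglongrightarrow> (LINT x|lebesgue_on \<Omega>. weak_gradient \<Omega> w x \<bullet> h x)"
      using weakD(3)[OF u dual_gradient[OF \<Omega>]] by simp
  next
    fix V \<phi> assume V: "flux_test \<Omega> A V" and \<phi>: "\<phi> \<in> test_functions \<Omega>"
    \<comment> \<open>The difference is the gradient of the weakly null \<open>u n - w\<close>, so
      the property of \<open>V\<close> as a \<open>flux_test\<close> field applies.\<close>
    have "(LINT x|lebesgue_on \<Omega>. \<phi> x * ((A n x *v V n x) \<bullet> (weak_gradient \<Omega> (u n) x - weak_gradient \<Omega> w x))) =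
       (LINT x|lebesgue_on \<Omega>. \<phi> x * ((A n x *v V n x) \<bullet> weak_gradient \<Omega> (\<lambda>x. u n x - w x) x))" for n
    proof (rule integral_cong_AE)
      note d = gradient_diff[OF \<Omega> uH[of n] wH]
      show "AE x in lebesgue_on \<Omega>. \<phi> x * ((A n x *v V n x) \<bullet> (weak_gradient \<Omega> (u n) x - weak_gradient \<Omega> w x)) =
          \<phi> x * ((A n x *v V n x) \<bullet> weak_gradient \<Omega> (\<lambda>x. u n x - w x) x)"
        using d(2) by eventually_elim simp
      show "(\<lambda>x. \<phi> x * ((A n x *v V n x) \<bullet> (weak_gradient \<Omega> (u n) x - weak_gradient \<Omega> w x))) \<in> borel_measurable (lebesgue_on \<Omega>)"
        using test_inner_integrable'[OF AL(1)[OF flux_testD(1)[OF V]] L2_diff[OF ug wg] \<phi>] by blast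
      show "(\<lambda>x. \<phi> x * ((A n x *v V n x) \<bullet> weak_gradient \<Omega> (\<lambda>x. u n x - w x) x)) \<in> borel_measurable (lebesgue_on \<Omega>)"
        using test_inner_integrable'[OF AL(1)[OF flux_testD(1)[OF V]] H1D(2)[OF \<Omega> d(1)] \<phi>] by blast
    qed
    then show "(\<lambda>n. LINT x|lebesgue_on \<Omega>. \<phi> x * ((A n x *v V n x) \<bullet> (weak_gradient \<Omega> (u n) x - weak_gradient \<Omega> w x))) \<longlonglongrightarrow> 0"
      using flux_testD(2)[OF V \<phi> weak_diff[OF \<Omega> u]] by simp
  qed
qed

text \<open>Multiplication by \<open>\<phi>\<close> maps \<open>H1\<close> boundedly into
  \<open>H10\<close>, so a functional controlled only on \<open>H10\<close> becomes one on
  \<open>H1\<close>, where weak convergence can be applied.\<close>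

lemma dual_mult_test:
  fixes l :: "(real^'n \<Rightarrow> real) \<Rightarrow> real"
  assumes \<Omega>: "open \<Omega>" and \<phi>: "\<phi> \<in> test_functions \<Omega>" and l: "l \<in> Hm1 \<Omega>"
  shows "(\<lambda>u. l (\<lambda>x. \<phi> x * u x)) \<in> dual_space (H1 \<Omega>) (H1_norm \<Omega>)"
proof -
  obtain C where C: "C > 0" "\<And>u. u \<in> H1 \<Omega> \<Longrightarrow> H1_norm \<Omega> (\<lambda>x. \<phi> x * u x) \<le> C * H1_norm \<Omega> u"
    using H1_mult_test_bound[OF \<Omega> \<phi>] by blast
  obtain D where D: "\<And>v. v \<in> H10 \<Omega> \<Longrightarrow> \<bar>l v\<bar> \<le> D * H1_norm \<Omega> v" using l unfolding Hm1_def dual_space_def by blast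
  note m = H10_mult_test[OF \<Omega> _ \<phi>]
  have add: "l (\<lambda>x. f x + g x) = l f + l g" if "f \<in> H10 \<Omega>" "g \<in> H10 \<Omega>" for f g
    using l that unfolding Hm1_def dual_space_def by blast
  have sc: "l (\<lambda>x. c * f x) = c * l f" if "f \<in> H10 \<Omega>" for f c
    using l that unfolding Hm1_def dual_space_def by simp
  show ?thesis
  proof (rule dual_H1I)
    show "l (\<lambda>x. \<phi> x * (u x + v x)) = l (\<lambda>x. \<phi> x * u x) + l (\<lambda>x. \<phi> x * v x)" if "u \<in> H1 \<Omega>" "v \<in> H1 \<Omega>" for u v
      using add[OF m[OF that(1)] m[OF that(2)]] by (simp add: distrib_left)
    show "l (\<lambda>x. \<phi> x * (c * u x)) = c * l (\<lambda>x. \<phi> x * u x)" if "u \<in> H1 \<Omega>" for c u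
      using sc[OF m[OF that], of c] by (simp add: mult.left_commute)
    fix u assume u: "u \<in> H1 \<Omega>"
    have "\<bar>l (\<lambda>x. \<phi> x * u x)\<bar> \<le> D * H1_norm \<Omega> (\<lambda>x. \<phi> x * u x)" by (rule D[OF m[OF u]])
    also have "\<dots> \<le> \<bar>D\<bar> * (C * H1_norm \<Omega> u)" using C(2)[OF u] by (intro mult_mono) auto
    finally show "\<bar>l (\<lambda>x. \<phi> x * u x)\<bar> \<le> (\<bar>D\<bar> * C) * H1_norm \<Omega> u" by (simp add: mult.assoc)
  qed
qed

text \<open>\<open>dual_norm\<close> is a supremum over the unit ball of a seminorm: boundedness
  makes that supremum finite, and it also settles the case \<open>N v = 0\<close>, in which
  \<open>v\<close> cannot be normalised.\<close>

lemma dual_norm_bound: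
  assumes v: "v \<in> V" and N: "\<And>f. 0 \<le> N f" and sc: "\<And>c. (\<lambda>x. c *\<^sub>R v x) \<in> V" "\<And>c. N (\<lambda>x. c *\<^sub>R v x) = \<bar>c\<bar> * N v"
    "\<And>c. l (\<lambda>x. c *\<^sub>R v x) = c * l v" and bd: "\<And>f. f \<in> V \<Longrightarrow> \<bar>l f\<bar> \<le> C * N f"
  shows "\<bar>l v\<bar> \<le> dual_norm V N l * N v"
proof (cases "N v = 0")
  case True
  then show ?thesis using bd[OF v] by simp
next
  case False
  then have p: "N v > 0" using N[of v] by simp
  let ?f = "\<lambda>x. (1 / N v) *\<^sub>R v x"
  have "bdd_above ((\<lambda>f. \<bar>l f\<bar>) ` {f \<in> V. N f \<le> 1})"
  proof (rule bdd_aboveI2)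
    fix f assume f: "f \<in> {f \<in> V. N f \<le> 1}"
    show "\<bar>l f\<bar> \<le> \<bar>C\<bar>"
    proof -
      have "\<bar>l f\<bar> \<le> C * N f" using bd f by blast
      also have "\<dots> \<le> \<bar>C\<bar> * 1" using f N by (intro mult_mono) auto
      finally show ?thesis by simp
    qed
  qed
  moreover have "?f \<in> {f \<in> V. N f \<le> 1}" using sc p by simp
  ultimately have "\<bar>l ?f\<bar> \<le> dual_norm V N l" unfolding dual_norm_def by (rule cSUP_upper[rotated])
  moreover have "\<bar>l ?f\<bar> = \<bar>l v\<bar> / N v" unfolding sc(3) using p by (simp add: abs_mult)
  ultimately show ?thesis using p by (simp add: field_simps)
qed

text \<open>The functional is split into its difference from the limit \<open>G\<close> and
  \<open>G\<close> itself: the former is small in norm while \<open>\<phi> * z n\<close> stays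
  bounded, the latter is a fixed functional on a weakly null sequence. The cutoff puts the arguments
  into \<open>H10\<close>.\<close>

lemma strongly_convergent_test:
  assumes \<Omega>: "open \<Omega>" and s: "strongly_convergent_Hm1 \<Omega> (\<lambda>n. neg_div \<Omega> (S n))"
    and \<phi>: "\<phi> \<in> test_functions \<Omega>" and z: "weakly_converges_H1 \<Omega> z (\<lambda>_. 0)"
  shows "(\<lambda>n. LINT x|lebesgue_on \<Omega>. S n x \<bullet> weak_gradient \<Omega> (\<lambda>x. \<phi> x * z n x) x) \<longlonglongrightarrow> 0"
proof -
  obtain G where F: "\<And>n. neg_div \<Omega> (S n) \<in> Hm1 \<Omega>" and G: "G \<in> Hm1 \<Omega>"
    and lim: "(\<lambda>n. dual_norm (H10 \<Omega>) (H1_norm \<Omega>) (\<lambda>v. neg_div \<Omega> (S n) v - G v)) \<longlonglongrightarrow> 0"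
    using s unfolding strongly_convergent_Hm1_def by blast
  note zH = weakD(1)[OF z]
  obtain B where B: "B > 0" "\<And>n. H1_norm \<Omega> (z n) \<le> B" using weak_bounded[OF \<Omega> z] by blast
  obtain C where C: "C > 0" "\<And>u. u \<in> H1 \<Omega> \<Longrightarrow> H1_norm \<Omega> (\<lambda>x. \<phi> x * u x) \<le> C * H1_norm \<Omega> u"
    using H1_mult_test_bound[OF \<Omega> \<phi>] by blast
  define v where "v n = (\<lambda>x. \<phi> x * z n x)" for n
  have vB: "H1_norm \<Omega> (v n) \<le> C * B" for n
    unfolding v_def using order_trans[OF C(2)[OF zH] mult_left_mono[OF B(2)]] C(1) by simp
  have vc: "(\<lambda>x. c *\<^sub>R v n x) = (\<lambda>x. \<phi> x * (c * z n x))" for c n by (simp add: v_def mult.left_commute)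
  have vH: "v n \<in> H10 \<Omega>" for n unfolding v_def by (rule H10_mult_test[OF \<Omega> zH \<phi>])
  have vH1: "v n \<in> H1 \<Omega>" for n using vH by (simp add: H10_def)
  interpret H: semi_hilbert "H1 \<Omega>" "H1_ip \<Omega>" by (rule H1_semi_hilbert[OF \<Omega>])
  have "(\<lambda>n. neg_div \<Omega> (S n) (v n) - G (v n)) \<longlonglongrightarrow> 0"
  proof (rule Lim_null_comparison)
    show "(\<lambda>n. \<bar>dual_norm (H10 \<Omega>) (H1_norm \<Omega>) (\<lambda>v. neg_div \<Omega> (S n) v - G v)\<bar> * (C * B)) \<longlonglongrightarrow> 0"
      using tendsto_mult_right[OF tendsto_rabs_zero[OF lim], of "C * B"] by simp
    show "\<forall>\<^sub>F n in sequentially. norm (neg_div \<Omega> (S n) (v n) - G (v n)) \<le>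
       \<bar>dual_norm (H10 \<Omega>) (H1_norm \<Omega>) (\<lambda>v. neg_div \<Omega> (S n) v - G v)\<bar> * (C * B)"
    proof (rule always_eventually, rule allI)
      fix n
      let ?l = "\<lambda>v. neg_div \<Omega> (S n) v - G v"
      obtain D1 where D1: "\<And>f. f \<in> H10 \<Omega> \<Longrightarrow> \<bar>neg_div \<Omega> (S n) f\<bar> \<le> D1 * H1_norm \<Omega> f"
        using F[of n] unfolding Hm1_def dual_space_def by blast
      obtain D2 where D2: "\<And>f. f \<in> H10 \<Omega> \<Longrightarrow> \<bar>G f\<bar> \<le> D2 * H1_norm \<Omega> f"
        using G unfolding Hm1_def dual_space_def by blast
      have "\<bar>?l (v n)\<bar> \<le> dual_norm (H10 \<Omega>) (H1_norm \<Omega>) ?l * H1_norm \<Omega> (v n)"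
      proof (rule dual_norm_bound[where C = "D1 + D2"])
        show "(\<lambda>x. c *\<^sub>R v n x) \<in> H10 \<Omega>" for c
          unfolding vc by (rule H10_mult_test[OF \<Omega> H1_scale[OF \<Omega> zH] \<phi>])
        show "H1_norm \<Omega> (\<lambda>x. c *\<^sub>R v n x) = \<bar>c\<bar> * H1_norm \<Omega> (v n)" for c
          using H.nm_scale[OF vH1[of n], of c] by (simp add: H1_nm[OF \<Omega>] scaleR_fun_def)
        show "neg_div \<Omega> (S n) (\<lambda>x. c *\<^sub>R v n x) - G (\<lambda>x. c *\<^sub>R v n x) = c * (neg_div \<Omega> (S n) (v n) - G (v n))" for c
        proof -
          have "neg_div \<Omega> (S n) (\<lambda>x. c *\<^sub>R v n x) = c * neg_div \<Omega> (S n) (v n)"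
            using F[of n] vH[of n] unfolding Hm1_def dual_space_def by blast
          moreover have "G (\<lambda>x. c *\<^sub>R v n x) = c * G (v n)"
            using G vH[of n] unfolding Hm1_def dual_space_def by blast
          ultimately show ?thesis by (simp only: right_diff_distrib)
        qed
        show "\<bar>neg_div \<Omega> (S n) f - G f\<bar> \<le> (D1 + D2) * H1_norm \<Omega> f" if "f \<in> H10 \<Omega>" for f
          using D1[OF that] D2[OF that] by (simp add: distrib_right)
      qed (use vH in auto)
      also have "\<dots> \<le> \<bar>dual_norm (H10 \<Omega>) (H1_norm \<Omega>) ?l\<bar> * (C * B)"
        using vB by (intro mult_mono) auto
      finally show "norm (neg_div \<Omega> (S n) (v n) - G (v n)) \<le> \<bar>dual_norm (H10 \<Omega>) (H1_norm \<Omega>) ?l\<bar> * (C * B)" by simp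
    qed
  qed
  moreover have "(\<lambda>n. G (v n)) \<longlonglongrightarrow> 0"
  proof -
    have "(\<lambda>n. G (v n)) \<longlonglongrightarrow> G (\<lambda>x. \<phi> x * 0)"
      unfolding v_def by (rule weakD(3)[OF z dual_mult_test[OF \<Omega> \<phi> G]])
    moreover have "G (\<lambda>x. \<phi> x * 0) = 0"
    proof -
      have "G (\<lambda>x. 0 *\<^sub>R v 0 x) = 0 * G (v 0)" using G vH[of 0] unfolding Hm1_def dual_space_def by blast
      then show ?thesis by simp
    qed
    ultimately show ?thesis by simp
  qed
  ultimately have "(\<lambda>n. neg_div \<Omega> (S n) (v n)) \<longlonglongrightarrow> 0" using tendsto_add by fastforce
  then show ?thesis by (simp add: neg_div_def v_def)
qed

lemma grad_like_test_sequence: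
  assumes \<Omega>: "open \<Omega>" and A: "\<And>n. A n \<in> coefficient_matrices \<alpha> \<beta> \<Omega>" and \<beta>: "0 \<le> \<beta>"
    and u: "weakly_converges_H1 \<Omega> u w" and s: "strongly_convergent_Hm1 \<Omega> (\<lambda>n. neg_div \<Omega> (flux \<Omega> (A n) (u n)))"
  shows "grad_like \<Omega> A (\<lambda>n. weak_gradient \<Omega> (u n)) (weak_gradient \<Omega> w)"
  using strongly_convergent_test[OF \<Omega> s]
  by (intro grad_like_gradient[OF \<Omega> A \<beta> u]) (simp add: flux_def[abs_def])

subsection \<open>Sequences that tend to the coordinate functions\<close>

lemma L2_extend_zero:
  fixes b :: "real^'n \<Rightarrow> real"
  assumes \<Omega>: "open \<Omega>" "bounded \<Omega>" and b: "b \<in> L2 \<Omega>"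
  shows "(\<lambda>x. if x \<in> \<Omega> then b x else 0) \<in> L2 UNIV" "integrable lebesgue (\<lambda>x. if x \<in> \<Omega> then b x else 0)"
proof -
  have "(\<lambda>x. if x \<in> \<Omega> then b x else 0) \<in> borel_measurable (lebesgue_on \<Omega>)"
    using L2_measurable[OF b] by (subst measurable_cong[where g = b]) auto
  then have "(\<lambda>x. if x \<in> \<Omega> then b x else 0) \<in> L2 \<Omega>"
    by (rule L2_cong_AE[OF b]) (auto intro!: AE_I2)
  then show 1: "(\<lambda>x. if x \<in> \<Omega> then b x else 0) \<in> L2 UNIV" by (rule L2_extend[OF \<Omega>(1)]) simp
  show "integrable lebesgue (\<lambda>x. if x \<in> \<Omega> then b x else 0)"
    by (rule L2_UNIV_integrable[OF 1, of "closure \<Omega>"]) (use \<Omega>(2) closure_subset[of \<Omega>] in \<open>auto simp: compact_closure\<close>)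
qed

text \<open>Orthogonality says that mollifications of \<open>b\<close> vanish at centres in
  \<open>Q\<close>; by continuity and density they vanish on the support of a given test function
  once the scale is small. They converge to \<open>b\<close> in \<open>L2\<close>, so the pairing
  with that test function is zero.\<close>

lemma zero_if_orthogonal_mollifiers:
  fixes b :: "real^'n \<Rightarrow> real"
  assumes \<Omega>: "open \<Omega>" "bounded \<Omega>" and b: "b \<in> L2 \<Omega>"
    and Q: "\<And>X. open X \<Longrightarrow> X \<noteq> {} \<Longrightarrow> \<exists>q\<in>Q. q \<in> X"
    and orth: "\<And>q m. q \<in> Q \<Longrightarrow> cball q (inverse (real (Suc m))) \<subseteq> \<Omega> \<Longrightarrow>
      (LINT y|lebesgue_on \<Omega>. b y * mollifier (inverse (real (Suc m))) (q - y)) = 0"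
  shows "AE x in lebesgue_on \<Omega>. b x = 0"
proof (rule zero_if_test_integrals_zero[OF \<Omega>(1) L2_locally_integrable[OF b \<Omega>(1)]])
  fix \<phi> assume \<phi>: "\<phi> \<in> test_functions \<Omega>"
  have \<Omega>m: "\<Omega> \<in> sets lebesgue" using \<Omega> by (simp add: borel_open)
  define b' where "b' x = (if x \<in> \<Omega> then b x else 0)" for x
  have b': "b' \<in> L2 UNIV" "integrable lebesgue b'"
    using L2_extend_zero[OF \<Omega> b] by (simp_all add: b'_def[abs_def])
  have toO: "(LINT y|lebesgue. b' y * g y) = (LINT y|lebesgue_on \<Omega>. b y * g y)" for g :: "real^'n \<Rightarrow> real"
  proof -
    have "(LINT y|lebesgue_on \<Omega>. b' y * g y) = (LINT y|lebesgue. b' y * g y)"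
      by (rule lebesgue_on_outside(1)[OF \<Omega>m]) (simp add: b'_def)
    moreover have "(LINT y|lebesgue_on \<Omega>. b' y * g y) = (LINT y|lebesgue_on \<Omega>. b y * g y)"
      by (rule Bochner_Integration.integral_cong) (auto simp: b'_def)
    ultimately show ?thesis by simp
  qed
  obtain K where K: "compact K" "K \<subseteq> \<Omega>" "\<And>x. x \<notin> K \<Longrightarrow> \<phi> x = 0"
    by (rule test_functionsE[OF \<phi>]) blast
  obtain \<epsilon> where \<epsilon>: "\<epsilon> > 0" "(\<Union>x\<in>K. cball x \<epsilon>) \<subseteq> \<Omega>"
    using compact_subset_open_imp_cball_epsilon_subset[OF K(1) \<Omega>(1) K(2)] by blast
  \<comment> \<open>A centre \<open>q\<close> closer than \<open>?\<delta>\<close> to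
    \<open>x\<close> still has its closed ball of radius \<open>?\<delta>\<close> inside the domain
    when twice this radius is at most \<open>\<epsilon>\<close>.\<close>
  have cz: "conv (mollifier (inverse (real (Suc m)))) b' x = 0"
    if x: "x \<in> K" and m: "2 * inverse (real (Suc m)) \<le> \<epsilon>" for x m
  proof (rule ccontr)
    let ?\<delta> = "inverse (real (Suc m))"
    let ?c = "conv (mollifier ?\<delta>) b'"
    have \<delta>: "?\<delta> > 0" by simp
    assume ne: "?c x \<noteq> 0"
    have "continuous_on UNIV ?c" by (rule smooth_continuous[OF smooth_conv[OF test_mollifier[OF \<delta>] b'(2)]])
    then have "open {y. ?c y \<noteq> 0}" by (rule open_Collect_neq) simp
    then have "open ({y. ?c y \<noteq> 0} \<inter> ball x ?\<delta>)" by (intro open_Int open_ball)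
    moreover have "x \<in> {y. ?c y \<noteq> 0} \<inter> ball x ?\<delta>" using ne \<delta> by simp
    ultimately obtain q where q: "q \<in> Q" "?c q \<noteq> 0" "dist x q < ?\<delta>" using Q by fastforce
    have "cball q ?\<delta> \<subseteq> cball x \<epsilon>"
    proof
      fix y assume "y \<in> cball q ?\<delta>"
      then have "dist q y \<le> ?\<delta>" by simp
      then have "dist x y \<le> 2 * ?\<delta>" using q(3) dist_triangle[of x y q] by linarith
      then show "y \<in> cball x \<epsilon>" using m by simp
    qed
    then have "cball q ?\<delta> \<subseteq> \<Omega>" using \<epsilon>(2) x by blast
    from orth[OF q(1) this] have "?c q = 0" by (simp add: conv_def toO[symmetric] mult.commute)
    with q(2) show False by simp
  qed
  have small: "\<bar>LINT y|lebesgue_on \<Omega>. b y * \<phi> y\<bar> \<le> e * L2_norm UNIV \<phi>" if e: "e > 0" for e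
  proof -
    obtain d where d: "d > 0" "\<And>\<delta>. 0 < \<delta> \<Longrightarrow> \<delta> < d \<Longrightarrow> (LINT x|lebesgue. (conv (mollifier \<delta>) b' x - b' x)\<^sup>2) < e\<^sup>2"
      using mollifier_L2[OF b', of "e\<^sup>2"] e by auto
    obtain m :: nat where m: "inverse (real (Suc m)) < min d (\<epsilon> / 2)"
      using reals_Archimedean[of "min d (\<epsilon> / 2)"] d(1) \<epsilon>(1) by auto
    let ?\<delta> = "inverse (real (Suc m))"
    have \<delta>: "?\<delta> > 0" by simp
    have cL: "conv (mollifier ?\<delta>) b' \<in> L2 UNIV" by (rule Young_L2[OF \<delta> b'(2,1)])
    note dL = L2_diff[OF cL b'(1)]
    have pt: "b' y * \<phi> y = - ((conv (mollifier ?\<delta>) b' y - b' y) * \<phi> y)" for y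
      using cz[of y m] K(3)[of y] m by (cases "y \<in> K") auto
    have "\<bar>LINT y|lebesgue_on \<Omega>. b y * \<phi> y\<bar> = \<bar>LINT y|lebesgue_on UNIV. (conv (mollifier ?\<delta>) b' y - b' y) \<bullet> \<phi> y\<bar>"
      unfolding toO[symmetric] pt by (simp add: lebesgue_on_UNIV_eq)
    also have "\<dots> \<le> L2_norm UNIV (\<lambda>y. conv (mollifier ?\<delta>) b' y - b' y) * L2_norm UNIV \<phi>"
      by (rule L2_Cauchy_Schwarz[OF dL test_L2[OF open_UNIV \<phi>]])
    also have "\<dots> \<le> e * L2_norm UNIV \<phi>"
    proof (rule mult_right_mono)
      show "L2_norm UNIV (\<lambda>y. conv (mollifier ?\<delta>) b' y - b' y) \<le> e"
        by (rule power2_le_imp_le) (use d(2)[of ?\<delta>] m e in \<open>auto simp: L2_norm_UNIV less_imp_le\<close>)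
    qed simp
    finally show ?thesis .
  qed
  have "\<bar>LINT y|lebesgue_on \<Omega>. b y * \<phi> y\<bar> \<le> 0 + e" if e: "e > 0" for e
  proof -
    have "\<bar>LINT y|lebesgue_on \<Omega>. b y * \<phi> y\<bar> \<le> e / (L2_norm UNIV \<phi> + 1) * L2_norm UNIV \<phi>"
      by (rule small) (use e in \<open>simp add: add_nonneg_pos\<close>)
    also have "\<dots> \<le> e"
    proof -
      have "L2_norm UNIV \<phi> + 1 > 0" using L2_norm_nonneg[of UNIV \<phi>] by linarith
      then show ?thesis using e by (simp add: pos_divide_le_eq mult_left_mono)
    qed
    finally show ?thesis by simp
  qed
  then have "\<bar>LINT y|lebesgue_on \<Omega>. b y * \<phi> y\<bar> \<le> 0" by (rule field_le_epsilon)
  then show "(LINT y|lebesgue_on \<Omega>. b y * \<phi> y) = 0" by simp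
qed

text \<open>Separability of \<open>L2\<close> in a form whose approximants remain test functions:
  the generators are mollifiers of radius \<open>1 / (m + 1)\<close> centred at a countable dense
  set, and a function orthogonal to all of them is zero.\<close>

lemma countable_test_dense:
  fixes \<Omega> :: "(real^'n) set"
  assumes \<Omega>: "open \<Omega>" "bounded \<Omega>"
  shows "\<exists>D :: nat \<Rightarrow> real^'n \<Rightarrow> real. (\<forall>k. D k \<in> test_functions \<Omega>) \<and>
    (\<forall>f\<in>L2 \<Omega>. \<forall>e>0. \<exists>d\<in>span (range D). L2_norm \<Omega> (\<lambda>x. f x - d x) < e)"
proof -
  obtain Q :: "(real^'n) set" where Qc: "countable Q" and Q: "\<And>X. open X \<Longrightarrow> X \<noteq> {} \<Longrightarrow> \<exists>q\<in>Q. q \<in> X"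
    using countable_dense_exists by blast
  \<comment> \<open>The zero function keeps the family nonempty, so that
    \<open>from_nat_into\<close> enumerates it even for an empty domain.\<close>
  define S where "S = insert (\<lambda>_. 0) ((\<lambda>(q, m) y. mollifier (inverse (real (Suc m))) (q - y)) `
     {(q, m). q \<in> Q \<and> cball q (inverse (real (Suc m))) \<subseteq> \<Omega>})"
  have "countable (Q \<times> (UNIV :: nat set))" using Qc by simp
  then have "countable {(q, m :: nat). q \<in> Q \<and> cball q (inverse (real (Suc m))) \<subseteq> \<Omega>}"
    by (rule countable_subset[rotated]) auto
  then have Sc: "countable S" by (simp add: S_def)
  have Sne: "S \<noteq> {}" by (simp add: S_def)
  have St: "s \<in> test_functions \<Omega>" if "s \<in> S" for s
    using that unfolding S_def
  proof (elim insertE imageE)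
    assume "s = (\<lambda>_. 0)"
    then show ?thesis by (simp add: test_zero)
  next
    fix p assume p: "s = (\<lambda>(q, m) y. mollifier (inverse (real (Suc m))) (q - y)) p"
      "p \<in> {(q, m). q \<in> Q \<and> cball q (inverse (real (Suc m))) \<subseteq> \<Omega>}"
    then obtain q m where s: "s = (\<lambda>y. mollifier (inverse (real (Suc m))) (q - y))" and sub: "cball q (inverse (real (Suc m))) \<subseteq> \<Omega>"
      by auto
    show ?thesis
      unfolding s
    proof (rule test_functionsI[OF smooth_mollifier_shift compact_cball sub])
      fix y assume "y \<notin> cball q (inverse (real (Suc m)))"
      then show "mollifier (inverse (real (Suc m))) (q - y) = 0"
        by (intro mollifier_outside) (auto simp: dist_norm)
    qed
  qed
  define D where "D = from_nat_into S"
  have rD: "range D = S" unfolding D_def by (rule range_from_nat_into[OF Sne Sc])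
  define K where "K = {f \<in> L2 \<Omega>. \<forall>e>0. \<exists>d\<in>span S. L2_norm \<Omega> (\<lambda>x. f x - d x) < e}"
  have sL: "S \<subseteq> L2 \<Omega>" using St test_L2[OF \<Omega>(1)] by blast
  have spL: "d \<in> L2 \<Omega>" if "d \<in> span S" for d
    using span_minimal[OF sL L2.V_subspace] that by blast
  have nm0: "L2_norm \<Omega> (\<lambda>x. 0 :: real) = 0" by (simp add: L2_norm_def)
  have KL: "K \<subseteq> L2 \<Omega>" by (auto simp: K_def)
  have SK: "s \<in> K" if "s \<in> S" for s
    using that sL span_base[OF that] nm0 by (force simp: K_def intro!: bexI[of _ s])
  have near: "f \<in> K" if f: "f \<in> L2 \<Omega>" and n: "\<And>e. e > 0 \<Longrightarrow> \<exists>g\<in>K. L2_norm \<Omega> (\<lambda>x. f x - g x) < e" for f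
    unfolding K_def
  proof (intro CollectI conjI f allI impI)
    fix e :: real assume "e > 0"
    then have e: "e / 2 > 0" by simp
    from n[OF e] obtain g where g: "g \<in> K" "L2_norm \<Omega> (\<lambda>x. f x - g x) < e / 2" by blast
    then obtain d where d: "d \<in> span S" "L2_norm \<Omega> (\<lambda>x. g x - d x) < e / 2" using e unfolding K_def by blast
    have "L2_norm \<Omega> (\<lambda>x. (f x - g x) + (g x - d x)) \<le> L2_norm \<Omega> (\<lambda>x. f x - g x) + L2_norm \<Omega> (\<lambda>x. g x - d x)"
      using g(1) KL f spL[OF d(1)] by (intro L2_norm_triangle L2_diff) auto
    with g d show "\<exists>d\<in>span S. L2_norm \<Omega> (\<lambda>x. f x - d x) < e" by (intro bexI[of _ d]) auto
  qed
  have closed: "L2.closed_sub \<Omega> K"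
    unfolding L2.closed_sub_def
  proof (intro conjI allI impI KL)
    show "subspace K"
      unfolding subspace_def
    proof (intro conjI ballI allI)
      show "0 \<in> K"
        using SK[of "\<lambda>_. 0"] by (simp add: S_def zero_fun_def)
      fix f g assume fg: "f \<in> K" "g \<in> K"
      show "f + g \<in> K"
        unfolding K_def
      proof (intro CollectI conjI allI impI)
        show "f + g \<in> L2 \<Omega>" using fg KL L2_add[of f \<Omega> g] by (auto simp: plus_fun_def)
        fix e :: real assume "e > 0"
        then have e: "e / 2 > 0" by simp
        obtain d where d: "d \<in> span S" "L2_norm \<Omega> (\<lambda>x. f x - d x) < e / 2" using fg(1) e unfolding K_def by blast
        obtain d' where d': "d' \<in> span S" "L2_norm \<Omega> (\<lambda>x. g x - d' x) < e / 2" using fg(2) e unfolding K_def by blast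
        have "L2_norm \<Omega> (\<lambda>x. (f x - d x) + (g x - d' x)) \<le> L2_norm \<Omega> (\<lambda>x. f x - d x) + L2_norm \<Omega> (\<lambda>x. g x - d' x)"
          using fg KL spL[OF d(1)] spL[OF d'(1)] by (intro L2_norm_triangle L2_diff) auto
        then have "L2_norm \<Omega> (\<lambda>x. (f + g) x - (d + d') x) < e" using d d' by (simp add: algebra_simps)
        then show "\<exists>d\<in>span S. L2_norm \<Omega> (\<lambda>x. (f + g) x - d x) < e" using span_add[OF d(1) d'(1)] by blast
      qed
    next
      fix c f assume f: "f \<in> K"
      show "c *\<^sub>R f \<in> K"
        unfolding K_def
      proof (intro CollectI conjI allI impI)
        show "c *\<^sub>R f \<in> L2 \<Omega>" using f KL L2_scale[of f \<Omega> c] by (auto simp: scaleR_fun_def)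
        fix e :: real assume e: "e > 0"
        then have "e / (\<bar>c\<bar> + 1) > 0" by (simp add: add_nonneg_pos)
        then obtain d where d: "d \<in> span S" "L2_norm \<Omega> (\<lambda>x. f x - d x) < e / (\<bar>c\<bar> + 1)" using f unfolding K_def by blast
        have "L2_norm \<Omega> (\<lambda>x. (c *\<^sub>R f) x - (c *\<^sub>R d) x) = \<bar>c\<bar> * L2_norm \<Omega> (\<lambda>x. f x - d x)"
          using L2_norm_scale[OF L2_diff[of f \<Omega> d], of c] f KL spL[OF d(1)] by (auto simp: right_diff_distrib)
        also have "\<dots> \<le> \<bar>c\<bar> * (e / (\<bar>c\<bar> + 1))" using d by (intro mult_left_mono) auto
        also have "\<dots> < e" using e by (simp add: field_simps add_nonneg_pos)
        finally show "\<exists>d\<in>span S. L2_norm \<Omega> (\<lambda>x. (c *\<^sub>R f) x - d x) < e" using span_scale[OF d(1)] by blast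
      qed
    qed
    fix X f assume X: "\<forall>n. X n \<in> K" and f: "f \<in> L2 \<Omega>" and lim: "(\<lambda>n. L2.nm \<Omega> (X n - f)) \<longlonglongrightarrow> 0"
    show "f \<in> K"
    proof (rule near[OF f])
      fix e :: real assume "e > 0"
      then have "\<forall>\<^sub>F n in sequentially. L2.nm \<Omega> (X n - f) < e" using lim by (intro order_tendstoD)
      then obtain n where "L2.nm \<Omega> (X n - f) < e" by (auto simp: eventually_sequentially)
      then have "L2_norm \<Omega> (\<lambda>x. X n x - f x) < e" unfolding L2_nm by (simp add: fun_diff_def)
      then have "L2_norm \<Omega> (\<lambda>x. f x - X n x) < e" by (simp add: L2_norm_def power2_commute)
      then show "\<exists>g\<in>K. L2_norm \<Omega> (\<lambda>x. f x - g x) < e" using X by blast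
    qed
  qed
  have all: "f \<in> K" if f: "f \<in> L2 \<Omega>" for f
  proof -
    \<comment> \<open>The orthogonal projection of \<open>f\<close> onto the closure
      \<open>K\<close>; the residual is orthogonal to all generators, hence zero almost
      everywhere.\<close>
    have "\<exists>p\<in>K. \<forall>v\<in>K. (LINT x|lebesgue_on \<Omega>. p x \<bullet> v x) = (LINT x|lebesgue_on \<Omega>. f x \<bullet> v x)"
    proof (rule L2.equiv_Riesz[OF closed, of 1 "\<lambda>f g. LINT x|lebesgue_on \<Omega>. f x \<bullet> g x" 1])
      note KLd = subsetD[OF KL]
      fix x y z c assume *: "x \<in> K" "y \<in> K" "z \<in> K"
      show "(LINT xa|lebesgue_on \<Omega>. (x + y) xa \<bullet> z xa) = (LINT xa|lebesgue_on \<Omega>. x xa \<bullet> z xa) + (LINT xa|lebesgue_on \<Omega>. y xa \<bullet> z xa)"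
        by (rule L2.ip_add[OF KLd KLd KLd]) (use * in auto)
      show "(LINT xa|lebesgue_on \<Omega>. (c *\<^sub>R x) xa \<bullet> z xa) = c * (LINT xa|lebesgue_on \<Omega>. x xa \<bullet> z xa)"
        by (rule L2.ip_scale[OF KLd KLd]) (use * in auto)
      show "(LINT xa|lebesgue_on \<Omega>. x xa \<bullet> y xa) = (LINT xa|lebesgue_on \<Omega>. y xa \<bullet> x xa)" by (simp add: mult.commute)
    qed (use f in auto)
    then obtain p where p: "p \<in> K" "\<And>v. v \<in> K \<Longrightarrow> (LINT x|lebesgue_on \<Omega>. p x * v x) = (LINT x|lebesgue_on \<Omega>. f x * v x)" by auto
    have pL: "p \<in> L2 \<Omega>" using p KL by blast
    let ?b = "\<lambda>x. f x - p x"
    have bL: "?b \<in> L2 \<Omega>" by (rule L2_diff[OF f pL])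
    have "AE x in lebesgue_on \<Omega>. ?b x = 0"
    proof (rule zero_if_orthogonal_mollifiers[OF \<Omega> bL Q])
      fix q m assume q: "q \<in> Q" "cball q (inverse (real (Suc m))) \<subseteq> \<Omega>"
      let ?s = "\<lambda>y. mollifier (inverse (real (Suc m))) (q - y)"
      have "?s \<in> S" using q by (auto simp: S_def)
      then have s: "?s \<in> K" "?s \<in> L2 \<Omega>" using SK sL by auto
      show "(LINT y|lebesgue_on \<Omega>. ?b y * ?s y) = 0"
        using p(2)[OF s(1)] L2_mult_integrable[OF f s(2)] L2_mult_integrable[OF pL s(2)] by (simp add: left_diff_distrib)
    qed
    then have "L2_norm \<Omega> ?b = L2_norm \<Omega> (\<lambda>x. 0 :: real)"
      by (rule L2_norm_cong_AE) (use L2_measurable[OF bL] in auto)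
    then show "f \<in> K" using p(1) nm0 by (intro near[OF f] bexI[of _ p]) auto
  qed
  have "\<forall>f\<in>L2 \<Omega>. \<forall>e>0. \<exists>d\<in>span (range D). L2_norm \<Omega> (\<lambda>x. f x - d x) < e"
    using all unfolding rD K_def by blast
  moreover have "\<forall>k. D k \<in> test_functions \<Omega>" using rD St by blast
  ultimately show ?thesis by blast
qed

section \<open>Bounded domains, coordinate functions and Neumann problems\<close>

lemma test_functions_subspace: "subspace (test_functions \<Omega>)"
  using test_zero test_add test_mult(2)[OF _ smooth_const]
  by (auto simp: subspace_def zero_fun_def plus_fun_def scaleR_fun_def)

lemma bounded_L2:
  fixes f :: "real^'n \<Rightarrow> 'b::euclidean_space"
  assumes \<Omega>: "open \<Omega>" "bounded \<Omega>" and f: "f \<in> borel_measurable (lebesgue_on \<Omega>)" "\<And>x. x \<in> \<Omega> \<Longrightarrow> norm (f x) \<le> M"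
  shows "f \<in> L2 \<Omega>"
proof (rule L2_bound[OF f(1)])
  have "\<Omega> \<in> lmeasurable" using \<Omega> by (simp add: bounded_set_imp_lmeasurable borel_open)
  then interpret finite_measure "lebesgue_on \<Omega>" by (rule finite_measure_lebesgue_on)
  show "integrable (lebesgue_on \<Omega>) (\<lambda>x. M\<^sup>2 :: real)" by simp
  show "AE x in lebesgue_on \<Omega>. (norm (f x))\<^sup>2 \<le> M\<^sup>2"
    using f(2) by (intro AE_I2 power_mono) auto
qed

lemma coordinate_H1:
  fixes \<Omega> :: "(real^'n) set"
  assumes \<Omega>: "open \<Omega>" "bounded \<Omega>"
  shows "(\<lambda>x. x $ i) \<in> H1 \<Omega>" "AE x in lebesgue_on \<Omega>. weak_gradient \<Omega> (\<lambda>x. x $ i) x = axis i 1"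
proof -
  obtain M where M: "\<And>x. x \<in> \<Omega> \<Longrightarrow> norm x \<le> M" using \<Omega>(2) by (auto simp: bounded_iff)
  have L: "(\<lambda>x. x $ i) \<in> L2 \<Omega>"
    using M by (intro bounded_L2[OF \<Omega> smooth_borel[OF smooth_nth], where M = M]) (auto intro: order_trans[OF component_le_norm_cart])
  have P: "partial_derivative j (\<lambda>x. x $ i) \<in> L2 \<Omega>" for j
    by (rule bounded_L2[OF \<Omega> smooth_borel[OF smooth_partial[OF smooth_nth]], where M = 1]) (simp add: partial_derivative_nth)
  show "(\<lambda>x. x $ i) \<in> H1 \<Omega>" by (rule H1_smooth(1)[OF \<Omega>(1) smooth_nth L P])
  show "AE x in lebesgue_on \<Omega>. weak_gradient \<Omega> (\<lambda>x. x $ i) x = axis i 1"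
    using H1_smooth(2)[OF \<Omega>(1) smooth_nth L P]
    by eventually_elim (simp add: partial_derivative_nth vec_eq_iff axis_def)
qed

text \<open>The abstract extraction is applied to \<open>a\<close>, the elliptic form plus the
  \<open>L2\<close> product. Ellipticity controls the gradient and the product controls the
  function, which gives coercivity with constant \<open>min \<alpha> 1\<close> for functions without
  any boundary condition.\<close>

lemma coordinate_sequences:
  fixes \<Omega> :: "(real^'n) set" and A :: "nat \<Rightarrow> real^'n \<Rightarrow> real^'n^'n"
  assumes \<Omega>: "open \<Omega>" "bounded \<Omega>" and A: "\<And>n. A n \<in> coefficient_matrices \<alpha> \<beta> \<Omega>" and \<alpha>: "0 < \<alpha>" and \<beta>: "0 \<le> \<beta>"
  shows "\<exists>r F X. strict_mono r \<and> (\<forall>i. F i \<in> H1 \<Omega>) \<and>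
    (\<forall>i::'n. weakly_converges_H1 \<Omega> (X i) (\<lambda>x. x $ i)) \<and>
    (\<forall>i n. \<forall>v\<in>H1 \<Omega>. (LINT x|lebesgue_on \<Omega>. (A (r n) x *v weak_gradient \<Omega> (X i n) x) \<bullet> weak_gradient \<Omega> v x) +
       (LINT x|lebesgue_on \<Omega>. X i n x * v x) = H1_ip \<Omega> (F i) v)"
proof -
  interpret H: semi_hilbert "H1 \<Omega>" "H1_ip \<Omega>" by (rule H1_semi_hilbert[OF \<Omega>(1)])
  define a where "a n u v = (LINT x|lebesgue_on \<Omega>. (A n x *v weak_gradient \<Omega> u x) \<bullet> weak_gradient \<Omega> v x) +
       (LINT x|lebesgue_on \<Omega>. u x * v x)" for n u v
  note g = H1D(2)[OF \<Omega>(1)] and l = H1D(1)[OF \<Omega>(1)]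
  have sym: "(LINT x|lebesgue_on \<Omega>. (A n x *v f x) \<bullet> h x) = (LINT x|lebesgue_on \<Omega>. f x \<bullet> (A n x *v h x))" for n f h
  proof (rule Bochner_Integration.integral_cong[OF refl])
    fix x assume "x \<in> space (lebesgue_on \<Omega>)"
    then have "(A n x *v f x) \<bullet> h x = (A n x *v h x) \<bullet> f x" by (intro coefficient_matricesD(2)[OF A]) simp
    then show "(A n x *v f x) \<bullet> h x = f x \<bullet> (A n x *v h x)" by (simp only: inner_commute)
  qed
  \<comment> \<open>The extraction takes targets indexed by naturals; \<open>from_nat\<close> lists
    the finitely many coordinates.\<close>
  define w where "w j = (\<lambda>x::real^'n. x $ (from_nat j :: 'n))" for j
  have "\<exists>r. strict_mono r \<and> (\<forall>j. \<exists>F\<in>H1 \<Omega>. \<exists>X. (\<forall>n. X n \<in> H1 \<Omega>) \<and>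
           (\<forall>n. \<forall>v\<in>H1 \<Omega>. a (r n) (X n) v = H1_ip \<Omega> F v) \<and> (\<forall>v\<in>H1 \<Omega>. (\<lambda>n. H1_ip \<Omega> (X n) v) \<longlonglongrightarrow> H1_ip \<Omega> (w j) v))"
  proof (rule H.oscillating_solutions[where a = a and w = w and \<alpha> = "min \<alpha> 1" and \<beta> = "max \<beta> 1"])
    show "min \<alpha> 1 > 0" using \<alpha> by simp
    show "w j \<in> H1 \<Omega>" for j unfolding w_def by (rule coordinate_H1[OF \<Omega>])
    fix n :: nat and x y z c assume x: "x \<in> H1 \<Omega>" and z: "z \<in> H1 \<Omega>"
    note Az = coefficient_L2(1)[OF A g[OF z], of n]
    have c: "c *\<^sub>R x = (\<lambda>t. 0 + c * x t)" by (simp add: scaleR_fun_def)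
    have 0: "(LINT t|lebesgue_on \<Omega>. weak_gradient \<Omega> (\<lambda>_. 0) t \<bullet> (A n t *v weak_gradient \<Omega> z t)) = 0"
      using AE_integral_cong_L2[OF g[OF H1_zero[OF \<Omega>(1)]] L2_zero Az gradient_zero[OF \<Omega>(1)]] by simp
    show "a n (c *\<^sub>R x) z = c * a n x z"
      unfolding a_def sym c gradient_integral_linear[OF \<Omega>(1) H1_zero[OF \<Omega>(1)] x Az] 0
      by (simp add: distrib_left mult.assoc)
    show "a n x z = a n z x"
      unfolding a_def by (subst sym) (simp add: inner_commute mult.commute)
    show "a n (x + y) z = a n x z + a n y z" if y: "y \<in> H1 \<Omega>"
    proof -
      have "x + y = (\<lambda>t. x t + 1 * y t)" by (simp add: plus_fun_def)
      then show ?thesis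
        unfolding a_def sym using gradient_integral_linear[OF \<Omega>(1) x y Az, of 1]
          L2_mult_integrable[OF l[OF x] l[OF z]] L2_mult_integrable[OF l[OF y] l[OF z]]
        by (simp add: distrib_right)
    qed
    have i: "integrable (lebesgue_on \<Omega>) (\<lambda>t. (norm (weak_gradient \<Omega> x t))\<^sup>2)" "integrable (lebesgue_on \<Omega>) (\<lambda>t. x t * x t)"
      "integrable (lebesgue_on \<Omega>) (\<lambda>t. (A n t *v weak_gradient \<Omega> x t) \<bullet> weak_gradient \<Omega> x t)"
      using L2_integrable_norm[OF g[OF x]] L2_mult_integrable[OF l[OF x] l[OF x]]
        L2_inner_integrable[OF coefficient_L2(1)[OF A g[OF x]] g[OF x]] by auto
    define N where "N = (LINT t|lebesgue_on \<Omega>. (norm (weak_gradient \<Omega> x t))\<^sup>2)"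
    define P where "P = (LINT t|lebesgue_on \<Omega>. x t * x t)"
    have NP: "N \<ge> 0" "P \<ge> 0" by (auto simp: N_def P_def)
    have ip: "H1_ip \<Omega> x x = P + N" by (simp add: H1_ip_def N_def P_def power2_norm_eq_inner)
    have "\<alpha> * N \<le> (LINT t|lebesgue_on \<Omega>. (A n t *v weak_gradient \<Omega> x t) \<bullet> weak_gradient \<Omega> x t)"
    proof -
      have "(LINT t|lebesgue_on \<Omega>. \<alpha> * (norm (weak_gradient \<Omega> x t))\<^sup>2) \<le> (LINT t|lebesgue_on \<Omega>. (A n t *v weak_gradient \<Omega> x t) \<bullet> weak_gradient \<Omega> x t)"
        using i coefficient_matricesD(3)[OF A[of n]] by (intro integral_mono_AE) (auto elim: eventually_mono)
      then show ?thesis by (simp add: N_def)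
    qed
    moreover have "min \<alpha> 1 * N \<le> \<alpha> * N" "min \<alpha> 1 * P \<le> 1 * P" using NP by (intro mult_right_mono; simp)+
    ultimately show "min \<alpha> 1 * H1_ip \<Omega> x x \<le> a n x x"
      unfolding ip a_def P_def[symmetric] by (simp add: distrib_left)
    have "(LINT t|lebesgue_on \<Omega>. (A n t *v weak_gradient \<Omega> x t) \<bullet> weak_gradient \<Omega> x t) \<le> \<beta> * N"
    proof -
      have "(LINT t|lebesgue_on \<Omega>. (A n t *v weak_gradient \<Omega> x t) \<bullet> weak_gradient \<Omega> x t) \<le> (LINT t|lebesgue_on \<Omega>. \<beta> * (norm (weak_gradient \<Omega> x t))\<^sup>2)"
      proof (rule integral_mono_AE)
        show "AE t in lebesgue_on \<Omega>. (A n t *v weak_gradient \<Omega> x t) \<bullet> weak_gradient \<Omega> x t \<le> \<beta> * (norm (weak_gradient \<Omega> x t))\<^sup>2"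
          using coefficient_matricesD(3)[OF A[of n]]
        proof eventually_elim
          case (elim t)
          let ?g = "weak_gradient \<Omega> x t"
          have "(A n t *v ?g) \<bullet> ?g \<le> norm (A n t *v ?g) * norm ?g" by (rule norm_cauchy_schwarz)
          also have "\<dots> \<le> \<beta> * norm ?g * norm ?g" using elim by (intro mult_right_mono) auto
          finally show ?case by (simp add: power2_eq_square mult.assoc)
        qed
      qed (use i in auto)
      then show ?thesis by (simp add: N_def)
    qed
    moreover have "\<beta> * N \<le> max \<beta> 1 * N" "1 * P \<le> max \<beta> 1 * P" using NP by (intro mult_right_mono; simp)+
    ultimately show "a n x x \<le> max \<beta> 1 * H1_ip \<Omega> x x"
      unfolding ip a_def P_def[symmetric] by (simp add: distrib_left)
  qed
  then obtain r where r: "strict_mono r" "\<forall>j. \<exists>F\<in>H1 \<Omega>. \<exists>X. (\<forall>n. X n \<in> H1 \<Omega>) \<and>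
           (\<forall>n. \<forall>v\<in>H1 \<Omega>. a (r n) (X n) v = H1_ip \<Omega> F v) \<and> (\<forall>v\<in>H1 \<Omega>. (\<lambda>n. H1_ip \<Omega> (X n) v) \<longlonglongrightarrow> H1_ip \<Omega> (w j) v)"
    by blast
  from r(2) obtain F where "\<forall>j. F j \<in> H1 \<Omega> \<and> (\<exists>X. (\<forall>n. X n \<in> H1 \<Omega>) \<and>
           (\<forall>n. \<forall>v\<in>H1 \<Omega>. a (r n) (X n) v = H1_ip \<Omega> (F j) v) \<and> (\<forall>v\<in>H1 \<Omega>. (\<lambda>n. H1_ip \<Omega> (X n) v) \<longlonglongrightarrow> H1_ip \<Omega> (w j) v))"
    unfolding Bex_def choice_iff by blast
  then have FH: "\<And>j. F j \<in> H1 \<Omega>" and "\<forall>j. \<exists>X. (\<forall>n. X n \<in> H1 \<Omega>) \<and>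
           (\<forall>n. \<forall>v\<in>H1 \<Omega>. a (r n) (X n) v = H1_ip \<Omega> (F j) v) \<and> (\<forall>v\<in>H1 \<Omega>. (\<lambda>n. H1_ip \<Omega> (X n) v) \<longlonglongrightarrow> H1_ip \<Omega> (w j) v)"
    by blast+
  then obtain X where X: "\<And>j n. X j n \<in> H1 \<Omega>" "\<And>j n v. v \<in> H1 \<Omega> \<Longrightarrow> a (r n) (X j n) v = H1_ip \<Omega> (F j) v"
    "\<And>j v. v \<in> H1 \<Omega> \<Longrightarrow> (\<lambda>n. H1_ip \<Omega> (X j n) v) \<longlonglongrightarrow> H1_ip \<Omega> (w j) v"
    unfolding choice_iff by blast
  show ?thesis
  proof (intro exI[of _ r] exI[of _ "\<lambda>i. F (to_nat i)"] exI[of _ "\<lambda>i. X (to_nat i)"] conjI allI ballI r FH)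
    fix i :: 'n
    have "w (to_nat i) = (\<lambda>x. x $ i)" by (simp add: w_def)
    then show "weakly_converges_H1 \<Omega> (X (to_nat i)) (\<lambda>x. x $ i)"
      using X(1,3) by (intro weakI_ip[OF \<Omega>(1)] coordinate_H1[OF \<Omega>]) metis+
    fix n v assume "v \<in> H1 \<Omega>"
    then show "(LINT x|lebesgue_on \<Omega>. (A (r n) x *v weak_gradient \<Omega> (X (to_nat i) n) x) \<bullet> weak_gradient \<Omega> v x) +
       (LINT x|lebesgue_on \<Omega>. X (to_nat i) n x * v x) = H1_ip \<Omega> (F (to_nat i)) v"
      using X(2) by (simp add: a_def)
  qed
qed

text \<open>The right side is a fixed functional of the weakly null \<open>\<phi> * z n\<close>, and
  the zero-order term pairs the bounded \<open>u n\<close> with a sequence that tends to 0 strongly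
  in \<open>L2\<close> by Rellich. The flux term must then vanish as well.\<close>

lemma grad_like_solution:
  fixes \<Omega> :: "(real^'n) set"
  assumes \<Omega>: "open \<Omega>" and A: "\<And>n. A n \<in> coefficient_matrices \<alpha> \<beta> \<Omega>" and \<beta>: "0 \<le> \<beta>"
    and u: "weakly_converges_H1 \<Omega> u w" and F: "F \<in> H1 \<Omega>"
    and eq: "\<And>n v. v \<in> H1 \<Omega> \<Longrightarrow> (LINT x|lebesgue_on \<Omega>. (A n x *v weak_gradient \<Omega> (u n) x) \<bullet> weak_gradient \<Omega> v x) +
       (LINT x|lebesgue_on \<Omega>. u n x * v x) = H1_ip \<Omega> F v"
  shows "grad_like \<Omega> A (\<lambda>n. weak_gradient \<Omega> (u n)) (weak_gradient \<Omega> w)"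
proof (rule grad_like_gradient[OF \<Omega> A \<beta> u])
  fix \<phi> z assume \<phi>: "\<phi> \<in> test_functions \<Omega>" and z: "weakly_converges_H1 \<Omega> z (\<lambda>_. 0)"
  interpret H: semi_hilbert "H1 \<Omega>" "H1_ip \<Omega>" by (rule H1_semi_hilbert[OF \<Omega>])
  note zH = weakD(1)[OF z] and uH = weakD(1)[OF u]
  obtain C where C: "C > 0" "\<And>n. H1_norm \<Omega> (u n) \<le> C" using weak_bounded[OF \<Omega> u] by blast
  have vH: "(\<lambda>x. \<phi> x * z n x) \<in> H1 \<Omega>" for n by (rule H1_mult_test(1)[OF \<Omega> zH \<phi>])
  have FHm: "(\<lambda>v. H1_ip \<Omega> v F) \<in> Hm1 \<Omega>"
    using dual_ip[OF \<Omega> F] unfolding Hm1_def dual_space_def by (auto simp: H10_def)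
  have "(\<lambda>n. H1_ip \<Omega> (\<lambda>x. \<phi> x * z n x) F) \<longlonglongrightarrow> H1_ip \<Omega> (\<lambda>x. \<phi> x * 0) F"
    by (rule weakD(3)[OF z dual_mult_test[OF \<Omega> \<phi> FHm]])
  moreover have "H1_ip \<Omega> (\<lambda>x. \<phi> x * 0) F = 0"
    using H.ip_scale[OF H1_zero[OF \<Omega>] F, of 0] by (simp add: zero_fun_def)
  ultimately have 1: "(\<lambda>n. H1_ip \<Omega> F (\<lambda>x. \<phi> x * z n x)) \<longlonglongrightarrow> 0"
    using H.ip_sym[OF F vH] by simp
  have 2: "(\<lambda>n. LINT x|lebesgue_on \<Omega>. u n x * (\<phi> x * z n x)) \<longlonglongrightarrow> 0"
  proof (rule Lim_null_comparison)
    show "(\<lambda>n. C * L2_norm \<Omega> (\<lambda>x. \<phi> x * z n x)) \<longlonglongrightarrow> 0"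
      using tendsto_mult_left[OF Rellich[OF \<Omega> z \<phi>], of C] by simp
    have "norm (LINT x|lebesgue_on \<Omega>. u n x * (\<phi> x * z n x)) \<le> C * L2_norm \<Omega> (\<lambda>x. \<phi> x * z n x)" for n
    proof -
      have "norm (LINT x|lebesgue_on \<Omega>. u n x * (\<phi> x * z n x)) \<le> L2_norm \<Omega> (u n) * L2_norm \<Omega> (\<lambda>x. \<phi> x * z n x)"
        using L2_Cauchy_Schwarz[OF H1D(1)[OF \<Omega> uH] H1D(1)[OF \<Omega> vH]] by simp
      also have "\<dots> \<le> C * L2_norm \<Omega> (\<lambda>x. \<phi> x * z n x)"
        using order_trans[OF H1_norm_ge(1) C(2)] by (intro mult_right_mono) auto
      finally show ?thesis .
    qed
    then show "\<forall>\<^sub>F n in sequentially. norm (LINT x|lebesgue_on \<Omega>. u n x * (\<phi> x * z n x)) \<le> C * L2_norm \<Omega> (\<lambda>x. \<phi> x * z n x)"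
      by simp
  qed
  have "(LINT x|lebesgue_on \<Omega>. (A n x *v weak_gradient \<Omega> (u n) x) \<bullet> weak_gradient \<Omega> (\<lambda>x. \<phi> x * z n x) x) =
    H1_ip \<Omega> F (\<lambda>x. \<phi> x * z n x) - (LINT x|lebesgue_on \<Omega>. u n x * (\<phi> x * z n x))" for n
    using eq[OF vH[of n], of n] by linarith
  then show "(\<lambda>n. LINT x|lebesgue_on \<Omega>. (A n x *v weak_gradient \<Omega> (u n) x) \<bullet> weak_gradient \<Omega> (\<lambda>x. \<phi> x * z n x) x) \<longlonglongrightarrow> 0"
    using tendsto_diff[OF 1 2] by simp
qed

subsection \<open>The effective matrix\<close>

text \<open>The majorant \<open>\<theta>\<close> stands in for \<open>\<bar>\<phi>\<bar>\<close>,
  which may fail to be smooth, while the energy estimates to be inserted for \<open>U\<close> and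
  \<open>V\<close> take test functions as weights.\<close>

lemma pairing_integral:
  fixes b :: real
  assumes B: "B \<in> coefficient_matrices a b \<Omega>" and b: "0 \<le> b" and U: "U \<in> L2 \<Omega>" and V: "V \<in> L2 \<Omega>"
    and \<phi>: "\<phi> \<in> test_functions \<Omega>" and \<theta>: "\<theta> \<in> test_functions \<Omega>" "\<And>x. \<bar>\<phi> x\<bar> \<le> \<theta> x"
  shows "\<bar>LINT x|lebesgue_on \<Omega>. \<phi> x * ((B x *v U x) \<bullet> V x)\<bar> \<le>
    b / 2 * ((LINT x|lebesgue_on \<Omega>. \<theta> x * (norm (U x))\<^sup>2) + (LINT x|lebesgue_on \<Omega>. \<theta> x * (norm (V x))\<^sup>2))"
proof -
  have sq: "integrable (lebesgue_on \<Omega>) (\<lambda>x. \<theta> x * (norm (f x))\<^sup>2)" if "f \<in> L2 \<Omega>" for f :: "real^'a \<Rightarrow> real^'a"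
    using test_inner_integrable'[OF that that \<theta>(1)] by (simp add: power2_norm_eq_inner)
  have "norm (LINT x|lebesgue_on \<Omega>. \<phi> x * ((B x *v U x) \<bullet> V x)) \<le>
    (LINT x|lebesgue_on \<Omega>. b / 2 * (\<theta> x * (norm (U x))\<^sup>2 + \<theta> x * (norm (V x))\<^sup>2))"
  proof (rule integral_norm_bound[THEN order_trans], rule integral_mono_AE)
    show "integrable (lebesgue_on \<Omega>) (\<lambda>x. norm (\<phi> x * ((B x *v U x) \<bullet> V x)))"
      by (intro integrable_norm test_inner_integrable'[OF coefficient_L2(1)[OF B U] V \<phi>])
    show "AE x in lebesgue_on \<Omega>. norm (\<phi> x * ((B x *v U x) \<bullet> V x)) \<le> b / 2 * (\<theta> x * (norm (U x))\<^sup>2 + \<theta> x * (norm (V x))\<^sup>2)"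
      using coefficient_matricesD(3)[OF B]
    proof eventually_elim
      case (elim x)
      have "\<bar>(B x *v U x) \<bullet> V x\<bar> \<le> norm (B x *v U x) * norm (V x)" by (rule Cauchy_Schwarz_ineq2)
      also have "\<dots> \<le> b * norm (U x) * norm (V x)" using elim by (intro mult_right_mono) auto
      also have "\<dots> \<le> b * (((norm (U x))\<^sup>2 + (norm (V x))\<^sup>2) / 2)"
        using sum_squares_bound[of "norm (U x)" "norm (V x)"] b by (simp only: mult.assoc, intro mult_left_mono) auto
      finally have *: "\<bar>(B x *v U x) \<bullet> V x\<bar> \<le> b * (((norm (U x))\<^sup>2 + (norm (V x))\<^sup>2) / 2)" .
      have "\<bar>\<phi> x\<bar> * \<bar>(B x *v U x) \<bullet> V x\<bar> \<le> \<theta> x * (b * (((norm (U x))\<^sup>2 + (norm (V x))\<^sup>2) / 2))"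
        using order_trans[OF abs_ge_zero \<theta>(2)[of x]] by (intro mult_mono \<theta> *) auto
      then show ?case by (simp add: abs_mult algebra_simps)
    qed
  qed (use sq[OF U] sq[OF V] in auto)
  then show ?thesis using sq[OF U] sq[OF V] by simp
qed

text \<open>Expanding the form at \<open>R + S\<close> leaves, by symmetry of \<open>B\<close>, the
  form at \<open>R\<close> and a cross term. Young's inequality with weight \<open>\<kappa>\<close>
  puts the large factor on \<open>R\<close>, which is to be small, and the small factor on
  \<open>S\<close>, which is merely bounded.\<close>

lemma quadratic_difference:
  fixes b :: real
  assumes B: "B \<in> coefficient_matrices a b \<Omega>" and b: "0 \<le> b" and R: "R \<in> L2 \<Omega>" and S: "S \<in> L2 \<Omega>"
    and T: "T \<in> L2 \<Omega>" "AE x in lebesgue_on \<Omega>. T x = R x + S x"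
    and \<phi>: "\<phi> \<in> test_functions \<Omega>" and \<theta>: "\<theta> \<in> test_functions \<Omega>" "\<And>x. \<bar>\<phi> x\<bar> \<le> \<theta> x" and \<kappa>: "0 < \<kappa>"
  shows "\<bar>(LINT x|lebesgue_on \<Omega>. \<phi> x * ((B x *v T x) \<bullet> T x)) - (LINT x|lebesgue_on \<Omega>. \<phi> x * ((B x *v S x) \<bullet> S x))\<bar> \<le>
    b * ((1 + 1 / \<kappa>) * (LINT x|lebesgue_on \<Omega>. \<theta> x * (norm (R x))\<^sup>2) + \<kappa> * (LINT x|lebesgue_on \<Omega>. \<theta> x * (norm (S x))\<^sup>2))"
proof -
  have sq: "integrable (lebesgue_on \<Omega>) (\<lambda>x. \<theta> x * (norm (f x))\<^sup>2)" if "f \<in> L2 \<Omega>" for f :: "real^'a \<Rightarrow> real^'a"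
    using test_inner_integrable'[OF that that \<theta>(1)] by (simp add: power2_norm_eq_inner)
  have p: "integrable (lebesgue_on \<Omega>) (\<lambda>x. \<phi> x * ((B x *v f x) \<bullet> f x))" if "f \<in> L2 \<Omega>" for f
    by (rule test_inner_integrable'[OF coefficient_L2(1)[OF B that] that \<phi>])
  have "norm (LINT x|lebesgue_on \<Omega>. \<phi> x * ((B x *v T x) \<bullet> T x) - \<phi> x * ((B x *v S x) \<bullet> S x)) \<le>
    (LINT x|lebesgue_on \<Omega>. b * ((1 + 1 / \<kappa>) * (\<theta> x * (norm (R x))\<^sup>2) + \<kappa> * (\<theta> x * (norm (S x))\<^sup>2)))"
  proof (rule integral_norm_bound[THEN order_trans], rule integral_mono_AE)
    show "integrable (lebesgue_on \<Omega>) (\<lambda>x. norm (\<phi> x * ((B x *v T x) \<bullet> T x) - \<phi> x * ((B x *v S x) \<bullet> S x)))"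
      by (intro integrable_norm Bochner_Integration.integrable_diff p T S)
    show "AE x in lebesgue_on \<Omega>. norm (\<phi> x * ((B x *v T x) \<bullet> T x) - \<phi> x * ((B x *v S x) \<bullet> S x)) \<le>
       b * ((1 + 1 / \<kappa>) * (\<theta> x * (norm (R x))\<^sup>2) + \<kappa> * (\<theta> x * (norm (S x))\<^sup>2))"
      using coefficient_matricesD(3)[OF B] AE_space T(2)
    proof eventually_elim
      case (elim x)
      have s: "(B x *v S x) \<bullet> R x = (B x *v R x) \<bullet> S x" using elim(2) by (intro coefficient_matricesD(2)[OF B]) simp
      have e: "norm (B x *v R x) \<le> b * norm (R x)" using elim(1) by blast
      have "(B x *v T x) \<bullet> T x - (B x *v S x) \<bullet> S x = (B x *v R x) \<bullet> R x + 2 * ((B x *v R x) \<bullet> S x)"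
        unfolding elim(3) using s by (simp add: matrix_vector_right_distrib inner_add_left inner_add_right)
      also have "\<bar>\<dots>\<bar> \<le> norm (B x *v R x) * norm (R x) + 2 * (norm (B x *v R x) * norm (S x))"
        using Cauchy_Schwarz_ineq2[of "B x *v R x" "R x"] Cauchy_Schwarz_ineq2[of "B x *v R x" "S x"] by linarith
      also have "\<dots> \<le> (b * norm (R x)) * norm (R x) + 2 * ((b * norm (R x)) * norm (S x))"
        by (intro add_mono mult_right_mono mult_left_mono e) auto
      also have "\<dots> = b * ((norm (R x))\<^sup>2 + 2 * norm (R x) * norm (S x))" by (simp add: power2_eq_square algebra_simps)
      also have "\<dots> \<le> b * ((1 + 1 / \<kappa>) * (norm (R x))\<^sup>2 + \<kappa> * (norm (S x))\<^sup>2)"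
      proof (intro mult_left_mono b)
        have "0 \<le> (norm (R x) - \<kappa> * norm (S x))\<^sup>2 / \<kappa>" using \<kappa> by simp
        also have "\<dots> = 1 / \<kappa> * (norm (R x))\<^sup>2 - 2 * norm (R x) * norm (S x) + \<kappa> * (norm (S x))\<^sup>2"
          using \<kappa> by (simp add: power2_eq_square field_simps)
        finally show "(norm (R x))\<^sup>2 + 2 * norm (R x) * norm (S x) \<le> (1 + 1 / \<kappa>) * (norm (R x))\<^sup>2 + \<kappa> * (norm (S x))\<^sup>2"
          by (simp add: distrib_right)
      qed
      finally have *: "\<bar>(B x *v T x) \<bullet> T x - (B x *v S x) \<bullet> S x\<bar> \<le> b * ((1 + 1 / \<kappa>) * (norm (R x))\<^sup>2 + \<kappa> * (norm (S x))\<^sup>2)" .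
      have "\<bar>\<phi> x\<bar> * \<bar>(B x *v T x) \<bullet> T x - (B x *v S x) \<bullet> S x\<bar> \<le> \<theta> x * (b * ((1 + 1 / \<kappa>) * (norm (R x))\<^sup>2 + \<kappa> * (norm (S x))\<^sup>2))"
        using order_trans[OF abs_ge_zero \<theta>(2)[of x]] by (intro mult_mono \<theta> *) auto
      moreover have "norm (\<phi> x * ((B x *v T x) \<bullet> T x) - \<phi> x * ((B x *v S x) \<bullet> S x)) = \<bar>\<phi> x\<bar> * \<bar>(B x *v T x) \<bullet> T x - (B x *v S x) \<bullet> S x\<bar>"
        by (simp add: abs_mult[symmetric] right_diff_distrib)
      ultimately show ?case by (simp add: algebra_simps)
    qed
  qed (use sq[OF R] sq[OF S] in auto)
  then show ?thesis using sq[OF R] sq[OF S] p[OF T(1)] p[OF S] by simp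
qed

text \<open>Energy estimates take nonnegative test functions as weights; a multiple of a cutoff that
  is 1 on the support replaces \<open>\<bar>\<phi>\<bar>\<close> there.\<close>

lemma test_majorant:
  assumes \<Omega>: "open \<Omega>" and \<phi>: "\<phi> \<in> test_functions \<Omega>"
  shows "\<exists>\<theta>\<in>test_functions \<Omega>. \<forall>x. \<bar>\<phi> x\<bar> \<le> \<theta> x"
proof -
  obtain K where K: "compact K" "K \<subseteq> \<Omega>" "\<And>x. x \<notin> K \<Longrightarrow> \<phi> x = 0"
    by (rule test_functionsE[OF \<phi>]) blast
  obtain \<eta> where \<eta>: "\<eta> \<in> test_functions \<Omega>" "\<And>x. 0 \<le> \<eta> x" "\<And>x. x \<in> K \<Longrightarrow> \<eta> x = 1"
    using cutoff[OF K(1) \<Omega> K(2)] by blast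
  obtain M where M: "M > 0" "\<And>x. \<bar>\<phi> x\<bar> \<le> M" using test_bounded[OF \<phi>] by blast
  have "\<bar>\<phi> x\<bar> \<le> M * \<eta> x" for x
    using M K(3)[of x] \<eta>(2)[of x] \<eta>(3)[of x] by (cases "x \<in> K") auto
  moreover have "(\<lambda>x. M * \<eta> x) \<in> test_functions \<Omega>" by (rule test_mult(2)[OF \<eta>(1) smooth_const])
  ultimately show ?thesis by (intro bexI[of _ "\<lambda>x. M * \<eta> x"]) auto
qed

text \<open>The limit of the pairing is controlled by the \<open>L2\<close> norm of \<open>\<phi>\<close>, although the pairings
  themselves are only bounded in \<open>L1\<close>: the energy estimate is applied with the smooth majorant
  \<open>\<phi>\<^sup>2 / (2 * t) + t / 2\<close> of \<open>\<bar>\<phi>\<bar>\<close>.\<close>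
lemma pairing_limit_bound:
  fixes \<Omega> :: "(real^'n) set"
  assumes \<Omega>: "open \<Omega>" "bounded \<Omega>" and A: "\<And>n. A n \<in> coefficient_matrices \<alpha> \<beta> \<Omega>" and \<alpha>: "0 < \<alpha>" and \<beta>: "0 \<le> \<beta>"
    and B: "\<And>n. B n \<in> coefficient_matrices a b \<Omega>" and b: "0 \<le> b"
    and U: "grad_like \<Omega> A U W" and V: "grad_like \<Omega> A V X"
    and W: "\<And>x. norm (W x) \<le> 1" and X: "\<And>x. norm (X x) \<le> 1"
    and \<phi>: "\<phi> \<in> test_functions \<Omega>" and t: "0 < t" "L2_norm \<Omega> \<phi> \<le> t"
  shows "\<forall>\<^sub>F n in sequentially. \<bar>LINT x|lebesgue_on \<Omega>. \<phi> x * ((B n x *v U n x) \<bullet> V n x)\<bar> \<le>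
     b * (\<beta> / \<alpha> * (1 + measure lebesgue \<Omega>) / 2 + 1) * t"
proof -
  have \<Omega>l: "\<Omega> \<in> lmeasurable" using \<Omega> by (simp add: bounded_set_imp_lmeasurable borel_open)
  then interpret finite_measure "lebesgue_on \<Omega>" by (rule finite_measure_lebesgue_on)
  obtain K where K: "compact K" "K \<subseteq> \<Omega>" "\<And>x. x \<notin> K \<Longrightarrow> \<phi> x = 0"
    by (rule test_functionsE[OF \<phi>]) blast
  obtain \<eta> where \<eta>: "\<eta> \<in> test_functions \<Omega>" "\<And>x. 0 \<le> \<eta> x" "\<And>x. \<eta> x \<le> 1" "\<And>x. x \<in> K \<Longrightarrow> \<eta> x = 1"
    using cutoff[OF K(1) \<Omega>(1) K(2)] by blast
  \<comment> \<open>\<open>\<eta>\<close> is 1 on the support of \<open>\<phi>\<close> and gives the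
    constant \<open>t / 2\<close> compact support; on that support the excess over
    \<open>\<bar>\<phi>\<bar>\<close> is
    \<open>(\<bar>\<phi> x\<bar> - t)\<^sup>2 / (2 * t)\<close>.\<close>
  define \<theta> where "\<theta> x = (\<phi> x * \<phi> x) * (1 / (2 * t)) + (\<eta> x * \<eta> x) * (t / 2)" for x
  have \<theta>: "\<theta> \<in> test_functions \<Omega>"
    unfolding \<theta>_def[abs_def]
    by (intro test_add test_mult(1)[OF test_mult(1)[OF \<phi> test_smooth[OF \<phi>]] smooth_const] test_mult(1)[OF test_mult(1)[OF \<eta>(1) test_smooth[OF \<eta>(1)]] smooth_const])
  have \<theta>0: "0 \<le> \<theta> x" for x using t by (simp add: \<theta>_def)
  have maj: "\<bar>\<phi> x\<bar> \<le> \<theta> x" for x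
  proof (cases "x \<in> K")
    case True
    have "0 \<le> (\<bar>\<phi> x\<bar> - t)\<^sup>2 / (2 * t)" using t by simp
    also have "\<dots> = \<theta> x - \<bar>\<phi> x\<bar>" using t True \<eta>(4) by (simp add: \<theta>_def power2_eq_square field_simps)
    finally show ?thesis by simp
  qed (use K \<theta>0 in simp)
  have int: "(LINT x|lebesgue_on \<Omega>. \<theta> x * (norm (Y x))\<^sup>2) \<le> t * (1 + measure lebesgue \<Omega>) / 2"
    if Y: "Y \<in> L2 \<Omega>" "\<And>x. norm (Y x) \<le> 1" for Y :: "real^'n \<Rightarrow> real^'n"
  proof -
    have p: "integrable (lebesgue_on \<Omega>) (\<lambda>x. (\<phi> x)\<^sup>2)" using L2_integrable_norm[OF test_L2[OF \<Omega>(1) \<phi>]] by simp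
    have "(LINT x|lebesgue_on \<Omega>. \<theta> x * (norm (Y x))\<^sup>2) \<le> (LINT x|lebesgue_on \<Omega>. (\<phi> x)\<^sup>2 * (1 / (2 * t)) + t / 2)"
    proof (rule integral_mono_AE)
      show "integrable (lebesgue_on \<Omega>) (\<lambda>x. \<theta> x * (norm (Y x))\<^sup>2)"
        using test_inner_integrable'[OF Y(1) Y(1) \<theta>] by (simp add: power2_norm_eq_inner)
      show "AE x in lebesgue_on \<Omega>. \<theta> x * (norm (Y x))\<^sup>2 \<le> (\<phi> x)\<^sup>2 * (1 / (2 * t)) + t / 2"
      proof (rule AE_I2)
        fix x
        have "\<theta> x * (norm (Y x))\<^sup>2 \<le> \<theta> x * 1" using Y(2) \<theta>0 by (intro mult_left_mono) (auto simp: power_le_one)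
        also have "\<dots> \<le> (\<phi> x)\<^sup>2 * (1 / (2 * t)) + t / 2"
          using mult_left_mono[OF mult_le_one[OF \<eta>(3) \<eta>(2) \<eta>(3), of x x], of "t / 2"] t
          by (simp add: \<theta>_def power2_eq_square mult.commute)
        finally show "\<theta> x * (norm (Y x))\<^sup>2 \<le> (\<phi> x)\<^sup>2 * (1 / (2 * t)) + t / 2" .
      qed
    qed (use p in auto)
    also have "\<dots> = (L2_norm \<Omega> \<phi>)\<^sup>2 / (2 * t) + t / 2 * measure lebesgue \<Omega>"
      using p \<Omega>l by (simp add: L2_norm_sq measure_restrict_space fmeasurableD)
    also have "\<dots> \<le> t\<^sup>2 / (2 * t) + t / 2 * measure lebesgue \<Omega>"
      using t by (intro add_right_mono divide_right_mono power_mono) auto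
    also have "\<dots> = t * (1 + measure lebesgue \<Omega>) / 2" using t by (simp add: power2_eq_square field_simps)
    finally show ?thesis .
  qed
  note u = grad_likeD[OF U] and v = grad_likeD[OF V]
  have q: "0 \<le> \<beta> / \<alpha>" using \<alpha> \<beta> by simp
  have "\<forall>\<^sub>F n in sequentially. (LINT x|lebesgue_on \<Omega>. \<theta> x * (norm (U n x))\<^sup>2) \<le> \<beta> / \<alpha> * (LINT x|lebesgue_on \<Omega>. \<theta> x * (norm (W x))\<^sup>2) + t"
    by (rule energy_estimate[OF A U \<alpha> \<theta> \<theta>0 t(1)])
  moreover have "\<forall>\<^sub>F n in sequentially. (LINT x|lebesgue_on \<Omega>. \<theta> x * (norm (V n x))\<^sup>2) \<le> \<beta> / \<alpha> * (LINT x|lebesgue_on \<Omega>. \<theta> x * (norm (X x))\<^sup>2) + t"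
    by (rule energy_estimate[OF A V \<alpha> \<theta> \<theta>0 t(1)])
  ultimately show ?thesis
  proof eventually_elim
    case (elim n)
    have "\<bar>LINT x|lebesgue_on \<Omega>. \<phi> x * ((B n x *v U n x) \<bullet> V n x)\<bar> \<le>
       b / 2 * ((LINT x|lebesgue_on \<Omega>. \<theta> x * (norm (U n x))\<^sup>2) + (LINT x|lebesgue_on \<Omega>. \<theta> x * (norm (V n x))\<^sup>2))"
      by (rule pairing_integral[OF B b u(2) v(2) \<phi> \<theta> maj])
    also have "\<dots> \<le> b / 2 * ((\<beta> / \<alpha> * (t * (1 + measure lebesgue \<Omega>) / 2) + t) + (\<beta> / \<alpha> * (t * (1 + measure lebesgue \<Omega>) / 2) + t))"
      using elim mult_left_mono[OF int[OF u(3) W] q] mult_left_mono[OF int[OF v(3) X] q] b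
      by (intro mult_left_mono add_mono) auto
    also have "\<dots> = b * (\<beta> / \<alpha> * (1 + measure lebesgue \<Omega>) / 2 + 1) * t" by (simp add: algebra_simps)
    finally show ?case .
  qed
qed

text \<open>The eventual bound by the \<open>L2\<close> norm of \<open>\<phi>\<close> has two uses:
  convergence spreads from the countable generators to all test functions, and the limit functional
  is continuous in \<open>L2\<close>, so Riesz represents it by a square integrable density.\<close>

lemma pairing_density:
  fixes \<Omega> :: "(real^'n) set"
  assumes \<Omega>: "open \<Omega>" "bounded \<Omega>" and A: "\<And>n. A n \<in> coefficient_matrices \<alpha> \<beta> \<Omega>" and \<alpha>: "0 < \<alpha>" and \<beta>: "0 \<le> \<beta>"
    and B: "\<And>n. B n \<in> coefficient_matrices a b \<Omega>" and b: "0 \<le> b"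
    and U: "grad_like \<Omega> A U W" and V: "grad_like \<Omega> A V X"
    and W: "\<And>x. norm (W x) \<le> 1" and X: "\<And>x. norm (X x) \<le> 1"
    and D: "\<And>k. D k \<in> test_functions \<Omega>" "\<And>f e. f \<in> L2 \<Omega> \<Longrightarrow> e > 0 \<Longrightarrow> \<exists>d\<in>span (range D). L2_norm \<Omega> (\<lambda>x. f x - d x) < e"
    and conv: "\<And>k :: nat. convergent (\<lambda>n. LINT x|lebesgue_on \<Omega>. D k x * ((B n x *v U n x) \<bullet> V n x))"
  shows "\<exists>g\<in>L2 \<Omega>. \<forall>\<phi>\<in>test_functions \<Omega>.
    (\<lambda>n. LINT x|lebesgue_on \<Omega>. \<phi> x * ((B n x *v U n x) \<bullet> V n x)) \<longlonglongrightarrow> (LINT x|lebesgue_on \<Omega>. g x * \<phi> x)"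
proof -
  note u = grad_likeD[OF U] and v = grad_likeD[OF V]
  define L where "L \<phi> n = (LINT x|lebesgue_on \<Omega>. \<phi> x * ((B n x *v U n x) \<bullet> V n x))" for \<phi> n
  define C where "C = b * (\<beta> / \<alpha> * (1 + measure lebesgue \<Omega>) / 2 + 1)"
  have C: "0 \<le> C" using b \<alpha> \<beta> by (simp add: C_def)
  have i: "integrable (lebesgue_on \<Omega>) (\<lambda>x. \<phi> x * ((B n x *v U n x) \<bullet> V n x))" if "\<phi> \<in> test_functions \<Omega>" for \<phi> n
    by (rule test_inner_integrable'[OF coefficient_L2(1)[OF B u(2)] v(2) that])
  note T = test_functions_subspace[of \<Omega>]
  have Ladd: "L (\<phi> + \<psi>) n = L \<phi> n + L \<psi> n" if "\<phi> \<in> test_functions \<Omega>" "\<psi> \<in> test_functions \<Omega>" for \<phi> \<psi> n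
    unfolding L_def using i[OF that(1), of n] i[OF that(2), of n] by (simp add: distrib_right)
  have Lsc: "L (c *\<^sub>R \<phi>) n = c * L \<phi> n" for c \<phi> n
    by (simp add: L_def mult.assoc)
  have Lbd: "\<forall>\<^sub>F n in sequentially. \<bar>L \<phi> n\<bar> \<le> C * t" if "\<phi> \<in> test_functions \<Omega>" "0 < t" "L2_norm \<Omega> \<phi> \<le> t" for \<phi> t
    unfolding L_def C_def by (rule pairing_limit_bound[OF \<Omega> A \<alpha> \<beta> B b U V W X that])
  define S where "S = {\<phi> \<in> test_functions \<Omega>. convergent (L \<phi>)}"
  have "subspace S"
    unfolding subspace_def S_def
  proof (intro conjI ballI allI CollectI)
    show "0 \<in> test_functions \<Omega>" by (rule subspace_0[OF T])
    have "L 0 = (\<lambda>_. 0)" by (rule ext) (simp add: L_def)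
    then show "convergent (L 0)" by (simp add: convergent_const)
  next
    fix \<phi> \<psi> assume "\<phi> \<in> {\<phi> \<in> test_functions \<Omega>. convergent (L \<phi>)}" "\<psi> \<in> {\<phi> \<in> test_functions \<Omega>. convergent (L \<phi>)}"
    then have *: "\<phi> \<in> test_functions \<Omega>" "\<psi> \<in> test_functions \<Omega>" "convergent (L \<phi>)" "convergent (L \<psi>)" by auto
    show "\<phi> + \<psi> \<in> test_functions \<Omega>" by (rule subspace_add[OF T *(1,2)])
    have "L (\<phi> + \<psi>) = (\<lambda>n. L \<phi> n + L \<psi> n)" using Ladd[OF *(1,2)] by blast
    then show "convergent (L (\<phi> + \<psi>))" using convergent_add[OF *(3,4)] by simp
  next
    fix c \<phi> assume "\<phi> \<in> {\<phi> \<in> test_functions \<Omega>. convergent (L \<phi>)}"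
    then have *: "\<phi> \<in> test_functions \<Omega>" "convergent (L \<phi>)" by auto
    show "c *\<^sub>R \<phi> \<in> test_functions \<Omega>" by (rule subspace_scale[OF T *(1)])
    have "L (c *\<^sub>R \<phi>) = (\<lambda>n. c * L \<phi> n)" using Lsc by blast
    then show "convergent (L (c *\<^sub>R \<phi>))" using convergent_mult[OF convergent_const *(2)] by simp
  qed
  moreover have "convergent (L (D k))" for k using conv[of k] by (simp add: L_def[abs_def])
  then have "range D \<subseteq> S" unfolding S_def using D(1) by blast
  ultimately have sp: "span (range D) \<subseteq> S" by (rule span_minimal[rotated])
  \<comment> \<open>The bound on \<open>L \<phi>\<close> holds only from an index depending on
    \<open>\<phi>\<close>, so the general result on equibounded functionals does not apply; the
    Cauchy property is derived directly, with \<open>\<phi> - d\<close> again a test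
    function.\<close>
  have cv: "convergent (L \<phi>)" if \<phi>: "\<phi> \<in> test_functions \<Omega>" for \<phi>
  proof -
    have "Cauchy (L \<phi>)"
    proof (rule metric_CauchyI)
      fix e :: real assume e: "e > 0"
      define t where "t = e / (3 * (C + 1))"
      have t: "t > 0" "C * t < e / 3" using e C by (auto simp: t_def field_simps)
      obtain d where d: "d \<in> span (range D)" "L2_norm \<Omega> (\<lambda>x. \<phi> x - d x) < t" using D(2)[OF test_L2[OF \<Omega>(1) \<phi>] t(1)] by blast
      then have dS: "d \<in> test_functions \<Omega>" "convergent (L d)" using sp by (auto simp: S_def)
      have df: "\<phi> - d \<in> test_functions \<Omega>" by (rule subspace_diff[OF T \<phi> dS(1)])
      have "\<forall>\<^sub>F n in sequentially. \<bar>L (\<phi> - d) n\<bar> \<le> C * t"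
        by (rule Lbd[OF df t(1)]) (use d(2) in \<open>simp add: fun_diff_def\<close>)
      then obtain N1 where N1: "\<And>n. n \<ge> N1 \<Longrightarrow> \<bar>L (\<phi> - d) n\<bar> \<le> C * t" by (auto simp: eventually_sequentially)
      have "Cauchy (L d)" using dS(2) by (simp add: Cauchy_convergent_iff)
      then obtain N2 where N2: "\<And>m n. m \<ge> N2 \<Longrightarrow> n \<ge> N2 \<Longrightarrow> dist (L d m) (L d n) < e / 3"
        using e metric_CauchyD[of "L d" "e / 3"] by auto
      have split: "L \<phi> n = L (\<phi> - d) n + L d n" for n using Ladd[OF df dS(1), of n] by simp
      show "\<exists>M. \<forall>m\<ge>M. \<forall>n\<ge>M. dist (L \<phi> m) (L \<phi> n) < e"
      proof (intro exI[of _ "max N1 N2"] allI impI)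
        fix m n assume "max N1 N2 \<le> m" "max N1 N2 \<le> n"
        then have "\<bar>L (\<phi> - d) m\<bar> \<le> C * t" "\<bar>L (\<phi> - d) n\<bar> \<le> C * t" "\<bar>L d m - L d n\<bar> < e / 3"
          using N1 N2[of m n] by (auto simp: dist_real_def)
        then have "\<bar>L \<phi> m - L \<phi> n\<bar> < e" unfolding split abs_le_iff abs_less_iff using t(2) by linarith
        then show "dist (L \<phi> m) (L \<phi> n) < e" by (simp add: dist_real_def)
      qed
    qed
    then show ?thesis by (simp add: Cauchy_convergent_iff)
  qed
  define l where "l \<phi> = lim (L \<phi>)" for \<phi>
  have ll: "L \<phi> \<longlonglongrightarrow> l \<phi>" if "\<phi> \<in> test_functions \<Omega>" for \<phi>
    using cv[OF that] by (simp add: l_def convergent_LIMSEQ_iff)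
  have "\<exists>g\<in>L2 \<Omega>. \<forall>\<phi>\<in>test_functions \<Omega>. (LINT x|lebesgue_on \<Omega>. g x \<bullet> \<phi> x) = l \<phi>"
  proof (rule L2.Riesz[OF T])
    show "test_functions \<Omega> \<subseteq> L2 \<Omega>" using test_L2[OF \<Omega>(1)] by blast
    show "l (\<phi> + \<psi>) = l \<phi> + l \<psi>" if "\<phi> \<in> test_functions \<Omega>" "\<psi> \<in> test_functions \<Omega>" for \<phi> \<psi>
    proof -
      have "L (\<phi> + \<psi>) = (\<lambda>n. L \<phi> n + L \<psi> n)" using Ladd[OF that] by blast
      then have "L (\<phi> + \<psi>) \<longlonglongrightarrow> l \<phi> + l \<psi>" using tendsto_add[OF ll[OF that(1)] ll[OF that(2)]] by simp
      then show ?thesis by (rule LIMSEQ_unique[OF ll[OF subspace_add[OF T that]]])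
    qed
    show "l (c *\<^sub>R \<phi>) = c * l \<phi>" if "\<phi> \<in> test_functions \<Omega>" for c \<phi>
    proof -
      have "L (c *\<^sub>R \<phi>) = (\<lambda>n. c * L \<phi> n)" using Lsc by blast
      then have "L (c *\<^sub>R \<phi>) \<longlonglongrightarrow> c * l \<phi>" using tendsto_mult_left[OF ll[OF that]] by simp
      then show ?thesis by (rule LIMSEQ_unique[OF ll[OF subspace_scale[OF T that]]])
    qed
    fix \<phi> assume \<phi>: "\<phi> \<in> test_functions \<Omega>"
    show "\<bar>l \<phi>\<bar> \<le> C * L2.nm \<Omega> \<phi>"
    proof (rule field_le_epsilon)
      fix e :: real assume e: "e > 0"
      \<comment> \<open>The bound requires \<open>t > 0\<close> also when \<open>\<phi>\<close> has
        norm zero; the excess costs at most \<open>e\<close>.\<close>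
      define t where "t = L2_norm \<Omega> \<phi> + e / (C + 1)"
      have ec: "e / (C + 1) > 0" using e C by simp
      have t: "t > 0" "L2_norm \<Omega> \<phi> \<le> t" using ec L2_norm_nonneg[of \<Omega> \<phi>] by (auto simp: t_def simp del: L2_norm_nonneg)
      have "\<bar>l \<phi>\<bar> \<le> C * t"
        by (rule tendsto_upperbound[OF tendsto_rabs[OF ll[OF \<phi>]] Lbd[OF \<phi> t]]) simp
      also have "\<dots> = C * L2_norm \<Omega> \<phi> + C * (e / (C + 1))" by (simp only: t_def distrib_left)
      also have "C * (e / (C + 1)) \<le> e" using e C by (simp add: field_simps)
      finally show "\<bar>l \<phi>\<bar> \<le> C * L2.nm \<Omega> \<phi> + e" unfolding L2_nm by simp
    qed
  qed
  then obtain g where g: "g \<in> L2 \<Omega>" "\<And>\<phi>. \<phi> \<in> test_functions \<Omega> \<Longrightarrow> (LINT x|lebesgue_on \<Omega>. g x * \<phi> x) = l \<phi>" by auto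
  show ?thesis
    using g ll unfolding L_def[abs_def] by (intro bexI[of _ g]) auto
qed

text \<open>Nonnegativity of the form at \<open>\<xi> - (1 / C) *\<^sub>R \<eta>\<close> with
  \<open>\<eta> = M *v \<xi>\<close>, together with the upper bound at \<open>\<xi>\<close> and at
  \<open>\<eta>\<close>, gives the norm bound with the same constant \<open>C\<close>.\<close>

lemma symmetric_norm_bound:
  fixes M :: "real^'n^'n"
  assumes sym: "\<And>\<xi> \<eta>. (M *v \<xi>) \<bullet> \<eta> = (M *v \<eta>) \<bullet> \<xi>" and C: "0 < C"
    and pos: "\<And>\<xi>. 0 \<le> (M *v \<xi>) \<bullet> \<xi>" and up: "\<And>\<xi>. (M *v \<xi>) \<bullet> \<xi> \<le> C * (norm \<xi>)\<^sup>2"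
  shows "norm (M *v \<xi>) \<le> C * norm \<xi>"
proof (rule power2_le_imp_le)
  define \<eta> where "\<eta> = M *v \<xi>"
  have "0 \<le> (M *v (\<xi> - (1 / C) *\<^sub>R \<eta>)) \<bullet> (\<xi> - (1 / C) *\<^sub>R \<eta>)" by (rule pos)
  also have "\<dots> = (M *v \<xi>) \<bullet> \<xi> - 2 * (1 / C) * ((M *v \<xi>) \<bullet> \<eta>) + (1 / C)\<^sup>2 * ((M *v \<eta>) \<bullet> \<eta>)"
    using sym[of \<eta> \<xi>] by (simp add: matrix_vector_mult_diff_distrib matrix_vector_mult_scaleR inner_diff_left inner_diff_right power2_eq_square algebra_simps)
  also have "(M *v \<xi>) \<bullet> \<eta> = (norm \<eta>)\<^sup>2" by (simp add: \<eta>_def power2_norm_eq_inner)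
  finally have "2 * (1 / C) * (norm \<eta>)\<^sup>2 \<le> (M *v \<xi>) \<bullet> \<xi> + (1 / C)\<^sup>2 * ((M *v \<eta>) \<bullet> \<eta>)" by simp
  also have "\<dots> \<le> C * (norm \<xi>)\<^sup>2 + (1 / C)\<^sup>2 * (C * (norm \<eta>)\<^sup>2)" by (intro add_mono up mult_left_mono) auto
  also have "(1 / C)\<^sup>2 * (C * (norm \<eta>)\<^sup>2) = (1 / C) * (norm \<eta>)\<^sup>2" using C by (simp add: power2_eq_square)
  finally have "(1 / C) * (norm \<eta>)\<^sup>2 \<le> C * (norm \<xi>)\<^sup>2" by simp
  then have "(norm \<eta>)\<^sup>2 \<le> C * (C * (norm \<xi>)\<^sup>2)" using C by (simp add: field_simps)
  then show "(norm (M *v \<xi>))\<^sup>2 \<le> (C * norm \<xi>)\<^sup>2" by (simp add: \<eta>_def power_mult_distrib power2_eq_square mult_ac)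
qed (use C in simp)

text \<open>One statement covers both bounds: \<open>s = 1\<close> with \<open>c = a\<close> is the
  lower one, \<open>s = - 1\<close> with \<open>c = - b\<close> the upper one. The set of vectors
  where the inequality fails is open, so it would meet \<open>Q\<close>.\<close>

lemma quadratic_form_dense:
  fixes M :: "real^'n^'n"
  assumes Q: "\<And>X. open X \<Longrightarrow> X \<noteq> {} \<Longrightarrow> \<exists>q\<in>Q. q \<in> X"
    and b: "\<And>q. q \<in> Q \<Longrightarrow> c * (norm q)\<^sup>2 \<le> s * ((M *v q) \<bullet> q)"
  shows "c * (norm \<xi>)\<^sup>2 \<le> s * ((M *v \<xi>) \<bullet> \<xi>)"
proof (rule ccontr)
  assume neg: "\<not> ?thesis"
  have "continuous_on UNIV (\<lambda>\<xi>. M *v \<xi>)" by (intro linear_continuous_on matrix_vector_mul_bounded_linear)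
  then have "open {\<xi>. s * ((M *v \<xi>) \<bullet> \<xi>) < c * (norm \<xi>)\<^sup>2}"
    by (intro open_Collect_less continuous_intros)
  moreover have "\<xi> \<in> {\<xi>. s * ((M *v \<xi>) \<bullet> \<xi>) < c * (norm \<xi>)\<^sup>2}" using neg by simp
  then have "{\<xi>. s * ((M *v \<xi>) \<bullet> \<xi>) < c * (norm \<xi>)\<^sup>2} \<noteq> {}" by blast
  ultimately show False using Q b by (metis (mono_tags, lifting) mem_Collect_eq not_less)
qed

text \<open>This replaces the weak gradient of a coordinate, known only almost everywhere, by the
  constant field \<open>axis i 1\<close>, whose norm is bounded at every point as
  \<open>pairing_limit_bound\<close> asks.\<close>

lemma grad_like_cong:
  assumes A: "\<And>n. A n \<in> coefficient_matrices \<alpha> \<beta> \<Omega>"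
    and U: "grad_like \<Omega> A U W" and X: "X \<in> L2 \<Omega>" "AE x in lebesgue_on \<Omega>. W x = X x"
  shows "grad_like \<Omega> A U X"
  unfolding grad_like_def
proof (intro conjI ballI allI impI)
  note u = grad_likeD[OF U]
  show "flux_test \<Omega> A U" "X \<in> L2 \<Omega>" by (fact u X)+
  show "(\<lambda>n. LINT x|lebesgue_on \<Omega>. U n x \<bullet> h x) \<longlonglongrightarrow> (LINT x|lebesgue_on \<Omega>. X x \<bullet> h x)" if "h \<in> L2 \<Omega>" for h
    using u(4)[OF that] AE_integral_cong_L2[OF u(3) X(1) that X(2)] by simp
  fix V \<phi> assume V: "flux_test \<Omega> A V" and \<phi>: "\<phi> \<in> test_functions \<Omega>"
  note AV = coefficient_L2(1)[OF A flux_testD(1)[OF V]]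
  have "(LINT x|lebesgue_on \<Omega>. \<phi> x * ((A n x *v V n x) \<bullet> (U n x - X x))) = (LINT x|lebesgue_on \<Omega>. \<phi> x * ((A n x *v V n x) \<bullet> (U n x - W x)))" for n
    using X(2) test_inner_integrable'[OF AV L2_diff[OF u(2) X(1)] \<phi>, of n n] test_inner_integrable'[OF AV L2_diff[OF u(2) u(3)] \<phi>, of n n]
    by (intro integral_cong_AE) (auto elim: eventually_mono)
  then show "(\<lambda>n. LINT x|lebesgue_on \<Omega>. \<phi> x * ((A n x *v V n x) \<bullet> (U n x - X x))) \<longlonglongrightarrow> 0"
    using u(5)[OF V \<phi>] by simp
qed

text \<open>The gradient \<open>U n\<close> is compared with the field \<open>\<Sum>i. P i * E i n\<close>, where the test functions
  \<open>P i\<close> approximate the components of the limit \<open>W\<close>.\<close>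
lemma effective_convergence:
  fixes \<Omega> :: "(real^'n) set"
  assumes \<Omega>: "open \<Omega>" "bounded \<Omega>" and A: "\<And>n. A n \<in> coefficient_matrices \<alpha> \<beta> \<Omega>" and \<alpha>: "0 < \<alpha>" "\<alpha> \<le> \<beta>"
    and B: "\<And>n. B n \<in> coefficient_matrices a b \<Omega>" and b: "0 < b"
    and Bs: "Bs \<in> coefficient_matrices a b' \<Omega>" and b': "0 < b'"
    and E: "\<And>i. grad_like \<Omega> A (E i) (\<lambda>_. axis i 1)"
    and lim: "\<And>\<phi> P. \<phi> \<in> test_functions \<Omega> \<Longrightarrow> (\<And>i. P i \<in> test_functions \<Omega>) \<Longrightarrow>
      (\<lambda>n. LINT x|lebesgue_on \<Omega>. \<phi> x * ((B n x *v (\<Sum>i\<in>UNIV. P i x *\<^sub>R E i n x)) \<bullet> (\<Sum>i\<in>UNIV. P i x *\<^sub>R E i n x)))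
        \<longlonglongrightarrow> (LINT x|lebesgue_on \<Omega>. \<phi> x * ((Bs x *v (\<chi> i. P i x)) \<bullet> (\<chi> i. P i x)))"
    and U: "grad_like \<Omega> A U W" and \<phi>: "\<phi> \<in> test_functions \<Omega>"
  shows "(\<lambda>n. LINT x|lebesgue_on \<Omega>. \<phi> x * ((B n x *v U n x) \<bullet> U n x)) \<longlonglongrightarrow> (LINT x|lebesgue_on \<Omega>. \<phi> x * ((Bs x *v W x) \<bullet> W x))"
proof (rule LIMSEQ_I)
  fix \<eta> :: real assume \<eta>: "\<eta> > 0"
  note u = grad_likeD[OF U]
  obtain \<theta> where \<theta>: "\<theta> \<in> test_functions \<Omega>" "\<And>x. \<bar>\<phi> x\<bar> \<le> \<theta> x" using test_majorant[OF \<Omega>(1) \<phi>] by blast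
  have \<theta>0: "0 \<le> \<theta> x" for x using \<theta>(2)[of x] by linarith
  obtain M where M: "M > 0" "\<And>x. \<bar>\<theta> x\<bar> \<le> M" using test_bounded[OF \<theta>(1)] by blast
  obtain D :: "nat \<Rightarrow> real^'n \<Rightarrow> real" where D: "\<And>k. D k \<in> test_functions \<Omega>"
    "\<And>f e. f \<in> L2 \<Omega> \<Longrightarrow> e > 0 \<Longrightarrow> \<exists>d\<in>span (range D). L2_norm \<Omega> (\<lambda>x. f x - d x) < e"
    using countable_test_dense[OF \<Omega>] by blast
  have Dsp: "span (range D) \<subseteq> test_functions \<Omega>"
    by (rule span_minimal[OF _ test_functions_subspace]) (use D(1) in blast)
  have sq: "integrable (lebesgue_on \<Omega>) (\<lambda>x. \<theta> x * (norm (f x))\<^sup>2)" if "f \<in> L2 \<Omega>" for f :: "real^'n \<Rightarrow> real^'n"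
    using test_inner_integrable'[OF that that \<theta>(1)] by (simp add: power2_norm_eq_inner)
  define I where "I f = (LINT x|lebesgue_on \<Omega>. \<theta> x * (norm (f x))\<^sup>2)" for f :: "real^'n \<Rightarrow> real^'n"
  have I0: "0 \<le> I f" for f unfolding I_def using \<theta>0 by (intro integral_nonneg_AE) auto
  define c where "c = \<beta> / \<alpha>"
  have c: "1 \<le> c" using \<alpha> by (simp add: c_def)
  define bt where "bt = b + b'"
  have bt: "bt > 0" "b \<le> bt" "b' \<le> bt" using b b' by (auto simp: bt_def)
  \<comment> \<open>Bounds the weighted energies of the comparison fields \<open>S n\<close> for
    large \<open>n\<close> before \<open>P\<close> is chosen: \<open>I ?P\<close> will be at most
    \<open>2 * I W + 2 * \<tau>\<close>, and \<open>\<tau>\<close> is at most 1.\<close>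
  define G where "G = c * (2 * I W + 2) + 1"
  have G: "G \<ge> 1" using c I0[of W] by (simp add: G_def)
  \<comment> \<open>The order of choices matters: \<open>\<kappa>\<close> makes the term with the
    energy of \<open>S n\<close> at most \<open>\<eta> / 4\<close>; only then is
    \<open>\<tau>\<close> fixed against \<open>H\<close>, which grows as \<open>\<kappa>\<close>
    decreases.\<close>
  define \<kappa> where "\<kappa> = \<eta> / (4 * bt * G)"
  have \<kappa>: "\<kappa> > 0" "bt * (\<kappa> * G) = \<eta> / 4" using \<eta> bt G by (auto simp: \<kappa>_def)
  define H where "H = (1 + 1 / \<kappa>) * (c + 1)"
  have H: "H > 0" using \<kappa> c by (simp add: H_def add_pos_pos)
  define \<tau> where "\<tau> = min 1 (\<eta> / (4 * bt * H))"
  have \<tau>: "\<tau> > 0" "\<tau> \<le> 1" using \<eta> bt H by (auto simp: \<tau>_def)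
  have "\<tau> \<le> \<eta> / (4 * bt * H)" by (simp add: \<tau>_def)
  then have \<tau>H: "bt * (H * \<tau>) \<le> \<eta> / 4" using bt H by (simp add: field_simps)
  \<comment> \<open>Tolerance per component: \<open>CARD('n)\<close> squared errors, weighted by
    \<open>M\<close>, add up to \<open>\<tau>\<close>.\<close>
  define \<epsilon> where "\<epsilon> = sqrt (\<tau> / (M * real CARD('n)))"
  have MN: "M * real CARD('n) > 0" using M by simp
  have \<epsilon>: "\<epsilon> > 0" "M * (real CARD('n) * \<epsilon>\<^sup>2) = \<tau>" using \<tau> MN by (auto simp: \<epsilon>_def)
  have "\<forall>i. \<exists>d\<in>span (range D). L2_norm \<Omega> (\<lambda>x. W x $ i - d x) < \<epsilon>" using D(2)[OF L2_nth[OF u(3)] \<epsilon>(1)] by blast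
  then obtain P where P: "\<And>i. P i \<in> test_functions \<Omega>" "\<And>i. L2_norm \<Omega> (\<lambda>x. W x $ i - P i x) < \<epsilon>"
    using Dsp by (metis subsetD)
  let ?P = "\<lambda>x. \<chi> i. P i x"
  have PL: "?P \<in> L2 \<Omega>" by (rule L2_vec) (simp add: test_L2[OF \<Omega>(1) P(1)])
  note dL = L2_diff[OF u(3) PL]
  have "(L2_norm \<Omega> (\<lambda>x. W x - ?P x))\<^sup>2 = (\<Sum>i\<in>UNIV. (L2_norm \<Omega> (\<lambda>x. W x $ i - P i x))\<^sup>2)"
    by (subst L2_norm_vec[OF dL]) simp
  also have "\<dots> \<le> (\<Sum>i\<in>(UNIV::'n set). \<epsilon>\<^sup>2)"
    by (intro sum_mono power_mono[OF less_imp_le[OF P(2)]]) simp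
  finally have d2: "(L2_norm \<Omega> (\<lambda>x. W x - ?P x))\<^sup>2 \<le> real CARD('n) * \<epsilon>\<^sup>2" by simp
  have I1: "I (\<lambda>x. W x - ?P x) \<le> \<tau>"
  proof -
    have "I (\<lambda>x. W x - ?P x) \<le> (LINT x|lebesgue_on \<Omega>. M * (norm (W x - ?P x))\<^sup>2)"
      unfolding I_def
      by (rule integral_mono_AE[OF sq[OF dL] integrable_mult_right[OF L2_integrable_norm[OF dL]] AE_I2])
        (intro mult_right_mono order_trans[OF abs_ge_self M(2)], simp)
    also have "\<dots> = M * (L2_norm \<Omega> (\<lambda>x. W x - ?P x))\<^sup>2" by (simp add: L2_norm_sq)
    also have "\<dots> \<le> M * (real CARD('n) * \<epsilon>\<^sup>2)" using d2 M by (intro mult_left_mono) auto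
    finally show ?thesis using \<epsilon> by simp
  qed
  have I2: "I ?P \<le> 2 * I W + 2 * \<tau>"
  proof -
    have "I ?P \<le> (LINT x|lebesgue_on \<Omega>. 2 * (\<theta> x * (norm (W x))\<^sup>2) + 2 * (\<theta> x * (norm (W x - ?P x))\<^sup>2))"
      unfolding I_def
    proof (rule integral_mono_AE[OF sq[OF PL] _ AE_I2])
      show "integrable (lebesgue_on \<Omega>) (\<lambda>x. 2 * (\<theta> x * (norm (W x))\<^sup>2) + 2 * (\<theta> x * (norm (W x - ?P x))\<^sup>2))"
        using sq[OF u(3)] sq[OF dL] by auto
      fix x
      have "(norm (?P x))\<^sup>2 \<le> 2 * (norm (W x))\<^sup>2 + 2 * (norm (?P x - W x))\<^sup>2"
        using norm_add_sq[of "W x" "?P x - W x"] by (metis add_diff_cancel_left' add_diff_eq)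
      then have "(norm (?P x))\<^sup>2 \<le> 2 * (norm (W x))\<^sup>2 + 2 * (norm (W x - ?P x))\<^sup>2"
        by (subst norm_minus_commute)
      from mult_left_mono[OF this \<theta>0[of x]]
      show "\<theta> x * (norm (?P x))\<^sup>2 \<le> 2 * (\<theta> x * (norm (W x))\<^sup>2) + 2 * (\<theta> x * (norm (W x - ?P x))\<^sup>2)"
        by (simp add: algebra_simps)
    qed
    also have "\<dots> = 2 * I W + 2 * I (\<lambda>x. W x - ?P x)" using sq[OF u(3)] sq[OF dL] by (simp add: I_def)
    finally show ?thesis using I1 by simp
  qed
  define S where "S n x = (\<Sum>i\<in>UNIV. P i x *\<^sub>R E i n x)" for n x
  have "\<forall>i. \<exists>M. \<forall>x. \<bar>P i x\<bar> \<le> M" using test_bounded[OF P(1)] by blast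
  then obtain MP where MP: "\<And>i x. \<bar>P i x\<bar> \<le> MP i" by metis
  have vs: "(\<Sum>i\<in>UNIV. P i x *\<^sub>R axis i 1) = ?P x" for x
    by (simp add: vec_eq_iff axis_def if_distrib[of "\<lambda>t. _ * t"] cong: if_cong)
  have Sg: "grad_like \<Omega> A S ?P"
    unfolding S_def[abs_def] vs[symmetric] by (rule grad_like_sum[OF \<Omega>(1) A E test_smooth[OF P(1)] MP finite])
  have Rg: "grad_like \<Omega> A (\<lambda>n x. U n x - S n x) (\<lambda>x. W x - ?P x)"
    using grad_like_add[OF \<Omega>(1) A U Sg smooth_const[of "-1"], of 1] by simp
  note s = grad_likeD[OF Sg] and r = grad_likeD[OF Rg]
  define T where "T n = (LINT x|lebesgue_on \<Omega>. \<phi> x * ((B n x *v U n x) \<bullet> U n x))" for n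
  define T' where "T' = (LINT x|lebesgue_on \<Omega>. \<phi> x * ((Bs x *v W x) \<bullet> W x))"
  define q where "q n = (LINT x|lebesgue_on \<Omega>. \<phi> x * ((B n x *v S n x) \<bullet> S n x))" for n
  define q' where "q' = (LINT x|lebesgue_on \<Omega>. \<phi> x * ((Bs x *v ?P x) \<bullet> ?P x))"
  have qlim: "q \<longlonglongrightarrow> q'" unfolding q_def[abs_def] q'_def S_def by (rule lim[OF \<phi> P(1)])
  have lim_side: "\<bar>T' - q'\<bar> \<le> b' * ((1 + 1 / \<kappa>) * I (\<lambda>x. W x - ?P x) + \<kappa> * I ?P)"
    unfolding T'_def q'_def I_def
    by (rule quadratic_difference[OF Bs less_imp_le[OF b'] dL PL u(3) _ \<phi> \<theta> \<kappa>(1)]) simp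
  have n_side: "\<bar>T n - q n\<bar> \<le> b * ((1 + 1 / \<kappa>) * I (\<lambda>x. U n x - S n x) + \<kappa> * I (S n))" for n
    unfolding T_def q_def I_def
    by (rule quadratic_difference[OF B less_imp_le[OF b] r(2) s(2) u(2) _ \<phi> \<theta> \<kappa>(1)]) simp
  have k1: "0 \<le> 1 + 1 / \<kappa>" using \<kappa> by simp
  have est: "\<beta>' * ((1 + 1 / \<kappa>) * x + \<kappa> * y) \<le> \<beta>' * (H * \<tau>) + \<beta>' * (\<kappa> * G)"
    if "0 \<le> \<beta>'" "x \<le> c * \<tau> + \<tau>" "y \<le> G" for \<beta>' x y
  proof -
    have "(1 + 1 / \<kappa>) * x \<le> (1 + 1 / \<kappa>) * (c * \<tau> + \<tau>)" using that k1 by (intro mult_left_mono)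
    also have "\<dots> = H * \<tau>" by (simp add: add_divide_distrib H_def algebra_simps)
    finally have "(1 + 1 / \<kappa>) * x + \<kappa> * y \<le> H * \<tau> + \<kappa> * G" using that \<kappa> by (intro add_mono mult_left_mono) auto
    from mult_left_mono[OF this that(1)] show ?thesis by (simp add: distrib_left)
  qed
  have cI: "c * (2 * I W + 2 * \<tau>) + \<tau> \<le> G"
    unfolding G_def using c \<tau> by (intro add_mono mult_left_mono) auto
  have "\<tau> \<le> c * \<tau> + \<tau>" using c \<tau> by simp
  moreover have "2 * I W + 2 * \<tau> \<le> G"
  proof -
    have "1 * (2 * I W + 2 * \<tau>) \<le> c * (2 * I W + 2 * \<tau>)" using c I0[of W] \<tau> by (intro mult_right_mono) auto
    then show ?thesis using cI \<tau> by simp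
  qed
  ultimately have L1: "\<bar>T' - q'\<bar> \<le> b' * (H * \<tau>) + b' * (\<kappa> * G)"
    using I1 I2 b' by (intro order_trans[OF lim_side est]) auto
  have "\<forall>\<^sub>F n in sequentially. I (\<lambda>x. U n x - S n x) \<le> c * I (\<lambda>x. W x - ?P x) + \<tau>"
    unfolding I_def c_def by (rule energy_estimate[OF A Rg \<alpha>(1) \<theta>(1) \<theta>0 \<tau>(1)])
  moreover have "\<forall>\<^sub>F n in sequentially. I (S n) \<le> c * I ?P + \<tau>"
    unfolding I_def c_def by (rule energy_estimate[OF A Sg \<alpha>(1) \<theta>(1) \<theta>0 \<tau>(1)])
  moreover have "\<forall>\<^sub>F n in sequentially. dist (q n) q' < \<eta> / 4" using qlim \<eta> by (intro tendstoD) auto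
  ultimately have "\<forall>\<^sub>F n in sequentially. norm (T n - T') < \<eta>"
  proof eventually_elim
    case (elim n)
    have "c * I (\<lambda>x. W x - ?P x) \<le> c * \<tau>" "c * I ?P \<le> c * (2 * I W + 2 * \<tau>)"
      using I1 I2 c by (auto intro!: mult_left_mono)
    then have "I (\<lambda>x. U n x - S n x) \<le> c * \<tau> + \<tau>" "I (S n) \<le> G" using elim cI by linarith+
    then have L2: "\<bar>T n - q n\<bar> \<le> b * (H * \<tau>) + b * (\<kappa> * G)"
      using b by (intro order_trans[OF n_side est]) auto
    \<comment> \<open>The two comparisons together cost at most \<open>\<eta> / 2\<close>, and the
      convergence of \<open>q\<close> less than \<open>\<eta> / 4\<close>.\<close>
    have "(b * (H * \<tau>) + b * (\<kappa> * G)) + (b' * (H * \<tau>) + b' * (\<kappa> * G)) = bt * (H * \<tau>) + bt * (\<kappa> * G)"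
      by (simp add: bt_def algebra_simps)
    then show ?case using L1 L2 \<tau>H \<kappa>(2) elim(3) \<eta> unfolding real_norm_def dist_real_def by linarith
  qed
  then show "\<exists>no. \<forall>n\<ge>no. norm ((LINT x|lebesgue_on \<Omega>. \<phi> x * ((B n x *v U n x) \<bullet> U n x)) - (LINT x|lebesgue_on \<Omega>. \<phi> x * ((Bs x *v W x) \<bullet> W x))) < \<eta>"
    by (simp add: T_def T'_def eventually_sequentially)
qed

section \<open>Assembly of the effective matrix\<close>

lemma weak_subseq:
  "weakly_converges_H1 \<Omega> u w \<Longrightarrow> strict_mono r \<Longrightarrow> weakly_converges_H1 \<Omega> (\<lambda>n. u (r n)) w"
  using LIMSEQ_subseq_LIMSEQ unfolding weakly_converges_H1_def weakly_converges_def o_def by fast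

text \<open>Weakly convergent sequences have bounded gradients, so for each fixed
  \<open>\<phi>\<close> all terms are bounded. This crude bound serves the extraction of
  subsequences; the one by the \<open>L2\<close> norm of \<open>\<phi>\<close> is only
  asymptotic.\<close>

lemma pairing_Bseq:
  fixes \<Omega> :: "(real^'n) set"
  assumes \<Omega>: "open \<Omega>" and B: "\<And>n. B n \<in> coefficient_matrices a b \<Omega>" and b: "0 \<le> b"
    and u: "weakly_converges_H1 \<Omega> u w" and v: "weakly_converges_H1 \<Omega> v z" and \<phi>: "\<phi> \<in> test_functions \<Omega>"
  shows "Bseq (\<lambda>n. LINT x|lebesgue_on \<Omega>. \<phi> x * ((B n x *v weak_gradient \<Omega> (u n) x) \<bullet> weak_gradient \<Omega> (v n) x))"
proof -
  obtain C where C: "C > 0" "\<And>n. H1_norm \<Omega> (u n) \<le> C" using weak_bounded[OF \<Omega> u] by blast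
  obtain C' where C': "C' > 0" "\<And>n. H1_norm \<Omega> (v n) \<le> C'" using weak_bounded[OF \<Omega> v] by blast
  obtain M where M: "M > 0" "\<And>x. \<bar>\<phi> x\<bar> \<le> M" using test_bounded[OF \<phi>] by blast
  note ug = H1D(2)[OF \<Omega> weakD(1)[OF u]] and vg = H1D(2)[OF \<Omega> weakD(1)[OF v]]
  have p: "(\<lambda>x. \<phi> x *\<^sub>R weak_gradient \<Omega> (v n) x) \<in> L2 \<Omega>" for n
    by (rule L2_mult_bounded[OF vg smooth_borel[OF test_smooth[OF \<phi>]] M(2)])
  show ?thesis
  proof (rule BseqI')
    fix n
    have "\<bar>LINT x|lebesgue_on \<Omega>. \<phi> x * ((B n x *v weak_gradient \<Omega> (u n) x) \<bullet> weak_gradient \<Omega> (v n) x)\<bar> =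
      \<bar>LINT x|lebesgue_on \<Omega>. (B n x *v weak_gradient \<Omega> (u n) x) \<bullet> (\<phi> x *\<^sub>R weak_gradient \<Omega> (v n) x)\<bar>" by simp
    also have "\<dots> \<le> L2_norm \<Omega> (\<lambda>x. B n x *v weak_gradient \<Omega> (u n) x) * L2_norm \<Omega> (\<lambda>x. \<phi> x *\<^sub>R weak_gradient \<Omega> (v n) x)"
      by (rule L2_Cauchy_Schwarz[OF coefficient_L2(1)[OF B ug] p])
    also have "\<dots> \<le> (b * C) * (M * C')"
    proof (rule mult_mono)
      show "L2_norm \<Omega> (\<lambda>x. B n x *v weak_gradient \<Omega> (u n) x) \<le> b * C"
        using order_trans[OF H1_norm_ge(2) C(2)] b
        by (intro order_trans[OF coefficient_L2(2)[OF B ug b]] mult_left_mono) auto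
      have "L2_norm \<Omega> (\<lambda>x. \<phi> x *\<^sub>R weak_gradient \<Omega> (v n) x) \<le> M * L2_norm \<Omega> (weak_gradient \<Omega> (v n))"
        by (rule L2_norm_mono[OF vg L2_measurable[OF p]]) (use M in \<open>auto intro!: mult_right_mono\<close>)
      also have "\<dots> \<le> M * C'" using order_trans[OF H1_norm_ge(2) C'(2)] M by (intro mult_left_mono) auto
      finally show "L2_norm \<Omega> (\<lambda>x. \<phi> x *\<^sub>R weak_gradient \<Omega> (v n) x) \<le> M * C'" .
    qed (use b C in auto)
    finally show "norm (LINT x|lebesgue_on \<Omega>. \<phi> x * ((B n x *v weak_gradient \<Omega> (u n) x) \<bullet> weak_gradient \<Omega> (v n) x)) \<le> (b * C) * (M * C')"
      by simp
  qed
qed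

text \<open>By bilinearity both coefficients \<open>P i\<close> and \<open>P j\<close> move into the
  test function, so the limits for pairs of basic fields determine all others.\<close>

lemma quadratic_pairing_limit:
  fixes \<Omega> :: "(real^'n) set" and g :: "'n \<Rightarrow> 'n \<Rightarrow> real^'n \<Rightarrow> real"
  assumes \<Omega>: "open \<Omega>" and B: "\<And>n. B n \<in> coefficient_matrices a b \<Omega>"
    and E: "\<And>i n. E i n \<in> L2 \<Omega>" and g: "\<And>i j. g i j \<in> L2 \<Omega>"
    and lim: "\<And>i j \<phi>. \<phi> \<in> test_functions \<Omega> \<Longrightarrow>
      (\<lambda>n. LINT x|lebesgue_on \<Omega>. \<phi> x * ((B n x *v E i n x) \<bullet> E j n x)) \<longlonglongrightarrow> (LINT x|lebesgue_on \<Omega>. g i j x * \<phi> x)"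
    and \<phi>: "\<phi> \<in> test_functions \<Omega>" and P: "\<And>i. smooth (P i)"
  shows "(\<lambda>n. LINT x|lebesgue_on \<Omega>. \<phi> x * ((B n x *v (\<Sum>i\<in>UNIV. P i x *\<^sub>R E i n x)) \<bullet> (\<Sum>i\<in>UNIV. P i x *\<^sub>R E i n x)))
        \<longlonglongrightarrow> (LINT x|lebesgue_on \<Omega>. \<phi> x * (((\<chi> i j. g i j x) *v (\<chi> i. P i x)) \<bullet> (\<chi> i. P i x)))"
proof -
  have t: "(\<lambda>x. \<phi> x * P i x * P j x) \<in> test_functions \<Omega>" for i j by (intro test_mult \<phi> P)
  have lin: "M *v (\<Sum>i\<in>UNIV. p i *\<^sub>R e i) = (\<Sum>i\<in>UNIV. p i *\<^sub>R (M *v e i))" for M :: "real^'n^'n" and p and e :: "'n \<Rightarrow> real^'n"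
    by (simp add: linear_sum[OF matrix_vector_mul_linear] matrix_vector_mult_scaleR)
  have "(LINT x|lebesgue_on \<Omega>. \<phi> x * ((B n x *v (\<Sum>i\<in>UNIV. P i x *\<^sub>R E i n x)) \<bullet> (\<Sum>i\<in>UNIV. P i x *\<^sub>R E i n x))) =
    (\<Sum>i\<in>UNIV. \<Sum>j\<in>UNIV. LINT x|lebesgue_on \<Omega>. (\<phi> x * P i x * P j x) * ((B n x *v E i n x) \<bullet> E j n x))" for n
  proof -
    have "\<phi> x * ((B n x *v (\<Sum>i\<in>UNIV. P i x *\<^sub>R E i n x)) \<bullet> (\<Sum>i\<in>UNIV. P i x *\<^sub>R E i n x)) =
      (\<Sum>i\<in>UNIV. \<Sum>j\<in>UNIV. (\<phi> x * P i x * P j x) * ((B n x *v E i n x) \<bullet> E j n x))" for x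
      unfolding lin inner_sum_left inner_sum_right by (simp add: sum_distrib_left mult_ac, subst sum.swap, simp add: mult_ac)
    then show ?thesis
      using test_inner_integrable'[OF coefficient_L2(1)[OF B E] E t] by simp
  qed
  moreover have "(\<lambda>n. \<Sum>i\<in>UNIV. \<Sum>j\<in>UNIV. LINT x|lebesgue_on \<Omega>. (\<phi> x * P i x * P j x) * ((B n x *v E i n x) \<bullet> E j n x))
    \<longlonglongrightarrow> (\<Sum>i\<in>UNIV. \<Sum>j\<in>UNIV. LINT x|lebesgue_on \<Omega>. g i j x * (\<phi> x * P i x * P j x))"
    by (intro tendsto_sum lim t)
  moreover have "(\<Sum>i\<in>UNIV. \<Sum>j\<in>UNIV. LINT x|lebesgue_on \<Omega>. g i j x * (\<phi> x * P i x * P j x)) =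
    (LINT x|lebesgue_on \<Omega>. \<phi> x * (((\<chi> i j. g i j x) *v (\<chi> i. P i x)) \<bullet> (\<chi> i. P i x)))"
  proof -
    have "\<phi> x * (((\<chi> i j. g i j x) *v (\<chi> i. P i x)) \<bullet> (\<chi> i. P i x)) = (\<Sum>i\<in>UNIV. \<Sum>j\<in>UNIV. g i j x * (\<phi> x * P i x * P j x))" for x
      by (simp add: inner_vec_def matrix_vector_mult_def sum_distrib_left sum_distrib_right mult_ac)
    then show ?thesis
      using L2_mult_integrable[OF g test_L2[OF \<Omega> t]] by simp
  qed
  ultimately show ?thesis by simp
qed

text \<open>For a fixed vector \<open>p\<close> the weighted inequalities give pointwise ones almost
  everywhere. A countable dense set of vectors has a common null set, and continuity of the form
  extends the bounds to all vectors; symmetry then turns the upper bound into one of the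
  norm.\<close>

lemma quadratic_coefficient_matrix:
  fixes \<Omega> :: "(real^'n) set" and G :: "real^'n \<Rightarrow> real^'n^'n"
  assumes \<Omega>: "open \<Omega>" "bounded \<Omega>" and G: "\<And>i j. (\<lambda>x. G x $ i $ j) \<in> L2 \<Omega>" and sym: "\<And>x. transpose (G x) = G x"
    and ab: "0 < a" "0 < b"
    and low: "\<And>p \<phi>. \<phi> \<in> test_functions \<Omega> \<Longrightarrow> (\<And>x. 0 \<le> \<phi> x) \<Longrightarrow>
       a * (norm p)\<^sup>2 * (LINT x|lebesgue_on \<Omega>. \<phi> x) \<le> (LINT x|lebesgue_on \<Omega>. \<phi> x * ((G x *v p) \<bullet> p))"
    and up: "\<And>p \<phi>. \<phi> \<in> test_functions \<Omega> \<Longrightarrow> (\<And>x. 0 \<le> \<phi> x) \<Longrightarrow>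
       (LINT x|lebesgue_on \<Omega>. \<phi> x * ((G x *v p) \<bullet> p)) \<le> b * (norm p)\<^sup>2 * (LINT x|lebesgue_on \<Omega>. \<phi> x)"
  shows "G \<in> coefficient_matrices a b \<Omega>"
proof -
  have const: "(\<lambda>_. c) \<in> L2 \<Omega>" for c :: real by (rule bounded_L2[OF \<Omega>, where M = "\<bar>c\<bar>"]) auto
  have qL: "(\<lambda>x. (G x *v p) \<bullet> p) \<in> L2 \<Omega>" for p
  proof -
    have "(\<lambda>x. \<Sum>i\<in>UNIV. \<Sum>j\<in>UNIV. (p $ j * p $ i) *\<^sub>R (G x $ i $ j)) \<in> L2 \<Omega>"
      by (intro L2_sum L2_scale G)
    moreover have "(\<lambda>x. \<Sum>i\<in>UNIV. \<Sum>j\<in>UNIV. (p $ j * p $ i) *\<^sub>R (G x $ i $ j)) = (\<lambda>x. (G x *v p) \<bullet> p)"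
      by (simp add: inner_vec_def matrix_vector_mult_def sum_distrib_left sum_distrib_right mult_ac)
    ultimately show ?thesis by simp
  qed
  have ae: "AE x in lebesgue_on \<Omega>. 0 \<le> s * ((G x *v p) \<bullet> p) + c"
    if h: "\<And>\<phi>. \<phi> \<in> test_functions \<Omega> \<Longrightarrow> (\<And>x. 0 \<le> \<phi> x) \<Longrightarrow> 0 \<le> s * (LINT x|lebesgue_on \<Omega>. \<phi> x * ((G x *v p) \<bullet> p)) + c * (LINT x|lebesgue_on \<Omega>. \<phi> x)" for s c p
  proof (rule nonneg_if_test_integrals_nonneg[OF \<Omega>(1) L2_locally_integrable[OF _ \<Omega>(1)]])
    show "(\<lambda>x. s * ((G x *v p) \<bullet> p) + c) \<in> L2 \<Omega>" using L2_add[OF L2_scale[OF qL[of p], of s] const[of c]] by simp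
    fix \<phi> assume \<phi>: "\<phi> \<in> test_functions \<Omega>" "\<And>x. 0 \<le> \<phi> x"
    have i: "integrable (lebesgue_on \<Omega>) (\<lambda>x. \<phi> x * ((G x *v p) \<bullet> p))" "integrable (lebesgue_on \<Omega>) \<phi>"
      using L2_mult_integrable[OF test_L2[OF \<Omega>(1) \<phi>(1)] qL[of p]] L2_mult_integrable[OF test_L2[OF \<Omega>(1) \<phi>(1)] const[of 1]] by auto
    have "(\<lambda>x. (s * ((G x *v p) \<bullet> p) + c) * \<phi> x) = (\<lambda>x. s * (\<phi> x * ((G x *v p) \<bullet> p)) + c * \<phi> x)" by (auto simp: algebra_simps)
    then show "0 \<le> (LINT x|lebesgue_on \<Omega>. (s * ((G x *v p) \<bullet> p) + c) * \<phi> x)" using h[OF \<phi>] i by simp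
  qed
  obtain Q :: "(real^'n) set" where Qc: "countable Q" and Q: "\<And>X. open X \<Longrightarrow> X \<noteq> {} \<Longrightarrow> \<exists>q\<in>Q. q \<in> X"
    using countable_dense_exists by blast
  have "AE x in lebesgue_on \<Omega>. \<forall>p\<in>Q. a * (norm p)\<^sup>2 \<le> 1 * ((G x *v p) \<bullet> p)"
    unfolding AE_ball_countable[OF Qc]
  proof
    fix p
    have "AE x in lebesgue_on \<Omega>. 0 \<le> 1 * ((G x *v p) \<bullet> p) + (- (a * (norm p)\<^sup>2))"
      by (rule ae) (use low in simp)
    then show "AE x in lebesgue_on \<Omega>. a * (norm p)\<^sup>2 \<le> 1 * ((G x *v p) \<bullet> p)" by eventually_elim simp
  qed
  moreover have "AE x in lebesgue_on \<Omega>. \<forall>p\<in>Q. - b * (norm p)\<^sup>2 \<le> - 1 * ((G x *v p) \<bullet> p)"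
    unfolding AE_ball_countable[OF Qc]
  proof
    fix p
    have "AE x in lebesgue_on \<Omega>. 0 \<le> - 1 * ((G x *v p) \<bullet> p) + b * (norm p)\<^sup>2"
      by (rule ae) (use up in simp)
    then show "AE x in lebesgue_on \<Omega>. - b * (norm p)\<^sup>2 \<le> - 1 * ((G x *v p) \<bullet> p)" by eventually_elim simp
  qed
  ultimately have "AE x in lebesgue_on \<Omega>. \<forall>\<xi>. (G x *v \<xi>) \<bullet> \<xi> \<ge> a * (norm \<xi>)\<^sup>2 \<and> norm (G x *v \<xi>) \<le> b * norm \<xi>"
  proof eventually_elim
    case (elim x)
    have 1: "a * (norm \<xi>)\<^sup>2 \<le> (G x *v \<xi>) \<bullet> \<xi>" for \<xi>
      using quadratic_form_dense[OF Q, of a 1 "G x" \<xi>] elim(1) by simp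
    have 2: "(G x *v \<xi>) \<bullet> \<xi> \<le> b * (norm \<xi>)\<^sup>2" for \<xi>
      using quadratic_form_dense[OF Q, of "- b" "- 1" "G x" \<xi>] elim(2) by simp
    have s: "(G x *v \<xi>) \<bullet> \<eta> = (G x *v \<eta>) \<bullet> \<xi>" for \<xi> \<eta>
    proof -
      have "(G x *v \<eta>) \<bullet> \<xi> = \<xi> \<bullet> (G x *v \<eta>)" by (rule inner_commute)
      also have "\<dots> = (\<xi> v* G x) \<bullet> \<eta>" by (rule dot_lmul_matrix[symmetric])
      also have "\<xi> v* G x = G x *v \<xi>" using transpose_matrix_vector[of "G x" \<xi>] by (simp add: sym)
      finally show ?thesis by simp
    qed
    have "0 \<le> (G x *v \<xi>) \<bullet> \<xi>" for \<xi> using order_trans[OF _ 1] ab by simp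
    then show ?case using 1 symmetric_norm_bound[OF s ab(2) _ 2] by blast
  qed
  moreover have "G \<in> borel_measurable (lebesgue_on \<Omega>)"
  proof -
    have m: "(\<lambda>x. G x $ i $ j) \<in> borel_measurable (lebesgue_on \<Omega>)" for i j by (rule L2_measurable[OF G])
    have "(\<lambda>x. \<Sum>i\<in>UNIV. \<Sum>j\<in>UNIV. G x $ i $ j *\<^sub>R (axis i (axis j 1) :: real^'n^'n)) \<in> borel_measurable (lebesgue_on \<Omega>)"
      using m by (intro borel_measurable_sum borel_measurable_scaleR) auto
    moreover have "(\<lambda>x. \<Sum>i\<in>UNIV. \<Sum>j\<in>UNIV. G x $ i $ j *\<^sub>R (axis i (axis j 1) :: real^'n^'n)) = G"
    proof
      fix x
      have "(\<Sum>i\<in>UNIV. \<Sum>j\<in>UNIV. (G x $ i $ j *\<^sub>R (axis i (axis j 1) :: real^'n^'n)) $ k $ l) = G x $ k $ l" for k l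
      proof -
        have "(G x $ i $ j *\<^sub>R (axis i (axis j 1) :: real^'n^'n)) $ k $ l = (if i = k then if j = l then G x $ i $ j else 0 else 0)" for i j
          by (auto simp: axis_def)
        then show ?thesis by (simp cong: if_cong) (simp add: sum.If_cases)
      qed
      then show "(\<Sum>i\<in>UNIV. \<Sum>j\<in>UNIV. G x $ i $ j *\<^sub>R (axis i (axis j 1) :: real^'n^'n)) = G x"
        by (simp add: vec_eq_iff)
    qed
    ultimately show ?thesis by simp
  qed
  ultimately show ?thesis using sym by (simp add: coefficient_matrices_def)
qed

lemma quadratic_locally_integrable:
  fixes \<Omega> :: "(real^'n) set"
  assumes \<Omega>: "open \<Omega>" and B: "B \<in> coefficient_matrices a b \<Omega>" and g: "g \<in> L2 \<Omega>"
  shows "(\<lambda>x. (B x *v g x) \<bullet> g x) locally_integrable_on \<Omega>"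
  unfolding locally_integrable_on_def
proof (intro allI impI, elim conjE)
  fix K assume K: "compact K" "K \<subseteq> \<Omega>"
  show "integrable (lebesgue_on K) (\<lambda>x. (B x *v g x) \<bullet> g x)"
    by (rule lebesgue_on_subset[OF K(2) _ _ L2_inner_integrable[OF coefficient_L2(1)[OF B g] g]])
      (use K(1) \<Omega> in \<open>auto simp: borel_open lmeasurable_compact fmeasurableD\<close>)
qed

theorem theorem2p1:
  fixes \<Omega> :: "(real^'n) set"
    and a\<^sub>1 a\<^sub>2 b\<^sub>1 b\<^sub>2 :: real
    and A B :: "nat \<Rightarrow> real^'n \<Rightarrow> real^'n^'n"
    and Astar :: "real^'n \<Rightarrow> real^'n^'n"
  assumes "open \<Omega>" and "bounded \<Omega>"
    and "0 < a\<^sub>1" and "a\<^sub>1 < a\<^sub>2" and "0 < b\<^sub>1" and "b\<^sub>1 < b\<^sub>2"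
    and "\<And>n. A n \<in> coefficient_matrices a\<^sub>1 a\<^sub>2 \<Omega>"
    and "Astar \<in> coefficient_matrices a\<^sub>1 a\<^sub>2 \<Omega>"
    and "H_converges \<Omega> A Astar"
    and "\<And>n. B n \<in> coefficient_matrices b\<^sub>1 b\<^sub>2 \<Omega>"
  shows "\<exists>r Bsharp. strict_mono (r :: nat \<Rightarrow> nat) \<and>
    Bsharp \<in> coefficient_matrices b\<^sub>1 (b\<^sub>2 * (a\<^sub>2 / a\<^sub>1)) \<Omega> \<and>
    (\<forall>u ulim. weakly_converges_H1 \<Omega> u ulim \<and>
       strongly_convergent_Hm1 \<Omega> (\<lambda>n. neg_div \<Omega> (flux \<Omega> (A (r n)) (u n))) \<longrightarrow>
       distr_converges \<Omega>
         (\<lambda>n x. (B (r n) x *v weak_gradient \<Omega> (u n) x) \<bullet> weak_gradient \<Omega> (u n) x)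
         (\<lambda>x. (Bsharp x *v weak_gradient \<Omega> ulim x) \<bullet> weak_gradient \<Omega> ulim x))"
proof -
  note \<Omega> = assms(1,2) and a = assms(3,4) and b = assms(5,6) and A = assms(7) and B = assms(10)
  have a2: "0 \<le> a\<^sub>2" and b2: "0 \<le> b\<^sub>2" using a b by auto
  obtain r1 F X where r1: "strict_mono r1" and F: "\<And>i. F i \<in> H1 \<Omega>"
    and X: "\<And>i::'n. weakly_converges_H1 \<Omega> (X i) (\<lambda>x. x $ i)"
    and eq: "\<And>i n v. v \<in> H1 \<Omega> \<Longrightarrow> (LINT x|lebesgue_on \<Omega>. (A (r1 n) x *v weak_gradient \<Omega> (X i n) x) \<bullet> weak_gradient \<Omega> v x) +
       (LINT x|lebesgue_on \<Omega>. X i n x * v x) = H1_ip \<Omega> (F i) v"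
    using coordinate_sequences[where A = A, OF \<Omega> A a(1) a2] by blast
  obtain D :: "nat \<Rightarrow> real^'n \<Rightarrow> real" where D: "\<And>k. D k \<in> test_functions \<Omega>"
    "\<And>f e. f \<in> L2 \<Omega> \<Longrightarrow> e > 0 \<Longrightarrow> \<exists>d\<in>span (range D). L2_norm \<Omega> (\<lambda>x. f x - d x) < e"
    using countable_test_dense[OF \<Omega>] by blast
  \<comment> \<open>One natural number encodes a test function and a pair of indices, so a single
    diagonal extraction makes all these pairings converge.\<close>
  define f where "f m n = (case from_nat m of (k, i, j) \<Rightarrow> LINT x|lebesgue_on \<Omega>. D k x *
      ((B (r1 n) x *v weak_gradient \<Omega> (X i n) x) \<bullet> weak_gradient \<Omega> (X j n) x))" for m n
  have "Bseq (f m)" for m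
  proof -
    obtain k and i j :: 'n where "from_nat m = (k :: nat, i, j)" by (metis prod_cases3)
    then show ?thesis
      using pairing_Bseq[OF \<Omega>(1) B b2 X[of i] X[of j] D(1)[of k], of r1] by (simp add: f_def[abs_def])
  qed
  then obtain r2 where r2: "strict_mono r2" "\<And>m. convergent (\<lambda>n. f m (r2 n))"
    using bounded_diagonal_subsequence by blast
  define r where "r n = r1 (r2 n)" for n
  have r: "strict_mono r" using strict_mono_o[OF r1 r2(1)] by (simp add: r_def[abs_def] o_def)
  \<comment> \<open>\<open>X\<close> is already indexed along \<open>r1\<close>, hence only
    \<open>r2\<close> is applied here, whereas \<open>A\<close> and \<open>B\<close> carry the
    composition \<open>r\<close>.\<close>
  define E where "E i n = weak_gradient \<Omega> (X i (r2 n))" for i n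
  define A' where "A' n = A (r n)" for n
  define B' where "B' n = B (r n)" for n
  have cv: "convergent (\<lambda>n. LINT x|lebesgue_on \<Omega>. D k x * ((B' n x *v E i n x) \<bullet> E j n x))" for k i j
    using r2(2)[of "to_nat (k, i, j)"] by (simp add: f_def r_def E_def B'_def)
  have Ar: "A' n \<in> coefficient_matrices a\<^sub>1 a\<^sub>2 \<Omega>" and Br: "B' n \<in> coefficient_matrices b\<^sub>1 b\<^sub>2 \<Omega>" for n
    unfolding A'_def B'_def by (rule A, rule B)
  have axL: "(\<lambda>_. axis i 1 :: real^'n) \<in> L2 \<Omega>" for i by (rule bounded_L2[OF \<Omega>, where M = 1]) auto
  have Eg: "grad_like \<Omega> A' (E i) (\<lambda>_. axis i 1)" for i
  proof (rule grad_like_cong[OF Ar _ axL coordinate_H1(2)[OF \<Omega>]])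
    show "grad_like \<Omega> A' (E i) (weak_gradient \<Omega> (\<lambda>x. x $ i))"
      unfolding E_def[abs_def]
      by (rule grad_like_solution[OF \<Omega>(1) Ar a2 weak_subseq[OF X r2(1)] F]) (simp add: eq r_def A'_def)
  qed
  note EL = grad_likeD(2)[OF Eg]
  have "\<exists>g\<in>L2 \<Omega>. \<forall>\<phi>\<in>test_functions \<Omega>. (\<lambda>n. LINT x|lebesgue_on \<Omega>. \<phi> x * ((B' n x *v E i n x) \<bullet> E j n x)) \<longlonglongrightarrow> (LINT x|lebesgue_on \<Omega>. g x * \<phi> x)" for i j
    by (rule pairing_density[OF \<Omega> Ar a(1) a2 Br b2 Eg Eg _ _ D cv]) auto
  then have "\<forall>i j. \<exists>g. g \<in> L2 \<Omega> \<and> (\<forall>\<phi>\<in>test_functions \<Omega>. (\<lambda>n. LINT x|lebesgue_on \<Omega>. \<phi> x * ((B' n x *v E i n x) \<bullet> E j n x)) \<longlonglongrightarrow> (LINT x|lebesgue_on \<Omega>. g x * \<phi> x))" by blast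
  then obtain g where "\<forall>i j. g i j \<in> L2 \<Omega> \<and> (\<forall>\<phi>\<in>test_functions \<Omega>. (\<lambda>n. LINT x|lebesgue_on \<Omega>. \<phi> x * ((B' n x *v E i n x) \<bullet> E j n x)) \<longlonglongrightarrow> (LINT x|lebesgue_on \<Omega>. g i j x * \<phi> x))"
    unfolding choice_iff by (elim exE)
  then have g: "\<And>i j. g i j \<in> L2 \<Omega>" and glim: "\<And>i j \<phi>. \<phi> \<in> test_functions \<Omega> \<Longrightarrow>
    (\<lambda>n. LINT x|lebesgue_on \<Omega>. \<phi> x * ((B' n x *v E i n x) \<bullet> E j n x)) \<longlonglongrightarrow> (LINT x|lebesgue_on \<Omega>. g i j x * \<phi> x)"
    by blast+
  \<comment> \<open>\<open>g i j\<close> and \<open>g j i\<close> have the same test integrals, but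
    \<open>coefficient_matrices\<close> asks for symmetry at every point of the domain; symmetrising
    changes none of the limits.\<close>
  define h where "h i j x = (1/2) *\<^sub>R (g i j x + g j i x)" for i j x
  have hL: "h i j \<in> L2 \<Omega>" for i j unfolding h_def[abs_def] by (intro L2_scale L2_add g)
  have hlim: "(\<lambda>n. LINT x|lebesgue_on \<Omega>. \<phi> x * ((B' n x *v E i n x) \<bullet> E j n x)) \<longlonglongrightarrow> (LINT x|lebesgue_on \<Omega>. h i j x * \<phi> x)"
    if \<phi>: "\<phi> \<in> test_functions \<Omega>" for i j \<phi>
  proof -
    have "(LINT x|lebesgue_on \<Omega>. \<phi> x * ((B' n x *v E i n x) \<bullet> E j n x)) = (LINT x|lebesgue_on \<Omega>. \<phi> x * ((B' n x *v E j n x) \<bullet> E i n x))" for n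
    proof (rule Bochner_Integration.integral_cong[OF refl])
      fix x assume "x \<in> space (lebesgue_on \<Omega>)"
      then have "(B' n x *v E i n x) \<bullet> E j n x = (B' n x *v E j n x) \<bullet> E i n x"
        by (intro coefficient_matricesD(2)[OF Br]) simp
      then show "\<phi> x * ((B' n x *v E i n x) \<bullet> E j n x) = \<phi> x * ((B' n x *v E j n x) \<bullet> E i n x)" by simp
    qed
    then have gg: "(LINT x|lebesgue_on \<Omega>. g i j x * \<phi> x) = (LINT x|lebesgue_on \<Omega>. g j i x * \<phi> x)"
      using LIMSEQ_unique[OF glim[OF \<phi>, of i j]] glim[OF \<phi>, of j i] by simp
    have "(LINT x|lebesgue_on \<Omega>. h i j x * \<phi> x) = (LINT x|lebesgue_on \<Omega>. (1/2) * (g i j x * \<phi> x) + (1/2) * (g j i x * \<phi> x))"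
      by (simp add: h_def distrib_left distrib_right mult.assoc)
    also have "\<dots> = (LINT x|lebesgue_on \<Omega>. g i j x * \<phi> x)"
      using gg L2_mult_integrable[OF g test_L2[OF \<Omega>(1) \<phi>], of i j] L2_mult_integrable[OF g test_L2[OF \<Omega>(1) \<phi>], of j i] by simp
    finally show ?thesis using glim[OF \<phi>, of i j] by simp
  qed
  define Bs where "Bs x = (\<chi> i j. h i j x)" for x
  \<comment> \<open>Stated for smooth \<open>P\<close> to serve two purposes: constant
    \<open>P\<close> yields the bounds of \<open>Bs\<close>, and test functions \<open>P\<close> are
    what the approximation of a general gradient supplies.\<close>
  have qlim: "(\<lambda>n. LINT x|lebesgue_on \<Omega>. \<phi> x * ((B' n x *v (\<Sum>i\<in>UNIV. P i x *\<^sub>R E i n x)) \<bullet> (\<Sum>i\<in>UNIV. P i x *\<^sub>R E i n x)))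
        \<longlonglongrightarrow> (LINT x|lebesgue_on \<Omega>. \<phi> x * ((Bs x *v (\<chi> i. P i x)) \<bullet> (\<chi> i. P i x)))"
    if "\<phi> \<in> test_functions \<Omega>" "\<And>i. smooth (P i)" for \<phi> P
    unfolding Bs_def by (rule quadratic_pairing_limit[OF \<Omega>(1) Br EL hL _ that]) (rule hlim)
  have Bs: "Bs \<in> coefficient_matrices b\<^sub>1 (b\<^sub>2 * (a\<^sub>2 / a\<^sub>1)) \<Omega>"
  proof (rule quadratic_coefficient_matrix[OF \<Omega>])
    show "(\<lambda>x. Bs x $ i $ j) \<in> L2 \<Omega>" for i j using hL by (simp add: Bs_def)
    show "transpose (Bs x) = Bs x" for x
      by (simp add: transpose_def Bs_def h_def vec_eq_iff add.commute)
    show "0 < b\<^sub>1" "0 < b\<^sub>2 * (a\<^sub>2 / a\<^sub>1)" using a b by auto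
    fix p :: "real^'n" and \<phi> assume \<phi>: "\<phi> \<in> test_functions \<Omega>" "\<And>x. 0 \<le> \<phi> x"
    let ?S = "\<lambda>n x. \<Sum>i\<in>UNIV. (p $ i) *\<^sub>R E i n x"
    let ?I = "LINT x|lebesgue_on \<Omega>. \<phi> x"
    let ?q = "\<lambda>n. LINT x|lebesgue_on \<Omega>. \<phi> x * ((B' n x *v ?S n x) \<bullet> ?S n x)"
    have ps: "(\<Sum>i\<in>UNIV. p $ i *\<^sub>R axis i 1) = p" by (simp add: basis_expansion scalar_mult_eq_scaleR[symmetric])
    \<comment> \<open>The combination of the \<open>E i\<close> with constant coefficients has limit
      \<open>p\<close>, so along it the form of \<open>Bs\<close> at \<open>p\<close> can be
      estimated.\<close>
    have S: "grad_like \<Omega> A' ?S (\<lambda>_. p)"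
      using grad_like_sum[where U = E and I = UNIV and c = "\<lambda>i _. p $ i" and M = "\<lambda>i. \<bar>p $ i\<bar>", OF \<Omega>(1) Ar Eg smooth_const order_refl finite] by (simp only: ps)
    note SL = grad_likeD(2)[OF S]
    have lim: "?q \<longlonglongrightarrow> (LINT x|lebesgue_on \<Omega>. \<phi> x * ((Bs x *v p) \<bullet> p))"
      using qlim[where P = "\<lambda>i _. p $ i", OF \<phi>(1) smooth_const] by simp
    have sq: "integrable (lebesgue_on \<Omega>) (\<lambda>x. \<phi> x * (norm (?S n x))\<^sup>2)" for n
      using test_inner_integrable'[OF SL SL \<phi>(1)] by (simp add: power2_norm_eq_inner)
    have pr: "integrable (lebesgue_on \<Omega>) (\<lambda>x. \<phi> x * ((B' n x *v ?S n x) \<bullet> ?S n x))" for n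
      by (rule test_inner_integrable'[OF coefficient_L2(1)[OF Br SL] SL \<phi>(1)])
    \<comment> \<open>The form is compared with the energy from both sides;
      \<open>energy_lower\<close> then keeps \<open>b\<^sub>1\<close> in the limit, while
      \<open>energy_estimate\<close> multiplies \<open>b\<^sub>2\<close> by
      \<open>a\<^sub>2 / a\<^sub>1\<close>.\<close>
    have ql: "b\<^sub>1 * (LINT x|lebesgue_on \<Omega>. \<phi> x * (norm (?S n x))\<^sup>2) \<le> ?q n" for n
    proof -
      have "(LINT x|lebesgue_on \<Omega>. b\<^sub>1 * (\<phi> x * (norm (?S n x))\<^sup>2)) \<le> ?q n"
      proof (rule integral_mono_AE[OF integrable_mult_right[OF sq] pr])
        show "AE x in lebesgue_on \<Omega>. b\<^sub>1 * (\<phi> x * (norm (?S n x))\<^sup>2) \<le> \<phi> x * ((B' n x *v ?S n x) \<bullet> ?S n x)"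
          using coefficient_matricesD(3)[OF Br[of n]]
        proof eventually_elim
          case (elim x)
          then have "b\<^sub>1 * (norm (?S n x))\<^sup>2 \<le> (B' n x *v ?S n x) \<bullet> ?S n x" by blast
          from mult_left_mono[OF this \<phi>(2)[of x]] show ?case by (simp add: mult.left_commute)
        qed
      qed
      then show ?thesis by simp
    qed
    have qu: "?q n \<le> b\<^sub>2 * (LINT x|lebesgue_on \<Omega>. \<phi> x * (norm (?S n x))\<^sup>2)" for n
    proof -
      have "\<bar>\<phi> x\<bar> \<le> \<phi> x" for x using \<phi>(2)[of x] by simp
      from pairing_integral[OF Br b2 SL SL \<phi>(1) \<phi>(1) this, of n n n] show ?thesis by simp
    qed
    show "b\<^sub>1 * (norm p)\<^sup>2 * ?I \<le> (LINT x|lebesgue_on \<Omega>. \<phi> x * ((Bs x *v p) \<bullet> p))"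
    proof (rule field_le_epsilon)
      fix e :: real assume e: "e > 0"
      have "\<forall>\<^sub>F n in sequentially. (LINT x|lebesgue_on \<Omega>. \<phi> x * (norm p)\<^sup>2) - e / b\<^sub>1 \<le> (LINT x|lebesgue_on \<Omega>. \<phi> x * (norm (?S n x))\<^sup>2)"
        by (rule energy_lower[OF S \<phi>]) (use e b in simp)
      then have "\<forall>\<^sub>F n in sequentially. b\<^sub>1 * (norm p)\<^sup>2 * ?I - e \<le> ?q n"
      proof eventually_elim
        case (elim n)
        have "b\<^sub>1 * (norm p)\<^sup>2 * ?I - e = b\<^sub>1 * ((LINT x|lebesgue_on \<Omega>. \<phi> x * (norm p)\<^sup>2) - e / b\<^sub>1)"
          using b by (simp add: right_diff_distrib mult_ac)
        also have "\<dots> \<le> b\<^sub>1 * (LINT x|lebesgue_on \<Omega>. \<phi> x * (norm (?S n x))\<^sup>2)" using elim b by (intro mult_left_mono) auto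
        finally show ?case using ql[of n] by linarith
      qed
      from tendsto_lowerbound[OF lim this] show "b\<^sub>1 * (norm p)\<^sup>2 * ?I \<le> (LINT x|lebesgue_on \<Omega>. \<phi> x * ((Bs x *v p) \<bullet> p)) + e" by simp
    qed
    show "(LINT x|lebesgue_on \<Omega>. \<phi> x * ((Bs x *v p) \<bullet> p)) \<le> b\<^sub>2 * (a\<^sub>2 / a\<^sub>1) * (norm p)\<^sup>2 * ?I"
    proof (rule field_le_epsilon)
      fix e :: real assume e: "e > 0"
      have bp: "b\<^sub>2 > 0" using b by simp
      have "\<forall>\<^sub>F n in sequentially. (LINT x|lebesgue_on \<Omega>. \<phi> x * (norm (?S n x))\<^sup>2) \<le> a\<^sub>2 / a\<^sub>1 * (LINT x|lebesgue_on \<Omega>. \<phi> x * (norm p)\<^sup>2) + e / b\<^sub>2"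
        by (rule energy_estimate[OF Ar S a(1) \<phi>]) (use e bp in simp)
      then have "\<forall>\<^sub>F n in sequentially. ?q n \<le> b\<^sub>2 * (a\<^sub>2 / a\<^sub>1) * (norm p)\<^sup>2 * ?I + e"
      proof eventually_elim
        case (elim n)
        have "b\<^sub>2 * (LINT x|lebesgue_on \<Omega>. \<phi> x * (norm (?S n x))\<^sup>2) \<le> b\<^sub>2 * (a\<^sub>2 / a\<^sub>1 * (LINT x|lebesgue_on \<Omega>. \<phi> x * (norm p)\<^sup>2) + e / b\<^sub>2)"
          using elim bp by (intro mult_left_mono) auto
        also have "\<dots> = b\<^sub>2 * (a\<^sub>2 / a\<^sub>1) * (norm p)\<^sup>2 * ?I + e" using bp by (simp add: distrib_left mult_ac)
        finally show ?case using qu[of n] by linarith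
      qed
      from tendsto_upperbound[OF lim this] show "(LINT x|lebesgue_on \<Omega>. \<phi> x * ((Bs x *v p) \<bullet> p)) \<le> b\<^sub>2 * (a\<^sub>2 / a\<^sub>1) * (norm p)\<^sup>2 * ?I + e" by simp
    qed
  qed
  show ?thesis
  proof (intro exI[of _ r] exI[of _ Bs] conjI allI impI r Bs)
    fix u ulim
    assume "weakly_converges_H1 \<Omega> u ulim \<and> strongly_convergent_Hm1 \<Omega> (\<lambda>n. neg_div \<Omega> (flux \<Omega> (A (r n)) (u n)))"
    then have u: "weakly_converges_H1 \<Omega> u ulim" and s: "strongly_convergent_Hm1 \<Omega> (\<lambda>n. neg_div \<Omega> (flux \<Omega> (A' n) (u n)))" by (auto simp: A'_def)
    note U = grad_like_test_sequence[OF \<Omega>(1) Ar a2 u s]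
    have lim: "(\<lambda>n. LINT x|lebesgue_on \<Omega>. \<phi> x * ((B' n x *v (\<Sum>i\<in>UNIV. P i x *\<^sub>R E i n x)) \<bullet> (\<Sum>i\<in>UNIV. P i x *\<^sub>R E i n x)))
        \<longlonglongrightarrow> (LINT x|lebesgue_on \<Omega>. \<phi> x * ((Bs x *v (\<chi> i. P i x)) \<bullet> (\<chi> i. P i x)))"
      if "\<phi> \<in> test_functions \<Omega>" "\<And>i. P i \<in> test_functions \<Omega>" for \<phi> P
      by (rule qlim[OF that(1) test_smooth[OF that(2)]])
    have bs: "0 < b\<^sub>2 * (a\<^sub>2 / a\<^sub>1)" "0 < b\<^sub>2" using a b by auto
    show "distr_converges \<Omega> (\<lambda>n x. (B (r n) x *v weak_gradient \<Omega> (u n) x) \<bullet> weak_gradient \<Omega> (u n) x)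
         (\<lambda>x. (Bs x *v weak_gradient \<Omega> ulim x) \<bullet> weak_gradient \<Omega> ulim x)"
      unfolding distr_converges_def B'_def[symmetric]
    proof (intro conjI allI ballI)
      show "(\<lambda>x. (B' n x *v weak_gradient \<Omega> (u n) x) \<bullet> weak_gradient \<Omega> (u n) x) locally_integrable_on \<Omega>" for n
        by (rule quadratic_locally_integrable[OF \<Omega>(1) Br H1D(2)[OF \<Omega>(1) weakD(1)[OF u]]])
      show "(\<lambda>x. (Bs x *v weak_gradient \<Omega> ulim x) \<bullet> weak_gradient \<Omega> ulim x) locally_integrable_on \<Omega>"
        by (rule quadratic_locally_integrable[OF \<Omega>(1) Bs H1D(2)[OF \<Omega>(1) weakD(2)[OF u]]])
      fix \<phi> assume "\<phi> \<in> test_functions \<Omega>"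
      from effective_convergence[OF \<Omega> Ar a(1) less_imp_le[OF a(2)] Br bs(2) Bs bs(1) Eg lim U this]
      show "(\<lambda>n. LINT x|lebesgue_on \<Omega>. ((B' n x *v weak_gradient \<Omega> (u n) x) \<bullet> weak_gradient \<Omega> (u n) x) * \<phi> x)
        \<longlonglongrightarrow> (LINT x|lebesgue_on \<Omega>. ((Bs x *v weak_gradient \<Omega> ulim x) \<bullet> weak_gradient \<Omega> ulim x) * \<phi> x)"
        by (simp add: mult.commute)
    qed
  qed
qed

end
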